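(* Let $T>0$ and let $f,U,\mathcal{K}$ satisfy the standing assumptions (C1)–(C5) of the context. Then there exist constants $C_0,C_1$ depending only on $f$ and $T$ such that, whenever $0<\varepsilon\le1$ and the mean field Markov chain given by $\mathcal{S}$, $Q$ satisfies the approximation assumptions (A1)–(A4) of the context with this $\varepsilon$ (and some bound $B_Q$), for all $m_0\in\mathcal{P}^2(\mathcal{K})$ and $\mu_0\in\Sigma^2$, $$\mathbb{H}(\mathcal{X}(m_0),\mathcal{X}_Q(\mu_0))\le C_0W_2(\mathscr{I}(\mu_0),m_0)+C_1\varepsilon.$$ Here $\mathcal{X}(m_0)=\{m(\cdot,0,\alpha):\alpha\in\mathcal{A}_{0,T}[m_0]\}$ is the bundle of motions of the deterministic mean field type control system, $\mathcal{X}_Q(\mu_0)=\{\mu(\cdot,0,\mu_0,\zeta_{\mathcal{S}}):\zeta_{\mathcal{S}}\in\mathcal{U}_{0,T}^{\mathcal{S}}\}$ is the bundle of motions of the Markov chain, and $$\mathbb{H}(\Upsilon_1,\Upsilon_2)=\max\Bigl\{\sup_{m(\cdot)\in\Upsilon_1}\inf_{\mu(\cdot)\in\Upsilon_2}\mathbb{d}(m(\cdot),\mu(\cdot)),\ \sup_{\mu(\cdot)\in\Upsilon_2}\inf_{m(\cdot)\in\Upsilon_1}\mathbb{d}(m(\cdot),\mu(\cdot))\Bigr\},\quad \mathbb{d}(m(\cdot),\mu(\cdot))=\sup_{t\in[0,T]}W_2(m(t),\mathscr{I}(\mu(t))).$$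
   Context: **Notation.** For a Polish space $X$, $\mathcal{M}(X)$ is the set of nonnegative Borel measures with the topology of narrow convergence, $\mathcal{P}^2(X)$ the set of Borel probabilities with finite second moment, with the 2-Wasserstein metric $W_2$. $h\sharp m$ is the push-forward of $m$ by $h$; $\operatorname{p}^1$ is the projection onto the first coordinate. For a measure $m$ on $X$, $\Lambda(X,m;Y)$ is the set of measures $\alpha\in\mathcal{M}(X\times Y)$ with $\operatorname{p}^1\sharp\alpha=m$; $\alpha(\cdot|x)$ denotes the disintegration of $\alpha$ with respect to $m$. $\Gamma_{s,r}=C([s,r],\mathbb{R}^d)$, $e_t(x(\cdot))=x(t)$. **Deterministic mean field type control system.** $f:[0,T]\times\mathbb{R}^d\times\mathcal{P}^2(\mathbb{R}^d)\times U\to\mathbb{R}^d$ is the dynamics of each agent, $\frac{d}{dt}x(t)=f(t,x(t),m(t),u(t))$, where $m(t)$ is the distribution of agents. Standing assumptions: (C1) $U$ is a compact metric space; (C2) $f$ is continuous; (C3) $\mathcal{K}\subset\mathbb{R}^d$ is a set such that if $\operatorname{supp}(m)\subset\mathcal{K}$ then $f(t,x,m,u)=0$ for all $x\notin\mathcal{K}$; (C4) $f$ is bounded by a constant $R$ on $[0,T]\times\mathcal{K}\times\mathcal{P}^2(\mathcal{K})\times U$; (C5) $f$ is Lipschitz continuous in the space and measure variables on $[0,T]\times\mathcal{K}\times\mathcal{P}^2(\mathcal{K})\times U$ with constant $C_f$. *Relaxed controls.* $\mathcal{U}_{s,r}=\Lambda([s,r],\lambda;U)$, $\lambda$ the Lebesgue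 measure. For a flow of probabilities $m(\cdot)$ on $[s,r]$, $y\in\mathbb{R}^d$, $\xi\in\mathcal{U}_{s,r}$, $x(\cdot,s,y,m(\cdot),\xi)$ is the solution of $\frac{d}{dt}x(t)=\int_U f(t,x(t),m(t),u)\,\xi(du|t)$, $x(s)=y$; $\operatorname{traj}^{s,r}_{m(\cdot)}(y,\xi)=x(\cdot,s,y,m(\cdot),\xi)\in\Gamma_{s,r}$. For a probability $m_*$, $\mathcal{A}_{s,r}[m_*]=\Lambda(\mathbb{R}^d,m_*;\mathcal{U}_{s,r})$ is the set of distributions of controls. *Motion.* For $\alpha\in\mathcal{A}_{s,r}[m_*]$, $m(\cdot):[s,r]\to\mathcal{P}^2(\mathbb{R}^d)$ is the motion produced by $s$ and $\alpha$, denoted $m(\cdot,s,\alpha)$, if there is $\chi\in\mathcal{P}^2(\Gamma_{s,r})$ with $m(s)=m_*$, $\chi=\operatorname{traj}^{s,r}_{m(\cdot)}\sharp\alpha$, and $m(t)=e_t\sharp\chi$ for $t\in[s,r]$. It is known that for $m_*\in\mathcal{P}^2(\mathcal{K})$ the motion exists, is unique and stays in $\mathcal{P}^2(\mathcal{K})$. **Mean field Markov chain.** $\mathcal{S}\subset\mathcal{K}$ is at most countable; $\Sigma$ is the set of $\mu=(\mu_{\bar x})_{\bar x\in\mathcal{S}}$ with $\mu_{\bar x}\ge0$, $\sum\mu_{\bar x}=1$; $\Sigma^2$ is the subset with $\sum\|\bar x\|^2\mu_{\bar x}<\infty$; $\mathscr{I}(\mu)=\sum_{\bar x\in\mathcal{S}}\mu_{\bar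 x}\delta_{\bar x}$. For $t\in[0,T]$, $\mu\in\Sigma^2$, $u\in U$, $Q(t,\mu,u)=(Q_{\bar x,\bar y}(t,\mu,u))_{\bar x,\bar y\in\mathcal{S}}$ is a Kolmogorov matrix: $Q_{\bar x,\bar y}\ge0$ for $\bar x\ne\bar y$ and $\sum_{\bar y}Q_{\bar x,\bar y}=0$. A feedback control on $[s,r]$ is $\zeta_{\mathcal{S}}=(\zeta_{\bar x})_{\bar x\in\mathcal{S}}\in\mathcal{U}_{s,r}^{\mathcal{S}}$; put $\mathcal{Q}_{\bar x,\bar y}(t,\mu,\zeta_{\mathcal{S}})=\int_UQ_{\bar x,\bar y}(t,\mu,u)\,\zeta_{\bar x}(du|t)$. The motion $\mu(\cdot)=\mu(\cdot,s,\mu_*,\zeta_{\mathcal{S}})$ in the chain produced by $\mu_*\in\Sigma^2$ and $\zeta_{\mathcal{S}}$ is the solution of $\frac{d}{dt}\mu_{\bar y}(t)=\sum_{\bar x\in\mathcal{S}}\mu_{\bar x}(t)\mathcal{Q}_{\bar x,\bar y}(t,\mu(t),\zeta_{\mathcal{S}})$, $\mu_{\bar y}(s)=\mu_{*,\bar y}$. It is a standing assumption that this solution exists in $\Sigma^2$ and is unique (sufficient: the entries of $Q$ are continuous, each row has only finitely many nonzero entries, and $Q$ is Lipschitz in $\mu$). **Approximation assumptions.** (A1) $\max_{x\in\mathcal{K}}\min_{\bar y\in\mathcal{S}}\|x-\bar y\|\le\varepsilon$; (A2) the entries of $Q$ are uniformly bounded (in absolute value) by $B_Q$; (A3) $\bigl\|f(t,\bar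 x,\mathscr{I}(\mu),u)-\sum_{\bar y\in\mathcal{S}}(\bar y-\bar x)Q_{\bar x,\bar y}(t,\mu,u)\bigr\|\le\varepsilon$ and (A4) $\sum_{\bar y\in\mathcal{S}}\|\bar y-\bar x\|^2Q_{\bar x,\bar y}(t,\mu,u)\le\varepsilon^2$ for all $t\in[0,T]$, $\bar x\in\mathcal{S}$, $\mu\in\Sigma^2$, $u\in U$. It is assumed that $\varepsilon\le1$. *)

theory Defs
  imports "HOL-Probability.Probability"
begin

section \<open>Measures, narrow topology, Wasserstein distance\<close>

definition borel_of :: "'b topology \<Rightarrow> 'b measure" where
  "borel_of X = sigma (topspace X) {V. openin X V}"

lemma borel_of_euclidean: "borel_of euclidean = borel"
  by (simp add: borel_of_def borel_def)

definition msupport :: "'a::topological_space measure \<Rightarrow> 'a set" where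
  "msupport m = {x. \<forall>V. open V \<and> x \<in> V \<longrightarrow> emeasure m V > 0}"

definition P2 :: "'b metric \<Rightarrow> 'b measure set" where
  "P2 X = {m. sets m = sets (borel_of (mtopology_of X)) \<and> prob_space m \<and>
     (\<exists>x0\<in>mspace X. (\<integral>\<^sup>+ x. ennreal ((mdist X x0 x)\<^sup>2) \<partial>m) < \<infinity>)}"

lemma P2_euclidean_metric:
  "m \<in> P2 (euclidean_metric :: 'a::euclidean_space metric) \<longleftrightarrow>
     sets m = sets borel \<and> prob_space m \<and> (\<exists>x0. (\<integral>\<^sup>+ x. ennreal ((dist x0 x)\<^sup>2) \<partial>m) < \<infinity>)"
  by (simp add: P2_def borel_of_euclidean)

text \<open>Probabilities on a subset \<open>K\<close> are represented as probabilities on the whole space that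
  are concentrated on \<open>K\<close>.  For closed \<open>K\<close> this is the same as having support in \<open>K\<close>.\<close>

definition P2_on :: "'a::euclidean_space set \<Rightarrow> 'a measure set" where
  "P2_on K = {m \<in> P2 euclidean_metric. AE x in m. x \<in> K}"

definition couplings :: "'a::euclidean_space measure \<Rightarrow> 'a measure \<Rightarrow> ('a \<times> 'a) measure set" where
  "couplings m m' = {p. sets p = sets (borel \<Otimes>\<^sub>M borel) \<and>
     distr p borel fst = m \<and> distr p borel snd = m'}"

text \<open>The infimum is finite whenever both arguments lie in \<open>P2 euclidean_metric\<close>.\<close>

definition W2 :: "'a::euclidean_space measure \<Rightarrow> 'a measure \<Rightarrow> real" where
  "W2 m m' = sqrt (enn2real (INF p\<in>couplings m m'. \<integral>\<^sup>+ z. ennreal ((dist (fst z) (snd z))\<^sup>2) \<partial>p))"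

text \<open>\<open>\<Lambda>(X,m;Y)\<close>: the \<open>\<sigma>\<close>-algebra of \<open>X\<close> is that of \<open>m\<close>, and \<open>N\<close> carries the one of \<open>Y\<close>.
  All spaces below are separable metrizable, so the product \<open>\<sigma>\<close>-algebra is the Borel one.\<close>

definition Lam :: "'b measure \<Rightarrow> 'c measure \<Rightarrow> ('b \<times> 'c) measure set" where
  "Lam m N = {\<alpha>. sets \<alpha> = sets (m \<Otimes>\<^sub>M N) \<and> distr \<alpha> m fst = m}"

definition is_disintegration ::
  "'b measure \<Rightarrow> 'c measure \<Rightarrow> ('b \<times> 'c) measure \<Rightarrow> ('b \<Rightarrow> 'c measure) \<Rightarrow> bool" where
  "is_disintegration m N \<alpha> \<kappa> \<longleftrightarrow> \<kappa> \<in> measurable m (prob_algebra N) \<and>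
     (\<forall>A\<in>sets m. \<forall>B\<in>sets N. emeasure \<alpha> (A \<times> B) = (\<integral>\<^sup>+ x\<in>A. emeasure (\<kappa> x) B \<partial>m))"

text \<open>Disintegrations are unique up to null sets; \<open>disintegration\<close> picks a version.\<close>

definition disintegration ::
  "'b measure \<Rightarrow> 'c measure \<Rightarrow> ('b \<times> 'c) measure \<Rightarrow> 'b \<Rightarrow> 'c measure" where
  "disintegration m N \<alpha> = (SOME \<kappa>. is_disintegration m N \<alpha> \<kappa>)"

text \<open>Topology of narrow convergence on a set \<open>P\<close> of finite measures on the space \<open>X\<close>.\<close>

definition narrow_topology ::
  "'b::topological_space set \<Rightarrow> 'b measure set \<Rightarrow> 'b measure topology" where
  "narrow_topology X P = topology_generated_by
     {{\<xi> \<in> P. (\<integral>z. \<phi> z \<partial>\<xi>) \<in> V} | (\<phi> :: 'b \<Rightarrow> real) V.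
        continuous_on X \<phi> \<and> bounded (\<phi> ` X) \<and> open V}"


section \<open>The deterministic mean field type control system\<close>

definition lebesgue_on_interval :: "real \<Rightarrow> real \<Rightarrow> real measure" where
  "lebesgue_on_interval s r = restrict_space lborel {s..r}"

definition relaxed_controls :: "real \<Rightarrow> real \<Rightarrow> (real \<times> 'u::metric_space) measure set" where
  "relaxed_controls s r = Lam (lebesgue_on_interval s r) borel"

definition relaxed_space :: "real \<Rightarrow> real \<Rightarrow> (real \<times> 'u::metric_space) measure measure" where
  "relaxed_space s r = borel_of (narrow_topology ({s..r} \<times> UNIV) (relaxed_controls s r))"

text \<open>\<open>control_kernel s r \<xi> t\<close> is \<open>\<xi>(\<sqdot>|t)\<close>.\<close>

definition control_kernel ::
  "real \<Rightarrow> real \<Rightarrow> (real \<times> 'u::metric_space) measure \<Rightarrow> real \<Rightarrow> 'u measure" where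
  "control_kernel s r \<xi> = disintegration (lebesgue_on_interval s r) borel \<xi>"

definition control_distributions ::
  "real \<Rightarrow> real \<Rightarrow> 'a::euclidean_space measure \<Rightarrow> ('a \<times> (real \<times> 'u::metric_space) measure) measure set"
  where "control_distributions s r m = Lam m (relaxed_space s r)"

definition path_space :: "real \<Rightarrow> real \<Rightarrow> (real \<Rightarrow> 'a::euclidean_space) metric" where
  "path_space s r = cfunspace (top_of_set {s..r}) euclidean_metric"

text \<open>The right-hand side of the equation is only measurable in time, so solutions are
  understood in the sense of Caratheodory, i.e. through the integral equation.\<close>

definition solves_ode ::
  "(real \<Rightarrow> 'a::euclidean_space \<Rightarrow> 'a measure \<Rightarrow> 'u::metric_space \<Rightarrow> 'a) \<Rightarrow> real \<Rightarrow> real \<Rightarrow>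
   (real \<Rightarrow> 'a measure) \<Rightarrow> 'a \<Rightarrow> (real \<times> 'u) measure \<Rightarrow> (real \<Rightarrow> 'a) \<Rightarrow> bool" where
  "solves_ode f s r m y \<xi> x \<longleftrightarrow>
     set_integrable lborel {s..r} (\<lambda>\<tau>. \<integral>u. f \<tau> (x \<tau>) (m \<tau>) u \<partial>(control_kernel s r \<xi> \<tau>)) \<and>
     (\<forall>t\<in>{s..r}. x t = y + (LINT \<tau>:{s..t}|lborel.
         (\<integral>u. f \<tau> (x \<tau>) (m \<tau>) u \<partial>(control_kernel s r \<xi> \<tau>))))"

definition traj ::
  "(real \<Rightarrow> 'a::euclidean_space \<Rightarrow> 'a measure \<Rightarrow> 'u::metric_space \<Rightarrow> 'a) \<Rightarrow> real \<Rightarrow> real \<Rightarrow>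
   (real \<Rightarrow> 'a measure) \<Rightarrow> 'a \<Rightarrow> (real \<times> 'u) measure \<Rightarrow> (real \<Rightarrow> 'a)" where
  "traj f s r m y \<xi> = (THE x. x \<in> mspace (path_space s r) \<and> solves_ode f s r m y \<xi> x)"

definition is_motion ::
  "(real \<Rightarrow> 'a::euclidean_space \<Rightarrow> 'a measure \<Rightarrow> 'u::metric_space \<Rightarrow> 'a) \<Rightarrow> real \<Rightarrow> real \<Rightarrow>
   'a measure \<Rightarrow> ('a \<times> (real \<times> 'u) measure) measure \<Rightarrow> (real \<Rightarrow> 'a measure) \<Rightarrow> bool" where
  "is_motion f s r mi \<alpha> m \<longleftrightarrow>
     (\<forall>t\<in>{s..r}. m t \<in> P2 euclidean_metric) \<and> m s = mi \<and>
     (\<exists>\<nu>\<in>P2 (path_space s r).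
        \<nu> = distr \<alpha> (borel_of (mtopology_of (path_space s r))) (\<lambda>(y, \<xi>). traj f s r m y \<xi>) \<and>
        (\<forall>t\<in>{s..r}. m t = distr \<nu> borel (\<lambda>x. x t)))"

text \<open>The motion produced by \<open>\<alpha>\<close> is the one that stays in \<open>P2_on K\<close>.  The restriction is stated
  explicitly because \<open>f\<close> is Lipschitz only on \<open>K\<close> and \<open>P2_on K\<close>: among flows that may leave
  \<open>P2_on K\<close> uniqueness can fail.\<close>

definition motions ::
  "(real \<Rightarrow> 'a::euclidean_space \<Rightarrow> 'a measure \<Rightarrow> 'u::metric_space \<Rightarrow> 'a) \<Rightarrow> 'a set \<Rightarrow> real \<Rightarrow>
   'a measure \<Rightarrow> (real \<Rightarrow> 'a measure) set" where
  "motions f K T m0 = {m. \<exists>\<alpha>\<in>control_distributions 0 T m0.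
     is_motion f 0 T m0 \<alpha> m \<and> (\<forall>t\<in>{0..T}. m t \<in> P2_on K)}"

text \<open>Compactness of the control space is a condition on the type \<open>'u\<close> and not included here.
  The first clause is joint continuity of \<open>f\<close> with respect to \<open>W2\<close> in the measure variable,
  the last two are the bound and the Lipschitz condition on \<open>K\<close>.\<close>

definition control_system ::
  "real \<Rightarrow> (real \<Rightarrow> 'a::euclidean_space \<Rightarrow> 'a measure \<Rightarrow> 'u::metric_space \<Rightarrow> 'a) \<Rightarrow> 'a set \<Rightarrow> bool" where
  "control_system T f K \<longleftrightarrow>
     (\<forall>t\<in>{0..T}. \<forall>x. \<forall>m\<in>P2 euclidean_metric. \<forall>u. \<forall>e>0. \<exists>\<delta>>0.
        \<forall>t'\<in>{0..T}. \<forall>x'. \<forall>m'\<in>P2 euclidean_metric. \<forall>u'.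
          dist t' t < \<delta> \<and> dist x' x < \<delta> \<and> W2 m' m < \<delta> \<and> dist u' u < \<delta> \<longrightarrow>
          dist (f t' x' m' u') (f t x m u) < e) \<and>
     (\<forall>t\<in>{0..T}. \<forall>m\<in>P2 euclidean_metric. \<forall>x u. msupport m \<subseteq> K \<and> x \<notin> K \<longrightarrow> f t x m u = 0) \<and>
     (\<exists>R. \<forall>t\<in>{0..T}. \<forall>x\<in>K. \<forall>m\<in>P2_on K. \<forall>u. norm (f t x m u) \<le> R) \<and>
     (\<exists>Cf. \<forall>t\<in>{0..T}. \<forall>x\<in>K. \<forall>x'\<in>K. \<forall>m\<in>P2_on K. \<forall>m'\<in>P2_on K. \<forall>u.
        norm (f t x m u - f t x' m' u) \<le> Cf * (norm (x - x') + W2 m m'))"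


section \<open>The mean field Markov chain\<close>

text \<open>Families indexed by \<open>S\<close> are represented as functions vanishing outside \<open>S\<close>.\<close>

definition Sigma1 :: "'a set \<Rightarrow> ('a \<Rightarrow> real) set" where
  "Sigma1 S = {\<mu>. (\<forall>x. 0 \<le> \<mu> x) \<and> (\<forall>x. x \<notin> S \<longrightarrow> \<mu> x = 0) \<and> (\<mu> has_sum 1) S}"

definition Sigma2 :: "'a::euclidean_space set \<Rightarrow> ('a \<Rightarrow> real) set" where
  "Sigma2 S = {\<mu> \<in> Sigma1 S. (\<lambda>x. (norm x)\<^sup>2 * \<mu> x) summable_on S}"

text \<open>\<open>chain_measure S \<mu>\<close> is the measure \<open>\<Sum>x\<in>S. \<mu> x \<delta>\<^sub>x\<close> on the Borel sets.\<close>

definition chain_measure :: "'a::euclidean_space set \<Rightarrow> ('a \<Rightarrow> real) \<Rightarrow> 'a measure" where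
  "chain_measure S \<mu> = distr (point_measure S (\<lambda>x. ennreal (\<mu> x))) borel (\<lambda>x. x)"

text \<open>\<open>Q t \<mu> u x y\<close> is the entry \<open>Q\<^bsub>x,y\<^esub>(t,\<mu>,u)\<close>.\<close>

definition kolmogorov_family ::
  "real \<Rightarrow> 'a::euclidean_space set \<Rightarrow> (real \<Rightarrow> ('a \<Rightarrow> real) \<Rightarrow> 'u \<Rightarrow> 'a \<Rightarrow> 'a \<Rightarrow> real) \<Rightarrow> bool" where
  "kolmogorov_family T S Q \<longleftrightarrow>
     (\<forall>t\<in>{0..T}. \<forall>\<mu>\<in>Sigma2 S. \<forall>u. \<forall>x\<in>S.
        (\<forall>y\<in>S. x \<noteq> y \<longrightarrow> 0 \<le> Q t \<mu> u x y) \<and> ((\<lambda>y. Q t \<mu> u x y) has_sum 0) S)"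

definition feedback_controls ::
  "'a set \<Rightarrow> real \<Rightarrow> real \<Rightarrow> ('a \<Rightarrow> (real \<times> 'u::metric_space) measure) set" where
  "feedback_controls S s r = {\<zeta>. \<forall>x\<in>S. \<zeta> x \<in> relaxed_controls s r}"

definition avg_rate ::
  "(real \<Rightarrow> ('a \<Rightarrow> real) \<Rightarrow> 'u \<Rightarrow> 'a \<Rightarrow> 'a \<Rightarrow> real) \<Rightarrow> real \<Rightarrow> real \<Rightarrow>
   ('a \<Rightarrow> (real \<times> 'u::metric_space) measure) \<Rightarrow> real \<Rightarrow> ('a \<Rightarrow> real) \<Rightarrow> 'a \<Rightarrow> 'a \<Rightarrow> real" where
  "avg_rate Q s r \<zeta> t \<mu> x y = (\<integral>u. Q t \<mu> u x y \<partial>(control_kernel s r (\<zeta> x) t))"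

text \<open>As above, the differential equation is understood through the integral equation; the
  first clauses express that all sums and integrals occurring in it exist.\<close>

definition is_chain_motion ::
  "'a::euclidean_space set \<Rightarrow> (real \<Rightarrow> ('a \<Rightarrow> real) \<Rightarrow> 'u \<Rightarrow> 'a \<Rightarrow> 'a \<Rightarrow> real) \<Rightarrow> real \<Rightarrow> real \<Rightarrow>
   ('a \<Rightarrow> real) \<Rightarrow> ('a \<Rightarrow> (real \<times> 'u::metric_space) measure) \<Rightarrow> (real \<Rightarrow> 'a \<Rightarrow> real) \<Rightarrow> bool" where
  "is_chain_motion S Q s r \<mu>i \<zeta> \<mu> \<longleftrightarrow>
     (\<forall>t\<in>{s..r}. \<mu> t \<in> Sigma2 S) \<and>
     (\<forall>x\<in>S. \<forall>y\<in>S. integrable (\<zeta> x) (\<lambda>(\<tau>, u). Q \<tau> (\<mu> \<tau>) u x y)) \<and>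
     (\<forall>y\<in>S.
        (AE \<tau> in lebesgue_on_interval s r.
           (\<lambda>x. \<mu> \<tau> x * avg_rate Q s r \<zeta> \<tau> (\<mu> \<tau>) x y) summable_on S) \<and>
        set_integrable lborel {s..r}
          (\<lambda>\<tau>. \<Sum>\<^sub>\<infinity>x\<in>S. \<mu> \<tau> x * avg_rate Q s r \<zeta> \<tau> (\<mu> \<tau>) x y) \<and>
        (\<forall>t\<in>{s..r}. \<mu> t y = \<mu>i y + (LINT \<tau>:{s..t}|lborel.
          (\<Sum>\<^sub>\<infinity>x\<in>S. \<mu> \<tau> x * avg_rate Q s r \<zeta> \<tau> (\<mu> \<tau>) x y))))"

definition chain_well_posed ::
  "real \<Rightarrow> 'a::euclidean_space set \<Rightarrow>
   (real \<Rightarrow> ('a \<Rightarrow> real) \<Rightarrow> 'u::metric_space \<Rightarrow> 'a \<Rightarrow> 'a \<Rightarrow> real) \<Rightarrow> bool" where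
  "chain_well_posed T S Q \<longleftrightarrow>
     (\<forall>s r. \<forall>\<mu>i\<in>Sigma2 S. \<forall>\<zeta>\<in>feedback_controls S s r. 0 \<le> s \<and> s < r \<and> r \<le> T \<longrightarrow>
        (\<exists>\<mu>. is_chain_motion S Q s r \<mu>i \<zeta> \<mu>) \<and>
        (\<forall>\<mu> \<mu>'. is_chain_motion S Q s r \<mu>i \<zeta> \<mu> \<and> is_chain_motion S Q s r \<mu>i \<zeta> \<mu>' \<longrightarrow>
           (\<forall>t\<in>{s..r}. \<mu> t = \<mu>' t)))"

definition markov_chain ::
  "real \<Rightarrow> 'a::euclidean_space set \<Rightarrow> 'a set \<Rightarrow>
   (real \<Rightarrow> ('a \<Rightarrow> real) \<Rightarrow> 'u::metric_space \<Rightarrow> 'a \<Rightarrow> 'a \<Rightarrow> real) \<Rightarrow> bool" where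
  "markov_chain T K S Q \<longleftrightarrow>
     countable S \<and> S \<subseteq> K \<and> kolmogorov_family T S Q \<and> chain_well_posed T S Q"

definition chain_motions ::
  "real \<Rightarrow> 'a::euclidean_space set \<Rightarrow> (real \<Rightarrow> ('a \<Rightarrow> real) \<Rightarrow> 'u::metric_space \<Rightarrow> 'a \<Rightarrow> 'a \<Rightarrow> real) \<Rightarrow>
   ('a \<Rightarrow> real) \<Rightarrow> (real \<Rightarrow> 'a \<Rightarrow> real) set" where
  "chain_motions T S Q \<mu>0 = {\<mu>. \<exists>\<zeta>\<in>feedback_controls S 0 T. is_chain_motion S Q 0 T \<mu>0 \<zeta> \<mu>}"

text \<open>Convergence of the sums is stated explicitly, since a divergent \<open>infsum\<close> has value 0.\<close>

definition approximates ::
  "real \<Rightarrow> (real \<Rightarrow> 'a::euclidean_space \<Rightarrow> 'a measure \<Rightarrow> 'u::metric_space \<Rightarrow> 'a) \<Rightarrow> 'a set \<Rightarrow> 'a set \<Rightarrow>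
   (real \<Rightarrow> ('a \<Rightarrow> real) \<Rightarrow> 'u \<Rightarrow> 'a \<Rightarrow> 'a \<Rightarrow> real) \<Rightarrow> real \<Rightarrow> real \<Rightarrow> bool" where
  "approximates T f K S Q B\<^sub>Q \<epsilon> \<longleftrightarrow>
     (\<forall>x\<in>K. \<exists>y\<in>S. norm (x - y) \<le> \<epsilon>) \<and>
     (\<forall>t\<in>{0..T}. \<forall>x\<in>S. \<forall>\<mu>\<in>Sigma2 S. \<forall>u.
        (\<forall>y\<in>S. \<bar>Q t \<mu> u x y\<bar> \<le> B\<^sub>Q) \<and>
        (\<lambda>y. Q t \<mu> u x y *\<^sub>R (y - x)) summable_on S \<and>
        norm (f t x (chain_measure S \<mu>) u - (\<Sum>\<^sub>\<infinity>y\<in>S. Q t \<mu> u x y *\<^sub>R (y - x))) \<le> \<epsilon> \<and>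
        (\<lambda>y. (norm (y - x))\<^sup>2 * Q t \<mu> u x y) summable_on S \<and>
        (\<Sum>\<^sub>\<infinity>y\<in>S. (norm (y - x))\<^sup>2 * Q t \<mu> u x y) \<le> \<epsilon>\<^sup>2)"


section \<open>Distance between the bundles\<close>

text \<open>Suprema and infima are taken in \<open>[0,\<infinity>]\<close>.\<close>

definition flow_dist ::
  "real \<Rightarrow> 'a::euclidean_space set \<Rightarrow> (real \<Rightarrow> 'a measure) \<Rightarrow> (real \<Rightarrow> 'a \<Rightarrow> real) \<Rightarrow> ennreal" where
  "flow_dist T S m \<mu> = (SUP t\<in>{0..T}. ennreal (W2 (m t) (chain_measure S (\<mu> t))))"

definition bundle_dist ::
  "real \<Rightarrow> 'a::euclidean_space set \<Rightarrow> (real \<Rightarrow> 'a measure) set \<Rightarrow> (real \<Rightarrow> 'a \<Rightarrow> real) set \<Rightarrow> ennreal" where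
  "bundle_dist T S Y1 Y2 = max
     (SUP m\<in>Y1. INF \<mu>\<in>Y2. flow_dist T S m \<mu>)
     (SUP \<mu>\<in>Y2. INF m\<in>Y1. flow_dist T S m \<mu>)"

end

theory Submission imports Defs begin

text \<open>Both inclusions come from one explicit coupling, so that neither a triangle inequality for \<open>W2\<close>
  nor any theory of stochastic processes is used. On a time grid of mesh \<open>h\<close> each agent \<open>X\<close> is
  accompanied by a state \<open>Y\<close> of the chain; over one step \<open>Y\<close> jumps with the Euler probabilities
  \<open>1[y = x] + \<integral> Q x y\<close>, integrated against the agent's own control. The drift and variance conditions (A3) and (A4)
  give \<open>E |Y - X|\<^sup>2 \<le> (1 + C h) E |Y - X|\<^sup>2 + 3 h \<epsilon>\<^sup>2\<close> over the step, while the law of \<open>Y\<close> differs from the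
  solution of the Kolmogorov equation by \<open>O(h)\<close> in a weighted \<open>l\<^sup>1\<close> norm. The mesh \<open>h\<close> is chosen last, depending on
  the chain, so that \<open>B\<^sub>Q\<close> and the moments do not enter the constants.
  Given a motion, the feedback of the chain in state \<open>x\<close> is the mixture of the controls of the agents
  with \<open>Y = x\<close>. Given a chain motion, an agent uses the feedback of its successive states.
  A relaxed control is represented as the image of Lebesgue measure under a Borel function \<open>\<Phi>(t, v)\<close>
  of time and a uniform variable \<open>v\<close>, which makes mixtures and concatenations explicit.\<close>

\<comment> \<open>The jump of Y and the displacement of X over a step use the same control, so that
  in the mean square the first-order terms cancel up to (A3) and the Lipschitz error. What remains
  is h times the error already present; hence the growth constant \<open>2 + 10 * L\<close> involves
  only the Lipschitz constant L. The two directions differ in what is known before a step. Starting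
  from a motion, the feedback is a conditional average over the current population, so feedback,
  chain motion and coupling have to grow together. Starting from a chain motion, the feedback is
  known in advance: the law of the controls is built on the whole history of Y, and only then does
  an existence theorem supply the motion; causality identifies it with the coupled agents step by
  step. Two obstacles come first. K is an arbitrary set, so that bounds on the field have to be
  carried from K to the whole space. The control space is compact metric without a second
  countability class, so that measurability goes through an explicit dense sequence. The weight 1 +
  |x|^2 in the l^1 norm is what turns errors of laws into errors in W2.\<close>
syntax
  "_NN" :: "pttrn => 'a measure => ennreal => ennreal" ("(NN _:_./ _)" [0, 51, 10] 10)
  "_NN_on" :: "pttrn => 'a measure => 'a set => ennreal => ennreal" ("(NN _:_|_./ _)" [0, 51, 51, 10] 10)
  "_CS" :: "pttrn => 'a set => ennreal => ennreal" ("(CS _:_./ _)" [0, 51, 10] 10)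
translations
  "NN x:M. f" => "CONST nn_integral M (%x. f)"
  "NN x:M|A. f" => "CONST set_nn_integral M A (%x. f)"
  "CS x:S. f" => "CONST nn_integral (CONST count_space S) (%x. f)"

notation measurable (infixr "->M" 60)
notation pair_measure (infixr "*M" 80)
abbreviation "bmeas == borel_measurable"
abbreviation "borel2 == borel *M borel"
abbreviation "ind == indicator"
lemmas mcomp = measurable_compose

section \<open>Compact metric spaces and functional representations\<close>

text \<open>The class of \<open>'u\<close> provides no second countability; this sequence, obtained
  from total boundedness, replaces it in the measurability arguments about controls.\<close>

lemma compact_dense_sequence:
 assumes "compact (UNIV :: 'u::metric_space set)"
 shows "EX d :: nat => 'u. ALL x. ALL e>0. EX i. dist x (d i) < e"
proof -
 have "ALL e>0. EX k. finite k & k \<subseteq> (UNIV :: 'u set) & (UNIV :: 'u set) \<subseteq> (\<Union>x\<in>k. ball x e)"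
  using assms unfolding compact_eq_totally_bounded by simp
 then have "ALL n. EX k. finite k & (UNIV :: 'u set) \<subseteq> (\<Union>x\<in>k. ball x (inverse (Suc n)))"
  by (metis inverse_positive_iff_positive of_nat_0_less_iff zero_less_Suc)
 then obtain k :: "nat => 'u set" where k: "!!n. finite (k n)" "!!n. UNIV \<subseteq> (\<Union>x\<in>k n. ball x (inverse (Suc n)))"
  by metis
 let ?D = "\<Union>n. k n"
 have cD: "countable ?D" using k(1) by (auto intro: countable_finite)
 have neD: "?D ~= {}" using k(2)[of 0] by blast
 have "EX i. dist x (from_nat_into ?D i) < e" if "e > 0" for x and e :: real
 proof -
  obtain n where n: "inverse (Suc n) < e" using \<open>e>0\<close> reals_Archimedean by blast
  obtain y where y: "y : k n" "dist x y < inverse (Suc n)"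
  proof -
   have "x : (\<Union>y\<in>k n. ball y (inverse (Suc n)))" using k(2)[of n] by blast
   then show ?thesis using that by (auto simp: dist_commute)
  qed
  then obtain i where "from_nat_into ?D i = y"
   by (metis UN_I UNIV_I cD from_nat_into_surj)
  then have "dist x (from_nat_into ?D i) < e" using y n by simp
  then show ?thesis by blast
 qed
 then show ?thesis by (intro exI[of _ "from_nat_into ?D"]) auto
qed

lemma open_pred_borel:
 assumes "open {u. P u}"
 shows "Measurable.pred borel P"
 using assms by (simp add: pred_def borel_open)

lemma measurable_near_index:
 fixes d :: "nat => 'u::metric_space"
 shows "(%u. LEAST i. dist u (d i) < e) : borel ->M count_space UNIV"
proof (rule measurable_Least, goal_cases)
 case (1 i)
 show ?case
  by (rule open_pred_borel) (intro open_Collect_less continuous_intros)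
qed

lemma near_index:
 fixes d :: "nat => 'u::metric_space"
 assumes "ALL x. ALL e>0. EX i. dist x (d i) < e" "e > 0"
 shows "dist u (d (LEAST i. dist u (d i) < e)) < e"
 using LeastI_ex[of "%i. dist u (d i) < e"] assms by blast

lemma near_index_tendsto:
 fixes d :: "nat => 'u::metric_space"
 assumes "ALL x. ALL e>0. EX i. dist x (d i) < e"
 shows "(%n. d (LEAST i. dist u (d i) < inverse (real (Suc n)))) \<longlonglongrightarrow> u"
proof (rule metric_LIMSEQ_I, goal_cases)
 case (1 r)
 then obtain n where n: "inverse (real (Suc n)) < r" using reals_Archimedean by blast
 have "dist (d (LEAST i. dist u (d i) < inverse (real (Suc k)))) u < r" if "n <= k" for k
 proof -
  have "dist u (d (LEAST i. dist u (d i) < inverse (real (Suc k)))) < inverse (real (Suc k))"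
   by (rule near_index[OF assms]) simp
  also have "... <= inverse (real (Suc n))" using that by (simp add: le_imp_inverse_le)
  finally show ?thesis using n by (simp add: dist_commute)
 qed
 then show ?case by blast
qed

text \<open>Replacing u by the first listed point within 1/(n+1) of it turns \<open>phi\<close> into
  a countable case distinction between functions of the first coordinate; continuity removes the
  rounding in the limit. Continuous functions are thus measurable for the product sigma-algebra,
  which a priori could be smaller than the Borel one.\<close>

lemma continuous_borel_measurable_prod:
 fixes phi :: "'b::t2_space * 'u::metric_space => 'c::metric_space"
 assumes cpt: "compact (UNIV :: 'u set)" and phi: "continuous_on UNIV phi"
 shows "phi : borel2 ->M borel"
proof -
 obtain d :: "nat => 'u" where d: "ALL x. ALL e>0. EX i. dist x (d i) < e"
  using compact_dense_sequence[OF cpt] by blast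
 let ?i = "%n u. LEAST i. dist u (d i) < inverse (real (Suc n))"
 show ?thesis
 proof (rule borel_measurable_LIMSEQ_metric)
  fix n
  show "(%z. phi (fst z, d (?i n (snd z)))) : borel2 ->M borel"
  proof (rule measurable_compose_countable)
   fix i
   have "(%b. phi (b, d i)) : borel ->M borel"
    by (intro borel_measurable_continuous_onI continuous_on_compose2[OF phi] continuous_intros) auto
   then show "(%z. phi (fst z, d i)) : borel2 ->M borel"
    by (rule mcomp[OF measurable_fst])
   show "(%z. ?i n (snd z)) : borel2 ->M count_space UNIV"
    by (rule mcomp[OF measurable_snd measurable_near_index])
  qed
 next
  fix z :: "'b * 'u"
  have "isCont phi z" using phi continuous_on_eq_continuous_at[OF open_UNIV] by blast
  moreover have "(%n. (fst z, d (?i n (snd z)))) \<longlonglongrightarrow> (fst z, snd z)"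
   by (intro tendsto_intros near_index_tendsto d)
  ultimately show "(%n. phi (fst z, d (?i n (snd z)))) \<longlonglongrightarrow> phi z"
   by (intro isCont_tendsto_compose[where g=phi]) simp_all
 qed
qed

subsection \<open>Borel coding by real numbers\<close>

text \<open>Digits 0 and 1 in base 4 leave no carries, so that distinct bit sequences give distinct
  numbers and floors recover the digits; in base 2 two expansions could coincide.\<close>

definition base4 :: "(nat => bool) => real" where
 "base4 b = (\<Sum>m. of_bool (b m) / 4 ^ Suc m)"

definition digit4 :: "nat => real => bool" where
 "digit4 m x \<longleftrightarrow> \<lfloor>4 ^ Suc m * x\<rfloor> mod 4 = 1"

lemma base4_summable: "summable (%m. of_bool (b m) / (4::real) ^ Suc m)"
proof (rule summable_comparison_test')
 show "summable (%m. (1/4 :: real) ^ Suc m)" by (simp add: summable_geometric)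
qed (auto simp: power_one_over)

lemma base4_bounds: "0 <= base4 b" "base4 b < 1"
proof -
 show "0 <= base4 b" unfolding base4_def by (intro suminf_nonneg base4_summable) auto
 have g: "(%m. (1/4 :: real) ^ Suc m) sums (1/3)"
  using sums_mult[OF geometric_sums[of "1/4 :: real"], of "1/4"] by simp
 have "base4 b <= (\<Sum>m. (1/4 :: real) ^ Suc m)"
  unfolding base4_def by (intro suminf_le base4_summable sums_summable[OF g]) (auto simp: power_one_over)
 then show "base4 b < 1" using sums_unique[OF g] by simp
qed

lemma digit4_base4: "digit4 m (base4 b) = b m"
proof -
 let ?f = "%m. of_bool (b m) / (4::real) ^ Suc m"
 \<comment> \<open>After multiplication by \<open>4 ^ Suc m\<close> the earlier digits contribute
   \<open>4 * I\<close>, the next one \<open>b m\<close>, and the tail lies in [0, 1): the floor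
   modulo 4 is the digit.\<close>
 define I :: int where "I = (\<Sum>i<m. of_bool (b i) * 4 ^ (m - 1 - i))"
 have "base4 b = (\<Sum>n. ?f (n + Suc m)) + (\<Sum>i<Suc m. ?f i)"
  unfolding base4_def by (rule suminf_split_initial_segment[OF base4_summable])
 also have "(\<Sum>n. ?f (n + Suc m)) = (\<Sum>n. (1 / 4 ^ Suc m) * (of_bool (b (n + Suc m)) / (4::real) ^ Suc n))"
  by (simp add: power_add field_simps)
 also have "... = 1 / 4 ^ Suc m * base4 (%n. b (n + Suc m))"
  unfolding base4_def by (rule suminf_mult[OF base4_summable])
 finally have "4 ^ Suc m * base4 b = base4 (%n. b (n + Suc m)) + (\<Sum>i<Suc m. 4 ^ Suc m * ?f i)"
  by (simp add: distrib_left sum_distrib_left)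
 also have "(\<Sum>i<Suc m. 4 ^ Suc m * ?f i) = (\<Sum>i<m. 4 * (of_bool (b i) * 4 ^ (m - 1 - i))) + of_bool (b m)"
 proof -
  have "4 ^ Suc m * ?f i = 4 * (of_bool (b i) * 4 ^ (m - 1 - i))" if "i < m" for i
  proof -
   have "(4::real) ^ m = 4 ^ (m - 1 - i) * 4 ^ Suc i" using that by (simp flip: power_add power_Suc)
   then show ?thesis by simp
  qed
  then show ?thesis by simp
 qed
 also have "... = of_int (4 * I + of_bool (b m))"
  unfolding I_def by (simp only: of_int_add of_int_mult of_int_sum of_int_of_bool of_int_power of_int_numeral sum_distrib_left)
 finally have e: "4 ^ Suc m * base4 b = of_int (4 * I + of_bool (b m)) + base4 (%n. b (n + Suc m))"
  by simp
 have "\<lfloor>4 ^ Suc m * base4 b\<rfloor> = 4 * I + of_bool (b m)"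
  unfolding e using base4_bounds[of "%n. b (n + Suc m)"] by linarith
 then show ?thesis unfolding digit4_def by simp
qed

text \<open>A control is coded by the answers to all questions whether it lies within 1/(n+1) of the
  i-th dense point, the pairs (n, i) being enumerated by \<open>prod_encode\<close>. Decoding takes,
  for each n, the first i with a positive answer and passes to the limit. Measures on the control
  space thereby become measures on [0, 1), where distribution functions are available.\<close>

lemma borel_coding:
 assumes cpt: "compact (UNIV :: 'u::metric_space set)"
 shows "EX s :: 'u => real. EX c :: real => 'u. s : borel ->M borel & c : borel ->M borel \<and>
  (ALL u. c (s u) = u & 0 <= s u & s u < 1)"
proof -
 obtain d :: "nat => 'u" where d: "ALL x. ALL e>0. EX i. dist x (d i) < e"
  using compact_dense_sequence[OF cpt] by blast
 define b where "b u m = (dist u (d (snd (prod_decode m))) < inverse (real (Suc (fst (prod_decode m)))))" for u m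
 define s where "s u = base4 (b u)" for u
 define j where "j n x = (LEAST i. digit4 (prod_encode (n, i)) x)" for n x
 \<comment> \<open>The Cauchy property with countable quantifiers. Off the range of \<open>s\<close>
   the digits need not describe a convergent sequence; \<open>cn\<close> then falls back to the
   constant \<open>d 0\<close>, which keeps \<open>c\<close> defined and Borel everywhere.\<close>
 define good where "good x = (ALL k. EX N. ALL m>=N. ALL n>=N. dist (d (j m x)) (d (j n x)) < inverse (real (Suc k)))" for x
 define cn where "cn n x = (if good x then d (j n x) else d 0)" for n x
 have [measurable]: "s : borel ->M borel"
  unfolding s_def base4_def
 proof (rule borel_measurable_suminf, goal_cases)
  case (1 i)
  have [measurable]: "Measurable.pred borel (%u. b u i)"
   unfolding b_def by (rule open_pred_borel) (intro open_Collect_less continuous_intros)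
  show ?case
   unfolding of_bool_def by measurable
 qed
 have [measurable]: "j n : borel ->M count_space UNIV" for n
  unfolding j_def digit4_def by measurable
 have [measurable]: "Measurable.pred borel good"
  unfolding good_def
 proof -
  have [measurable]: "Measurable.pred borel (%x. dist (d (j m x)) (d (j n x)) < inverse (real (Suc k)))" for k m n
   by measurable
  show "Measurable.pred borel (%x. ALL k. EX N. ALL m>=N. ALL n>=N. dist (d (j m x)) (d (j n x)) < inverse (real (Suc k)))"
   by measurable
 qed
 have Cau: "Cauchy (%n. cn n x)" for x
 proof (cases "good x")
  case True
  show ?thesis
  proof (rule metric_CauchyI, goal_cases)
   case (1 e)
   then obtain k where k: "inverse (real (Suc k)) < e" using reals_Archimedean by blast
   with True show ?case
    unfolding cn_def good_def by (simp) (meson less_trans)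
  qed
 next
  case False
  then show ?thesis by (simp add: cn_def Cauchy_def)
 qed
 have "EX l. (%n. cn n x) \<longlonglongrightarrow> l" for x
  using compact_imp_complete[OF cpt] Cau[of x] unfolding complete_def by auto
 then obtain c where c: "!!x. (%n. cn n x) \<longlonglongrightarrow> c x" by metis
 have "c : borel ->M borel"
 proof (rule borel_measurable_LIMSEQ_metric[OF _ c], goal_cases)
  case (1 n)
  have "(%x. if good x then d (j n x) else d 0) : borel ->M borel"
   by (intro measurable_If mcomp[OF \<open>j n : _\<close>]) auto
  then show ?case unfolding cn_def .
 qed
 moreover have "c (s u) = u" for u
 proof -
  have ju: "j n (s u) = (LEAST i. dist u (d i) < inverse (real (Suc n)))" for n
   unfolding j_def s_def digit4_base4 b_def by simp
  have lim: "(%n. d (j n (s u))) \<longlonglongrightarrow> u" unfolding ju by (rule near_index_tendsto[OF d])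
  then have "Cauchy (%n. d (j n (s u)))" by (rule LIMSEQ_imp_Cauchy)
  then have "good (s u)" unfolding good_def Cauchy_def by auto
  then have "(%n. cn n (s u)) \<longlonglongrightarrow> u" using lim by (simp add: cn_def)
  then show ?thesis using c LIMSEQ_unique by blast
 qed
 ultimately show ?thesis using \<open>s : _\<close> base4_bounds s_def by metis
qed

subsection \<open>Functional representation of couplings\<close>

abbreviation U01 :: "real measure" where
 "U01 \<equiv> lebesgue_on_interval 0 1"

lemma space_lebesgue_on_interval [simp]: "space (lebesgue_on_interval s r) = {s..r}"
 by (simp add: lebesgue_on_interval_def space_restrict_space)

lemma emeasure_lebesgue_on_interval:
 "A : sets (lebesgue_on_interval s r) ==> emeasure (lebesgue_on_interval s r) A = emeasure lborel A"
 unfolding lebesgue_on_interval_def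
 by (subst emeasure_restrict_space) (auto simp: sets_restrict_space)

lemma finite_measure_lebesgue_on_interval: "finite_measure (lebesgue_on_interval s r)"
 by (rule finite_measureI) (simp add: emeasure_lebesgue_on_interval[of "{s..r}"] lebesgue_on_interval_def sets_restrict_space emeasure_restrict_space space_restrict_space emeasure_lborel_Icc_eq)

lemma prob_space_U01: "prob_space U01"
 by (rule prob_spaceI) (simp add: lebesgue_on_interval_def emeasure_restrict_space space_restrict_space)

lemma sets_lebesgue_on_interval: "sets (lebesgue_on_interval s r) = sets (restrict_space borel {s..r})"
 by (simp add: lebesgue_on_interval_def sets_restrict_space)

lemma measurable_interval [measurable]: "(%x. x) : lebesgue_on_interval s r ->M borel"
 unfolding lebesgue_on_interval_def by (intro measurable_restrict_space1) simp

lemma emeasure_U01_less: "emeasure U01 {v : {0..1}. ennreal v < p} = min 1 p"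
proof (cases "p >= 1")
 case True
 have "{v : {0..1::real}. ennreal v < p} = {0..1} \<or> {v : {0..1::real}. ennreal v < p} = {0..<1}"
 proof (cases "p > 1")
  case True
  then have "ennreal v < p" if "v <= 1" for v :: real
   using that by (metis ennreal_le_1 le_less_trans)
  then show ?thesis by auto
 next
  case False
  with \<open>p >= 1\<close> have p: "p = 1" by auto
  show ?thesis unfolding p by (auto simp: ennreal_less_one_iff)
 qed
 moreover have "emeasure U01 {0..1} = 1" "emeasure U01 {0..<1} = 1"
  by ((subst emeasure_lebesgue_on_interval; auto simp: sets_lebesgue_on_interval sets_restrict_space_iff))+
 ultimately show ?thesis using True by (auto simp: min_def)
next
 case False
 then obtain q where q: "p = ennreal q" "0 <= q" "q < 1"
  by (cases p) (auto simp: ennreal_less_one_iff not_le)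
 have "{v : {0..1::real}. ennreal v < p} = {0..<q}" using q by (auto simp: ennreal_less_iff)
 moreover have "emeasure U01 {0..<q} = q"
  using q by (subst emeasure_lebesgue_on_interval) (auto simp: sets_lebesgue_on_interval sets_restrict_space_iff)
 ultimately show ?thesis using q False by (auto simp: min_def)
qed

text \<open>The conditional quantile transform. Conditional probabilities of half-lines are
  Radon-Nikodym derivatives, of which only countably many are compared at a time; the generalised
  inverse of the resulting conditional distribution function is \<open>Phi\<close>, and a uniform v
  reproduces the conditional law of the second coordinate.\<close>

lemma functional_representation_real:
 fixes beta :: "('b * real) measure"
 assumes "prob_space beta" and sets_beta: "sets beta = sets (M *M borel)"
  and bnd: "AE z in beta. 0 <= snd z & snd z < 1"
 shows "EX Phi : M *M borel ->M borel.
  beta = distr (distr beta M fst *M U01) (M *M borel) (%(x, v). (x, Phi (x, v)))"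
proof -
 interpret B: prob_space beta by fact
 define rho where "rho = distr beta M fst"
 have sets_rho [measurable_cong, simp]: "sets rho = sets M" by (simp add: rho_def)
 note sets_beta[measurable_cong, simp]
 have spbeta: "space beta = space M \<times> UNIV" using sets_eq_imp_space_eq[OF sets_beta] by (simp add: space_pair_measure)
 have sprho: "space rho = space M" using sets_eq_imp_space_eq[OF sets_rho] .
 have mf[measurable]: "fst : beta ->M M" "snd : beta ->M borel"
  using measurable_cong_sets[OF sets_beta refl] measurable_fst measurable_snd by blast+
 interpret R: prob_space rho unfolding rho_def by (rule B.prob_space_distr) (rule mf)
 interpret V: prob_space U01 by (rule prob_space_U01)
 interpret RV: pair_prob_space rho U01 ..
 define nu where "nu I = distr (density beta (%z. ind I (snd z))) M fst" for I :: "real set"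
 have rect: "A \<times> I : sets beta" if "A : sets M" "I : sets borel" for A and I :: "real set"
  using that by simp
 have nu_em: "emeasure (nu I) A = emeasure beta (A \<times> I)" if [measurable]: "A : sets M" "I : sets borel" for I A
 proof -
  have "A \<subseteq> space M" using that sets.sets_into_space by blast
  have "emeasure (nu I) A = (NN z:beta. ind I (snd z) * ind (fst -` A \<inter> space beta) z)"
   unfolding nu_def using measurable_sets[OF mf(1) that(1)]
   by (subst emeasure_distr; (subst emeasure_density)?) auto
  also have "... = (NN z:beta. ind (A \<times> I) z)"
   using \<open>A \<subseteq> space M\<close> by (intro nn_integral_cong) (auto simp: spbeta split: split_indicator)
  finally show ?thesis using rect that by simp
 qed
 have rho_em: "emeasure rho A = emeasure beta (A \<times> UNIV)" if [measurable]: "A : sets M" for A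
  unfolding rho_def using that sets.sets_into_space[OF that]
  by (subst emeasure_distr[OF mf(1)]) (auto simp: spbeta intro!: arg_cong[where f="emeasure beta"])
 \<comment> \<open>A version of the conditional probability that the second coordinate lies in
   I.\<close>
 define F where "F I = RN_deriv rho (nu I)" for I
 have Fm[measurable]: "F I : bmeas M" for I
  using borel_measurable_RN_deriv[of rho "nu I"] measurable_cong_sets[OF sets_rho refl] unfolding F_def by blast
 have Fint: "(NN x:rho. F I x * ind A x) = emeasure beta (A \<times> I)"
  if [measurable]: "A : sets M" "I : sets borel" for A I
 proof -
  have "absolutely_continuous rho (nu I)"
   unfolding absolutely_continuous_def
  proof
   fix N assume N: "N : null_sets rho"
   then have [measurable]: "N : sets M" by auto
   have "emeasure beta (N \<times> I) <= emeasure beta (N \<times> UNIV)" by (intro emeasure_mono) auto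
   also have "... = 0" using N rho_em[of N] by auto
   finally show "N : null_sets (nu I)" using nu_em[of N I] that by (auto simp: null_sets_def nu_def)
  qed
  then have "density rho (F I) = nu I"
   unfolding F_def by (rule R.density_RN_deriv) (simp add: nu_def)
  then show ?thesis using emeasure_density[of "F I" rho A] nu_em[OF that] that by simp
 qed
 have eqI: "AE x in rho. g x = h x"
  if [measurable]: "g : bmeas M" "h : bmeas M"
   and e: "!!A. A : sets M ==> (NN x:rho. g x * ind A x) = (NN x:rho. h x * ind A x)" for g h
 proof (rule R.density_unique)
  show "density rho g = density rho h"
   by (rule measure_eqI) (auto simp: emeasure_density e)
 qed auto
 have F_mono: "AE x in rho. F {..<q} x <= F {..<q'} x" if "q <= q'" for q q'
 proof -
  have "AE x in rho. F {..<q'} x = F {..<q} x + F {q..<q'} x"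
  proof (rule eqI)
   fix A assume [measurable]: "A : sets M"
   have "(NN x:rho. (F {..<q} x + F {q..<q'} x) * ind A x) = emeasure beta (A \<times> {..<q}) + emeasure beta (A \<times> {q..<q'})"
    by (simp add: distrib_right nn_integral_add Fint)
   also have "... = emeasure beta (A \<times> {..<q} \<union> A \<times> {q..<q'})" by (intro plus_emeasure) auto
   also have "A \<times> {..<q} \<union> A \<times> {q..<q'} = A \<times> {..<q'}" using that by auto
   finally show "(NN x:rho. F {..<q'} x * ind A x) = (NN x:rho. (F {..<q} x + F {q..<q'} x) * ind A x)"
    by (simp add: Fint)
  qed auto
  then show ?thesis by eventually_elim auto
 qed
 have F_one: "AE x in rho. F {..<q} x = 1" if "q >= 1" for q
 proof (rule eqI)
  fix A assume [measurable]: "A : sets M"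
  have "emeasure beta (A \<times> {..<q}) = emeasure beta (A \<times> UNIV)"
  proof (rule emeasure_eq_AE)
   show "AE z in beta. z : A \<times> {..<q} \<longleftrightarrow> z : A \<times> UNIV"
    using bnd by eventually_elim (use that in \<open>auto simp: mem_Times_iff\<close>)
  qed auto
  then show "(NN x:rho. F {..<q} x * ind A x) = (NN x:rho. 1 * ind A x)"
   by (simp add: Fint rho_em)
 qed auto
 have F_zero: "AE x in rho. F {..<q} x = 0" if "q <= 0" for q
 proof (rule eqI)
  fix A assume [measurable]: "A : sets M"
  have "emeasure beta (A \<times> {..<q}) = emeasure beta {}"
  proof (rule emeasure_eq_AE)
   show "AE z in beta. z : A \<times> {..<q} \<longleftrightarrow> z : {}"
    using bnd by eventually_elim (use that in \<open>auto simp: mem_Times_iff\<close>)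
  qed auto
  then show "(NN x:rho. F {..<q} x * ind A x) = (NN x:rho. 0 * ind A x)"
   by (simp add: Fint)
 qed auto
 define Qs where "Qs = \<rat> \<inter> {0..1::real}"
 have cQ: "countable Qs" unfolding Qs_def using countable_rat by (rule countable_Int1)
 \<comment> \<open>The inserted 1 keeps the set nonempty and the value in [0, 1]; the thresholds are
   rational, so that sublevel sets are countable unions.\<close>
 define Phi where "Phi z = Inf (insert 1 {q : Qs. ennreal (snd z) < F {..<q} (fst z)})" for z
 have Phi_ge: "0 <= Phi z" "Phi z <= 1" for z
 proof -
  have b: "bdd_below (insert 1 {q : Qs. ennreal (snd z) < F {..<q} (fst z)})"
   by (rule bdd_belowI[of _ 0]) (auto simp: Qs_def)
  show "0 <= Phi z" unfolding Phi_def by (rule cInf_greatest) (auto simp: Qs_def)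
  show "Phi z <= 1" unfolding Phi_def by (rule cInf_lower[OF _ b]) simp
 qed
 have Phi_less: "Phi z < a \<longleftrightarrow> 1 < a \<or> (EX q:Qs. q < a & ennreal (snd z) < F {..<q} (fst z))" for z a
 proof -
  have b: "bdd_below (insert 1 {q : Qs. ennreal (snd z) < F {..<q} (fst z)})"
   by (rule bdd_belowI[of _ 0]) (auto simp: Qs_def)
  show ?thesis unfolding Phi_def by (subst cInf_less_iff[OF _ b]) auto
 qed
 have Phim[measurable]: "Phi : M *M borel ->M borel"
 proof (rule borel_measurableI_less, goal_cases)
  case (1 a)
  have "{z : space (M *M borel). Phi z < a} = (if 1 < a then space (M *M borel) else
    (\<Union>q\<in>Qs \<inter> {..<a}. {z : space (M *M borel). ennreal (snd z) < F {..<q} (fst z)}))"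
   by (auto simp: Phi_less)
  also have "... : sets (M *M borel)"
  proof -
   have "{z : space (M *M borel). ennreal (snd z) < F {..<q} (fst z)} : sets (M *M borel)" for q
    by measurable
   then have "(\<Union>q\<in>Qs \<inter> {..<a}. {z : space (M *M borel). ennreal (snd z) < F {..<q} (fst z)}) : sets (M *M borel)"
    by (intro sets.countable_UN'' countable_Int1 cQ) auto
   then show ?thesis by auto
  qed
  finally show ?case .
 qed
 define eta where "eta = distr (rho *M U01) (M *M borel) (%(x, v). (x, Phi (x, v)))"
 have gm[measurable]: "(%(x, v). (x, Phi (x, v))) : rho *M U01 ->M M *M borel"
  by measurable
 have sp: "space (rho *M U01) = space M \<times> {0..1}" by (simp add: space_pair_measure sprho)
 have key: "emeasure eta (A \<times> {..<a}) = emeasure beta (A \<times> {..<a})" if [measurable]: "A : sets M" for A a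
 proof -
  have Asub: "A \<subseteq> space M" using that sets.sets_into_space by blast
  define D where "D = (%(x, v). (x, Phi (x, v))) -` (A \<times> {..<a}) \<inter> space (rho *M U01)"
  have D: "D : sets (rho *M U01)" unfolding D_def by (rule measurable_sets[OF gm]) simp
  have e1: "emeasure eta (A \<times> {..<a}) = emeasure (rho *M U01) D"
   unfolding eta_def D_def by (rule emeasure_distr[OF gm]) simp
  also have "... = (NN x:rho. emeasure U01 (Pair x -` D))"
   by (rule V.emeasure_pair_measure_alt[OF D])
  also have "... = (NN x:rho. emeasure U01 {v : {0..1}. Phi (x, v) < a} * ind A x)"
  proof (rule nn_integral_cong, goal_cases)
   case (1 x)
   then have "Pair x -` D = (if x : A then {v : {0..1}. Phi (x, v) < a} else {})"
    unfolding D_def sp by (auto simp: sprho)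
   then show ?case
    by simp
  qed
  finally have e: "emeasure eta (A \<times> {..<a}) = (NN x:rho. emeasure U01 {v : {0..1}. Phi (x, v) < a} * ind A x)" .
  consider "a <= 0" | "a > 1" | "0 < a" "a <= 1" by linarith
  then show ?thesis
  proof cases
   case 1
   then have s1: "{v : {0..1}. Phi (x, v) < a} = {}" for x using Phi_ge(1) by (auto simp: not_less intro: order_trans)
   moreover have "emeasure beta (A \<times> {..<a}) = 0"
   proof -
    have "(NN x:rho. F {..<a} x * ind A x) = (NN x:rho. 0)"
     by (intro nn_integral_cong_AE, use F_zero[OF 1] in eventually_elim) simp
    then show ?thesis by (simp add: Fint)
   qed
   ultimately show ?thesis unfolding e s1 by simp
  next
   case 2
   then have s1: "{v : {0..1}. Phi (x, v) < a} = {0..1}" for x by (auto simp: Phi_less)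
   moreover have "emeasure beta (A \<times> {..<a}) = emeasure rho A"
   proof -
    have "(NN x:rho. F {..<a} x * ind A x) = (NN x:rho. ind A x)"
     by (intro nn_integral_cong_AE, use F_one[OF less_imp_le[OF 2]] in eventually_elim) simp
    then show ?thesis by (simp add: Fint)
   qed
   ultimately show ?thesis unfolding e s1 using V.emeasure_space_1 by simp
  next
   case 3
   \<comment> \<open>\<open>Phi (x, v) < a\<close> refers to rational thresholds strictly below a,
     which this sequence exhausts. Off one null set, the values v with \<open>Phi (x, v) < a\<close>
     therefore form an initial interval of length \<open>SUP n. F {..<an n} x\<close>.\<close>
   define an where "an n = a - 1 / real (Suc n)" for n
   have "inc": "incseq an" unfolding an_def by (intro monoI) (auto simp: field_simps)
   define C where "C = Qs \<union> range an \<union> {1}"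
   have cC: "countable C" using cQ by (auto simp: C_def)
   have "AE x in rho. ALL q:C. ALL q':C. q <= q' --> F {..<q} x <= F {..<q'} x"
    using F_mono by (auto simp: AE_ball_countable[OF cC])
   moreover have "AE x in rho. ALL q:C. q <= 0 --> F {..<q} x = 0"
    using F_zero by (auto simp: AE_ball_countable[OF cC])
   moreover have "AE x in rho. F {..<1} x = 1" by (rule F_one) simp
   ultimately have ae: "AE x in rho. emeasure U01 {v : {0..1}. Phi (x, v) < a} = (SUP n. F {..<an n} x) & incseq (%n. F {..<an n} x)"
   proof eventually_elim
    case (elim x)
    have "1 / real (Suc n) > 0" for n by simp
    then have an1: "an n < 1" for n using 3 unfolding an_def by (smt (verit))
    have le1: "F {..<an n} x <= 1" for n
     using elim(1) elim(3) an1[of n] by (metis (no_types, lifting) C_def UnCI insertI1 less_imp_le rangeI)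
    have *: "Phi (x, v) < a \<longleftrightarrow> ennreal v < (SUP n. F {..<an n} x)" if "v : {0..1}" for v
    proof
     assume "Phi (x, v) < a"
     then obtain q where q: "q : Qs" "q < a" "ennreal v < F {..<q} x" using Phi_less 3 by auto
     obtain n where "inverse (real (Suc n)) < a - q" using q reals_Archimedean[of "a - q"] by auto
     then have "q <= an n" by (simp add: an_def field_simps inverse_eq_divide)
     then have "F {..<q} x <= F {..<an n} x" using elim(1) q by (auto simp: C_def)
     then have "ennreal v < F {..<an n} x" using q by order
     then show "ennreal v < (SUP n. F {..<an n} x)" by (auto simp: less_SUP_iff)
    next
     assume "ennreal v < (SUP n. F {..<an n} x)"
     then obtain n where n: "ennreal v < F {..<an n} x" by (auto simp: less_SUP_iff)
     have "an n > 0"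
     proof (rule ccontr)
      assume "\<not> an n > 0"
      then have "F {..<an n} x = 0" using elim(2) by (auto simp: C_def)
      then show False using n by simp
     qed
     moreover have "an n < a" by (simp add: an_def)
     ultimately obtain q where q: "q : \<rat>" "an n < q" "q < a" using Rats_dense_in_real by blast
     then have "q : Qs" using \<open>an n > 0\<close> 3 by (auto simp: Qs_def)
     moreover have "F {..<an n} x <= F {..<q} x" using elim(1) q \<open>q : Qs\<close> by (auto simp: C_def)
     then have "ennreal v < F {..<q} x" using n by order
     ultimately show "Phi (x, v) < a" using q unfolding Phi_less by auto
    qed
    have "{v : {0..1}. Phi (x, v) < a} = {v : {0..1}. ennreal v < (SUP n. F {..<an n} x)}" using * by auto
    then have "emeasure U01 {v : {0..1}. Phi (x, v) < a} = min 1 (SUP n. F {..<an n} x)"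
     by (simp only: emeasure_U01_less)
    also have "... = (SUP n. F {..<an n} x)" using le1 by (simp add: min_absorb2 SUP_le_iff)
    finally show ?case
     using elim(1) "inc" by (auto simp: incseq_def C_def)
   qed
   have "emeasure eta (A \<times> {..<a}) = (NN x:rho. (SUP n. F {..<an n} x * ind A x))"
    unfolding e by (intro nn_integral_cong_AE, use ae in eventually_elim) (auto split: split_indicator)
   also have "... = (SUP n. (NN x:rho. F {..<an n} x * ind A x))"
   proof (rule nn_integral_monotone_convergence_SUP_AE)
    fix n show "AE x in rho. F {..<an n} x * ind A x <= F {..<an (Suc n)} x * ind A x"
     using ae by eventually_elim (auto simp: incseq_Suc_iff split: split_indicator)
    show "(%x. F {..<an n} x * ind A x) : bmeas rho" for n
     using borel_measurable_times_ennreal[OF Fm[of "{..<an n}"] borel_measurable_indicator[OF that]]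
      measurable_cong_sets[OF sets_rho refl] by blast
   qed
   also have "... = (SUP n. emeasure beta (A \<times> {..<an n}))" by (simp add: Fint)
   also have "... = emeasure beta (\<Union>n. A \<times> {..<an n})"
    by (rule SUP_emeasure_incseq) (use "inc" in \<open>auto simp: incseq_def intro: less_le_trans\<close>)
   also have "(\<Union>n. A \<times> {..<an n}) = A \<times> {..<a}"
   proof -
    have "EX n. y < an n" if yl: "y < a" for y
    proof -
     obtain n where "inverse (real (Suc n)) < a - y" using reals_Archimedean[of "a - y"] yl by (auto simp del: of_nat_Suc)
     then show ?thesis by (intro exI[of _ n]) (simp add: an_def field_simps inverse_eq_divide)
    qed
    moreover have "an n < a" for n by (simp add: an_def)
    ultimately show ?thesis by (auto intro: less_trans)
   qed
   finally show ?thesis .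
  qed
 qed
 have [simp]: "sets eta = sets (M *M borel)" by (simp add: eta_def)
 interpret E: prob_space eta unfolding eta_def by (rule RV.prob_space_distr) (rule gm)
 have key2: "emeasure eta (A \<times> I) = emeasure beta (A \<times> I)" if A[measurable]: "A : sets M" and I[measurable]: "I : sets borel" for A I
 proof -
  have speta: "space eta = space M \<times> UNIV" by (simp add: eta_def space_pair_measure)
  \<comment> \<open>With A fixed, both sides are finite measures in I that agree on half-lines,
    hence on all Borel sets.\<close>
  define nu1 where "nu1 kappa = distr (density kappa (ind (A \<times> UNIV))) borel (snd :: _ => real)" for kappa :: "('b * real) measure"
  have em: "emeasure (nu1 kappa) J = emeasure kappa (A \<times> J)" if s: "sets kappa = sets (M *M borel)" and J[measurable]: "J : sets borel" for kappa J
  proof -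
   note s[measurable_cong, simp]
   have spk: "space kappa = space M \<times> UNIV" using sets_eq_imp_space_eq[OF s] by (simp add: space_pair_measure)
   have sndm[measurable]: "snd : kappa ->M borel" using measurable_cong_sets[OF s refl] measurable_snd by blast
   have "emeasure (nu1 kappa) J = (NN z:kappa. ind (A \<times> UNIV) z * ind (snd -` J \<inter> space kappa) z)"
    unfolding nu1_def using measurable_sets[OF sndm J]
    by (subst emeasure_distr; (subst emeasure_density)?) auto
   also have "... = (NN z:kappa. ind (A \<times> J) z)"
    by (intro nn_integral_cong) (auto simp: spk split: split_indicator)
   finally show ?thesis using J A by simp
  qed
  have "nu1 eta = nu1 beta"
  proof (rule measure_eqI_generator_eq[where E="range lessThan" and \<Omega>=UNIV and A="%n::nat. {..<real n}"])
   show "Int_stable (range (lessThan :: real => _))" by (auto simp: Int_stable_def greaterThan_Int_greaterThan)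
   show "emeasure (nu1 eta) X = emeasure (nu1 beta) X" if "X : range lessThan" for X
    using that key[OF A] by (auto simp: em)
   show "sets (nu1 eta) = sigma_sets UNIV (range lessThan)" "sets (nu1 beta) = sigma_sets UNIV (range lessThan)"
    by (simp_all add: nu1_def borel_Iio)
   show "(\<Union>i::nat. {..<real i}) = UNIV" by (auto intro: reals_Archimedean2)
   show "emeasure (nu1 eta) {..<real i} ~= \<infinity>" for i by (simp add: em)
  qed auto
  then show ?thesis using em[of eta I] em[of beta I] I by simp
 qed
 have "beta = eta"
 proof (rule measure_eqI_generator_eq[OF Int_stable_pair_measure_generator[of M "borel :: real measure"], where \<Omega>="space M \<times> UNIV" and A="%_. space M \<times> UNIV"])
  show "sets beta = sigma_sets (space M \<times> UNIV) {a \<times> b |a b. a : sets M & b : sets borel}"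
   "sets eta = sigma_sets (space M \<times> UNIV) {a \<times> b |a b. a : sets M & b : sets borel}"
   by (simp_all add: sets_pair_measure)
  show "{a \<times> b |a b. a : sets M & b : sets borel} \<subseteq> Pow (space M \<times> UNIV)"
   using sets.sets_into_space by fastforce
  show "range (%_::nat. space M \<times> UNIV) \<subseteq> {a \<times> b |a b. a : sets M & b : sets (borel :: real measure)}"
   by (auto intro!: exI[of _ "space M"] exI[of _ "UNIV :: real set"])
 qed (auto simp: key2)
 then show ?thesis using Phim unfolding eta_def rho_def by blast
qed

text \<open>The second coordinate is coded in [0, 1), the real coupling is represented, and
  \<open>c\<close> decodes the result.\<close>

lemma functional_representation:
 fixes beta :: "('b * 'u::metric_space) measure"
 assumes cpt: "compact (UNIV :: 'u set)"
  and "prob_space beta" and sets_beta: "sets beta = sets (M *M borel)"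
 shows "EX Phi : M *M borel ->M borel.
  beta = distr (distr beta M fst *M U01) (M *M borel) (%(x, v). (x, Phi (x, v)))"
proof -
 interpret B: prob_space beta by fact
 obtain s :: "'u => real" and c where [measurable]: "s : borel ->M borel" "c : borel ->M borel"
  and cs: "!!u. c (s u) = u" "!!u. 0 <= s u" "!!u. s u < 1"
  using borel_coding[OF cpt] by blast
 note sets_beta[measurable_cong]
 have spbeta: "space beta = space M \<times> UNIV" using sets_eq_imp_space_eq[OF sets_beta] by (simp add: space_pair_measure)
 have m1[measurable]: "(%z. (fst z, s (snd z))) : beta ->M M *M borel" by measurable
 define beta' where "beta' = distr beta (M *M borel) (%z. (fst z, s (snd z)))"
 have "prob_space beta'" unfolding beta'_def by (rule B.prob_space_distr) (rule m1)
 moreover have "AE z in beta'. 0 <= snd z & snd z < 1"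
  unfolding beta'_def by (subst AE_distr_iff) (auto simp: cs)
 ultimately obtain Phi where [measurable]: "Phi : M *M borel ->M borel" and
  e: "beta' = distr (distr beta' M fst *M U01) (M *M borel) (%(x, v). (x, Phi (x, v)))"
  using functional_representation_real[of beta' M] by (auto simp: beta'_def)
 have f1: "distr beta' M fst = distr beta M fst" unfolding beta'_def by (subst distr_distr) (auto simp: o_def)
 define rho where "rho = distr beta M fst"
 have [measurable_cong]: "sets rho = sets M" by (simp add: rho_def)
 have gm[measurable]: "(%(x, v). (x, Phi (x, v))) : rho *M U01 ->M M *M borel"
  by measurable
 have mc[measurable]: "(%z. (fst z, c (snd z))) : M *M borel ->M M *M borel" by measurable
 have "beta = distr beta (M *M borel) (%z. z)" by (rule distr_id2[symmetric]) (simp add: sets_beta)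
 also have "... = distr beta' (M *M borel) (%z. (fst z, c (snd z)))"
  unfolding beta'_def by (subst distr_distr) (auto simp: o_def cs)
 also have "... = distr (distr beta M fst *M U01) (M *M borel) (%(x, v). (x, c (Phi (x, v))))"
  by (subst e, unfold f1, fold rho_def, subst distr_distr[OF mc gm]) (auto simp: o_def case_prod_unfold)
 finally show ?thesis by (intro bexI[of _ "%z. c (Phi z)"]) (auto simp: case_prod_unfold)
qed

section \<open>Relaxed controls\<close>

text \<open>Controls live on the strip over {s..r}, while control functions, fields and rates are
  Borel on the whole plane; this identification moves between the two.\<close>

lemma restrict_pair_sets:
 "sets (lebesgue_on_interval s r *M N) = sets (restrict_space (borel *M N) ({s..r} \<times> space N))"
proof -
 have "sets (lebesgue_on_interval s r *M N) = sets (restrict_space borel {s..r} *M N)"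
  by (intro sets_pair_measure_cong sets_lebesgue_on_interval refl)
 also have "... = sets (restrict_space (borel *M N) ({s..r} \<times> space N))"
 proof (rule antisym)
  have 1: "(%z. z) : restrict_space (borel *M N) ({s..r} \<times> space N) ->M restrict_space borel {s..r} *M N"
  proof (rule measurable_pair_swap_iff[THEN iffD1, unfolded case_prod_unfold, THEN measurable_pair_swap_iff[THEN iffD2, unfolded case_prod_unfold]] | rule measurable_pair)+
   show "fst \<circ> (%z. z) : restrict_space (borel *M N) ({s..r} \<times> space N) ->M restrict_space borel {s..r}"
    by (rule measurable_restrict_space2) (auto simp: space_restrict_space o_def intro!: measurable_restrict_space1)
   show "snd \<circ> (%z. z) : restrict_space (borel *M N) ({s..r} \<times> space N) ->M N"
    by (auto simp: o_def intro!: measurable_restrict_space1)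
  qed
  show "sets (restrict_space borel {s..r} *M N) \<subseteq> sets (restrict_space (borel *M N) ({s..r} \<times> space N))"
  proof
   fix X assume X: "X : sets (restrict_space borel {s..r} *M N)"
   have "(%z. z) -` X \<inter> space (restrict_space (borel *M N) ({s..r} \<times> space N)) : sets (restrict_space (borel *M N) ({s..r} \<times> space N))"
    by (rule measurable_sets[OF 1 X])
   moreover have "X \<subseteq> {s..r} \<times> space N" using sets.sets_into_space[OF X] by (auto simp: space_pair_measure space_restrict_space)
   then have "(%z. z) -` X \<inter> space (restrict_space (borel *M N) ({s..r} \<times> space N)) = X"
    by (auto simp: space_restrict_space space_pair_measure)
   ultimately show "X : sets (restrict_space (borel *M N) ({s..r} \<times> space N))" by simp
  qed
  have 2: "(%z. z) : restrict_space borel {s..r} *M N ->M restrict_space (borel *M N) ({s..r} \<times> space N)"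
  proof (rule measurable_restrict_space2)
   show "(%z. z) : space (restrict_space borel {s..r} *M N) \<rightarrow> {s..r} \<times> space N"
    by (auto simp: space_pair_measure space_restrict_space)
   have "(%z. (fst z, snd z)) : restrict_space borel {s..r} *M N ->M borel *M N"
    by (intro measurable_Pair measurable_snd mcomp[OF measurable_fst] measurable_restrict_space1) auto
   then show "(%z. z) : restrict_space borel {s..r} *M N ->M borel *M N" by simp
  qed
  show "sets (restrict_space (borel *M N) ({s..r} \<times> space N)) \<subseteq> sets (restrict_space borel {s..r} *M N)"
  proof
   fix X assume X: "X : sets (restrict_space (borel *M N) ({s..r} \<times> space N))"
   have "(%z. z) -` X \<inter> space (restrict_space borel {s..r} *M N) : sets (restrict_space borel {s..r} *M N)"
    by (rule measurable_sets[OF 2 X])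
   moreover have "X \<subseteq> {s..r} \<times> space N" using sets.sets_into_space[OF X] by (auto simp: space_pair_measure space_restrict_space)
   then have "(%z. z) -` X \<inter> space (restrict_space borel {s..r} *M N) = X"
    by (auto simp: space_restrict_space space_pair_measure)
   ultimately show "X : sets (restrict_space borel {s..r} *M N)" by simp
  qed
 qed
 finally show ?thesis .
qed

lemma measurable_lebesgue_on_interval_pair:
 assumes "f : borel *M N ->M L"
 shows "f : lebesgue_on_interval s r *M N ->M L"
 using measurable_restrict_space1[OF assms, of "{s..r} \<times> space N"]
 by (simp cong: measurable_cong_sets[OF restrict_pair_sets refl])

definition fcontrol :: "real => real => (real * real => 'u::metric_space) => (real * 'u) measure" where
 "fcontrol s r Phi = distr (lebesgue_on_interval s r *M U01) (lebesgue_on_interval s r *M borel) (%z. (fst z, Phi z))"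

lemma measurable_U01_pair:
 assumes [measurable]: "Phi : borel2 ->M L"
 shows "Phi : lebesgue_on_interval s r *M U01 ->M L"
proof -
 have "(%z. Phi (fst z, snd z)) : lebesgue_on_interval s r *M U01 ->M L"
  by (intro mcomp[OF _ assms] measurable_Pair mcomp[OF measurable_fst measurable_interval]
   mcomp[OF measurable_snd measurable_interval])
 then show ?thesis by simp
qed

lemma measurable_graph_control:
 assumes "Phi : borel2 ->M borel"
 shows "(%z. (fst z, Phi z)) : lebesgue_on_interval s r *M U01 ->M lebesgue_on_interval s r *M borel"
 by (intro measurable_Pair measurable_fst measurable_U01_pair assms)

lemma sets_function_control [simp, measurable_cong]:
 "sets (fcontrol s r Phi) = sets (lebesgue_on_interval s r *M borel)"
 by (simp add: fcontrol_def)

lemma function_control_in: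
 assumes "Phi : borel2 ->M borel"
 shows "fcontrol s r Phi : relaxed_controls s r"
proof -
 interpret V: prob_space U01 by (rule prob_space_U01)
 have "distr (fcontrol s r Phi) (lebesgue_on_interval s r) fst = distr (lebesgue_on_interval s r *M U01) (lebesgue_on_interval s r) fst"
  unfolding fcontrol_def
  by (subst distr_distr[OF measurable_fst measurable_graph_control[OF assms]]) (simp add: o_def)
 also have "... = lebesgue_on_interval s r" by (rule V.distr_pair_fst)
 finally show ?thesis by (simp add: relaxed_controls_def Lam_def)
qed

lemma relaxed_control_emeasure:
 assumes "xi : relaxed_controls s r" and A: "A : sets (lebesgue_on_interval s r)"
 shows "emeasure xi (A \<times> UNIV) = emeasure (lebesgue_on_interval s r) A"
proof -
 have s: "sets xi = sets (lebesgue_on_interval s r *M borel)" and d: "distr xi (lebesgue_on_interval s r) fst = lebesgue_on_interval s r"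
  using assms by (auto simp: relaxed_controls_def Lam_def)
 have [measurable]: "fst : xi ->M lebesgue_on_interval s r"
  using measurable_cong_sets[OF s refl] measurable_fst by blast
 have "emeasure (lebesgue_on_interval s r) A = emeasure xi (fst -` A \<inter> space xi)"
  by (subst d[symmetric], rule emeasure_distr[OF _ A]) measurable
 also have "fst -` A \<inter> space xi = A \<times> UNIV"
  using sets_eq_imp_space_eq[OF s] sets.sets_into_space[OF A] by (auto simp: space_pair_measure)
 finally show ?thesis by simp
qed

lemma relaxed_control_function:
 fixes xi :: "(real * 'u::metric_space) measure"
 assumes cpt: "compact (UNIV :: 'u set)" and sr: "s < r" and xi: "xi : relaxed_controls s r"
 shows "EX Phi : borel2 ->M borel. xi = fcontrol s r Phi"
proof -
 let ?L = "lebesgue_on_interval s r"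
 interpret V: prob_space U01 by (rule prob_space_U01)
 have s: "sets xi = sets (?L *M borel)" and d: "distr xi ?L fst = ?L"
  using xi by (auto simp: relaxed_controls_def Lam_def)
 note s[measurable_cong]
 have sp: "space xi = {s..r} \<times> UNIV" using sets_eq_imp_space_eq[OF s] by (simp add: space_pair_measure)
 \<comment> \<open>The control has total mass r - s, while \<open>functional_representation\<close>
   is about probabilities; the factor cancels at the end.\<close>
 define c where "c = ennreal (1 / (r - s))"
 have c: "ennreal (r - s) * c = 1" using sr by (simp add: c_def flip: ennreal_mult)
 define beta where "beta = scale_measure c xi"
 have sb: "sets beta = sets (?L *M borel)" by (simp add: beta_def s)
 have "emeasure xi (space xi) = ennreal (r - s)"
  using relaxed_control_emeasure[OF xi, of "{s..r}"] sr
  by (simp add: sp emeasure_lebesgue_on_interval sets_lebesgue_on_interval sets_restrict_space_iff)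
 then have "prob_space beta" using c by (intro prob_spaceI) (simp add: beta_def space_scale_measure mult.commute)
 then obtain Phi where Phi: "Phi : ?L *M borel ->M (borel :: 'u measure)"
  and e: "beta = distr (distr beta ?L fst *M U01) (?L *M borel) (%(x, v). (x, Phi (x, v)))"
  using functional_representation[OF cpt _ sb] by blast
 \<comment> \<open>An arbitrary value outside {s..r} makes the function Borel on the whole
   plane.\<close>
 define Phi' where "Phi' z = (if fst z : {s..r} then Phi z else undefined)" for z :: "real * real"
 have Phi'[measurable]: "Phi' : borel2 ->M borel"
 proof -
  have Phir: "Phi : restrict_space (borel2) ({s..r} \<times> UNIV) ->M borel"
  proof -
   have "sets (restrict_space (borel2) ({s..r} \<times> UNIV)) = sets (?L *M (borel :: real measure))"
    using restrict_pair_sets[of s r "borel :: real measure"] by (simp only: space_borel)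
   from measurable_cong_sets[OF this refl, of "borel :: 'u measure"] Phi show ?thesis by (simp only:)
  qed
  have "(%z. if z : {s..r} \<times> UNIV then Phi z else undefined) : borel2 ->M borel"
   by (rule measurable_restrict_space_iff[THEN iffD1, OF _ _ Phir]) auto
  moreover have "Phi' = (%z. if z : {s..r} \<times> UNIV then Phi z else undefined)"
   by (auto simp: Phi'_def fun_eq_iff mem_Times_iff)
  ultimately show ?thesis by simp
 qed
 have db: "distr beta ?L fst = scale_measure c ?L"
 proof (rule measure_eqI)
  fix A assume "A : sets (distr beta ?L fst)"
  then have A: "A : sets ?L" by simp
  have f: "fst : beta ->M ?L" using measurable_cong_sets[OF sb refl] measurable_fst by blast
  have "fst -` A \<inter> space beta = A \<times> UNIV"
   using sets.sets_into_space[OF A] by (auto simp: beta_def space_scale_measure sp)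
  then show "emeasure (distr beta ?L fst) A = emeasure (scale_measure c ?L) A"
   using relaxed_control_emeasure[OF xi A] by (subst emeasure_distr[OF f A]) (simp add: beta_def)
 qed simp
 have "xi = fcontrol s r Phi'"
 proof (rule measure_eqI)
  show "sets xi = sets (fcontrol s r Phi')" by (simp add: s)
  fix X assume "X : sets xi"
  then have X: "X : sets (?L *M borel)" by (simp add: s)
  have ms: "sets (scale_measure c ?L) = sets ?L" by simp
  have gm: "(%(x, v). (x, Phi (x, v))) : scale_measure c ?L *M U01 ->M ?L *M borel"
  proof -
   have "(%z. (fst z, Phi (fst z, snd z))) : ?L *M U01 ->M ?L *M borel"
    by (intro measurable_Pair measurable_fst mcomp[OF _ Phi] mcomp[OF measurable_snd measurable_interval])
   then show ?thesis
    using measurable_cong_sets[OF sets_pair_measure_cong[OF ms refl] refl] by (simp add: case_prod_unfold)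
  qed
  define D where "D = (%(x, v). (x, Phi (x, v))) -` X \<inter> ({s..r} \<times> {0..1})"
  have spL: "space (scale_measure c ?L *M U01) = {s..r} \<times> {0..1}" "space (?L *M U01) = {s..r} \<times> {0..1}"
   by (simp_all add: space_pair_measure space_scale_measure)
  have D: "D : sets (scale_measure c ?L *M U01)"
   using measurable_sets[OF gm X] unfolding D_def spL by simp
  then have D': "D : sets (?L *M U01)" using sets_pair_measure_cong[OF ms refl] by blast
  have "emeasure xi X = ennreal (r - s) * emeasure beta X"
   using c by (simp add: beta_def mult.assoc[symmetric])
  also have "emeasure beta X = emeasure (scale_measure c ?L *M U01) D"
   by (subst e, unfold db, subst emeasure_distr[OF gm X]) (simp add: D_def spL)
  also have "... = (NN x:(scale_measure c ?L). emeasure U01 (Pair x -` D))"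
   by (rule V.emeasure_pair_measure_alt[OF D])
  also have "... = c * (NN x:?L. emeasure U01 (Pair x -` D))"
   by (rule nn_integral_scale_measure) (rule V.measurable_emeasure_Pair[OF D'])
  also have "(NN x:?L. emeasure U01 (Pair x -` D)) = emeasure (?L *M U01) D"
   by (rule V.emeasure_pair_measure_alt[OF D', symmetric])
  also have "ennreal (r - s) * (c * emeasure (?L *M U01) D) = emeasure (?L *M U01) D"
   using c by (simp add: mult.assoc[symmetric])
  also have "... = emeasure (fcontrol s r Phi') X"
   unfolding fcontrol_def
   by (subst emeasure_distr[OF measurable_graph_control[OF Phi'] X])
    (auto simp: D_def spL Phi'_def intro!: arg_cong[where f="emeasure (?L *M U01)"])
  finally show "emeasure xi X = emeasure (fcontrol s r Phi') X" .
 qed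
 then show ?thesis using Phi' by blast
qed

lemma AE_lebesgue_on_interval:
 "(AE t in lebesgue_on_interval s r. P t) \<longleftrightarrow> (AE t in lborel. t : {s..r} --> P t)"
 unfolding lebesgue_on_interval_def by (subst AE_restrict_space_iff) auto

text \<open>Countably many half-lines decide equality, which is what a single null set in
  \<open>disintegration_unique\<close> can accommodate.\<close>

lemma emeasure_lessThan_rat_eqI:
 fixes mu nu :: "real measure"
 assumes [simp]: "sets mu = sets borel" "sets nu = sets borel" and fin: "finite_measure mu"
  and eq: "!!q. q : \<rat> ==> emeasure mu {..<q} = emeasure nu {..<q}"
 shows "mu = nu"
proof -
 have sg: "sigma_sets UNIV (lessThan ` \<rat>) = sets (borel :: real measure)"
 proof -
  have "sigma_sets UNIV (lessThan ` \<rat>) = sigma_sets UNIV (range (lessThan :: real => _))"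
  proof (rule sigma_sets_eqI)
   fix a assume "a : range (lessThan :: real => _)"
   then obtain x where x: "a = {..<x}" by auto
   have "{..<x} = (\<Union>q\<in>{q\<in>\<rat>. q < x}. {..<q})"
    by (auto intro: less_trans) (metis Rats_dense_in_real)
   moreover have "(\<Union>q\<in>{q\<in>\<rat>. q < x}. {..<q}) : sigma_sets UNIV (lessThan ` \<rat>)"
    using countable_rat by (intro sigma_sets_UNION) (auto intro: countable_subset)
   ultimately show "a : sigma_sets UNIV (lessThan ` \<rat>)" using x by simp
  qed auto
  then show ?thesis by (simp add: borel_Iio)
 qed
 interpret finite_measure mu by fact
 show ?thesis
 proof (rule measure_eqI_generator_eq[where E="lessThan ` \<rat>" and \<Omega>=UNIV and A="%n::nat. {..<real n}"])
  show "Int_stable (lessThan ` (\<rat> :: real set))"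
   unfolding Int_stable_def by (auto simp: greaterThan_Int_greaterThan min_def)
  show "(\<Union>i::nat. {..<real i}) = UNIV" by (auto intro: reals_Archimedean2)
  show "emeasure mu {..<real i} ~= \<infinity>" for i by simp
  show "range (%n. {..<real n}) \<subseteq> lessThan ` \<rat>" by auto
 qed (auto simp: sg eq)
qed

lemma disintegration_function_control:
 fixes Phi :: "real * real => 'u::metric_space"
 assumes Phi[measurable]: "Phi : borel2 ->M borel"
 shows "is_disintegration (lebesgue_on_interval s r) borel (fcontrol s r Phi) (%t. distr U01 borel (%v. Phi (t, v)))"
proof -
 let ?L = "lebesgue_on_interval s r"
 interpret V: prob_space U01 by (rule prob_space_U01)
 have Phit[measurable]: "(%v. Phi (t, v)) : U01 ->M borel" for t
  by (intro mcomp[OF measurable_Pair1' Phi] mcomp[OF measurable_interval]) auto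
 have "(%t. distr U01 borel (%v. Phi (t, v))) : ?L ->M subprob_algebra borel"
 proof (rule measurable_distr2[where M=U01])
  show "(%(x, y). Phi (x, y)) : ?L *M U01 ->M borel"
   using measurable_U01_pair[OF Phi] by simp
  show "(%x. U01) : ?L ->M subprob_algebra U01"
   using prob_space_imp_subprob_space[OF prob_space_U01] by (intro measurable_const) (simp add: space_subprob_algebra)
 qed
 then have 1: "(%t. distr U01 borel (%v. Phi (t, v))) : ?L ->M prob_algebra borel"
  by (rule measurable_prob_algebraI[rotated]) (rule V.prob_space_distr[OF Phit])
 show ?thesis unfolding is_disintegration_def
 proof (intro conjI 1 ballI)
  fix A and B :: "'u set" assume A: "A : sets ?L" and B: "B : sets borel"
  define D where "D = (%z. (fst z, Phi z)) -` (A \<times> B) \<inter> space (?L *M U01)"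
  have D: "D : sets (?L *M U01)" unfolding D_def
   by (rule measurable_sets[OF measurable_graph_control[OF Phi]]) (use A B in simp)
  have "emeasure (fcontrol s r Phi) (A \<times> B) = emeasure (?L *M U01) D"
   unfolding fcontrol_def D_def
   by (rule emeasure_distr[OF measurable_graph_control[OF Phi]]) (use A B in simp)
  also have "... = (NN x:?L. emeasure U01 (Pair x -` D))"
   by (rule V.emeasure_pair_measure_alt[OF D])
  also have "... = (NN x:?L|A. emeasure (distr U01 borel (%v. Phi (x, v))) B)"
  proof (rule nn_integral_cong, goal_cases)
   case (1 x)
   then have "Pair x -` D = (if x : A then (%v. Phi (x, v)) -` B \<inter> space U01 else {})"
    unfolding D_def by (auto simp: space_pair_measure)
   then show ?case
    by (simp add: emeasure_distr[OF Phit B])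
  qed
  finally show "emeasure (fcontrol s r Phi) (A \<times> B) = (NN x:?L|A. emeasure (distr U01 borel (%v. Phi (x, v))) B)" .
 qed
qed

text \<open>On each fixed Borel set two versions agree for almost every time. Coding the controls by
  reals leaves only the preimages of rational half-lines to compare, so that one null set of times
  suffices for equality of the measures.\<close>

lemma disintegration_unique:
 fixes kappa kappa' :: "real => 'u::metric_space measure"
 assumes cpt: "compact (UNIV :: 'u set)"
  and k: "is_disintegration (lebesgue_on_interval s r) borel xi kappa"
  and k': "is_disintegration (lebesgue_on_interval s r) borel xi kappa'"
 shows "AE t in lebesgue_on_interval s r. kappa t = kappa' t"
proof -
 let ?L = "lebesgue_on_interval s r"
 interpret L: finite_measure ?L by (rule finite_measure_lebesgue_on_interval)
 obtain sc :: "'u => real" and c where sm[measurable]: "sc : borel ->M borel" and cm[measurable]: "c : borel ->M borel"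
  and cs: "!!u. c (sc u) = u"
  using borel_coding[OF cpt] by blast
 have m[measurable]: "kappa : ?L ->M prob_algebra borel" "kappa' : ?L ->M prob_algebra borel"
  using k k' by (auto simp: is_disintegration_def)
 have em: "(%t. emeasure (kappa t) B) : bmeas ?L" "(%t. emeasure (kappa' t) B) : bmeas ?L"
  if B: "B : sets borel" for B
  using B measurable_prob_algebraD[OF m(1)] measurable_prob_algebraD[OF m(2)]
  by (auto intro: mcomp[OF _ measurable_emeasure_subprob_algebra])
 have eq: "AE t in ?L. emeasure (kappa t) B = emeasure (kappa' t) B" if B: "B : sets borel" for B
 proof (rule L.density_unique)
  show "density ?L (%t. emeasure (kappa t) B) = density ?L (%t. emeasure (kappa' t) B)"
  proof (rule measure_eqI)
   fix A assume "A : sets (density ?L (%t. emeasure (kappa t) B))"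
   then have A: "A : sets ?L" by simp
   then show "emeasure (density ?L (%t. emeasure (kappa t) B)) A = emeasure (density ?L (%t. emeasure (kappa' t) B)) A"
    using em[OF B] k k' B by (simp add: emeasure_density is_disintegration_def)
  qed simp
 qed (use em[OF B] in auto)
 have "AE t in ?L. ALL q:\<rat>. emeasure (kappa t) (sc -` {..<q}) = emeasure (kappa' t) (sc -` {..<q})"
  using eq measurable_sets[OF sm, of "{..<_}"] by (auto simp: AE_ball_countable[OF countable_rat])
 moreover have "AE t in ?L. t : space ?L" by (rule AE_space)
 ultimately show ?thesis
 proof eventually_elim
  case (elim t)
  have p: "kappa t : space (prob_algebra borel)" "kappa' t : space (prob_algebra borel)"
   using measurable_space[OF m(1)] measurable_space[OF m(2)] elim(2) by auto
  then have sk: "sets (kappa t) = sets borel" "sets (kappa' t) = sets borel" and pk: "prob_space (kappa t)"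
   by (auto simp: space_prob_algebra)
  note sk[measurable_cong, simp]
  have spk: "space (kappa t) = UNIV" "space (kappa' t) = UNIV" using sets_eq_imp_space_eq[OF sk(1)] sets_eq_imp_space_eq[OF sk(2)] by simp_all
  have "distr (kappa t) borel sc = distr (kappa' t) borel sc"
  proof (rule emeasure_lessThan_rat_eqI)
   show "finite_measure (distr (kappa t) borel sc)"
    using prob_space.prob_space_distr[OF pk, of sc borel] measurable_cong_sets[OF sk(1) refl] sm prob_space.axioms(1) by blast
   fix q :: real assume "q : \<rat>"
   then show "emeasure (distr (kappa t) borel sc) {..<q} = emeasure (distr (kappa' t) borel sc) {..<q}"
    using elim(1) by (simp add: emeasure_distr spk)
  qed simp_all
  moreover have "nu = distr (distr nu borel sc) borel c" if s: "sets nu = sets borel" for nu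
  proof -
   note s[measurable_cong]
   have "distr (distr nu borel sc) borel c = distr nu borel (%x. x)" by (subst distr_distr) (auto simp: o_def cs)
   also have "... = nu" by (rule distr_id2) (simp add: s)
   finally show ?thesis by simp
  qed
  ultimately show ?case using sk by metis
 qed
qed

text \<open>\<open>disintegration\<close> is an arbitrary choice, but for an \<open>fcontrol\<close>
  a disintegration exists, so the choice is a genuine one and uniqueness identifies it almost
  everywhere.\<close>

lemma control_kernel_function:
 fixes Phi :: "real * real => 'u::metric_space"
 assumes cpt: "compact (UNIV :: 'u set)" and Phi: "Phi : borel2 ->M borel"
 shows "AE t in lborel. t : {s..r} -->
  control_kernel s r (fcontrol s r Phi) t = distr U01 borel (%v. Phi (t, v))"
proof -
 have "is_disintegration (lebesgue_on_interval s r) borel (fcontrol s r Phi) (control_kernel s r (fcontrol s r Phi))"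
  unfolding control_kernel_def disintegration_def
  by (rule someI[of "is_disintegration (lebesgue_on_interval s r) borel (fcontrol s r Phi)"]) (rule disintegration_function_control[OF Phi])
 then show ?thesis
  unfolding AE_lebesgue_on_interval[symmetric]
  by (rule disintegration_unique[OF cpt _ disintegration_function_control[OF Phi]])
qed

section \<open>The space of relaxed controls\<close>

text \<open>Adding the bound C makes every component nonnegative, which reduces the claim to
  measurability of \<open>nn_integral\<close> against a kernel.\<close>

lemma integral_measurable_kernel:
 fixes F :: "'m \<times> 'n => 'a::euclidean_space"
 assumes F[measurable]: "F : bmeas (M *M N)" and K: "K : M ->M prob_algebra N"
  and bnd: "!!z. norm (F z) <= C"
 shows "(%om. (LINT z|K om. F (om, z))) : bmeas M"
proof (rule borel_measurable_euclidean_space[THEN iffD2], intro ballI, goal_cases)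
 case b: (1 b)
 let ?G = "%z. F z \<bullet> b + C"
 have nn: "0 <= ?G z" for z
  using Basis_le_norm[OF b, of "F z"] bnd[of z] by linarith
 have "(%om. (NN z:(K om). ennreal (?G (om, z)))) : bmeas M"
  by (rule nn_integral_measurable_subprob_algebra2[OF _ measurable_prob_algebraD[OF K]]) simp
 then have m: "(%om. enn2real (NN z:(K om). ennreal (?G (om, z))) - C) : bmeas M"
  by measurable
 have "(LINT z|K om. F (om, z)) \<bullet> b = enn2real (NN z:(K om). ennreal (?G (om, z))) - C" if w: "om : space M" for om
 proof -
  have "K om : space (prob_algebra N)" using measurable_space[OF K w] .
  then have p: "prob_space (K om)" and s: "sets (K om) = sets N" by (auto simp: space_prob_algebra)
  interpret prob_space "K om" by fact
  have "(%z. F (om, z)) : bmeas N"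
   using mcomp[OF measurable_Pair1'[OF w] F] by simp
  then have Fm: "(%z. F (om, z)) : bmeas (K om)"
   using measurable_cong_sets[OF s refl] by blast
  have i: "integrable (K om) (%z. F (om, z))"
   by (rule integrable_const_bound[of _ C]) (auto simp: bnd Fm)
  have "enn2real (NN z:(K om). ennreal (?G (om, z))) = (LINT z|K om. ?G (om, z))"
   using Fm by (intro integral_eq_nn_integral[symmetric]) (auto simp: nn)
  also have "... = (LINT z|K om. F (om, z) \<bullet> b) + C"
   using i by (subst Bochner_Integration.integral_add) (auto simp: prob_space)
  also have "(LINT z|K om. F (om, z) \<bullet> b) = (LINT z|K om. F (om, z)) \<bullet> b"
   using i by (simp add: integral_inner_left)
  finally show ?thesis by simp
 qed
 then show ?case
  using m by (simp cong: measurable_cong)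
qed

lemma space_relaxed_space: "space (relaxed_space 0 T) = (relaxed_controls 0 T :: (real * 'u::metric_space) measure set)"
proof -
 have "topspace (narrow_topology ({0..T} \<times> UNIV) (relaxed_controls 0 T)) = (relaxed_controls 0 T :: (real * 'u) measure set)"
 proof -
  have "{xi : relaxed_controls 0 T. (LINT z|xi. 0) : UNIV} : {{xi : relaxed_controls 0 T. (LINT z|xi. phi z) : V} | (phi :: real * 'u => real) V.
    continuous_on ({0..T} \<times> UNIV) phi & bounded (phi ` ({0..T} \<times> UNIV)) & open V}"
   by (intro CollectI exI[of _ "%_. 0"] exI[of _ UNIV]) (auto simp: bounded_iff)
  then show ?thesis unfolding narrow_topology_def topology_generated_by_topspace by auto
 qed
 then show ?thesis unfolding relaxed_space_def borel_of_def
  by (simp add: space_measure_of_conv)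
qed

lemma measurable_integral_relaxed:
 fixes phi :: "real * 'u::metric_space => real"
 assumes "continuous_on UNIV phi" "!!z. \<bar>phi z\<bar> <= C"
 shows "(%xi. (LINT z|xi. phi z)) : bmeas (relaxed_space 0 T)"
proof (rule borel_measurableI, goal_cases)
 case V: (1 V)
 let ?X = "narrow_topology ({0..T} \<times> UNIV) (relaxed_controls 0 T :: (real * 'u) measure set)"
 have "{xi : relaxed_controls 0 T. (LINT z|xi. phi z) : V} : {{xi : relaxed_controls 0 T. (LINT z|xi. phi z) : V} | (phi :: real * 'u => real) V.
    continuous_on ({0..T} \<times> UNIV) phi & bounded (phi ` ({0..T} \<times> UNIV)) & open V}"
  using V assms by (intro CollectI exI[of _ phi] exI[of _ V]) (auto simp: bounded_iff intro: continuous_on_subset)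
 then have "openin ?X {xi : relaxed_controls 0 T. (LINT z|xi. phi z) : V}"
  unfolding narrow_topology_def by (rule topology_generated_by_Basis)
 then have "{xi : relaxed_controls 0 T. (LINT z|xi. phi z) : V} : sets (relaxed_space 0 T)"
  unfolding relaxed_space_def borel_of_def by (subst sets_measure_of) (auto dest: openin_subset)
 moreover have "(%xi. (LINT z|xi. phi z)) -` V \<inter> space (relaxed_space 0 T) = {xi : relaxed_controls 0 T. (LINT z|xi. phi z) : V}"
  by (auto simp: space_relaxed_space)
 ultimately show ?case by simp
qed

text \<open>Scaling by 1/T and passing from the strip to the plane turns every control into a point
  of \<open>prob_algebra\<close>, so that random controls form a kernel and can be averaged with
  \<open>bind\<close>.\<close>

definition normed :: "real => (real * 'u::metric_space) measure => (real * 'u) measure" where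
 "normed T xi = distr (scale_measure (ennreal (1 / T)) xi) (borel2) (%z. z)"

lemma sets_normalized_control [simp, measurable_cong]: "sets (normed T xi) = sets (borel2)"
 by (simp add: normed_def)

lemma space_normalized_control [simp]: "space (normed T xi) = UNIV"
 by (simp add: normed_def space_pair_measure)

lemma relaxed_control_sets:
 assumes "xi : relaxed_controls s r"
 shows "sets xi = sets (lebesgue_on_interval s r *M borel)" "space xi = {s..r} \<times> UNIV"
proof -
 show 1: "sets xi = sets (lebesgue_on_interval s r *M borel)" using assms by (simp add: relaxed_controls_def Lam_def)
 show "space xi = {s..r} \<times> UNIV" using sets_eq_imp_space_eq[OF 1] by (simp add: space_pair_measure)
qed

lemma relaxed_control_finite:
 assumes "xi : relaxed_controls s r"
 shows "emeasure xi (space xi) = ennreal (r - s)"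
 using relaxed_control_emeasure[OF assms, of "{s..r}"]
 by (auto simp: relaxed_control_sets(2)[OF assms] emeasure_lebesgue_on_interval sets_lebesgue_on_interval sets_restrict_space_iff
  emeasure_lborel_Icc_eq ennreal_neg)

lemma relaxed_control_measurable:
 assumes xi: "xi : relaxed_controls s r" and f: "f : borel2 ->M L"
 shows "f : xi ->M L"
 using measurable_lebesgue_on_interval_pair[OF f, of s r] measurable_cong_sets[OF relaxed_control_sets(1)[OF xi] refl] by blast

lemma emeasure_normalized_control:
 assumes xi: "xi : relaxed_controls s r" and A: "A : sets (borel2)"
 shows "emeasure (normed T xi) A = ennreal (1 / T) * emeasure xi (A \<inter> space xi)"
proof -
 have "(%z. z) : scale_measure (ennreal (1 / T)) xi ->M borel2"
  using relaxed_control_measurable[OF xi measurable_ident[unfolded id_def]] by (simp add: measurable_def space_scale_measure)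
 then show ?thesis unfolding normed_def using A
  by (simp add: emeasure_distr space_scale_measure)
qed

lemma prob_space_normalized_control:
 assumes xi: "xi : relaxed_controls 0 T" and T: "0 < T"
 shows "prob_space (normed T xi)"
proof (rule prob_spaceI)
 show "emeasure (normed T xi) (space (normed T xi)) = 1"
  using T by (simp add: emeasure_normalized_control[OF xi, of UNIV] sets.top[of "borel2", unfolded space_pair_measure space_borel, simplified] relaxed_control_finite[OF xi] flip: ennreal_mult)
qed

lemma nn_integral_normalized_control:
 assumes xi: "xi : relaxed_controls s r" and f[measurable]: "f : bmeas (borel2)"
 shows "(NN z:(normed T xi). f z) = ennreal (1 / T) * (NN z:xi. f z)"
proof -
 have "(%z. z) : scale_measure (ennreal (1 / T)) xi ->M borel2"
  using relaxed_control_measurable[OF xi measurable_ident[unfolded id_def]] by (simp add: measurable_def space_scale_measure)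
 then show ?thesis unfolding normed_def
  by (subst nn_integral_distr) (auto intro!: nn_integral_scale_measure relaxed_control_measurable[OF xi])
qed

lemma closed_bump_tendsto:
 fixes x :: "'c::metric_space"
 assumes "closed C" "C ~= {}"
 shows "(%n. max 0 (1 - real n * infdist x C)) \<longlonglongrightarrow> ind C x"
proof (cases "x : C")
 case True then show ?thesis by simp
next
 case False
 then have p: "infdist x C > 0" using assms by (metis in_closed_iff_infdist_zero infdist_nonneg less_eq_real_def)
 obtain N :: nat where N: "real N * infdist x C > 1" using p reals_Archimedean3 by blast
 have "max 0 (1 - real n * infdist x C) = ind C x" if "n >= N" for n
 proof -
  have "real N * infdist x C <= real n * infdist x C" using that p by (intro mult_right_mono) auto
  then show ?thesis using N False by simp
 qed
 then show ?thesis by (intro tendsto_eventually) (auto simp: eventually_sequentially)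
qed

text \<open>Closed rectangles are the sets whose indicators \<open>closed_bump_tendsto\<close>
  approximates by continuous functions, and they are stable under intersection.\<close>

lemma sets_borel_pair_closed:
 "sets (borel *M (borel :: 'u::metric_space measure)) = sigma_sets UNIV {A \<times> B | (A :: real set) B. closed A & closed B}"
proof -
 let ?G = "{A \<times> B | (A :: real set) (B :: 'u set). closed A & closed B}"
 let ?S = "sigma UNIV ?G"
 have sS: "sets ?S = sigma_sets UNIV ?G" by (rule sets_measure_of) auto
 have spS: "space ?S = UNIV" by (simp add: space_measure_of_conv)
 have f: "fst : ?S ->M borel"
 proof (rule borel_measurableI, goal_cases)
  case (1 S)
  then have "(- S) \<times> UNIV : sets ?S" unfolding sS by (intro sigma_sets.Basic CollectI exI[of _ "- S"] exI[of _ UNIV]) auto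
  then have "space ?S - (- S) \<times> UNIV : sets ?S" by (rule sets.compl_sets)
  then show ?case by (rule back_subst[of "%X. X : sets ?S"]) (auto simp: spS)
 qed
 have g: "snd : ?S ->M borel"
 proof (rule borel_measurableI, goal_cases)
  case (1 S)
  then have "UNIV \<times> (- S) : sets ?S" unfolding sS by (intro sigma_sets.Basic CollectI exI[of _ UNIV] exI[of _ "- S"]) auto
  then have "space ?S - UNIV \<times> (- S) : sets ?S" by (rule sets.compl_sets)
  then show ?case by (rule back_subst[of "%X. X : sets ?S"]) (auto simp: spS)
 qed
 have "sets (borel *M (borel :: 'u measure)) \<subseteq> sets ?S"
 proof (rule sets_pair_in_sets)
  fix A :: "real set" and B :: "'u set" assume "A : sets borel" "B : sets borel"
  then have "(fst -` A \<inter> space ?S) \<inter> (snd -` B \<inter> space ?S) : sets ?S"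
   by (intro sets.Int measurable_sets[OF f] measurable_sets[OF g])
  then show "A \<times> B : sets ?S" by (rule back_subst[of "%X. X : sets ?S"]) (auto simp: spS)
 qed
 moreover have "sigma_sets UNIV ?G \<subseteq> sets (borel *M (borel :: 'u measure))"
 proof -
  have "sigma_sets (space (borel *M (borel :: 'u measure))) ?G \<subseteq> sets (borel *M (borel :: 'u measure))"
   by (rule sets.sigma_sets_subset) auto
  then show ?thesis by (simp add: space_pair_measure)
 qed
 ultimately show ?thesis by (simp add: sS)
qed

text \<open>Evaluation on a closed rectangle is a limit of integrals of the continuous functions
  \<open>phi n\<close>, which are measurable by the definition of the narrow topology; closed
  rectangles generate. Later integrals against random controls see the narrow topology only through
  this kernel.\<close>

lemma measurable_normalized_control:
 assumes cpt: "compact (UNIV :: 'u::metric_space set)" and T: "0 < T"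
 shows "normed T : relaxed_space 0 T ->M prob_algebra (borel *M (borel :: 'u measure))"
proof (rule measurable_prob_algebra_generated[OF sets_borel_pair_closed])
 let ?G = "{A \<times> B | (A :: real set) (B :: 'u set). closed A & closed B}"
 show "Int_stable ?G"
 proof (rule Int_stableI)
  fix a b assume "a : ?G" "b : ?G"
  then obtain A B A' B' where "a = A \<times> B" "b = A' \<times> B'" "closed A" "closed B" "closed A'" "closed B'" by auto
  then show "a \<inter> b : ?G"
   by (intro CollectI exI[of _ "A \<inter> A'"] exI[of _ "B \<inter> B'"]) (simp add: Times_Int_Times closed_Int)
 qed
 show "?G \<subseteq> Pow UNIV" by simp
 fix X assume "X : ?G"
 then obtain A and B :: "'u set" where X: "X = A \<times> B" "closed A" "closed B" by auto
 show "(%xi. emeasure (normed T xi) X) : bmeas (relaxed_space 0 T)"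
 proof (cases "A = {} \<or> B = {}")
  case True then show ?thesis by (auto simp: X)
 next
  case False
  define phi where "phi n z = max 0 (1 - real n * infdist (fst z) A) * max 0 (1 - real n * infdist (snd z) B)" for n and z :: "real * 'u"
  have phic: "continuous_on UNIV (phi n)" for n unfolding phi_def by (intro continuous_intros)
  have phib: "0 <= phi n z" "phi n z <= 1" for n z
   unfolding phi_def by (auto intro!: mult_le_one simp: infdist_nonneg)
  have lim: "(%n. phi n z) \<longlonglongrightarrow> ind X z" for z
  proof -
   have "(%n. phi n z) \<longlonglongrightarrow> ind A (fst z) * ind B (snd z)"
    unfolding phi_def using False by (intro tendsto_mult closed_bump_tendsto X) auto
   then show ?thesis by (simp add: X indicator_times)
  qed
  have "(%xi. (LINT z|xi. (ind X z :: real))) : bmeas (relaxed_space 0 T :: (real * 'u) measure measure)"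
  proof (rule borel_measurable_LIMSEQ_real)
   fix n show "(%xi. (LINT z|xi. phi n z)) : bmeas (relaxed_space 0 T :: (real * 'u) measure measure)"
    using phib by (intro measurable_integral_relaxed[OF phic, of _ 1]) (auto simp: abs_le_iff intro: order_trans[of _ 0])
  next
   fix xi :: "(real * 'u) measure" assume "xi : space (relaxed_space 0 T)"
   then have xi: "xi : relaxed_controls 0 T" by (simp add: space_relaxed_space)
   interpret finite_measure xi by (rule finite_measureI) (simp add: relaxed_control_finite[OF xi])
   show "(%n. (LINT z|xi. phi n z)) \<longlonglongrightarrow> (LINT z|xi. (ind X z :: real))"
   proof (rule integral_dominated_convergence[where w="%_. 1"])
    show "(ind X :: _ => real) : bmeas xi"
     by (rule relaxed_control_measurable[OF xi]) (auto simp: X)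
    show "phi n : bmeas xi" for n
     by (intro relaxed_control_measurable[OF xi] continuous_borel_measurable_prod[OF cpt phic])
    show "AE z in xi. norm (phi n z) <= 1" for n using phib by (auto simp: abs_le_iff intro: order_trans[of _ 0])
   qed (auto simp: lim)
  qed
  then have "(%xi. ennreal (1 / T) * ennreal (LINT z|xi. ind X z)) : bmeas (relaxed_space 0 T :: (real * 'u) measure measure)"
   by measurable
  moreover have "emeasure (normed T xi) X = ennreal (1 / T) * ennreal (LINT z|xi. ind X z)"
   if "xi : space (relaxed_space 0 T)" for xi
  proof -
   from that have xi: "xi : relaxed_controls 0 T" by (simp add: space_relaxed_space)
   interpret finite_measure xi by (rule finite_measureI) (simp add: relaxed_control_finite[OF xi])
   have "(ind X :: _ => real) : bmeas xi"
    by (rule relaxed_control_measurable[OF xi]) (auto simp: X)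
   then have "X \<inter> space xi : sets xi" by (simp add: borel_measurable_indicator_iff)
   then show ?thesis
    by (subst emeasure_normalized_control[OF xi]) (auto simp: X emeasure_eq_measure Int_commute)
  qed
  ultimately show ?thesis by (simp cong: measurable_cong)
 qed
qed (auto simp: space_relaxed_space prob_space_normalized_control T)

lemma normalized_control_function:
 fixes Phi :: "real * real => 'u::metric_space"
 assumes Phi: "Phi : borel2 ->M borel" and f[measurable]: "f : bmeas (borel2)"
 shows "(NN z:(normed T (fcontrol 0 T Phi)). f z)
  = ennreal (1 / T) * (NN t:lborel|{0..T}. (NN v:U01. f (t, Phi (t, v))))"
proof -
 let ?L = "lebesgue_on_interval 0 T"
 interpret V: prob_space U01 by (rule prob_space_U01)
 have fg: "(%z. f (fst z, Phi z)) : bmeas (?L *M U01)"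
  by (rule mcomp[OF measurable_graph_control[OF Phi] measurable_lebesgue_on_interval_pair[OF f]])
 have "(NN z:(fcontrol 0 T Phi). f z) = (NN z:(?L *M U01). f (fst z, Phi z))"
  unfolding fcontrol_def
  by (subst nn_integral_distr[OF measurable_graph_control[OF Phi]]) (simp_all add: measurable_lebesgue_on_interval_pair[OF f])
 also have "... = (NN t:?L. (NN v:U01. f (t, Phi (t, v))))"
  using V.nn_integral_fst[OF fg] by simp
 also have "... = (NN t:lborel|{0..T}. (NN v:U01. f (t, Phi (t, v))))"
  unfolding lebesgue_on_interval_def[of 0 T] by (subst nn_integral_restrict_space) auto
 finally show ?thesis
  by (simp add: nn_integral_normalized_control[OF function_control_in[OF Phi] f])
qed

lemma normalized_control_marginal:
 assumes xi: "xi : relaxed_controls 0 T" and T: "0 < T" and f[measurable]: "f : bmeas borel"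
 shows "(NN z:(normed T xi). f (fst z)) = ennreal (1 / T) * (NN t:lborel|{0..T}. f t)"
proof -
 have m: "fst : xi ->M lebesgue_on_interval 0 T"
  using measurable_cong_sets[OF relaxed_control_sets(1)[OF xi] refl] measurable_fst by blast
 have fm: "f : bmeas (lebesgue_on_interval 0 T)"
  by (rule mcomp[OF measurable_interval f])
 have "(NN z:(normed T xi). f (fst z)) = ennreal (1 / T) * (NN z:xi. f (fst z))"
  by (rule nn_integral_normalized_control[OF xi]) simp
 also have "(NN z:xi. f (fst z)) = (NN t:(distr xi (lebesgue_on_interval 0 T) fst). f t)"
  by (rule nn_integral_distr[OF m, symmetric]) (use fm in simp)
 also have "distr xi (lebesgue_on_interval 0 T) fst = lebesgue_on_interval 0 T"
  using xi by (simp add: relaxed_controls_def Lam_def)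
 also have "(NN t:(lebesgue_on_interval 0 T). f t) = (NN t:lborel|{0..T}. f t)"
  unfolding lebesgue_on_interval_def by (subst nn_integral_restrict_space) auto
 finally show ?thesis .
qed

lemma normalized_control_distr:
 fixes Phi :: "real * real => 'u::metric_space"
 assumes Phi: "Phi : borel2 ->M borel"
 shows "normed T (fcontrol 0 T Phi)
  = distr (density (lebesgue_on_interval 0 T *M U01) (%_. ennreal (1 / T))) (borel2) (%z. (fst z, Phi z))"
  (is "_ = distr (density ?P _) _ ?h")
proof (rule measure_eqI)
 fix A assume "A : sets (normed T (fcontrol 0 T Phi))"
 then have A: "A : sets (borel2)" by simp
 have h: "?h : ?P ->M borel2"
  by (intro measurable_Pair mcomp[OF measurable_fst measurable_interval] measurable_U01_pair Phi)
 then have h': "?h : density ?P (%_. ennreal (1 / T)) ->M borel2" by simp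
 note c = function_control_in[OF Phi, of 0 T]
 have "(ind A :: _ => real) : bmeas (fcontrol 0 T Phi)"
  using A by (intro relaxed_control_measurable[OF c]) simp
 then have A': "A \<inter> space (fcontrol 0 T Phi) : sets (lebesgue_on_interval 0 T *M borel)"
  by (simp add: borel_measurable_indicator_iff)
 have D: "?h -` A \<inter> space ?P : sets ?P" by (rule measurable_sets[OF h A])
 have "emeasure (fcontrol 0 T Phi) (A \<inter> space (fcontrol 0 T Phi)) = emeasure ?P (?h -` A \<inter> space ?P)"
  by (subst fcontrol_def, subst emeasure_distr[OF measurable_graph_control[OF Phi] A'])
   (auto simp: relaxed_control_sets(2)[OF c] space_pair_measure intro!: arg_cong[where f="emeasure ?P"])
 then have "emeasure (normed T (fcontrol 0 T Phi)) A = ennreal (1 / T) * emeasure ?P (?h -` A \<inter> space ?P)"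
  by (simp add: emeasure_normalized_control[OF c A])
 also have "... = emeasure (distr (density ?P (%_. ennreal (1 / T))) (borel2) ?h) A"
  using D by (subst emeasure_distr[OF h' A]) (simp add: emeasure_density nn_integral_cmult_indicator)
 finally show "emeasure (normed T (fcontrol 0 T Phi)) A = ..." .
qed simp

section \<open>Gronwall's inequality\<close>

lemma nn_integral_exp_Icc:
 fixes c beta s t :: real
 assumes "0 <= c" "0 < beta" "s <= t"
 shows "(NN tau:lborel|{s..t}. ennreal (c * exp (beta * (tau - s)))) = ennreal (c * (exp (beta * (t - s)) - 1) / beta)"
proof -
 have "(NN tau:lborel|{s..t}. ennreal (c * exp (beta * (tau - s))))
  = ennreal (c * exp (beta * (t - s)) / beta - c * exp (beta * (s - s)) / beta)"
 proof (rule nn_integral_FTC_Icc)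
  fix x show "((%tau. c * exp (beta * (tau - s)) / beta) has_real_derivative c * exp (beta * (x - s))) (at x)"
   using assms by (auto intro!: derivative_eq_intros)
 qed (use assms in auto)
 then show ?thesis by (simp add: right_diff_distrib diff_divide_distrib)
qed

text \<open>With S the supremum of u divided by \<open>exp (L * (t - s))\<close>, inserting the
  bound by S into the integral inequality would lower S strictly if S exceeded a. Only monotonicity
  of \<open>nn_integral\<close> enters, so that u carries no measurability assumption; its
  boundedness makes S finite.\<close>

lemma gronwall:
 fixes u :: "real => real"
 assumes nn: "!!t. t : {s..r} ==> 0 <= u t" and bnd: "!!t. t : {s..r} ==> u t <= M"
  and a: "0 <= a" and L: "0 <= L"
  and ineq: "!!t. t : {s..r} ==> ennreal (u t) <= ennreal a + (NN tau:lborel|{s..t}. ennreal (L * u tau))"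
  and t: "t : {s..r}"
 shows "u t <= a * exp (L * (t - s))"
proof (cases "L = 0")
 case True
 then show ?thesis using ineq[OF t] nn[OF t] a by (simp add: ennreal_le_iff)
next
 case False
 with L have L: "0 < L" by simp
 define v where "v t = u t * exp (- (L * (t - s)))" for t
 define S where "S = (SUP t\<in>{s..r}. v t)"
 have bdd: "bdd_above (v ` {s..r})"
 proof (rule bdd_aboveI2)
  fix t assume t: "t : {s..r}"
  have "v t <= u t * 1" unfolding v_def using t L nn[OF t] by (intro mult_left_mono) auto
  then show "v t <= M" using bnd[OF t] by simp
 qed
 have vS: "v t <= S" if "t : {s..r}" for t unfolding S_def using that bdd by (rule cSUP_upper)
 have uS: "u t <= S * exp (L * (t - s))" if "t : {s..r}" for t
 proof -
  have "u t = v t * exp (L * (t - s))" by (simp add: v_def mult.assoc flip: exp_add)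
  then show ?thesis using vS[OF that] by (simp add: mult_right_mono)
 qed
 have S0: "0 <= S" using vS[OF t] nn[OF t] by (smt (verit) v_def exp_ge_zero mult_nonneg_nonneg)
 have step: "u t <= a + S * (exp (L * (t - s)) - 1)" if t: "t : {s..r}" for t
 proof -
  have "(NN tau:lborel|{s..t}. ennreal (L * u tau)) <= (NN tau:lborel|{s..t}. ennreal ((L * S) * exp (L * (tau - s))))"
   using uS t L by (intro nn_integral_mono) (auto split: split_indicator intro!: ennreal_leI simp: mult.assoc)
  also have "... = ennreal (S * (exp (L * (t - s)) - 1))"
   using t L S0 by (subst nn_integral_exp_Icc) auto
  finally have "ennreal (u t) <= ennreal a + ennreal (S * (exp (L * (t - s)) - 1))"
   using ineq[OF t] by (meson add_left_mono order_trans)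
  also have "... = ennreal (a + S * (exp (L * (t - s)) - 1))"
   using a S0 L t by (intro ennreal_plus[symmetric]) auto
  finally show ?thesis
   using a S0 L t by (subst (asm) ennreal_le_iff) (auto intro!: add_nonneg_nonneg)
 qed
 have "S <= a"
 proof (rule ccontr)
  assume "\<not> S <= a"
  then have Sa: "S > a" by simp
  \<comment> \<open>The gain is uniform in t because the decaying exponential is smallest at r; this
    contradicts S being the supremum.\<close>
  have "v t <= S - (S - a) * exp (- (L * (r - s)))" if t: "t : {s..r}" for t
  proof -
   have "v t <= (a + S * (exp (L * (t - s)) - 1)) * exp (- (L * (t - s)))"
    unfolding v_def using step[OF t] by (intro mult_right_mono) auto
   also have "... = S - (S - a) * exp (- (L * (t - s)))"
    by (simp add: algebra_simps flip: exp_add)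
   also have "... <= S - (S - a) * exp (- (L * (r - s)))"
    using Sa t L by (intro diff_left_mono mult_left_mono) auto
   finally show ?thesis .
  qed
  then have "S <= S - (S - a) * exp (- (L * (r - s)))"
   unfolding S_def[of] using t by (intro cSUP_least) (auto simp: S_def)
  moreover have "0 < (S - a) * exp (- (L * (r - s)))" using Sa by simp
  ultimately show False by linarith
 qed
 then have "S * exp (L * (t - s)) <= a * exp (L * (t - s))" by (intro mult_right_mono) auto
 with uS[OF t] show ?thesis by linarith
qed

section \<open>Controlled differential equations\<close>

text \<open>The factor T undoes the normalisation: this is the integral of F over the times {0..t}
  against xi itself. Unlike the integrals in \<open>solves_ode\<close> it involves no choice of a
  disintegration, and it depends measurably on xi.\<close>

definition cint :: "real => (real * 'u::metric_space) measure => (real * 'u => 'a::euclidean_space) => real => 'a" where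
 "cint T xi F t = T *\<^sub>R (LINT z|normed T xi. ind {0..t} (fst z) *\<^sub>R F z)"

lemma integrable_normalized_control:
 fixes F :: "real * 'u::metric_space => 'a::euclidean_space"
 assumes xi: "xi : relaxed_controls 0 T" and T: "0 < T" and F[measurable]: "F : bmeas (borel2)"
  and C: "!!z. norm (F z) <= C"
 shows "integrable (normed T xi) (%z. ind {0..t} (fst z) *\<^sub>R F z)"
proof -
 interpret prob_space "normed T xi" by (rule prob_space_normalized_control[OF xi T])
 have m: "(%z. ind {0..t} (fst z) *\<^sub>R F z) : bmeas (borel2)" by measurable
 show ?thesis
 proof (rule integrable_const_bound[of _ C])
  show "AE z in normed T xi. norm (ind {0..t} (fst z) *\<^sub>R F z) <= C"
   using C order_trans[OF norm_ge_zero C] by (auto split: split_indicator)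
  show "(%z. ind {0..t} (fst z) *\<^sub>R F z) : bmeas (normed T xi)"
   using m measurable_cong_sets[OF sets_normalized_control refl] by blast
 qed
qed

text \<open>The bound h depends on time alone, so that the control disappears from the estimate: the
  time marginal of every relaxed control is Lebesgue measure.\<close>

lemma control_integral_diff:
 fixes F F' :: "real * 'u::metric_space => 'a::euclidean_space"
 assumes xi: "xi : relaxed_controls 0 T" and T: "0 < T"
  and F[measurable]: "F : bmeas (borel2)" "F' : bmeas (borel2)"
  and C: "!!z. norm (F z) <= C" "!!z. norm (F' z) <= C"
  and h[measurable]: "h : bmeas borel" and d: "!!tau u. tau : {0..t} ==> norm (F (tau, u) - F' (tau, u)) <= h tau"
  and t: "t : {0..T}"
 shows "ennreal (norm (cint T xi F t - cint T xi F' t)) <= (NN tau:lborel|{0..t}. ennreal (h tau))"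
proof -
 let ?N = "normed T xi"
 let ?I = "%F z. ind {0..t} (fst z) *\<^sub>R (F z :: 'a)"
 note i = integrable_normalized_control[OF xi T F(1) C(1), of t] integrable_normalized_control[OF xi T F(2) C(2), of t]
 have "cint T xi F t - cint T xi F' t = T *\<^sub>R (LINT z|?N. ?I F z - ?I F' z)"
  unfolding cint_def using i by (simp add: scaleR_diff_right)
 then have "ennreal (norm (cint T xi F t - cint T xi F' t)) = ennreal T * ennreal (norm (LINT z|?N. ?I F z - ?I F' z))"
  using T by (simp add: ennreal_mult)
 also have "... <= ennreal T * (NN z:?N. ennreal (norm (?I F z - ?I F' z)))"
  using i by (intro mult_left_mono integral_norm_bound_ennreal) auto
 also have "(NN z:?N. ennreal (norm (?I F z - ?I F' z))) <= (NN z:?N. (ennreal (h (fst z)) * ind {0..t} (fst z)))"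
  using d by (intro nn_integral_mono) (auto split: split_indicator intro!: ennreal_leI)
 also have "... = ennreal (1 / T) * (NN tau:lborel|{0..T}. (ennreal (h tau) * ind {0..t} tau))"
  by (rule normalized_control_marginal[OF xi T, where f="%tau. ennreal (h tau) * ind {0..t} tau"]) measurable
 also have "(NN tau:lborel|{0..T}. (ennreal (h tau) * ind {0..t} tau)) = (NN tau:lborel|{0..t}. ennreal (h tau))"
  using t by (intro nn_integral_cong) (auto split: split_indicator)
 also have "ennreal T * (ennreal (1 / T) * (NN tau:lborel|{0..t}. ennreal (h tau))) = (NN tau:lborel|{0..t}. ennreal (h tau))"
  using T by (simp add: mult.assoc[symmetric] flip: ennreal_mult)
 finally show ?thesis by (simp add: mult_left_mono)
qed

lemma control_integral_cong:
 assumes xi: "xi : relaxed_controls 0 T" and "t <= T"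
  and "!!tau u. tau : {0..t} ==> F (tau, u) = F' (tau, u)"
 shows "cint T xi F t = cint T xi F' t"
proof -
 have "(%z. ind {0..t} (fst z) *\<^sub>R F z) = (%z. ind {0..t} (fst z) *\<^sub>R F' z)"
  using assms(3) by (auto simp: fun_eq_iff split: split_indicator)
 then show ?thesis unfolding cint_def by simp
qed

lemma control_integral_lipschitz:
 fixes F :: "real * 'u::metric_space => 'a::euclidean_space"
 assumes xi: "xi : relaxed_controls 0 T" and T: "0 < T"
  and F[measurable]: "F : bmeas (borel2)"
  and C: "!!z. norm (F z) <= C" and t: "0 <= s" "s <= t" "t <= T"
 shows "norm (cint T xi F t - cint T xi F s) <= C * (t - s)"
proof -
 have C0: "0 <= C" using C[of undefined] norm_ge_zero order_trans by blast
 \<comment> \<open>F cut off at s, so that both integrals run up to t.\<close>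
 define F' where "F' z = ind {0..s} (fst z) *\<^sub>R F z" for z
 have [measurable]: "F' : bmeas (borel2)" unfolding F'_def by measurable
 have "(%z. ind {0..s} (fst z) *\<^sub>R F z) = (%z. ind {0..t} (fst z) *\<^sub>R F' z)"
  using t by (auto simp: F'_def indicator_def fun_eq_iff)
 then have e: "cint T xi F s = cint T xi F' t"
  unfolding cint_def by simp
 have F'C: "norm (F' z) <= C" for z using C[of z] C0 by (auto simp: F'_def split: split_indicator)
 have "ennreal (norm (cint T xi F t - cint T xi F' t)) <= (NN tau:lborel|{0..t}. ennreal (C * ind {s<..t} tau))"
 proof (rule control_integral_diff[OF xi T F _ C F'C])
  fix tau u assume "tau : {0..t}"
  then show "norm (F (tau, u) - F' (tau, u)) <= C * ind {s<..t} tau"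
   using C[of "(tau, u)"] by (auto simp: F'_def split: split_indicator)
 qed (use t in auto)
 also have "... = (NN tau:lborel. ennreal C * ind {s<..t} tau)"
  using t C0 by (intro nn_integral_cong) (auto split: split_indicator)
 also have "... = ennreal (C * (t - s))" using t C0 by (simp add: nn_integral_cmult_indicator ennreal_mult)
 finally show ?thesis unfolding e using C0 t by (simp add: ennreal_le_iff)
qed

lemma control_integral_0:
 fixes F :: "real * 'u::metric_space => 'a::euclidean_space"
 assumes xi: "xi : relaxed_controls 0 T" and T: "0 < T"
  and F[measurable]: "F : bmeas (borel2)"
  and C: "!!z. norm (F z) <= C"
 shows "cint T xi F 0 = 0"
proof -
 have "ennreal (norm (cint T xi F 0 - cint T xi (%_. 0) 0)) <= (NN tau:lborel|{0..0::real}. ennreal C)"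
  using T order_trans[OF norm_ge_zero C] C
  by (intro control_integral_diff[OF xi T F, where F'="%_. 0" and h="%_. C" and C=C]) auto
 also have "... = 0" by (simp add: nn_integral_cmult_indicator)
 finally show ?thesis by (simp add: cint_def)
qed

text \<open>Writing xi as an \<open>fcontrol\<close>, whose kernel is explicit almost everywhere,
  reduces the second claim to Fubini for time and the uniform variable.\<close>

lemma control_integral_kernel:
 fixes F :: "real * 'u::metric_space => 'a::euclidean_space"
 assumes cpt: "compact (UNIV :: 'u set)"
  and xi: "xi : relaxed_controls 0 T" and T: "0 < T" and F[measurable]: "F : bmeas (borel2)"
  and C: "!!z. norm (F z) <= C"
 shows "set_integrable lborel {0..T} (%tau. (LINT u|control_kernel 0 T xi tau. F (tau, u)))" (is ?A)
  and "t : {0..T} ==> (LINT tau:{0..t}|lborel. (LINT u|control_kernel 0 T xi tau. F (tau, u))) = cint T xi F t" (is "_ ==> ?B")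
proof -
 let ?L = "lebesgue_on_interval 0 T"
 obtain Phi where Phi[measurable]: "Phi : borel2 ->M borel" and e: "xi = fcontrol 0 T Phi"
  using relaxed_control_function[OF cpt T xi] by blast
 interpret V: prob_space U01 by (rule prob_space_U01)
 interpret L: finite_measure ?L by (rule finite_measure_lebesgue_on_interval)
 interpret LV: pair_sigma_finite ?L U01 ..
 interpret LVf: finite_measure "?L *M U01" by (rule finite_measure_pair_measure) unfold_locales
 have C0: "0 <= C" using C[of undefined] norm_ge_zero order_trans by blast
 have Phiv: "(%v. Phi (tau, v)) : U01 ->M borel" for tau
  by (intro mcomp[OF measurable_Pair1' Phi] mcomp[OF measurable_interval]) auto
 have Fu: "(%u. F (tau, u)) : bmeas borel" for tau by measurable
 define G where "G tau = (LINT v|U01. F (tau, Phi (tau, v)))" for tau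
 have Fm: "(%z. F (fst z, Phi z)) : bmeas (borel2)" by measurable
 have Gm[measurable]: "G : bmeas borel"
 proof -
  have "(%(tau, v). F (tau, Phi (tau, v))) : bmeas (borel *M U01)"
  proof -
   have "(%z. F (fst z, Phi (fst z, snd z))) : bmeas (borel *M U01)"
    by (intro mcomp[OF _ F] measurable_Pair measurable_fst mcomp[OF _ Phi]
     mcomp[OF measurable_snd measurable_interval])
   then show ?thesis by (simp add: case_prod_unfold)
  qed
  then show ?thesis unfolding G_def by (rule V.borel_measurable_lebesgue_integral)
 qed
 have GC: "norm (G tau) <= C" for tau
 proof -
  have "norm (G tau) <= (LINT v|U01. norm (F (tau, Phi (tau, v))))"
   unfolding G_def by (rule integral_norm_bound)
  also have "... <= C"
   by (rule V.integral_le_const)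
   (auto intro!: V.integrable_const_bound[of _ C] C mcomp[OF Phiv Fu])
  finally show ?thesis .
 qed
 have ae: "AE tau in lborel. tau : {0..T} --> (LINT u|control_kernel 0 T xi tau. F (tau, u)) = G tau"
  using control_kernel_function[OF cpt Phi, of 0 T]
 proof eventually_elim
  case (elim tau)
  then show ?case unfolding e G_def by (auto simp: integral_distr[OF Phiv Fu])
 qed
 have Gi: "set_integrable lborel {0..T} G"
  unfolding set_integrable_def
  by (rule integrableI_bounded_set_indicator[where B=C]) (use GC in \<open>auto simp: emeasure_lborel_Icc_eq\<close>)
 obtain kappa where kappa: "is_disintegration ?L borel xi kappa" using disintegration_function_control[OF Phi] e by blast
 then have "is_disintegration ?L borel xi (control_kernel 0 T xi)"
  unfolding control_kernel_def disintegration_def by (rule someI[of "is_disintegration ?L borel xi"])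
 then have km: "control_kernel 0 T xi : ?L ->M prob_algebra borel" by (simp add: is_disintegration_def)
 have "(%tau. (LINT u|control_kernel 0 T xi tau. (%z. F z) (tau, u))) : bmeas ?L"
  by (rule integral_measurable_kernel[OF _ km C]) (rule measurable_lebesgue_on_interval_pair[OF F])
 then have mk: "(%tau. ind {0..T} tau *\<^sub>R (LINT u|control_kernel 0 T xi tau. F (tau, u))) : bmeas lborel"
  unfolding lebesgue_on_interval_def by (subst (asm) borel_measurable_restrict_space_iff) auto
 show ?A unfolding set_integrable_def
  by (rule integrable_cong_AE_imp[OF Gi[unfolded set_integrable_def] mk])
   (use ae in eventually_elim, auto split: split_indicator)
 show ?B if t: "t : {0..T}"
 proof -
  let ?H = "%z. (ind {0..t} (fst z) *\<^sub>R F z) :: 'a"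
  have Hm: "?H : bmeas (borel2)" by measurable
  have h: "(%z. (fst z, Phi z)) : ?L *M U01 ->M borel2"
   by (intro measurable_Pair mcomp[OF measurable_fst measurable_interval] measurable_U01_pair Phi)
  have Hh: "(%z. ?H (fst z, Phi z)) : bmeas (?L *M U01)"
   by (rule mcomp[OF h Hm])
  have int: "integrable (?L *M U01) (%z. ?H (fst z, Phi z))"
   by (rule LVf.integrable_const_bound[of _ C]) (use C C0 Hh in \<open>auto split: split_indicator\<close>)
  have "(LINT z|normed T xi. ?H z) = (LINT z|(density (?L *M U01) (%_. ennreal (1 / T))). ?H (fst z, Phi z))"
   unfolding e normalized_control_distr[OF Phi] by (rule integral_distr) (use h Hm in auto)
  also have "... = (LINT z|(?L *M U01). (1 / T) *\<^sub>R ?H (fst z, Phi z))"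
   using Hh T by (subst integral_density) auto
  also have "... = (1 / T) *\<^sub>R (LINT z|(?L *M U01). ?H (fst z, Phi z))"
   by (rule integral_scaleR_right)
  also have "(LINT z|(?L *M U01). ?H (fst z, Phi z)) = (LINT tau|?L. (LINT v|U01. ?H (tau, Phi (tau, v))))"
   using LV.integral_fst'[OF int] by simp
  also have "... = (LINT tau|?L. ind {0..t} tau *\<^sub>R G tau)" by (simp add: G_def)
  also have "... = (LINT tau|lborel. ind {0..T} tau *\<^sub>R (ind {0..t} tau *\<^sub>R G tau))"
   unfolding lebesgue_on_interval_def by (subst integral_restrict_space) auto
  also have "... = (LINT tau|lborel. ind {0..t} tau *\<^sub>R (LINT u|control_kernel 0 T xi tau. F (tau, u)))"
  proof (rule integral_cong_AE)
   show "(%tau. ind {0..t} tau *\<^sub>R (LINT u|control_kernel 0 T xi tau. F (tau, u))) : bmeas lborel"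
   proof -
    have "(%tau. ind {0..t} tau *\<^sub>R (ind {0..T} tau *\<^sub>R (LINT u|control_kernel 0 T xi tau. F (tau, u)))) : bmeas lborel"
     by (intro borel_measurable_scaleR mk) auto
    moreover have "(%tau. ind {0..t} tau *\<^sub>R (ind {0..T} tau *\<^sub>R (LINT u|control_kernel 0 T xi tau. F (tau, u)))) = (%tau. ind {0..t} tau *\<^sub>R (LINT u|control_kernel 0 T xi tau. F (tau, u)))"
     using t by (auto simp: fun_eq_iff indicator_def)
    ultimately show ?thesis by (simp only:)
   qed
   show "AE tau in lborel. ind {0..T} tau *\<^sub>R ind {0..t} tau *\<^sub>R G tau = ind {0..t} tau *\<^sub>R (LINT u|control_kernel 0 T xi tau. F (tau, u))"
    using ae by eventually_elim (use t in \<open>auto split: split_indicator\<close>)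
  qed simp
  finally show ?B using T by (simp add: cint_def set_lebesgue_integral_def)
 qed
qed

text \<open>Flows and solutions matter on {0..T} only; composing with the projection onto this
  interval makes fields continuous and paths Borel on the whole line.\<close>

definition clamp_time :: "real => real => real" where
 "clamp_time T t = max 0 (min T t)"

lemma clamp_time_in: "0 <= T ==> clamp_time T t : {0..T}"
 by (auto simp: clamp_time_def)

lemma clamp_time_id [simp]: "t : {0..T} ==> clamp_time T t = t"
 by (auto simp: clamp_time_def)

lemma continuous_clamp_time [continuous_intros]: "continuous_on A (clamp_time T)"
 unfolding clamp_time_def by (intro continuous_intros)

lemma measurable_clamp_time [measurable]: "clamp_time T : bmeas borel"
 by (intro borel_measurable_continuous_onI continuous_intros)

text \<open>The nesting ((t, x), u) makes the control the second factor, as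
  \<open>continuous_borel_measurable_prod\<close> requires.\<close>

definition regular_field :: "real => real => ((real * 'a::euclidean_space) * 'u::metric_space => 'a) => bool" where
 "regular_field L R g \<longleftrightarrow> continuous_on UNIV g & (ALL z. norm (g z) <= R) \<and>
  (ALL t x x' u. norm (g ((t, x), u) - g ((t, x'), u)) <= L * norm (x - x'))"

definition along :: "((real * 'a) * 'u => 'a) => (real => 'a) => real * 'u => 'a" where
 "along g x z = g ((fst z, x (fst z)), snd z)"

lemma regular_field_measurable:
 assumes "compact (UNIV :: 'u::metric_space set)" "regular_field L R (g :: (real * 'a::euclidean_space) * 'u => 'a)"
 shows "g : bmeas (borel2)"
 using assms by (auto simp: regular_field_def intro!: continuous_borel_measurable_prod)

lemma along_measurable:
 fixes g :: "(real * 'a::euclidean_space) * 'u::metric_space => 'a"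
 assumes cpt: "compact (UNIV :: 'u set)" and rf: "regular_field L R g" and x[measurable]: "x : bmeas borel"
 shows "along g x : bmeas (borel2)"
proof -
 have "(%z. ((fst z, x (fst z)), snd z)) : borel *M (borel :: 'u measure) ->M borel2"
  by (intro measurable_Pair measurable_snd borel_measurable_Pair measurable_fst mcomp[OF measurable_fst x])
 then show ?thesis unfolding along_def[abs_def]
  by (rule mcomp[OF _ regular_field_measurable[OF cpt rf]])
qed

lemma along_bound: "regular_field L R g ==> norm (along g x z) <= R"
 by (auto simp: regular_field_def along_def)

section \<open>Picard iteration for controlled equations\<close>

primrec picard :: "real => ((real * 'a::euclidean_space) * 'u::metric_space => 'a) => 'a => (real * 'u) measure => nat => real => 'a" where
 "picard T g y xi 0 = (%t. y)"
| "picard T g y xi (Suc n) = (%t. y + cint T xi (along g (picard T g y xi n)) t)"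

definition solution :: "real => ((real * 'a::euclidean_space) * 'u::metric_space => 'a) => 'a => (real * 'u) measure => real => 'a" where
 "solution T g y xi t = lim (%n. picard T g y xi n (clamp_time T t))"

text \<open>Measurability in starting point, control and time jointly passes through one kernel
  integral per iterate. It is what allows solutions to be random variables under a distribution of
  controls.\<close>

lemma picard_measurable_joint:
 fixes g :: "(real * 'a::euclidean_space) * 'u::metric_space => 'a"
 assumes cpt: "compact (UNIV :: 'u set)" and T: "0 < T" and rf: "regular_field L R g"
 shows "(%p. picard T g (fst (fst p)) (snd (fst p)) n (snd p)) : bmeas ((borel *M relaxed_space 0 T) *M borel)"
proof (induction n)
 case 0
 show ?case by simp
next
 case (Suc n)
 let ?M = "(borel *M relaxed_space 0 T) *M borel :: (('a * (real * 'u) measure) * real) measure"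
 let ?F = "%q. if 0 <= fst (snd q) & fst (snd q) <= snd (fst q)
  then g ((fst (snd q), picard T g (fst (fst (fst q))) (snd (fst (fst q))) n (fst (snd q))), snd (snd q)) else 0"
 note gm = regular_field_measurable[OF cpt rf]
 have R: "norm (g z) <= R" for z using rf unfolding regular_field_def by blast
 then have R0: "0 <= R" using norm_ge_zero order_trans by blast
 have 1: "(%q. (fst (fst q), fst (snd q))) : ?M *M (borel2) ->M ?M"
  by (intro measurable_Pair mcomp[OF measurable_fst measurable_fst] mcomp[OF measurable_snd measurable_fst])
 have 2: "(%q. picard T g (fst (fst (fst q))) (snd (fst (fst q))) n (fst (snd q))) : bmeas (?M *M (borel *M (borel :: 'u measure)))"
  using mcomp[OF 1 Suc.IH] by simp
 have 3: "(%q. g ((fst (snd q), picard T g (fst (fst (fst q))) (snd (fst (fst q))) n (fst (snd q))), snd (snd q))) : bmeas (?M *M (borel2))"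
  by (intro mcomp[OF _ gm] measurable_Pair borel_measurable_Pair 2 mcomp[OF measurable_snd measurable_snd]
   mcomp[OF measurable_snd measurable_fst])
 have 4: "Measurable.pred (?M *M (borel *M (borel :: 'u measure))) (%q. 0 <= fst (snd q) & fst (snd q) <= snd (fst q))"
 proof -
  have [measurable]: "(%q. fst (snd q)) : bmeas (?M *M (borel *M (borel :: 'u measure)))"
   "(%q. snd (fst q)) : bmeas (?M *M (borel *M (borel :: 'u measure)))"
   by (intro mcomp[OF measurable_snd measurable_fst] mcomp[OF measurable_fst measurable_snd])+
  show ?thesis by measurable
 qed
 have Fm: "?F : bmeas (?M *M (borel2))"
  by (intro measurable_If 3) (use 4 in \<open>auto simp: pred_def\<close>)
 have Km: "(%p. normed T (snd (fst p))) : ?M ->M prob_algebra (borel2)"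
  by (intro mcomp[OF _ measurable_normalized_control[OF cpt T]] mcomp[OF measurable_fst measurable_snd])
 have "(%p. (LINT z|normed T (snd (fst p)). ?F (p, z))) : bmeas ?M"
  by (rule integral_measurable_kernel[OF Fm Km, of R]) (use R R0 in auto)
 then have "(%p. fst (fst p) + T *\<^sub>R (LINT z|normed T (snd (fst p)). ?F (p, z))) : bmeas ?M"
  by (intro borel_measurable_add borel_measurable_scaleR borel_measurable_const mcomp[OF measurable_fst measurable_fst])
 moreover have "(%z. ?F (p, z)) = (%z. ind {0..snd p} (fst z) *\<^sub>R along g (picard T g (fst (fst p)) (snd (fst p)) n) z)" for p
  by (auto simp: fun_eq_iff along_def split: split_indicator)
 ultimately show ?case by (simp add: cint_def)
qed

lemma picard_measurable:
 fixes g :: "(real * 'a::euclidean_space) * 'u::metric_space => 'a"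
 assumes cpt: "compact (UNIV :: 'u set)" and T: "0 < T" and rf: "regular_field L R g" and xi: "xi : relaxed_controls 0 T"
 shows "picard T g y xi n : bmeas borel"
proof -
 have "(%t. ((y, xi), t)) : borel ->M (borel *M relaxed_space 0 T) *M borel"
  by (rule measurable_Pair1') (simp add: space_pair_measure space_relaxed_space xi)
 from mcomp[OF this picard_measurable_joint[OF cpt T rf]] show ?thesis by simp
qed

text \<open>In the weight \<open>exp (2 * L * t)\<close> the integral operator contracts by 1/2,
  since L times the integral of the weight over {0..t} is at most half its value at t.\<close>

lemma picard_step:
 fixes g :: "(real * 'a::euclidean_space) * 'u::metric_space => 'a"
 assumes cpt: "compact (UNIV :: 'u set)" and T: "0 < T" and rf: "regular_field L R g" and L: "0 < L"
  and xi: "xi : relaxed_controls 0 T" and t: "t : {0..T}"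
 shows "norm (picard T g y xi (Suc n) t - picard T g y xi n t) <= R * T * (1/2) ^ n * exp (2 * L * (t - 0))"
 using t
proof (induction n arbitrary: t)
 case 0
 note am = along_measurable[OF cpt rf picard_measurable[OF cpt T rf xi]]
 have "norm (cint T xi (along g (picard T g y xi 0)) t - cint T xi (along g (picard T g y xi 0)) 0) <= R * (t - 0)"
  using 0 by (intro control_integral_lipschitz[OF xi T am along_bound[OF rf]]) auto
 moreover have "cint T xi (along g (picard T g y xi 0)) 0 = 0"
  by (rule control_integral_0[OF xi T am along_bound[OF rf]])
 ultimately have 1: "norm (picard T g y xi (Suc 0) t - picard T g y xi 0 t) <= R * t" by simp
 have R0: "0 <= R" using along_bound[OF rf] norm_ge_zero order_trans by blast
 have "norm (picard T g y xi (Suc 0) t - picard T g y xi 0 t) <= R * t" by (rule 1)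
 also have "R * t <= R * T * 1" using 0 R0 by (simp add: mult_left_mono)
 also have "... <= R * T * exp (2 * L * (t - 0))" using R0 T L 0 by (intro mult_left_mono) auto
 finally show ?case by simp
next
 case (Suc n)
 note am = along_measurable[OF cpt rf picard_measurable[OF cpt T rf xi]]
 have R0: "0 <= R" using along_bound[OF rf] norm_ge_zero order_trans by blast
 let ?c = "L * (R * T * (1/2) ^ n)"
 have "ennreal (norm (picard T g y xi (Suc (Suc n)) t - picard T g y xi (Suc n) t)) =
  ennreal (norm (cint T xi (along g (picard T g y xi (Suc n))) t - cint T xi (along g (picard T g y xi n)) t))"
  by (simp add: algebra_simps)
 also have "... <= (NN tau:lborel|{0..t}. ennreal (?c * exp (2 * L * (tau - 0))))"
 proof (rule control_integral_diff[OF xi T am am along_bound[OF rf] along_bound[OF rf]])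
  fix tau u assume tau: "tau : {0..t}"
  have "norm (along g (picard T g y xi (Suc n)) (tau, u) - along g (picard T g y xi n) (tau, u))
   <= L * norm (picard T g y xi (Suc n) tau - picard T g y xi n tau)"
   using rf unfolding regular_field_def along_def fst_conv snd_conv by blast
  also have "... <= L * (R * T * (1/2) ^ n * exp (2 * L * (tau - 0)))"
   using Suc.IH[of tau] tau Suc.prems L by (intro mult_left_mono) auto
  finally show "norm (along g (picard T g y xi (Suc n)) (tau, u) - along g (picard T g y xi n) (tau, u)) <= ?c * exp (2 * L * (tau - 0))"
   by (simp add: mult.assoc)
 qed (use Suc.prems in auto)
 also have "... = ennreal (?c * (exp (2 * L * (t - 0)) - 1) / (2 * L))"
  using Suc.prems L R0 T by (intro nn_integral_exp_Icc) auto
 also have "?c * (exp (2 * L * (t - 0)) - 1) / (2 * L) = R * T * (1/2) ^ Suc n * (exp (2 * L * (t - 0)) - 1)"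
  using L by (simp add: field_simps)
 finally have "norm (picard T g y xi (Suc (Suc n)) t - picard T g y xi (Suc n) t) <= R * T * (1/2) ^ Suc n * (exp (2 * L * (t - 0)) - 1)"
  using R0 T L Suc.prems by (subst (asm) ennreal_le_iff) auto
 also have "... <= R * T * (1/2) ^ Suc n * exp (2 * L * (t - 0))"
  using R0 T by (intro mult_left_mono) auto
 finally show ?case .
qed

lemma solution_tendsto:
 fixes g :: "(real * 'a::euclidean_space) * 'u::metric_space => 'a"
 assumes cpt: "compact (UNIV :: 'u set)" and T: "0 < T" and rf: "regular_field L R g" and L: "0 < L"
  and xi: "xi : relaxed_controls 0 T"
 shows "(%n. picard T g y xi n (clamp_time T t)) \<longlonglongrightarrow> solution T g y xi t"
proof -
 let ?t = "clamp_time T t" and ?x = "%n. picard T g y xi n (clamp_time T t)"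
 have t: "?t : {0..T}" using T by (intro clamp_time_in) simp
 have "summable (%n. ?x (Suc n) - ?x n)"
 proof (rule summable_comparison_test')
  show "summable (%n. (R * T * exp (2 * L * (?t - 0))) * (1/2) ^ n)"
   by (intro summable_mult summable_geometric) simp
  show "norm (?x (Suc n) - ?x n) <= (R * T * exp (2 * L * (?t - 0))) * (1/2) ^ n" for n
   using picard_step[OF cpt T rf L xi t, of y n] by (simp only: mult_ac)
 qed
 then have "(%n. \<Sum>k<n. ?x (Suc k) - ?x k) \<longlonglongrightarrow> (\<Sum>n. ?x (Suc n) - ?x n)" by (rule summable_LIMSEQ)
 then have "(%n. ?x n - ?x 0) \<longlonglongrightarrow> (\<Sum>n. ?x (Suc n) - ?x n)" unfolding sum_lessThan_telescope[of ?x] .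
 from tendsto_add[OF this tendsto_const[of "?x 0"]] have "convergent ?x" unfolding convergent_def by auto
 then show ?thesis unfolding solution_def by (simp add: convergent_LIMSEQ_iff)
qed

lemma solution_clamp: "0 <= T ==> solution T g y xi (clamp_time T t) = solution T g y xi t"
 unfolding solution_def using clamp_time_in[of T t] by simp

lemma solution_measurable_time:
 fixes g :: "(real * 'a::euclidean_space) * 'u::metric_space => 'a"
 assumes cpt: "compact (UNIV :: 'u set)" and T: "0 < T" and rf: "regular_field L R g" and L: "0 < L"
  and xi: "xi : relaxed_controls 0 T"
 shows "solution T g y xi : bmeas borel"
proof (rule borel_measurable_LIMSEQ_metric[OF _ solution_tendsto[OF cpt T rf L xi]])
 show "(%t. picard T g y xi n (clamp_time T t)) : bmeas borel" for n
  by (rule mcomp[OF measurable_clamp_time picard_measurable[OF cpt T rf xi]])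
qed

lemma solution_measurable:
 fixes g :: "(real * 'a::euclidean_space) * 'u::metric_space => 'a"
 assumes cpt: "compact (UNIV :: 'u set)" and T: "0 < T" and rf: "regular_field L R g" and L: "0 < L"
 shows "(%p. solution T g (fst p) (snd p) t) : bmeas (borel *M relaxed_space 0 T)"
proof (rule borel_measurable_LIMSEQ_metric)
 fix n
 have "(%p. (p, clamp_time T t)) : (borel *M relaxed_space 0 T) ->M (borel *M relaxed_space 0 T) *M (borel :: real measure)"
  by (rule measurable_Pair2') simp
 from mcomp[OF this picard_measurable_joint[OF cpt T rf]]
 show "(%p. picard T g (fst p) (snd p) n (clamp_time T t)) : bmeas (borel *M relaxed_space 0 T)" by simp
next
 fix p :: "'a * (real * 'u) measure" assume "p : space (borel *M relaxed_space 0 T)"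
 then have "snd p : relaxed_controls 0 T" by (auto simp: space_pair_measure space_relaxed_space)
 then show "(%n. picard T g (fst p) (snd p) n (clamp_time T t)) \<longlonglongrightarrow> solution T g (fst p) (snd p) t"
  by (rule solution_tendsto[OF cpt T rf L])
qed

lemma control_integral_tendsto:
 fixes F :: "nat => real * 'u::metric_space => 'a::euclidean_space"
 assumes xi: "xi : relaxed_controls 0 T" and T: "0 < T"
  and F[measurable]: "!!n. F n : bmeas (borel2)" "G : bmeas (borel2)"
  and C: "!!n z. norm (F n z) <= C"
  and lim: "!!tau u. tau : {0..t} ==> (%n. F n (tau, u)) \<longlonglongrightarrow> G (tau, u)"
 shows "(%n. cint T xi (F n) t) \<longlonglongrightarrow> cint T xi G t"
 unfolding cint_def
proof (intro tendsto_scaleR tendsto_const integral_dominated_convergence[where w="%_. C"])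
 interpret prob_space "normed T xi" by (rule prob_space_normalized_control[OF xi T])
 have C0: "0 <= C" using C norm_ge_zero order_trans by blast
 show "(%z. ind {0..t} (fst z) *\<^sub>R G z) : bmeas (normed T xi)"
  "(%z. ind {0..t} (fst z) *\<^sub>R F n z) : bmeas (normed T xi)" for n
  unfolding measurable_cong_sets[OF sets_normalized_control refl] by measurable
 show "integrable (normed T xi) (%_. C)" by simp
 show "AE z in normed T xi. (%n. ind {0..t} (fst z) *\<^sub>R F n z) \<longlonglongrightarrow> ind {0..t} (fst z) *\<^sub>R G z"
 proof (rule AE_I2, goal_cases)
  case (1 z)
  show ?case
   using lim[of "fst z" "snd z"] by (cases "fst z : {0..t}") auto
 qed
 show "AE z in normed T xi. norm (ind {0..t} (fst z) *\<^sub>R F n z) <= C" for n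
  using C C0 by (auto split: split_indicator)
qed

lemma solution_eq:
 fixes g :: "(real * 'a::euclidean_space) * 'u::metric_space => 'a"
 assumes cpt: "compact (UNIV :: 'u set)" and T: "0 < T" and rf: "regular_field L R g" and L: "0 < L"
  and xi: "xi : relaxed_controls 0 T" and t: "t : {0..T}"
 shows "solution T g y xi t = y + cint T xi (along g (solution T g y xi)) t"
proof -
 note tends = solution_tendsto[OF cpt T rf L xi]
 have "(%n. cint T xi (along g (picard T g y xi n)) t) \<longlonglongrightarrow> cint T xi (along g (solution T g y xi)) t"
 proof (rule control_integral_tendsto[OF xi T along_measurable[OF cpt rf picard_measurable[OF cpt T rf xi]]
   along_measurable[OF cpt rf solution_measurable_time[OF cpt T rf L xi]] along_bound[OF rf]])
  fix tau and u :: 'u assume tau: "tau : {0..t}"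
  then have "tau : {0..T}" using t by auto
  then have "(%n. picard T g y xi n tau) \<longlonglongrightarrow> solution T g y xi tau" using tends[of y tau] by simp
  then have "(%n. ((tau, picard T g y xi n tau), u)) \<longlonglongrightarrow> ((tau, solution T g y xi tau), u)"
   by (intro tendsto_intros)
  moreover have "isCont g ((tau, solution T g y xi tau), u)"
   using rf continuous_on_eq_continuous_at[OF open_UNIV] unfolding regular_field_def by blast
  ultimately show "(%n. along g (picard T g y xi n) (tau, u)) \<longlonglongrightarrow> along g (solution T g y xi) (tau, u)"
   unfolding along_def fst_conv snd_conv by (rule isCont_tendsto_compose[rotated])
 qed
 then have "(%n. picard T g y xi (Suc n) t) \<longlonglongrightarrow> y + cint T xi (along g (solution T g y xi)) t"
  by (simp add: tendsto_add)
 moreover have "(%n. picard T g y xi (Suc n) t) \<longlonglongrightarrow> solution T g y xi t"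
  using LIMSEQ_Suc[OF tends[of y t]] t by simp
 ultimately show ?thesis using LIMSEQ_unique by blast
qed

lemma solution_lipschitz:
 fixes g :: "(real * 'a::euclidean_space) * 'u::metric_space => 'a"
 assumes cpt: "compact (UNIV :: 'u set)" and T: "0 < T" and rf: "regular_field L R g" and L: "0 < L"
  and xi: "xi : relaxed_controls 0 T" and t: "s : {0..T}" "t : {0..T}"
 shows "norm (solution T g y xi t - solution T g y xi s) <= R * \<bar>t - s\<bar>"
proof -
 have *: "norm (solution T g y xi t - solution T g y xi s) <= R * (t - s)" if "s : {0..T}" "t : {0..T}" "s <= t" for s t
 proof -
  have "norm (cint T xi (along g (solution T g y xi)) t - cint T xi (along g (solution T g y xi)) s) <= R * (t - s)"
   using that by (intro control_integral_lipschitz[OF xi T along_measurable[OF cpt rf solution_measurable_time[OF cpt T rf L xi]] along_bound[OF rf]]) auto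
  then show ?thesis by (simp add: solution_eq[OF cpt T rf L xi that(1)] solution_eq[OF cpt T rf L xi that(2)])
 qed
 show ?thesis using *[OF t] *[OF t(2) t(1)] by (cases "s <= t") (auto simp: norm_minus_commute)
qed

lemma solution_continuous:
 fixes g :: "(real * 'a::euclidean_space) * 'u::metric_space => 'a"
 assumes cpt: "compact (UNIV :: 'u set)" and T: "0 < T" and rf: "regular_field L R g" and L: "0 < L"
  and xi: "xi : relaxed_controls 0 T"
 shows "continuous_on {0..T} (solution T g y xi)"
proof -
 have "R-lipschitz_on {0..T} (solution T g y xi)"
 proof (rule lipschitz_onI)
  show "0 <= R" using along_bound[OF rf] norm_ge_zero order_trans by blast
  show "dist (solution T g y xi a) (solution T g y xi b) <= R * dist a b" if "a : {0..T}" "b : {0..T}" for a b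
   using solution_lipschitz[OF cpt T rf L xi that(2) that(1), of y] by (simp add: dist_norm)
 qed
 then show ?thesis by (rule lipschitz_on_continuous_on)
qed

lemma ode_unique:
 fixes g :: "(real * 'a::euclidean_space) * 'u::metric_space => 'a"
 assumes cpt: "compact (UNIV :: 'u set)" and T: "0 < T" and rf: "regular_field L R g" and L: "0 < L"
  and xi: "xi : relaxed_controls 0 T" and m: "x : bmeas borel" "x' : bmeas borel"
  and x: "!!t. t : {0..T} ==> x t = y + cint T xi (along g x) t"
  and x': "!!t. t : {0..T} ==> x' t = y + cint T xi (along g x') t"
  and t: "t : {0..T}"
 shows "x t = x' t"
proof -
 note am = along_measurable[OF cpt rf]
 have R0: "0 <= R" using along_bound[OF rf] norm_ge_zero order_trans by blast
 have diff: "ennreal (norm (x t - x' t)) <= (NN tau:lborel|{0..t}. ennreal (L * norm (x tau - x' tau)))" if t: "t : {0..T}" for t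
 proof -
  have "ennreal (norm (cint T xi (along g x) t - cint T xi (along g x') t)) <= (NN tau:lborel|{0..t}. ennreal (L * norm (x tau - x' tau)))"
  proof (rule control_integral_diff[OF xi T am[OF m(1)] am[OF m(2)] along_bound[OF rf] along_bound[OF rf] _ _ t])
   show "(%tau. L * norm (x tau - x' tau)) : bmeas borel" using m by simp
   show "norm (along g x (tau, u) - along g x' (tau, u)) <= L * norm (x tau - x' tau)" for tau u
    using rf unfolding regular_field_def along_def fst_conv snd_conv by blast
  qed
  then show ?thesis by (simp add: x[OF t] x'[OF t])
 qed
 have bnd: "norm (x t - x' t) <= 2 * R * T" if t: "t : {0..T}" for t
 proof -
  have b: "norm (cint T xi (along g w) t) <= R * T" if w: "w : bmeas borel" for w
  proof -
   have "norm (cint T xi (along g w) t - cint T xi (along g w) 0) <= R * (t - 0)"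
    using t by (intro control_integral_lipschitz[OF xi T am[OF w] along_bound[OF rf]]) auto
   also have "... <= R * T" using t R0 by (intro mult_left_mono) auto
   finally show ?thesis by (simp add: control_integral_0[OF xi T am[OF w] along_bound[OF rf]])
  qed
  have "norm (x t - x' t) = norm (cint T xi (along g x) t - cint T xi (along g x') t)"
   by (simp add: x[OF t] x'[OF t])
  also have "... <= R * T + R * T"
   by (intro order_trans[OF norm_triangle_ineq4] add_mono b m)
  finally show ?thesis by simp
 qed
 have "norm (x t - x' t) <= 0 * exp (L * (t - 0))"
  by (rule gronwall[where s=0 and r=T and M="2 * R * T"]) (use diff bnd L t in auto)
 then show ?thesis by simp
qed

lemma mspace_path_space:
 "x : mspace (path_space s r :: (real => 'a::euclidean_space) metric) \<longleftrightarrow> x : extensional {s..r} & continuous_on {s..r} x"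
proof -
 have "bounded (x ` {s..r})" if "continuous_on {s..r} x"
  using compact_continuous_image[OF that compact_Icc] by (rule compact_imp_bounded)
 then show ?thesis
  unfolding path_space_def by auto
qed

text \<open>For continuous paths \<open>solves_ode\<close> is the fixed point equation of
  \<open>cint\<close>, so existence and uniqueness determine the \<open>THE\<close> in
  \<open>traj\<close>. The restriction is the normal form of elements of the path space, which are
  extensional.\<close>

lemma traj_eq:
 fixes g :: "(real * 'a::euclidean_space) * 'u::metric_space => 'a"
 assumes cpt: "compact (UNIV :: 'u set)" and T: "0 < T" and rf: "regular_field L R g" and L: "0 < L"
  and xi: "xi : relaxed_controls 0 T"
  and fg: "!!tau x u. tau : {0..T} ==> f tau x (m tau) u = g ((tau, x), u)"
 shows "traj f 0 T m y xi = restrict (solution T g y xi) {0..T}"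
proof -
 have iff: "solves_ode f 0 T m y xi x \<longleftrightarrow> (ALL t:{0..T}. x t = y + cint T xi (along g (%t. x (clamp_time T t))) t)"
  if c: "continuous_on {0..T} x" for x
 proof -
  have xm: "(%t. x (clamp_time T t)) : bmeas borel"
   using T by (intro borel_measurable_continuous_onI continuous_on_compose2[OF c] continuous_intros) (auto simp: clamp_time_def)
  let ?F = "along g (%t. x (clamp_time T t))"
  note am = along_measurable[OF cpt rf xm]
  have e: "(LINT u|control_kernel 0 T xi tau. f tau (x tau) (m tau) u) = (LINT u|control_kernel 0 T xi tau. ?F (tau, u))" if "tau : {0..T}" for tau
   using that by (simp add: along_def fg)
  have "set_integrable lborel {0..T} (%tau. (LINT u|control_kernel 0 T xi tau. f tau (x tau) (m tau) u))
   \<longleftrightarrow> set_integrable lborel {0..T} (%tau. (LINT u|control_kernel 0 T xi tau. ?F (tau, u)))"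
   by (rule set_integrable_cong) (use e in auto)
  moreover have "(LINT tau:{0..t}|lborel. (LINT u|control_kernel 0 T xi tau. f tau (x tau) (m tau) u)) = cint T xi ?F t" if t: "t : {0..T}" for t
  proof -
   have "(LINT tau:{0..t}|lborel. (LINT u|control_kernel 0 T xi tau. f tau (x tau) (m tau) u)) = (LINT tau:{0..t}|lborel. (LINT u|control_kernel 0 T xi tau. ?F (tau, u)))"
    by (rule set_lebesgue_integral_cong) (use e t in auto)
   also have "... = cint T xi ?F t" by (rule control_integral_kernel(2)[OF cpt xi T am along_bound[OF rf] t])
   finally show ?thesis .
  qed
  ultimately show ?thesis unfolding solves_ode_def
   using control_integral_kernel(1)[OF cpt xi T am along_bound[OF rf]] by auto
 qed
 let ?x = "restrict (solution T g y xi) {0..T}"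
 have sc: "(%t. ?x (clamp_time T t)) = solution T g y xi"
  using T clamp_time_in[of T] by (auto simp: fun_eq_iff solution_clamp)
 have cx: "continuous_on {0..T} ?x"
  using solution_continuous[OF cpt T rf L xi, of y]
   continuous_on_cong[of "{0..T}" "{0..T}" ?x "solution T g y xi"] by auto
 show ?thesis unfolding traj_def
 proof (rule the_equality)
  show "?x : mspace (path_space 0 T) & solves_ode f 0 T m y xi ?x"
   unfolding mspace_path_space iff[OF cx] sc using cx by (auto intro!: solution_eq[OF cpt T rf L xi])
  fix x assume x: "x : mspace (path_space 0 T) & solves_ode f 0 T m y xi x"
  then have c: "continuous_on {0..T} x" and ext: "x : extensional {0..T}" by (auto simp: mspace_path_space)
  have xm: "(%t. x (clamp_time T t)) : bmeas borel"
   using T by (intro borel_measurable_continuous_onI continuous_on_compose2[OF c] continuous_intros) (auto simp: clamp_time_def)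
  have eq: "x (clamp_time T t) = solution T g y xi t" if t: "t : {0..T}" for t
   by (rule ode_unique[OF cpt T rf L xi xm solution_measurable_time[OF cpt T rf L xi] _ solution_eq[OF cpt T rf L xi] t])
    (use x iff[OF c] in auto)
  show "x = ?x"
  proof
   fix t show "x t = ?x t"
    using eq[of t] ext by (cases "t : {0..T}") (auto simp: extensional_def)
  qed
 qed
qed

section \<open>Random paths\<close>

text \<open>At finitely many grid times a path is rounded to a countable dense set, and one path is
  kept for every list of rounded values that occurs; the common Lipschitz constant controls the
  times in between.\<close>

lemma lipschitz_paths_countable_net:
 fixes X :: "'w => real => 'a::euclidean_space"
 assumes T: "0 < T" and R: "0 <= R"
  and lip: "!!om s t. om : \<Omega> ==> s : {0..T} ==> t : {0..T} ==> dist (X om s) (X om t) <= R * \<bar>s - t\<bar>"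
 shows "EX D. countable D & D \<subseteq> \<Omega> & (ALL om:\<Omega>. ALL e>0. EX om':D. ALL t:{0..T}. dist (X om' t) (X om t) <= e)"
proof -
 obtain D0 :: "'a set" where D0: "countable D0" "!!Y :: 'a set. open Y ==> Y ~= {} ==> EX d:D0. d : Y"
  using countable_dense_setE by blast
 define pick where "pick n x = (SOME d. d : D0 & dist d x < 1 / real (Suc n))" for n :: nat and x
 have pick: "pick n x : D0 & dist (pick n x) x < 1 / real (Suc n)" for n x
 proof -
  have "EX d:D0. d : ball x (1 / real (Suc n))" by (rule D0(2)) (auto simp: ball_eq_empty)
  then have "EX d. d : D0 & dist d x < 1 / real (Suc n)" by (auto simp: dist_commute)
  then show ?thesis unfolding pick_def by (rule someI_ex)
 qed
 \<comment> \<open>The grid has n + 2 points, so that it contains both 0 and T.\<close>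
 define code where "code n om = map (%i. pick n (X om (T * real i / real (Suc n)))) [0..<Suc (Suc n)]" for n om
 define rep where "rep n c = (SOME om. om : \<Omega> & code n om = c)" for n c
 have rep: "rep n (code n om) : \<Omega> & code n (rep n (code n om)) = code n om" if "om : \<Omega>" for n om
  unfolding rep_def by (rule someI[of _ om]) (use that in simp)
 define D where "D = (\<Union>n. rep n ` code n ` \<Omega>)"
 have "countable (code n ` \<Omega>)" for n
 proof (rule countable_subset)
  show "code n ` \<Omega> \<subseteq> lists D0" using pick by (auto simp: code_def)
  show "countable (lists D0)" using D0(1) by simp
 qed
 then have "countable D" unfolding D_def by blast
 moreover have "D \<subseteq> \<Omega>" unfolding D_def using rep by blast
 moreover have "EX om':D. ALL t:{0..T}. dist (X om' t) (X om t) <= e" if w: "om : \<Omega>" and e: "e > 0" for om and e :: real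
 proof -
  obtain n :: nat where n: "(2 + 2 * R * T) / e < real n" using reals_Archimedean2 by blast
  then have n': "(2 + 2 * R * T) / real (Suc n) <= e" using e by (simp add: field_simps)
  define w' where "w' = rep n (code n om)"
  have w': "w' : \<Omega>" "code n w' = code n om" using rep[OF w] by (auto simp: w'_def)
  have "dist (X w' t) (X om t) <= e" if t: "t : {0..T}" for t
  proof -
   define i where "i = nat \<lfloor>t * real (Suc n) / T\<rfloor>"
   define s where "s = T * real i / real (Suc n)"
   have "t / T * real (Suc n) <= 1 * real (Suc n)" using t T by (intro mult_right_mono) auto
   then have q: "0 <= t * real (Suc n) / T" "t * real (Suc n) / T <= real (Suc n)"
    using t T by auto
   have i: "real i <= t * real (Suc n) / T" "t * real (Suc n) / T < real i + 1"
    unfolding i_def using q(1) by linarith+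
   have iS: "i < Suc (Suc n)" using i(1) q(2) by linarith
   have "s <= t" using i(1) T by (simp add: s_def field_simps del: of_nat_Suc)
   moreover have "t < T * (real i + 1) / real (Suc n)" using i(2) T by (simp add: field_simps del: of_nat_Suc)
   then have "t - s <= T / real (Suc n)" by (simp add: s_def distrib_left add_divide_distrib del: of_nat_Suc)
   moreover have "0 <= s" using T by (simp add: s_def)
   ultimately have s: "s : {0..T}" "\<bar>s - t\<bar> <= T / real (Suc n)" using t by auto
   have "code n w' ! i = code n om ! i" using w' by simp
   then have pe: "pick n (X w' s) = pick n (X om s)" using iS by (simp add: code_def s_def del: upt_Suc)
   have st: "R * \<bar>s - t\<bar> <= R * (T / real (Suc n))" using s R by (intro mult_left_mono) auto
   have "dist (X w' t) (X om t) <= dist (X w' t) (X w' s) + dist (X w' s) (pick n (X w' s)) + dist (pick n (X om s)) (X om s) + dist (X om s) (X om t)"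
    using dist_triangle[of "X w' t" "X om t" "X w' s"] dist_triangle[of "X w' s" "X om t" "pick n (X w' s)"]
     dist_triangle[of "pick n (X w' s)" "X om t" "X om s"] pe by simp
   also have "... <= R * (T / real (Suc n)) + 1 / real (Suc n) + 1 / real (Suc n) + R * (T / real (Suc n))"
    using lip[OF w'(1) s(1) t] lip[OF w s(1) t] pick[of n "X w' s"] pick[of n "X om s"] st
    by (intro add_mono) (auto simp: dist_commute)
   also have "... = (2 + 2 * R * T) / real (Suc n)" by (simp add: field_simps del: of_nat_Suc)
   finally show ?thesis using n' by linarith
  qed
  moreover have "w' : D" using w by (auto simp: D_def w'_def)
  ultimately show ?thesis by blast
 qed
 ultimately show ?thesis by blast
qed

lemma mdist_path_space_le_iff:
 assumes "x : mspace (path_space 0 T)" "y : mspace (path_space 0 T :: (real => 'a::euclidean_space) metric)" "0 <= T"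
 shows "mdist (path_space 0 T) x y <= a \<longleftrightarrow> (ALL t:{0..T}. dist (x t) (y t) <= a)"
 using cfunspace_mdist_le[OF assms(1,2)[unfolded path_space_def], of a] assms(3) unfolding path_space_def by simp

text \<open>A family with a common Lipschitz constant has separable range. The preimage of an open
  set is therefore a countable union of closed balls about net points, and each such ball is cut out
  by conditions at countably many times.\<close>

lemma measurable_path:
 fixes X :: "'w => real => 'a::euclidean_space"
 assumes T: "0 < T" and R: "0 <= R"
  and lip: "!!om s t. om : space M ==> s : {0..T} ==> t : {0..T} ==> dist (X om s) (X om t) <= R * \<bar>s - t\<bar>"
  and ext: "!!om. om : space M ==> X om : extensional {0..T}"
  and m: "!!t. t : {0..T} ==> (%om. X om t) : bmeas M"
 shows "X : M ->M borel_of (mtopology_of (path_space 0 T))"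
proof -
 let ?P = "path_space 0 T :: (real => 'a) metric"
 have Xin: "X om : mspace ?P" if w: "om : space M" for om
 proof -
  have "R-lipschitz_on {0..T} (X om)"
   by (rule lipschitz_onI) (use lip[OF w] R in \<open>auto simp: dist_real_def\<close>)
  then show ?thesis unfolding mspace_path_space using ext[OF w] by (auto dest: lipschitz_on_continuous_on)
 qed
 obtain D where D: "countable D" "D \<subseteq> space M"
  "!!om e. om : space M ==> e > 0 ==> EX om':D. ALL t:{0..T}. dist (X om' t) (X om t) <= e"
  using lipschitz_paths_countable_net[where \<Omega>="space M" and X=X, OF T R lip] by blast
 have ball: "{om : space M. mdist ?P (X d) (X om) <= q} : sets M" if d: "d : space M" for d q
 proof -
  \<comment> \<open>A countable dense set of times in {0..T}; the Lipschitz bound carries the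
    inequality to all times.\<close>
  let ?Q = "{0..T} \<inter> (%r. T * r) ` \<rat>"
  have eq: "mdist ?P (X d) (X om) <= q \<longleftrightarrow> (ALL t:?Q. dist (X d t) (X om t) <= q)" if w: "om : space M" for om
  proof
   assume "mdist ?P (X d) (X om) <= q"
   then show "ALL t:?Q. dist (X d t) (X om t) <= q"
    using mdist_path_space_le_iff[OF Xin[OF d] Xin[OF w]] T by auto
  next
   assume a: "ALL t:?Q. dist (X d t) (X om t) <= q"
   have "dist (X d t) (X om t) <= q" if t: "t : {0..T}" for t
   proof (rule field_le_epsilon)
    fix e :: real assume e: "e > 0"
    define delta where "delta = e / (2 * R + 1)"
    have delta: "delta > 0" "2 * R * delta <= e" using e R by (auto simp: delta_def field_simps)
    obtain s where s: "s : ?Q" "\<bar>s - t\<bar> <= delta"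
    proof (cases "t = 0")
     case True
     then show ?thesis using T delta by (intro that[of 0]) (auto intro: image_eqI[of _ _ 0])
    next
     case False
     then have "max 0 (t - delta) / T < t / T" using t T delta by (intro divide_strict_right_mono) auto
     then obtain r where r: "r : \<rat>" "max 0 (t - delta) / T < r" "r < t / T" using Rats_dense_in_real by blast
     then have "max 0 (t - delta) < T * r" "T * r < t" using T by (auto simp: field_simps)
     then have "T * r : {0..T}" 
     proof -
      assume a: "max 0 (t - delta) < T * r" "T * r < t"
      have "0 <= t" "t <= T" using t by auto
      then have "0 <= T * r & T * r <= T" using a by linarith
      then show ?thesis by (simp only: atLeastAtMost_iff)
     qed
     then show ?thesis using r t \<open>max 0 (t - delta) < T * r\<close> \<open>T * r < t\<close> by (intro that[of "T * r"]) auto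
    qed
    have "dist (X d t) (X om t) <= dist (X d t) (X d s) + dist (X d s) (X om s) + dist (X om s) (X om t)"
     by (smt (verit) dist_triangle)
    also have "... <= R * \<bar>t - s\<bar> + q + R * \<bar>s - t\<bar>"
     using s t a by (intro add_mono lip d w) auto
    also have "... = q + 2 * R * \<bar>s - t\<bar>" by (simp add: abs_minus_commute)
    also have "... <= q + 2 * R * delta" using s R by (intro add_left_mono mult_left_mono) auto
    also have "... <= q + e" using delta by simp
    finally show "dist (X d t) (X om t) <= q + e" .
   qed
   then show "mdist ?P (X d) (X om) <= q"
    using mdist_path_space_le_iff[OF Xin[OF d] Xin[OF w]] T by auto
  qed
  have "countable ?Q" using countable_rat by (intro countable_Int2 countable_image)
  then have "(\<Inter>t\<in>?Q. {om : space M. dist (X d t) (X om t) <= q}) : sets M"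
  proof (rule sets.countable_INT')
   have "0 : (%r. T * r) ` \<rat>" by (rule image_eqI[of _ _ 0]) auto
   then have "0 : ?Q" using T by simp
   then show "?Q ~= {}" by blast
   have "{om : space M. dist (X d t) (X om t) <= q} : sets M" if "t : ?Q" for t
   proof -
    have [measurable]: "(%om. X om t) : bmeas M" using that by (intro m) auto
    show ?thesis by measurable
   qed
   then show "(%t. {om : space M. dist (X d t) (X om t) <= q}) ` ?Q \<subseteq> sets M" by blast
  qed
  moreover have "{om : space M. mdist ?P (X d) (X om) <= q} = (\<Inter>t\<in>?Q. {om : space M. dist (X d t) (X om t) <= q})"
  proof -
   have "0 : (%r. T * r) ` \<rat>" by (rule image_eqI[of _ _ 0]) auto
   then have "0 : ?Q" using T by simp
   then show ?thesis using eq by blast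
  qed
  ultimately show ?thesis by simp
 qed
 interpret PM: Metric_space "mspace ?P" "mdist ?P" by (rule Metric_space_mspace_mdist)
 show ?thesis unfolding borel_of_def
 proof (rule measurable_measure_of)
  show "{V. openin (mtopology_of ?P) V} \<subseteq> Pow (topspace (mtopology_of ?P))" by (auto dest!: openin_subset)
  show "X : space M \<rightarrow> topspace (mtopology_of ?P)" using Xin by auto
  fix V assume "V : {V. openin (mtopology_of ?P) V}"
  then have V: "V \<subseteq> mspace ?P" "!!x. x : V ==> EX r>0. PM.mball x r \<subseteq> V"
   unfolding mtopology_of_def by (auto simp: PM.openin_mtopology)
  let ?A = "{(d, q). d : D & q : \<rat> & PM.mcball (X d) q \<subseteq> V}"
  have cA: "countable ?A" by (rule countable_subset[OF _ countable_SIGMA[OF D(1) countable_rat]]) auto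
  have "X -` V \<inter> space M = (\<Union>(d, q)\<in>?A. {om : space M. mdist ?P (X d) (X om) <= q})"
  proof (intro equalityI subsetI)
   fix om assume "om : X -` V \<inter> space M"
   then have w: "om : space M" "X om : V" by auto
   obtain r where r: "r > 0" "PM.mball (X om) r \<subseteq> V" using V(2)[OF w(2)] by blast
   obtain q where q: "q : \<rat>" "0 < q" "q < r / 2" using r Rats_dense_in_real[of 0 "r/2"] by auto
   obtain d where d: "d : D" "ALL t:{0..T}. dist (X d t) (X om t) <= q" using D(3)[OF w(1) q(2)] by blast
   have dM: "d : space M" using d D(2) by blast
   have dq: "mdist ?P (X d) (X om) <= q"
    using mdist_path_space_le_iff[OF Xin[OF dM] Xin[OF w(1)]] T d by auto
   have "PM.mcball (X d) q \<subseteq> PM.mball (X om) r"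
   proof
    fix z assume "z : PM.mcball (X d) q"
    then have z: "z : mspace ?P" "mdist ?P (X d) z <= q" by auto
    have "mdist ?P (X om) z <= mdist ?P (X om) (X d) + mdist ?P (X d) z"
     by (rule PM.triangle[OF Xin[OF w(1)] Xin[OF dM] z(1)])
    then have "mdist ?P (X om) z < r" using z dq q PM.commute[of "X om" "X d"] by linarith
    then show "z : PM.mball (X om) r" using z Xin[OF w(1)] by auto
   qed
   then show "om : (\<Union>(d, q)\<in>?A. {om : space M. mdist ?P (X d) (X om) <= q})"
    using r d q dq w by (intro UN_I[of "(d, q)"]) auto
  next
   fix om assume "om : (\<Union>(d, q)\<in>?A. {om : space M. mdist ?P (X d) (X om) <= q})"
   then obtain d q where dq: "d : D" "PM.mcball (X d) q \<subseteq> V" "om : space M" "mdist ?P (X d) (X om) <= q" by auto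
   then have "X om : PM.mcball (X d) q" using Xin D(2) by auto
   then show "om : X -` V \<inter> space M" using dq by auto
  qed
  also have "... : sets M"
   by (rule sets.countable_UN''[OF cA]) (use ball D(2) in auto)
  finally show "X -` V \<inter> space M : sets M" .
 qed
qed

lemma measurable_eval_path:
 assumes "t : {0..T}"
 shows "(%x. x t) : borel_of (mtopology_of (path_space 0 T :: (real => 'a::euclidean_space) metric)) ->M borel"
proof (rule borel_measurableI)
 let ?P = "path_space 0 T :: (real => 'a) metric"
 interpret PM: Metric_space "mspace ?P" "mdist ?P" by (rule Metric_space_mspace_mdist)
 fix S :: "'a set" assume S: "open S"
 have "openin (mtopology_of ?P) {x : mspace ?P. x t : S}"
  unfolding mtopology_of_def PM.openin_mtopology
 proof (intro conjI allI impI)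
  fix x assume "x : {x : mspace ?P. x t : S}"
  then have x: "x : mspace ?P" "x t : S" by auto
  obtain e where e: "e > 0" "!!y. dist y (x t) < e ==> y : S" using S x(2) unfolding open_dist by blast
  have "y t : S" if y: "y : mspace ?P" "mdist ?P x y < e" for y
  proof (rule e(2))
   have "dist (x t) (y t) <= mdist ?P x y"
    using mdist_path_space_le_iff[OF x(1) y(1), of "mdist ?P x y"] assms by auto
   then show "dist (y t) (x t) < e" using y by (simp add: dist_commute)
  qed
  then show "EX r>0. PM.mball x r \<subseteq> {x : mspace ?P. x t : S}" using e(1) by (intro exI[of _ e]) auto
 qed auto
 then have "{x : mspace ?P. x t : S} : sets (borel_of (mtopology_of ?P))"
  unfolding borel_of_def by (subst sets_measure_of) (auto dest!: openin_subset)
 moreover have "space (borel_of (mtopology_of ?P)) = mspace ?P" by (simp add: borel_of_def space_measure_of_conv)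
 ultimately show "(%x. x t) -` S \<inter> space (borel_of (mtopology_of ?P)) : sets (borel_of (mtopology_of ?P))"
  by (simp add: vimage_def Int_def conj_commute)
qed

lemma measurable_mdist_path:
 assumes x0: "x0 : mspace (path_space 0 T :: (real => 'a::euclidean_space) metric)"
 shows "(%x. mdist (path_space 0 T) x0 x) : bmeas (borel_of (mtopology_of (path_space 0 T :: (real => 'a) metric)))"
proof (rule borel_measurableI_less)
 let ?P = "path_space 0 T :: (real => 'a) metric"
 interpret PM: Metric_space "mspace ?P" "mdist ?P" by (rule Metric_space_mspace_mdist)
 fix a
 have "openin (mtopology_of ?P) (PM.mball x0 a)" unfolding mtopology_of_def by simp
 then have "PM.mball x0 a : sets (borel_of (mtopology_of ?P))"
  unfolding borel_of_def by (subst sets_measure_of) (auto dest!: openin_subset)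
 moreover have "space (borel_of (mtopology_of ?P)) = mspace ?P" by (simp add: borel_of_def space_measure_of_conv)
 moreover have "{x : mspace ?P. mdist ?P x0 x < a} = PM.mball x0 a" using x0 by auto
 ultimately show "{x : space (borel_of (mtopology_of ?P)). mdist ?P x0 x < a} : sets (borel_of (mtopology_of ?P))"
  by simp
qed

section \<open>The Wasserstein distance and the vector field\<close>

lemma W2_nonneg [simp]: "0 <= W2 m m'"
 by (simp add: W2_def)

lemma W2_le_coupling:
 assumes p: "p : couplings m m'" and le: "(NN z:p. ennreal ((dist (fst z) (snd z))^2)) <= ennreal (c^2)" and c: "0 <= c"
 shows "W2 m m' <= c"
proof -
 have "(INF p\<in>couplings m m'. (NN z:p. ennreal ((dist (fst z) (snd z))^2))) <= ennreal (c^2)"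
  using p le by (rule INF_lower2)
 then have "enn2real (INF p\<in>couplings m m'. (NN z:p. ennreal ((dist (fst z) (snd z))^2))) <= c^2"
  by (rule enn2real_leI[rotated]) simp
 then show ?thesis unfolding W2_def using c by (intro real_le_lsqrt) auto
qed

text \<open>A joint law on one sample space is a coupling; distances between flows over the same
  control distribution are bounded in this way.\<close>

lemma W2_le_distr:
 fixes Z Z' :: "'w => 'a::euclidean_space"
 assumes Z[measurable]: "Z : bmeas P" "Z' : bmeas P"
  and le: "(NN om:P. ennreal ((dist (Z om) (Z' om))^2)) <= ennreal (c^2)" and c: "0 <= c"
 shows "W2 (distr P borel Z) (distr P borel Z') <= c"
proof (rule W2_le_coupling[OF _ _ c])
 let ?p = "distr P (borel2) (%om. (Z om, Z' om))"
 show "?p : couplings (distr P borel Z) (distr P borel Z')"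
  unfolding couplings_def by (auto simp: distr_distr o_def)
 have "(NN z:?p. ennreal ((dist (fst z) (snd z))^2)) = (NN om:P. ennreal ((dist (Z om) (Z' om))^2))"
  by (subst nn_integral_distr) auto
 then show "(NN z:?p. ennreal ((dist (fst z) (snd z))^2)) <= ennreal (c^2)" using le by simp
qed

lemma W2_refl:
 assumes "sets m = sets borel"
 shows "W2 m m = 0"
proof -
 have "W2 (distr m borel (%x. x)) (distr m borel (%x. x)) <= 0"
  using assms measurable_cong_sets[OF assms refl, of borel] by (intro W2_le_distr) auto
 moreover have "distr m borel (%x. x) = m" by (rule distr_id2) (simp add: assms)
 ultimately show ?thesis using W2_nonneg[of m m] by simp
qed

lemma P2_moment:
 assumes m: "m : P2 (euclidean_metric :: 'a::euclidean_space metric)"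
 shows "(NN x:m. ennreal ((dist a x)^2)) < \<infinity>"
proof -
 obtain x0 where x0: "(NN x:m. ennreal ((dist x0 x)^2)) < \<infinity>" and s: "sets m = sets borel" and "prob_space m"
  using m by (auto simp: P2_euclidean_metric)
 interpret prob_space m by fact
 note s[measurable_cong]
 have "(NN x:m. ennreal ((dist a x)^2)) <= (NN x:m. ennreal (2 * (dist a x0)^2) + 2 * ennreal ((dist x0 x)^2))"
 proof (rule nn_integral_mono, goal_cases)
  case (1 x)
  have "(dist a x)^2 <= (dist a x0 + dist x0 x)^2" by (intro power_mono dist_triangle) simp
  also have "... <= 2 * (dist a x0)^2 + 2 * (dist x0 x)^2"
   using sum_squares_bound[of "dist a x0" "dist x0 x"] by (simp add: power2_sum)
  finally have "ennreal ((dist a x)^2) <= ennreal (2 * (dist a x0)^2 + 2 * (dist x0 x)^2)" by (rule ennreal_leI)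
  then show ?case
   by (simp add: ennreal_plus ennreal_mult)
 qed
 also have "... = ennreal (2 * (dist a x0)^2) + 2 * (NN x:m. ennreal ((dist x0 x)^2))"
  by (subst nn_integral_add) (auto simp: nn_integral_cmult emeasure_space_1)
 also have "... < \<infinity>" using x0 by (simp add: ennreal_mult_less_top)
 finally show ?thesis .
qed

text \<open>The product measure has finite cost, so the infimum in \<open>W2\<close> is finite and
  \<open>enn2real\<close> preserves it. A coupling within delta of the infimum stands in for an
  optimal one.\<close>

lemma W2_near_optimal:
 fixes m m' :: "'a::euclidean_space measure"
 assumes m: "m : P2 euclidean_metric" and m': "m' : P2 euclidean_metric" and delta: "0 < delta"
 shows "EX p:couplings m m'. (NN z:p. ennreal ((dist (fst z) (snd z))^2)) <= ennreal ((W2 m m')^2 + delta)"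
proof -
 have s: "sets m = sets borel" "sets m' = sets borel" and "prob_space m" "prob_space m'"
  using m m' by (auto simp: P2_euclidean_metric)
 interpret M: prob_space m by fact
 interpret M': prob_space m' by fact
 interpret MM: pair_prob_space m m' ..
 note s[measurable_cong]
 let ?cost = "%p. (NN z:p. ennreal ((dist (fst z) (snd z :: 'a))^2))"
 let ?I = "INF p\<in>couplings m m'. ?cost p"
 have "m *M m' : couplings m m'"
 proof -
  have "distr (m *M m') borel fst = distr (m *M m') m fst" by (rule distr_cong) (auto simp: s)
  also have "... = m" by (rule M'.distr_pair_fst)
  moreover have "distr (m *M m') borel snd = m'"
  proof (rule measure_eqI)
   fix A assume A: "A : sets (distr (m *M m') borel snd)"
   then have "emeasure (distr (m *M m') borel snd) A = emeasure (m *M m') (space m \<times> A)"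
    using sets_eq_imp_space_eq[OF s(1)] sets_eq_imp_space_eq[OF s(2)]
    by (subst emeasure_distr) (auto simp: space_pair_measure intro!: arg_cong[where f="emeasure (m *M m')"])
   then show "emeasure (distr (m *M m') borel snd) A = emeasure m' A"
    using A M'.emeasure_pair_measure_Times[OF sets.top, of A m] s M.emeasure_space_1 by simp
  qed (simp add: s)
  ultimately show ?thesis using sets_pair_measure_cong[OF s] by (simp add: couplings_def)
 qed
 moreover have "?cost (m *M m') < \<infinity>"
 proof -
  have "?cost (m *M m') <= (NN z:(m *M m'). 2 * ennreal ((dist 0 (fst z))^2) + 2 * ennreal ((dist 0 (snd z))^2))"
  proof (rule nn_integral_mono, goal_cases)
   case (1 z)
   have "(dist (fst z) (snd z))^2 <= (dist 0 (fst z) + dist 0 (snd z))^2"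
    by (intro power_mono) (metis dist_triangle3, simp)
   also have "... <= 2 * (dist 0 (fst z))^2 + 2 * (dist 0 (snd z))^2"
    using sum_squares_bound[of "dist 0 (fst z)" "dist 0 (snd z)"] by (simp add: power2_sum)
   finally have "ennreal ((dist (fst z) (snd z))^2) <= ennreal (2 * (dist 0 (fst z))^2 + 2 * (dist 0 (snd z))^2)" by (rule ennreal_leI)
   then show ?case
    by (simp add: ennreal_plus ennreal_mult)
  qed
  also have "... = 2 * (NN x:m. ennreal ((dist 0 x)^2)) + 2 * (NN x:m'. ennreal ((dist 0 x)^2))"
  proof -
   have "(NN z:(m *M m'). ennreal ((dist 0 (fst z))^2)) = (NN x:m. ennreal ((dist 0 x)^2))"
    by (subst M'.nn_integral_fst[symmetric]) (auto simp: M'.emeasure_space_1)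
   moreover have "(NN z:(m *M m'). ennreal ((dist 0 (snd z))^2)) = (NN x:m'. ennreal ((dist 0 x)^2))"
    by (subst M'.nn_integral_fst[symmetric]) (auto simp: M.emeasure_space_1)
   ultimately show ?thesis by (subst nn_integral_add) (auto simp: nn_integral_cmult)
  qed
  also have "... < \<infinity>" using P2_moment[OF m, of 0] P2_moment[OF m', of 0] by (simp add: ennreal_mult_less_top)
  finally show ?thesis .
 qed
 ultimately have fin: "?I < \<infinity>" by (auto simp: INF_less_iff)
 then have I: "?I = ennreal ((W2 m m')^2)" by (simp add: W2_def)
 have "ennreal ((W2 m m')^2) < ennreal ((W2 m m')^2 + delta)" using delta by (intro ennreal_lessI) (auto intro: add_nonneg_pos)
 then have "?I < ennreal ((W2 m m')^2 + delta)" unfolding I .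
 then show ?thesis unfolding INF_less_iff by (auto intro: less_imp_le)
qed

text \<open>Inner regularity is applied to the finite measure with density (dist c0 x)^2, so that
  the compact set captures the second moment and not only the mass.\<close>

lemma P2_on_inner_compact:
 fixes K :: "'a::euclidean_space set"
 assumes m: "m : P2_on K" and e: "0 < e"
 shows "EX C c0. compact C & C \<subseteq> K & c0 : C & (NN x:m|-C. ennreal ((dist c0 x)^2)) <= ennreal e"
proof -
 have mP: "m : P2 euclidean_metric" and aeK: "AE x in m. x : K" using m by (auto simp: P2_on_def)
 then have s: "sets m = sets borel" and "prob_space m" by (auto simp: P2_euclidean_metric)
 interpret prob_space m by fact
 note s[measurable_cong, simp]
 obtain N where N: "{x : space m. \<not> x : K} \<subseteq> N" "emeasure m N = 0" "N : sets m" using aeK by (rule AE_E)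
 have sp: "space m = UNIV" using sets_eq_imp_space_eq[OF s] by simp
 \<comment> \<open>K is not assumed to be Borel; B is a Borel subset of K that carries the whole
   mass.\<close>
 define B where "B = - N"
 have B: "B \<subseteq> K" "B : sets borel" using N by (auto simp: B_def sp s)
 have aeB: "AE x in m. x : B" using AE_not_in[of N m] N by (auto simp: B_def null_sets_def)
 have "B ~= {}"
 proof
  assume "B = {}"
  then have "N = UNIV" unfolding B_def by blast
  then show False using N(2) emeasure_space_1 sp by simp
 qed
 then obtain c0 where c0: "c0 : B" by blast
 define nu where "nu = density m (%x. ennreal ((dist c0 x)^2))"
 have snu: "sets nu = sets borel" by (simp add: nu_def)
 have fin: "emeasure nu (space nu) ~= \<infinity>"
  using P2_moment[OF mP, of c0] by (simp add: nu_def emeasure_density sp)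
 interpret N: finite_measure nu by (rule finite_measureI) (rule fin)
 have "emeasure nu B = (SUP C\<in>{C. C \<subseteq> B & compact C}. emeasure nu C)"
  by (rule inner_regular[OF snu fin B(2)])
 moreover have "emeasure nu B < emeasure nu B + ennreal e" using e by (simp add: N.emeasure_eq_measure ennreal_less_iff flip: ennreal_plus)
 ultimately have "EX C:{C. C \<subseteq> B & compact C}. emeasure nu B < emeasure nu C + ennreal e"
  by (intro SUP_approx_ennreal) (use e in auto)
 then obtain C where C: "C \<subseteq> B" "compact C" "emeasure nu B < emeasure nu C + ennreal e" by blast
 \<comment> \<open>With c0 added, the compact set contains the point to which the remaining mass
   will be sent.\<close>
 let ?C = "insert c0 C"
 have cC: "?C : sets borel" using C(2) by (simp add: borel_closed compact_imp_closed closed_insert)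
 have "(NN x:m|-?C. ennreal ((dist c0 x)^2)) = emeasure nu (-?C)"
  unfolding nu_def using cC by (subst emeasure_density) auto
 also have "... = emeasure nu (B - ?C)"
 proof (rule emeasure_eq_AE)
  have "AE x in nu. x : B" unfolding nu_def using aeB by (subst AE_density) auto
  then show "AE x in nu. x : - ?C \<longleftrightarrow> x : B - ?C" by eventually_elim auto
 qed (use cC B in \<open>auto simp: snu\<close>)
 also have "... <= emeasure nu (B - C)" using C(2) B by (intro emeasure_mono) (auto simp: snu borel_closed compact_imp_closed)
 also have "... = emeasure nu B - emeasure nu C"
  using C B by (intro emeasure_Diff) (auto simp: snu borel_closed compact_imp_closed)
 also have "... <= ennreal e" using C(3) by (simp add: ennreal_minus_le_iff add.commute less_imp_le)
 finally show ?thesis using C c0 B by (intro exI[of _ ?C] exI[of _ c0]) auto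
qed

section \<open>Extending the bounds on the field from K to the whole space\<close>

context
 fixes T :: real and f :: "real => 'a::euclidean_space => 'a measure => 'u::metric_space => 'a" and K :: "'a set"
 assumes cs: "control_system T f K"
begin

lemma field_continuous:
 assumes "t : {0..T}" "m : P2 euclidean_metric" "0 < e"
 shows "EX delta>0. ALL t':{0..T}. ALL x'. ALL m':P2 euclidean_metric. ALL u'.
  dist t' t < delta & dist x' x < delta & W2 m' m < delta & dist u' u < delta --> dist (f t' x' m' u') (f t x m u) < e"
 using cs assms unfolding control_system_def by blast

lemma field_continuous_space:
 assumes t: "t : {0..T}" and m: "m : P2 euclidean_metric"
 shows "continuous_on UNIV (%x. f t x m u)"
 unfolding continuous_on_iff
proof (intro ballI allI impI)
 fix x :: 'a and e :: real assume "0 < e"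
 from field_continuous[OF t m this, of x u] obtain delta where delta: "delta > 0" "ALL t':{0..T}. ALL x'. ALL m':P2 euclidean_metric. ALL u'.
  dist t' t < delta & dist x' x < delta & W2 m' m < delta & dist u' u < delta --> dist (f t' x' m' u') (f t x m u) < e" by blast
 have "W2 m m = 0" using m by (intro W2_refl) (simp add: P2_euclidean_metric)
 then show "EX d>0. ALL x':UNIV. dist x' x < d --> dist (f t x' m u) (f t x m u) < e"
  using delta t m by (intro exI[of _ delta]) auto
qed

text \<open>The vanishing condition on f is about measures with support in K, whereas
  \<open>P2_on K\<close> asks for almost sure concentration and K need not be closed. Sending the
  mass outside a compact subset of K to one of its points gives a W2-close measure with support in
  K, and continuity of f transfers the zero.\<close>

lemma field_zero_off:
 assumes t: "t : {0..T}" and m: "m : P2_on K" and z: "z \<notin> K"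
 shows "f t z m u = 0"
proof (rule ccontr)
 assume n0: "f t z m u ~= 0"
 have mP: "m : P2 euclidean_metric" using m by (simp add: P2_on_def)
 then have s: "sets m = sets borel" and "prob_space m" by (auto simp: P2_euclidean_metric)
 interpret prob_space m by fact
 note s[measurable_cong]
 have e: "0 < norm (f t z m u)" using n0 by simp
 from field_continuous[OF t mP e, of z u] obtain delta where delta: "delta > 0" "ALL t':{0..T}. ALL x'. ALL m':P2 euclidean_metric. ALL u'.
  dist t' t < delta & dist x' z < delta & W2 m' m < delta & dist u' u < delta --> dist (f t' x' m' u') (f t z m u) < norm (f t z m u)" by blast
 have "0 < (delta/2)^2" using delta by simp
 from P2_on_inner_compact[OF m this] obtain C c0 where C: "compact C" "C \<subseteq> K" "c0 : C"
  "(NN x:m|-C. ennreal ((dist c0 x)^2)) <= ennreal ((delta/2)^2)" by blast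
 have [measurable]: "C : sets borel" using C(1) by (simp add: borel_closed compact_imp_closed)
 define Z where "Z x = (if x : C then x else c0)" for x
 have Zm[measurable]: "Z : bmeas m" unfolding Z_def by measurable
 have idm: "(%x. x) : bmeas m" by measurable
 define m' where "m' = distr m borel Z"
 have ZC: "Z x : C" for x using C by (auto simp: Z_def)
 have "msupport m' \<subseteq> K"
 proof
  fix x assume x: "x : msupport m'"
  show "x : K"
  proof (rule ccontr)
   assume "x \<notin> K"
   then have "x : - C" "open (- C)" using C by (auto simp: compact_imp_closed)
   then have "emeasure m' (- C) > 0" using x by (auto simp: msupport_def)
   moreover have "emeasure m' (- C) = emeasure m (Z -` (- C) \<inter> space m)"
    unfolding m'_def by (rule emeasure_distr) auto
   moreover have "Z -` (- C) = {}" using ZC by auto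
   ultimately show False by simp
  qed
 qed
 moreover have m'P: "m' : P2 euclidean_metric"
 proof -
  have "(NN x:m'. ennreal ((dist c0 x)^2)) = (NN x:m. ennreal ((dist c0 (Z x))^2))"
   unfolding m'_def by (subst nn_integral_distr) auto
  also have "... <= (NN x:m. ennreal ((dist c0 x)^2))"
   by (intro nn_integral_mono ennreal_leI) (auto simp: Z_def)
  also have "... < \<infinity>" by (rule P2_moment[OF mP])
  finally show ?thesis unfolding P2_euclidean_metric m'_def by (auto intro: prob_space_distr)
 qed
 ultimately have f0: "f t z m' u = 0" using cs t z unfolding control_system_def by blast
 have "W2 (distr m borel Z) (distr m borel (%x. x)) <= delta/2"
 proof (rule W2_le_distr[OF Zm idm])
  have "(NN x:m. ennreal ((dist (Z x) x)^2)) = (NN x:m|-C. ennreal ((dist c0 x)^2))"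
   by (intro nn_integral_cong) (auto simp: Z_def split: split_indicator)
  then show "(NN x:m. ennreal ((dist (Z x) x)^2)) <= ennreal ((delta/2)^2)" using C(4) by simp
 qed (use delta in simp)
 moreover have "distr m borel (%x. x) = m" by (rule distr_id2) (simp add: s)
 ultimately have "W2 m' m < delta" using delta by (simp add: m'_def)
 then have "dist (f t z m' u) (f t z m u) < norm (f t z m u)" using delta t m'P by auto
 then show False using f0 by simp
qed

lemma field_zero_closure:
 assumes t: "t : {0..T}" and m: "m : P2_on K" and z: "z : closure (- K)"
 shows "f t z m u = 0"
proof -
 have mP: "m : P2 euclidean_metric" using m by (simp add: P2_on_def)
 have "closed {x. f t x m u = 0}"
  using continuous_closed_vimage[of "{0}" "%x. f t x m u"] field_continuous_space[OF t mP, of u]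
  by (simp add: continuous_on_eq_continuous_at vimage_def)
 moreover have "- K \<subseteq> {x. f t x m u = 0}" using field_zero_off[OF t m] by auto
 ultimately have "closure (- K) \<subseteq> {x. f t x m u = 0}" by (rule closure_minimal[rotated])
 then show ?thesis using z by auto
qed

text \<open>Off K the field is zero, so only pairs with x in K and x' outside need an argument. The
  segment between them meets the frontier of K in some z; f vanishes at z by continuity, the
  Lipschitz estimate from x reaches z through the closure of K, and z is no farther from x than x'
  is.\<close>

lemma field_constants:
 obtains L R where "0 < L" "0 < R"
  "!!t x m u. t : {0..T} ==> m : P2_on K ==> norm (f t x m u) <= R"
  "!!t x x' m m' u. t : {0..T} ==> m : P2_on K ==> m' : P2_on K ==>
   norm (f t x m u - f t x' m' u) <= L * (norm (x - x') + W2 m m')"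
proof -
 have "EX R. ALL t:{0..T}. ALL x:K. ALL m:P2_on K. ALL u. norm (f t x m u) <= R"
  using cs unfolding control_system_def by (elim conjE)
 then obtain R0 where R0: "!!t x m u. t : {0..T} ==> x : K ==> m : P2_on K ==> norm (f t x m u) <= R0"
  by blast
 have "EX Cf. ALL t:{0..T}. ALL x:K. ALL x':K. ALL m:P2_on K. ALL m':P2_on K. ALL u.
    norm (f t x m u - f t x' m' u) <= Cf * (norm (x - x') + W2 m m')"
  using cs unfolding control_system_def by (elim conjE)
 then obtain L0 where L0: "!!t x x' m m' u. t : {0..T} ==> x : K ==> x' : K ==> m : P2_on K ==> m' : P2_on K ==>
   norm (f t x m u - f t x' m' u) <= L0 * (norm (x - x') + W2 m m')"
  by blast
 \<comment> \<open>The maximum with 1 makes both constants positive; \<open>control_system\<close>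
   does not fix their signs.\<close>
 define R where "R = max 1 R0"
 define L where "L = max 1 L0"
 have R: "norm (f t x m u) <= R" if "t : {0..T}" "m : P2_on K" for t x m u
  using R0[OF that(1) _ that(2), of x u] field_zero_off[OF that, of x u] by (cases "x : K") (auto simp: R_def)
 have L1: "norm (f t x m u - f t x' m' u) <= L * (norm (x - x') + W2 m m')"
  if "t : {0..T}" "x : K" "x' : K" "m : P2_on K" "m' : P2_on K" for t x x' m m' u
 proof -
  have "L0 * (norm (x - x') + W2 m m') <= L * (norm (x - x') + W2 m m')"
   by (intro mult_right_mono) (auto simp: L_def)
  then show ?thesis using L0[OF that, of u] by linarith
 qed
 have Lx: "norm (f t x m u) <= L * norm (x - x')" if t: "t : {0..T}" and m: "m : P2_on K" and x: "x : K" and x': "x' \<notin> K" for t x x' m u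
 proof -
  have mP: "m : P2 euclidean_metric" using m by (simp add: P2_on_def)
  have W0: "W2 m m = 0" using mP by (intro W2_refl) (simp add: P2_euclidean_metric)
  have "closed_segment x x' \<inter> frontier K ~= {}"
   using x x' by (intro connected_Int_frontier) (auto intro!: exI[of _ x] exI[of _ x'])
  then obtain z where z: "z : closed_segment x x'" "z : closure K" "z : closure (- K)"
   by (auto simp: frontier_closures)
  have fz: "f t z m u = 0" by (rule field_zero_closure[OF t m z(3)])
  have "closed {y. norm (f t x m u - f t y m u) <= L * norm (x - y)}"
   by (intro closed_Collect_le continuous_intros field_continuous_space[OF t mP])
  moreover have "K \<subseteq> {y. norm (f t x m u - f t y m u) <= L * norm (x - y)}"
   using L1[OF t x _ m m] W0 by auto
  ultimately have "closure K \<subseteq> {y. norm (f t x m u - f t y m u) <= L * norm (x - y)}" by (rule closure_minimal[rotated])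
  then have "norm (f t x m u - f t z m u) <= L * norm (x - z)" using z(2) by auto
  also have "norm (x - z) <= norm (x - x')"
   using dist_in_closed_segment[OF z(1)] by (simp add: dist_norm norm_minus_commute)
  finally show ?thesis using fz by (simp add: L_def mult_left_mono)
 qed
 have L2: "norm (f t x m u - f t x' m' u) <= L * (norm (x - x') + W2 m m')"
  if t: "t : {0..T}" and m: "m : P2_on K" and m': "m' : P2_on K" for t x x' m m' u
 proof -
  have LW: "L * norm (x - x') <= L * (norm (x - x') + W2 m m')" by (intro mult_left_mono) (auto simp: L_def)
  consider "x : K" "x' : K" | "x : K" "x' \<notin> K" | "x \<notin> K" "x' : K" | "x \<notin> K" "x' \<notin> K" by blast
  then show ?thesis
  proof cases
   case 1 then show ?thesis by (rule L1[OF t _ _ m m'])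
  next
   case 2
   then show ?thesis using Lx[OF t m 2, of u] field_zero_off[OF t m' 2(2), of u] LW by simp
  next
   case 3
   then show ?thesis using Lx[OF t m' 3(2,1), of u] field_zero_off[OF t m 3(1), of u] LW by (simp add: norm_minus_commute)
  next
   case 4
   have "0 <= L * (norm (x - x') + W2 m m')" by (auto simp: L_def)
   then show ?thesis using field_zero_off[OF t m 4(1), of u] field_zero_off[OF t m' 4(2), of u] by simp
  qed
 qed
 show ?thesis by (rule that[of L R]) (use R L2 in \<open>auto simp: L_def R_def\<close>)
qed

end

section \<open>Motions of the deterministic system\<close>

definition flow_field :: "real => (real => 'a::euclidean_space => 'a measure => 'u::metric_space => 'a) => (real => 'a measure) => (real * 'a) * 'u => 'a" where
 "flow_field T f m z = f (clamp_time T (fst (fst z))) (snd (fst z)) (m (clamp_time T (fst (fst z)))) (snd z)"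

definition W2_continuous :: "real => (real => 'a::euclidean_space measure) => bool" where
 "W2_continuous T m \<longleftrightarrow> (ALL t:{0..T}. ALL e>0. EX delta>0. ALL t':{0..T}. \<bar>t' - t\<bar> < delta --> W2 (m t') (m t) < e)"

lemma flow_field_regular:
 assumes cs: "control_system T f K" and T: "0 < T"
  and P: "!!t. t : {0..T} ==> m t : P2 euclidean_metric" and W: "W2_continuous T m"
  and R: "!!t x u. t : {0..T} ==> norm (f t x (m t) u) <= R"
  and L: "!!t x x' u. t : {0..T} ==> norm (f t x (m t) u - f t x' (m t) u) <= L * norm (x - x')"
 shows "regular_field L R (flow_field T f m)"
proof -
 have c: "clamp_time T t : {0..T}" for t using T by (intro clamp_time_in) simp
 have "continuous_on UNIV (flow_field T f m)"
  unfolding continuous_on_iff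
 proof (intro ballI allI impI)
  fix z :: "(real * 'a) \<times> 'b" and e :: real assume e: "0 < e"
  let ?t = "clamp_time T (fst (fst z))"
  from field_continuous[OF cs c[of "fst (fst z)"] P[OF c[of "fst (fst z)"]] e, where x="snd (fst z)" and u="snd z"]
  obtain delta where delta: "delta > 0" "ALL t':{0..T}. ALL x'. ALL m':P2 euclidean_metric. ALL u'.
   dist t' ?t < delta & dist x' (snd (fst z)) < delta & W2 m' (m ?t) < delta & dist u' (snd z) < delta -->
   dist (f t' x' m' u') (f ?t (snd (fst z)) (m ?t) (snd z)) < e" by blast
  obtain delta' where delta': "delta' > 0" "ALL t':{0..T}. \<bar>t' - ?t\<bar> < delta' --> W2 (m t') (m ?t) < delta"
   using W c[of "fst (fst z)"] delta(1) unfolding W2_continuous_def by blast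
  show "EX d>0. ALL z':UNIV. dist z' z < d --> dist (flow_field T f m z') (flow_field T f m z) < e"
  proof (intro exI[of _ "min delta delta'"] conjI ballI impI)
   fix z' assume z': "dist z' z < min delta delta'"
   have "dist (fst z') (fst z) <= dist z' z" "dist (snd z') (snd z) <= dist z' z" by (rule dist_fst_le dist_snd_le)+
   moreover have "dist (fst (fst z')) (fst (fst z)) <= dist (fst z') (fst z)" "dist (snd (fst z')) (snd (fst z)) <= dist (fst z') (fst z)"
    by (rule dist_fst_le dist_snd_le)+
   moreover have "dist (clamp_time T (fst (fst z'))) ?t <= dist (fst (fst z')) (fst (fst z))"
    by (auto simp: clamp_time_def dist_real_def)
   ultimately show "dist (flow_field T f m z') (flow_field T f m z) < e"
    unfolding flow_field_def using delta(2) delta'(2) c[of "fst (fst z')"] P[OF c] z' by (auto simp: dist_real_def)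
  qed (use delta delta' in auto)
 qed
 moreover have "norm (flow_field T f m z) <= R" for z unfolding flow_field_def using R[OF c] .
 moreover have "norm (flow_field T f m ((t, x), u) - flow_field T f m ((t, x'), u)) <= L * norm (x - x')" for t x x' u
  unfolding flow_field_def using L[OF c] by simp
 ultimately show ?thesis unfolding regular_field_def by blast
qed

lemma flow_field_eq: "tau : {0..T} ==> f tau x (m tau) u = flow_field T f m ((tau, x), u)"
 by (simp add: flow_field_def)

text \<open>Gronwall's inequality in the reversed time t1 - s: a solution that reaches a rest point
  has been there from the start. This backward uniqueness keeps agents from leaving K.\<close>

lemma stationary_backward:
 fixes g :: "(real * 'a::euclidean_space) * 'u::metric_space => 'a"
 assumes cpt: "compact (UNIV :: 'u set)" and T: "0 < T" and rf: "regular_field L R g" and L: "0 < L"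
  and xi: "xi : relaxed_controls 0 T" and t1: "t1 : {0..T}" and z: "solution T g y xi t1 = z"
  and g0: "!!tau u. tau : {0..T} ==> g ((tau, z), u) = 0"
 shows "y = z"
proof -
 let ?x = "solution T g y xi" and ?F = "along g (solution T g y xi)"
 note xm = solution_measurable_time[OF cpt T rf L xi, of y]
 note am = along_measurable[OF cpt rf xm]
 note eq = solution_eq[OF cpt T rf L xi]
 have R0: "0 <= R" by (rule order_trans[OF norm_ge_zero along_bound[OF rf]])
 have "norm (?x (t1 - s) - z) <= 0 * exp (L * (s - 0))" if s: "s : {0..t1}" for s
 proof (rule gronwall[where M="R * T" and r=t1 and u="%s. norm (?x (t1 - s) - z)" and L=L and a=0])
  fix s assume s: "s : {0..t1}"
  have st: "t1 - s : {0..T}" using s t1 by auto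
  have "norm (?x t1 - ?x (t1 - s)) <= R * \<bar>t1 - (t1 - s)\<bar>"
   by (rule solution_lipschitz[OF cpt T rf L xi st t1])
  also have "... <= R * T" using s t1 R0 by (intro mult_left_mono) auto
  finally show "norm (?x (t1 - s) - z) <= R * T" using z by (simp add: norm_minus_commute)
  define F' where "F' w = ind {0..t1 - s} (fst w) *\<^sub>R ?F w" for w
  have F'm: "F' : bmeas (borel2)" unfolding F'_def using am by measurable
  have "(%w. ind {0..t1 - s} (fst w) *\<^sub>R ?F w) = (%w. ind {0..t1} (fst w) *\<^sub>R F' w)"
   using s by (auto simp: F'_def indicator_def fun_eq_iff)
  then have e: "cint T xi ?F (t1 - s) = cint T xi F' t1"
   unfolding cint_def by simp
  have "ennreal (norm (cint T xi ?F t1 - cint T xi F' t1)) <=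
   (NN tau:lborel|{0..t1}. ennreal (ind {t1 - s..t1} tau * (L * norm (?x tau - z))))"
  proof (rule control_integral_diff[OF xi T am F'm along_bound[OF rf] _ _ _ t1])
   show "norm (F' w) <= R" for w using along_bound[OF rf] R0 by (auto simp: F'_def split: split_indicator)
   show "(%tau. ind {t1 - s..t1} tau * (L * norm (?x tau - z))) : bmeas borel" using xm by measurable
   fix tau and u :: 'u assume tau: "tau : {0..t1}"
   have "norm (?F (tau, u)) = norm (g ((tau, ?x tau), u) - g ((tau, z), u))" using g0[of tau u] tau t1 by (simp add: along_def)
   also have "... <= L * norm (?x tau - z)" using rf unfolding regular_field_def by blast
   finally show "norm (?F (tau, u) - F' (tau, u)) <= ind {t1 - s..t1} tau * (L * norm (?x tau - z))"
    using tau L by (auto simp: F'_def split: split_indicator)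
  qed
  also have "... = (NN tau:lborel. ennreal (L * norm (?x tau - z)) * ind {t1 - s..t1} tau)"
   using s by (intro nn_integral_cong) (auto split: split_indicator)
  also have "... = (NN tau:lborel. ennreal (L * norm (?x (t1 + -1 * tau) - z)) * ind {t1 - s..t1} (t1 + -1 * tau))"
   using nn_integral_real_affine[of "%tau. ennreal (L * norm (?x tau - z)) * ind {t1 - s..t1} tau" "-1" t1] xm by simp
  also have "... = (NN tau:lborel|{0..s}. ennreal (L * norm (?x (t1 - tau) - z)))"
   by (intro nn_integral_cong) (auto split: split_indicator)
  finally show "ennreal (norm (?x (t1 - s) - z)) <= ennreal 0 + (NN tau:lborel|{0..s}. ennreal (L * norm (?x (t1 - tau) - z)))"
   unfolding e[symmetric] using eq[OF t1, of y] eq[OF st, of y] z by (simp add: norm_minus_commute)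
 qed (use s L in auto)
 from this[of t1] have "?x 0 = z" using t1 by simp
 moreover have "?x 0 = y"
  using eq[where t=0 and y=y] T control_integral_0[OF xi T am along_bound[OF rf]] by simp
 ultimately show ?thesis by simp
qed

lemma stationary_forward:
 fixes g :: "(real * 'a::euclidean_space) * 'u::metric_space => 'a"
 assumes cpt: "compact (UNIV :: 'u set)" and T: "0 < T" and rf: "regular_field L R g" and L: "0 < L"
  and xi: "xi : relaxed_controls 0 T" and t: "t : {0..T}"
  and g0: "!!tau u. tau : {0..T} ==> g ((tau, y), u) = 0"
 shows "solution T g y xi t = y"
proof -
 have "cint T xi (along g (%_. y)) t = 0" if t: "t : {0..T}" for t
 proof -
  have "cint T xi (along g (%_. y)) t = cint T xi (%_. 0) t"
   by (rule control_integral_cong[OF xi]) (use t g0 in \<open>auto simp: along_def\<close>)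
  then show ?thesis by (simp add: cint_def)
 qed
 then show ?thesis
  by (intro ode_unique[OF cpt T rf L xi solution_measurable_time[OF cpt T rf L xi] _ solution_eq[OF cpt T rf L xi] _ t]) auto
qed

lemma solution_initial:
 fixes g :: "(real * 'a::euclidean_space) * 'u::metric_space => 'a"
 assumes cpt: "compact (UNIV :: 'u set)" and T: "0 < T" and rf: "regular_field L R g" and L: "0 < L"
  and xi: "xi : relaxed_controls 0 T"
 shows "solution T g y xi 0 = y"
proof -
 have "cint T xi (along g (solution T g y xi)) 0 = 0"
  by (rule control_integral_0[OF xi T along_measurable[OF cpt rf solution_measurable_time[OF cpt T rf L xi]] along_bound[OF rf]])
 then show ?thesis using solution_eq[OF cpt T rf L xi, where t=0 and y=y] T by simp
qed

section \<open>Laws of solutions under a distribution of controls\<close>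

lemma distribution_props:
 fixes alpha :: "('a::euclidean_space * (real * 'u::metric_space) measure) measure"
 assumes m0: "m0 : P2 euclidean_metric" and alpha: "alpha : control_distributions 0 T m0"
 shows "sets alpha = sets (borel *M relaxed_space 0 T)" "prob_space alpha" "distr alpha borel fst = m0"
  "p : space alpha ==> snd p : relaxed_controls 0 T" "fst : bmeas alpha"
proof -
 have s0: "sets m0 = sets borel" and p0: "prob_space m0" using m0 by (auto simp: P2_euclidean_metric)
 have s: "sets alpha = sets (m0 *M relaxed_space 0 T)" and d: "distr alpha m0 fst = m0"
  using alpha by (auto simp: control_distributions_def Lam_def)
 show s': "sets alpha = sets (borel *M relaxed_space 0 T)" using s sets_pair_measure_cong[OF s0 refl] by simp
 show fm: "fst : bmeas alpha" using measurable_cong_sets[OF s' refl] measurable_fst by blast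
 show d': "distr alpha borel fst = m0" using d distr_cong[OF refl s0, of alpha fst fst] by simp
 show "prob_space alpha" using p0 fm unfolding d'[symmetric] by (rule prob_space_distrD[rotated])
 assume "p : space alpha"
 then show "snd p : relaxed_controls 0 T"
 proof -
  assume "p : space alpha"
  moreover have "space alpha = UNIV \<times> relaxed_controls 0 T"
   using sets_eq_imp_space_eq[OF s'] by (simp add: space_pair_measure space_relaxed_space)
  ultimately show ?thesis by (simp add: mem_Times_iff)
 qed
qed

lemma nn_integral_initial:
 fixes m0 :: "'a::euclidean_space measure"
 assumes m0: "m0 : P2 euclidean_metric" and alpha: "alpha : control_distributions 0 T m0" and [measurable]: "h : bmeas borel"
 shows "(NN p:alpha. h (fst p)) = (NN y:m0. h y)"
proof -
 note pr = distribution_props[OF m0 alpha]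
 have "(NN p:alpha. h (fst p)) = (NN y:(distr alpha borel fst). h y)" by (rule nn_integral_distr[OF pr(5), symmetric]) simp
 then show ?thesis by (simp add: pr(3))
qed

lemma displaced_law_P2:
 fixes m0 :: "'a::euclidean_space measure" and X :: "'a * (real * 'u::metric_space) measure => 'a"
 assumes m0: "m0 : P2 euclidean_metric" and alpha: "alpha : control_distributions 0 T m0" and X: "X : bmeas alpha"
  and d: "!!p. p : space alpha ==> norm (X p - fst p) <= C"
 shows "distr alpha borel X : P2 euclidean_metric"
proof -
 note pr = distribution_props[OF m0 alpha]
 interpret A: prob_space alpha by (rule pr(2))
 have "(NN x:(distr alpha borel X). ennreal ((dist 0 x)^2)) = (NN p:alpha. ennreal ((dist 0 (X p))^2))"
  by (rule nn_integral_distr[OF X]) simp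
 also have "... <= (NN p:alpha. (2 * ennreal ((dist 0 (fst p))^2) + ennreal (2 * C^2)))"
 proof (rule nn_integral_mono, goal_cases)
  case p: (1 p)
  have "dist 0 (X p) <= dist 0 (fst p) + C"
   using d[OF p] dist_triangle[of 0 "X p" "fst p"] by (simp add: dist_norm norm_minus_commute)
  then have "(dist 0 (X p))^2 <= (dist 0 (fst p) + C)^2" by (intro power_mono) auto
  also have "... <= 2 * (dist 0 (fst p))^2 + 2 * C^2"
   using sum_squares_bound[of "dist 0 (fst p)" C] by (simp add: power2_sum)
  finally have "ennreal ((dist 0 (X p))^2) <= ennreal (2 * (dist 0 (fst p))^2 + 2 * C^2)" by (rule ennreal_leI)
  then show ?case
   by (simp add: ennreal_plus ennreal_mult)
 qed
 also have "... = 2 * (NN p:alpha. ennreal ((dist 0 (fst p))^2)) + ennreal (2 * C^2)"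
  using pr(5) by (subst nn_integral_add) (auto simp: nn_integral_cmult A.emeasure_space_1)
 also have "(NN p:alpha. ennreal ((dist 0 (fst p))^2)) = (NN y:m0. ennreal ((dist 0 y)^2))"
  by (rule nn_integral_initial[OF m0 alpha]) simp
 also have "2 * ... + ennreal (2 * C^2) < \<infinity>"
  using P2_moment[OF m0, of 0] by (simp add: ennreal_mult_less_top)
 finally show ?thesis unfolding P2_euclidean_metric
  using A.prob_space_distr[OF X] by (intro conjI exI[of _ 0]) simp_all
qed

lemma lipschitz_law_W2_continuous:
 fixes m0 :: "'a::euclidean_space measure" and X :: "real => 'a * (real * 'u::metric_space) measure => 'a"
 assumes m0: "m0 : P2 euclidean_metric" and alpha: "alpha : control_distributions 0 T m0" and X: "!!t. X t : bmeas alpha"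
  and lip: "!!p s t. p : space alpha ==> s : {0..T} ==> t : {0..T} ==> dist (X s p) (X t p) <= R * \<bar>s - t\<bar>"
  and R: "0 <= R" and m: "!!t. t : {0..T} ==> m t = distr alpha borel (X t)"
 shows "W2_continuous T m"
 unfolding W2_continuous_def
proof (intro ballI allI impI)
 interpret A: prob_space alpha by (rule distribution_props(2)[OF m0 alpha])
 fix t and e :: real assume t: "t : {0..T}" and e: "0 < e"
 have b: "W2 (m t') (m t) <= R * \<bar>t' - t\<bar>" if t': "t' : {0..T}" for t'
  unfolding m[OF t] m[OF t']
 proof (rule W2_le_distr[OF X X])
  have "(NN p:alpha. ennreal ((dist (X t' p) (X t p))^2)) <= (NN p:alpha. ennreal ((R * \<bar>t' - t\<bar>)^2))"
   using lip t t' by (intro nn_integral_mono ennreal_leI power_mono) auto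
  then show "(NN p:alpha. ennreal ((dist (X t' p) (X t p))^2)) <= ennreal ((R * \<bar>t' - t\<bar>)^2)"
   by (simp add: A.emeasure_space_1)
 qed (use R in simp)
 have "W2 (m t') (m t) < e" if t': "t' : {0..T}" and d: "\<bar>t' - t\<bar> < e / (R + 1)" for t'
 proof -
  have "R * \<bar>t' - t\<bar> <= R * (e / (R + 1))" using d R by (intro mult_left_mono) auto
  also have "... < e" using e R by (simp add: field_simps)
  finally show ?thesis using b[OF t'] by linarith
 qed
 then show "EX delta>0. ALL t':{0..T}. \<bar>t' - t\<bar> < delta --> W2 (m t') (m t) < e"
  using e R by (intro exI[of _ "e / (R + 1)"]) (auto intro!: divide_pos_pos)
qed

context
 fixes T :: real and L R :: real and g :: "(real * 'a::euclidean_space) * 'u::metric_space => 'a" and m0 :: "'a measure"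
  and alpha :: "('a * (real * 'u) measure) measure"
 assumes cpt: "compact (UNIV :: 'u set)" and T: "0 < T" and rf: "regular_field L R g" and L: "0 < L"
  and m0: "m0 : P2 euclidean_metric" and alpha: "alpha : control_distributions 0 T m0"
begin

lemma solution_measurable_dist: "(%p. solution T g (fst p) (snd p) t) : bmeas alpha"
 unfolding measurable_cong_sets[OF distribution_props(1)[OF m0 alpha] refl]
 by (rule solution_measurable[OF cpt T rf L])

lemma field_bound_nonneg: "0 <= R"
 by (rule order_trans[OF norm_ge_zero along_bound[OF rf]])

lemma solution_displacement:
 assumes p: "p : space alpha" and t: "t : {0..T}"
 shows "norm (solution T g (fst p) (snd p) t - fst p) <= R * T"
proof -
 note xi = distribution_props(4)[OF m0 alpha p]
 have "norm (solution T g (fst p) (snd p) t - solution T g (fst p) (snd p) 0) <= R * \<bar>t - 0\<bar>"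
  using T t by (intro solution_lipschitz[OF cpt T rf L xi]) auto
 also have "... <= R * T" using t field_bound_nonneg by (intro mult_left_mono) auto
 finally show ?thesis by (simp add: solution_initial[OF cpt T rf L xi])
qed

lemma law_P2:
 assumes t: "t : {0..T}"
 shows "distr alpha borel (%p. solution T g (fst p) (snd p) t) : P2 euclidean_metric"
 by (rule displaced_law_P2[OF m0 alpha solution_measurable_dist]) (rule solution_displacement[OF _ t])

lemma law_W2_continuous:
 assumes m: "!!t. t : {0..T} ==> m t = distr alpha borel (%p. solution T g (fst p) (snd p) t)"
 shows "W2_continuous T m"
proof (rule lipschitz_law_W2_continuous[OF m0 alpha solution_measurable_dist _ field_bound_nonneg m])
 fix p s t assume p: "p : space alpha" and s: "s : {0..T}" and t: "t : {0..T}"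
 show "dist (solution T g (fst p) (snd p) s) (solution T g (fst p) (snd p) t) <= R * \<bar>s - t\<bar>"
  unfolding dist_norm by (rule solution_lipschitz[OF cpt T rf L distribution_props(4)[OF m0 alpha p] t s])
qed

text \<open>By continuity the field vanishes on the closure of the complement of K. Agents starting
  there rest, and agents starting in the interior of K never arrive there, by
  \<open>stationary_backward\<close>.\<close>

lemma law_P2_on:
 assumes m0K: "m0 : P2_on K" and t: "t : {0..T}"
  and g0: "!!tau z u. tau : {0..T} ==> z \<notin> K ==> g ((tau, z), u) = 0"
 shows "distr alpha borel (%p. solution T g (fst p) (snd p) t) : P2_on K"
proof -
 note pr = distribution_props[OF m0 alpha]
 interpret A: prob_space alpha by (rule pr(2))
 let ?X = "%p. solution T g (fst p) (snd p) t"
 have gz: "g ((tau, z), u) = 0" if tau: "tau : {0..T}" and z: "z : closure (- K)" for tau z u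
 proof -
  have "continuous_on UNIV (%x. g ((tau, x), u))"
   using rf unfolding regular_field_def by (auto intro!: continuous_on_compose2[of UNIV g] continuous_intros)
  then have "closed {x. g ((tau, x), u) = 0}"
   using continuous_closed_vimage[of "{0}" "%x. g ((tau, x), u)"] by (simp add: continuous_on_eq_continuous_at vimage_def)
  then have "closure (- K) \<subseteq> {x. g ((tau, x), u) = 0}" using g0[OF tau] by (intro closure_minimal) auto
  then show ?thesis using z by auto
 qed
 have sm0: "sets m0 = sets borel" using m0 by (simp add: P2_euclidean_metric)
 have spm0: "space m0 = UNIV" using sets_eq_imp_space_eq[OF sm0] by simp
 have "AE x in m0. x : K" using m0K by (simp add: P2_on_def)
 then obtain N where N: "{x : space m0. \<not> x : K} \<subseteq> N" "emeasure m0 N = 0" "N : sets m0" by (rule AE_E)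
 \<comment> \<open>A Borel subset of K that contains almost every starting point and is never left;
   K itself may fail to be measurable.\<close>
 define S where "S = interior K \<union> - N"
 have SK: "S \<subseteq> K" using N(1) interior_subset by (auto simp: S_def spm0)
 have Sm: "S : sets borel" using N(3) unfolding S_def by (auto simp: sm0 intro!: sets.Un borel_open)
 have "AE x in m0. x : - N" using AE_not_in[of N m0] N by (auto simp: null_sets_def)
 then have "AE p in alpha. fst p : - N" unfolding pr(3)[symmetric] by (rule AE_distrD[OF pr(5)])
 moreover have "AE p in alpha. p : space alpha" by (rule AE_space)
 ultimately have "AE p in alpha. ?X p : S"
 proof eventually_elim
  case (elim p)
  note xi = pr(4)[OF elim(2)]
  show ?case
  proof (cases "fst p : closure (- K)")
   case True
   have "?X p = fst p" by (rule stationary_forward[OF cpt T rf L xi t]) (rule gz[OF _ True])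
   then show ?thesis using elim by (simp add: S_def)
  next
   case False
   have "?X p \<notin> closure (- K)"
   proof
    assume c: "?X p : closure (- K)"
    have "fst p = ?X p" by (rule stationary_backward[OF cpt T rf L xi t refl]) (rule gz[OF _ c])
    then show False using c False by simp
   qed
   then show ?thesis by (simp add: S_def interior_closure)
  qed
 qed
 then have "AE x in distr alpha borel ?X. x : S" using Sm by (subst AE_distr_iff[OF solution_measurable_dist]) auto
 then have "AE x in distr alpha borel ?X. x : K" by eventually_elim (use SK in auto)
 then show ?thesis using law_P2[OF t] by (simp add: P2_on_def)
qed

text \<open>Solutions share the Lipschitz constant R, so \<open>measurable_path\<close> applies; the
  distance of a solution from the zero path is at most the norm of its starting point plus R T,
  which gives the second moment.\<close>

lemma path_law:
 assumes fg: "!!tau x u. tau : {0..T} ==> f tau x (m tau) u = g ((tau, x), u)"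
 shows "(%(y, xi). traj f 0 T m y xi) : alpha ->M borel_of (mtopology_of (path_space 0 T))"
  and "distr alpha (borel_of (mtopology_of (path_space 0 T))) (%(y, xi). traj f 0 T m y xi) : P2 (path_space 0 T)"
  and "t : {0..T} ==> distr (distr alpha (borel_of (mtopology_of (path_space 0 T))) (%(y, xi). traj f 0 T m y xi)) borel (%x. x t)
   = distr alpha borel (%p. solution T g (fst p) (snd p) t)"
proof -
 note pr = distribution_props[OF m0 alpha]
 interpret A: prob_space alpha by (rule pr(2))
 let ?B = "borel_of (mtopology_of (path_space 0 T)) :: (real => 'a) measure"
 let ?X = "%p. restrict (solution T g (fst p) (snd p)) {0..T}"
 have eq: "(%(y, xi). traj f 0 T m y xi) p = ?X p" if p: "p : space alpha" for p
  using traj_eq[where f=f and m=m, OF cpt T rf L pr(4)[OF p] fg] by (simp add: case_prod_unfold)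
 have Xm: "?X : alpha ->M ?B"
 proof (rule measurable_path[OF T field_bound_nonneg])
  fix p s t assume p: "p : space alpha" and s: "s : {0..T}" and t: "t : {0..T}"
  show "dist (?X p s) (?X p t) <= R * \<bar>s - t\<bar>"
   using solution_lipschitz[OF cpt T rf L pr(4)[OF p] t s, of "fst p"] s t by (simp add: dist_norm)
 next
  fix t assume "t : {0..T}"
  then show "(%p. ?X p t) : bmeas alpha" using solution_measurable_dist[of t] by simp
 qed auto
 show trm: "(%(y, xi). traj f 0 T m y xi) : alpha ->M ?B"
  using Xm eq by (simp cong: measurable_cong)
 have dx: "distr alpha ?B (%(y, xi). traj f 0 T m y xi) = distr alpha ?B ?X"
  by (rule distr_cong) (use eq in auto)
 define z0 where "z0 = restrict (%_::real. 0::'a) {0..T}"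
 have z0: "z0 : mspace (path_space 0 T)"
 proof -
  have "continuous_on {0..T} z0 = continuous_on {0..T} (%_. 0 :: 'a)"
   unfolding z0_def by (rule continuous_on_cong) auto
  then show ?thesis unfolding mspace_path_space by (simp add: z0_def del: restrict_apply)
 qed
 have "(NN x:(distr alpha ?B ?X). ennreal ((mdist (path_space 0 T) z0 x)^2)) = (NN p:alpha. ennreal ((mdist (path_space 0 T) z0 (?X p))^2))"
  using measurable_mdist_path[OF z0] by (intro nn_integral_distr[OF Xm]) simp
 also have "... <= (NN p:alpha. (2 * ennreal ((dist 0 (fst p))^2) + ennreal (2 * (R * T)^2)))"
 proof (rule nn_integral_mono, goal_cases)
  case p: (1 p)
  have Xp: "?X p : mspace (path_space 0 T)"
   using measurable_space[OF Xm p] by (simp add: borel_of_def space_measure_of_conv)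
  have "dist (z0 t) (?X p t) <= dist 0 (fst p) + R * T" if t: "t : {0..T}" for t
   using solution_displacement[OF p t] dist_triangle[of 0 "?X p t" "fst p"] t by (simp add: z0_def dist_norm norm_minus_commute)
  then have "mdist (path_space 0 T) z0 (?X p) <= dist 0 (fst p) + R * T"
   using mdist_path_space_le_iff[OF z0 Xp] T by auto
  then have "(mdist (path_space 0 T) z0 (?X p))^2 <= (dist 0 (fst p) + R * T)^2" by (intro power_mono) auto
  also have "... <= 2 * (dist 0 (fst p))^2 + 2 * (R * T)^2"
   using sum_squares_bound[of "dist 0 (fst p)" "R * T"] by (simp add: power2_sum)
  finally have "ennreal ((mdist (path_space 0 T) z0 (?X p))^2) <= ennreal (2 * (dist 0 (fst p))^2 + 2 * (R * T)^2)" by (rule ennreal_leI)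
  then show ?case
   by (simp add: ennreal_plus ennreal_mult)
 qed
 also have "... = 2 * (NN p:alpha. ennreal ((dist 0 (fst p))^2)) + ennreal (2 * (R * T)^2)"
  using pr(5) by (subst nn_integral_add) (auto simp: nn_integral_cmult A.emeasure_space_1)
 also have "(NN p:alpha. ennreal ((dist 0 (fst p))^2)) = (NN y:m0. ennreal ((dist 0 y)^2))"
  by (rule nn_integral_initial[OF m0 alpha]) simp
 also have "2 * ... + ennreal (2 * (R * T)^2) < \<infinity>"
  using P2_moment[OF m0, of 0] by (simp add: ennreal_mult_less_top)
 finally have fin: "(NN x:(distr alpha ?B ?X). ennreal ((mdist (path_space 0 T) z0 x)^2)) < \<infinity>" .
 show "distr alpha ?B (%(y, xi). traj f 0 T m y xi) : P2 (path_space 0 T)"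
  unfolding dx P2_def by (intro CollectI conjI bexI[of _ z0] fin z0 A.prob_space_distr[OF Xm]) simp
 assume t: "t : {0..T}"
 show "distr (distr alpha ?B (%(y, xi). traj f 0 T m y xi)) borel (%x. x t) = distr alpha borel (%p. solution T g (fst p) (snd p) t)"
  unfolding dx using t by (subst distr_distr[OF measurable_eval_path[OF t] Xm]) (simp add: o_def)
qed

end

text \<open>\<open>is_motion\<close> does not mention continuity of the flow, but
  \<open>flow_field\<close> is a regular field only along continuous flows. Continuity follows by
  dominated convergence under the path measure, the second moment in the supremum metric providing
  the dominating function.\<close>

lemma path_measure_W2_continuous:
 fixes nu :: "(real => 'a::euclidean_space) measure"
 assumes T: "0 < T" and nu: "nu : P2 (path_space 0 T)"
  and m: "!!t. t : {0..T} ==> m t = distr nu borel (%x. x t)"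
 shows "W2_continuous T m"
 unfolding W2_continuous_def
proof (intro ballI allI impI, rule ccontr)
 let ?P = "path_space 0 T :: (real => 'a) metric"
 fix t and e :: real assume t: "t : {0..T}" and e: "0 < e"
  and n: "\<not> (EX delta>0. ALL t':{0..T}. \<bar>t' - t\<bar> < delta --> W2 (m t') (m t) < e)"
 have s: "sets nu = sets (borel_of (mtopology_of ?P))" and "prob_space nu" using nu by (auto simp: P2_def)
 interpret prob_space nu by fact
 obtain x0 where x0: "x0 : mspace ?P" "(NN x:nu. ennreal ((mdist ?P x0 x)^2)) < \<infinity>" using nu by (auto simp: P2_def)
 have sp: "space nu = mspace ?P" using sets_eq_imp_space_eq[OF s] by (simp add: borel_of_def space_measure_of_conv)
 have "ALL n. EX t':{0..T}. \<bar>t' - t\<bar> < inverse (real (Suc n)) & \<not> W2 (m t') (m t) < e"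
  using n by (metis inverse_positive_iff_positive of_nat_0_less_iff zero_less_Suc)
 then obtain q where q: "!!n. q n : {0..T}" "!!n. \<bar>q n - t\<bar> < inverse (real (Suc n))" "!!n. \<not> W2 (m (q n)) (m t) < e" by metis
 have ql: "q \<longlonglongrightarrow> t"
 proof (rule metric_LIMSEQ_I, goal_cases)
  case (1 r)
  then obtain n where n: "inverse (real (Suc n)) < r" using reals_Archimedean by blast
  have "dist (q k) t < r" if "n <= k" for k
  proof -
   have "inverse (real (Suc k)) <= inverse (real (Suc n))" using that by (simp add: le_imp_inverse_le)
   then show ?thesis using q(2)[of k] n unfolding dist_real_def by linarith
  qed
  then show ?case by blast
 qed
 have ev: "(%x. x s) : bmeas nu" if "s : {0..T}" for s
  using measurable_eval_path[OF that] measurable_cong_sets[OF s refl] by blast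
 note evq = ev[OF q(1)] and evt = ev[OF t]
 have "bounded (x0 ` {0..T})"
  using x0(1) by (intro compact_imp_bounded compact_continuous_image) (auto simp: mspace_path_space)
 then obtain C where C: "!!s s'. s : {0..T} ==> s' : {0..T} ==> dist (x0 s) (x0 s') <= C"
  unfolding bounded_two_points by blast
 have C0: "0 <= C" using C[OF t t] by simp
 have lim: "(%n. (NN x:nu. ennreal ((dist (x (q n)) (x t))^2))) \<longlonglongrightarrow> (NN x:nu. 0)"
 \<comment> \<open>The dominating function comes from (2 d + C)^2 <= 8 d^2 + 2 C^2, with d the
   distance of x from the reference path \<open>x0\<close> and C the oscillation of
   \<open>x0\<close>.\<close>
 proof (rule nn_integral_dominated_convergence[where w="%x. 8 * ennreal ((mdist ?P x0 x)^2) + ennreal (2 * C^2)"])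
  show "(%x. ennreal ((dist (x (q n)) (x t))^2)) : bmeas nu" for n
   using evq[of n] evt by measurable
  have mm: "(%x. mdist ?P x0 x) : bmeas nu" using measurable_mdist_path[OF x0(1)] measurable_cong_sets[OF s refl] by blast
  show wm: "(%x. 8 * ennreal ((mdist ?P x0 x)^2) + ennreal (2 * C^2)) : bmeas nu" using mm by measurable
  have "(NN x:nu. 8 * ennreal ((mdist ?P x0 x)^2) + ennreal (2 * C^2)) = 8 * (NN x:nu. ennreal ((mdist ?P x0 x)^2)) + ennreal (2 * C^2)"
   using mm by (subst nn_integral_add) (auto simp: nn_integral_cmult emeasure_space_1)
  also have "... < \<infinity>" using x0(2) by (simp add: ennreal_mult_less_top)
  finally show "(NN x:nu. 8 * ennreal ((mdist ?P x0 x)^2) + ennreal (2 * C^2)) < \<infinity>" .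
  show "AE x in nu. ennreal ((dist (x (q n)) (x t))^2) <= 8 * ennreal ((mdist ?P x0 x)^2) + ennreal (2 * C^2)" for n
  proof (rule AE_I2, goal_cases)
   case (1 x)
   then have x: "x : mspace ?P" by (simp add: sp)
   let ?d = "mdist ?P x0 x"
   have pd: "dist (x0 s) (x s) <= ?d" if "s : {0..T}" for s
    using mdist_path_space_le_iff[OF x0(1) x, of ?d] T that by auto
   have "dist (x (q n)) (x t) <= dist (x0 (q n)) (x (q n)) + dist (x0 (q n)) (x0 t) + dist (x0 t) (x t)"
    using dist_triangle[of "x (q n)" "x t" "x0 (q n)"] dist_triangle[of "x0 (q n)" "x t" "x0 t"] by (simp add: dist_commute)
   also have "... <= ?d + C + ?d" by (intro add_mono pd C q(1) t)
   finally have "(dist (x (q n)) (x t))^2 <= (2 * ?d + C)^2" by (intro power_mono) auto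
   also have "... <= 8 * ?d^2 + 2 * C^2"
    using sum_squares_bound[of "2 * ?d" C] by (simp add: power2_sum power_mult_distrib)
   finally have "ennreal ((dist (x (q n)) (x t))^2) <= ennreal (8 * ?d^2 + 2 * C^2)" by (rule ennreal_leI)
   then show ?case
    by (simp add: ennreal_plus ennreal_mult)
  qed
  show "AE x in nu. (%n. ennreal ((dist (x (q n)) (x t))^2)) \<longlonglongrightarrow> 0"
  proof (rule AE_I2, goal_cases)
   case (1 x)
   then have c: "continuous_on {0..T} x" by (simp add: sp mspace_path_space)
   have "(%n. x (q n)) \<longlonglongrightarrow> x t"
    using continuous_on_tendsto_compose[OF c ql t] q(1) by simp
   then have "(%n. ennreal ((dist (x (q n)) (x t))^2)) \<longlonglongrightarrow> ennreal ((dist (x t) (x t))^2)"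
    by (intro tendsto_ennrealI tendsto_intros)
   then show ?case by simp
  qed
 qed simp
 have "0 < ennreal ((e/2)^2)" using e by simp
 then have "\<forall>\<^sub>F n in sequentially. (NN x:nu. ennreal ((dist (x (q n)) (x t))^2)) < ennreal ((e/2)^2)"
  using order_tendstoD(2)[OF lim, of "ennreal ((e/2)^2)"] by simp
 then obtain n where "(NN x:nu. ennreal ((dist (x (q n)) (x t))^2)) < ennreal ((e/2)^2)"
  using eventually_happens[of _ sequentially] by auto
 then have "W2 (distr nu borel (%x. x (q n))) (distr nu borel (%x. x t)) <= e/2"
  using e by (intro W2_le_distr[OF evq evt]) auto
 then show False using q(3)[of n] m[OF q(1)] m[OF t] e by simp
qed

definition field_consts :: "real => (real => 'a::euclidean_space => 'a measure => 'u::metric_space => 'a) => 'a set => real => real => bool" where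
 "field_consts T f K L R \<longleftrightarrow> 0 < L & 0 < R \<and>
  (ALL t:{0..T}. ALL m:P2_on K. ALL x u. norm (f t x m u) <= R) \<and>
  (ALL t:{0..T}. ALL m:P2_on K. ALL m':P2_on K. ALL x x' u. norm (f t x m u - f t x' m' u) <= L * (norm (x - x') + W2 m m'))"

lemma flow_field_regular_on:
 assumes cs: "control_system T f K" and T: "0 < T" and fc: "field_consts T f K L R"
  and P: "!!t. t : {0..T} ==> m t : P2_on K" and W: "W2_continuous T m"
 shows "regular_field L R (flow_field T f m)"
proof (rule flow_field_regular[OF cs T _ W])
 fix t assume t: "t : {0..T}"
 show mP: "m t : P2 euclidean_metric" using P[OF t] by (simp add: P2_on_def)
 show "norm (f t x (m t) u) <= R" for x u using fc P[OF t] t by (auto simp: field_consts_def)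
 have "W2 (m t) (m t) = 0" using mP by (intro W2_refl) (simp add: P2_euclidean_metric)
 moreover have "norm (f t x (m t) u - f t x' (m t) u) <= L * (norm (x - x') + W2 (m t) (m t))" for x x' u
  using fc P[OF t] t unfolding field_consts_def by blast
 ultimately show "norm (f t x (m t) u - f t x' (m t) u) <= L * norm (x - x')" for x x' u by simp
qed

text \<open>Brings a motion into the form used by the coupling, in which the field is frozen along
  the motion and the agents solve ordinary controlled equations.\<close>

lemma motion_solution:
 fixes f :: "real => 'a::euclidean_space => 'a measure => 'u::metric_space => 'a"
 assumes cpt: "compact (UNIV :: 'u set)" and T: "0 < T" and cs: "control_system T f K" and fc: "field_consts T f K L R"
  and m0: "m0 : P2_on K" and m: "m : motions f K T m0"
 shows "EX alpha:control_distributions 0 T m0. regular_field L R (flow_field T f m) \<and>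
  (ALL t:{0..T}. m t : P2_on K & m t = distr alpha borel (%p. solution T (flow_field T f m) (fst p) (snd p) t))"
proof -
 obtain alpha where alpha: "alpha : control_distributions 0 T m0" "is_motion f 0 T m0 alpha m" and mK: "!!t. t : {0..T} ==> m t : P2_on K"
  using m by (auto simp: motions_def)
 then obtain nu where nu: "nu : P2 (path_space 0 T)"
  "nu = distr alpha (borel_of (mtopology_of (path_space 0 T))) (%(y, xi). traj f 0 T m y xi)"
  "!!t. t : {0..T} ==> m t = distr nu borel (%x. x t)"
  unfolding is_motion_def by blast
 have W: "W2_continuous T m" by (rule path_measure_W2_continuous[OF T nu(1,3)])
 have rf: "regular_field L R (flow_field T f m)" by (rule flow_field_regular_on[OF cs T fc mK W])
 have m0P: "m0 : P2 euclidean_metric" using m0 by (simp add: P2_on_def)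
 have L: "0 < L" using fc by (simp add: field_consts_def)
 have "m t = distr alpha borel (%p. solution T (flow_field T f m) (fst p) (snd p) t)" if t: "t : {0..T}" for t
  unfolding nu(3)[OF t] nu(2) by (rule path_law(3)[where f=f and m=m, OF cpt T rf L m0P alpha(1) flow_field_eq[where T=T and f=f and m=m] t])
 then show ?thesis using alpha(1) rf mK by blast
qed

section \<open>Existence of motions by iteration on the flow\<close>

lemma geometric_limit:
 fixes x :: "nat => 'a::banach"
 assumes d: "!!n. norm (x (Suc n) - x n) <= c * (1/2) ^ n"
 shows "EX l. x \<longlonglongrightarrow> l & (ALL n. norm (x n - l) <= 2 * c * (1/2) ^ n)"
proof -
 have "summable (%n. x (Suc n) - x n)"
  by (rule summable_comparison_test'[OF _ d]) (intro summable_mult summable_geometric, simp)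
 then have "(%n. \<Sum>k<n. x (Suc k) - x k) \<longlonglongrightarrow> (\<Sum>n. x (Suc n) - x n)" by (rule summable_LIMSEQ)
 then have "(%n. x n - x 0) \<longlonglongrightarrow> (\<Sum>n. x (Suc n) - x n)" unfolding sum_lessThan_telescope .
 from tendsto_add[OF this tendsto_const[of "x 0"]] obtain l where l: "x \<longlonglongrightarrow> l" by auto
 have b: "norm (x n - x (n + j)) <= 2 * c * (1/2) ^ n * (1 - (1/2) ^ j)" for n j
 proof (induction j)
  case (Suc j)
  have "norm (x n - x (n + Suc j)) <= norm (x n - x (n + j)) + norm (x (Suc (n + j)) - x (n + j))"
   using norm_triangle_ineq4[of "x n - x (n + j)" "x (Suc (n + j)) - x (n + j)"] by simp
  also have "... <= 2 * c * (1/2) ^ n * (1 - (1/2) ^ j) + c * (1/2) ^ (n + j)" by (intro add_mono Suc.IH d)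
  also have "... = 2 * c * (1/2) ^ n * (1 - (1/2) ^ Suc j)" by (simp add: power_add algebra_simps)
  finally show ?case .
 qed simp
 have c: "0 <= c" using order_trans[OF norm_ge_zero d[of 0]] by simp
 have "norm (x n - l) <= 2 * c * (1/2) ^ n" for n
 proof (rule Lim_norm_ubound[OF _ tendsto_diff[OF tendsto_const LIMSEQ_ignore_initial_segment[OF l, of n]]])
  show "\<forall>\<^sub>F j in sequentially. norm (x n - x (j + n)) <= 2 * c * (1/2) ^ n"
  proof (rule always_eventually, rule allI)
   fix j
   have "2 * c * (1/2) ^ n * (1 - (1/2) ^ j) <= 2 * c * (1/2) ^ n * 1" using c by (intro mult_left_mono) auto
   then show "norm (x n - x (j + n)) <= 2 * c * (1/2) ^ n" using b[of n j] by (simp add: add.commute)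
  qed
 qed simp
 then show ?thesis using l by blast
qed

primrec picard_flow :: "real => (real => 'a::euclidean_space => 'a measure => 'u::metric_space => 'a) => 'a measure =>
  ('a * (real * 'u) measure) measure => nat => real => 'a measure" where
 "picard_flow T f m0 alpha 0 = (%t. m0)"
| "picard_flow T f m0 alpha (Suc n) = (%t. distr alpha borel (%p. solution T (flow_field T f (picard_flow T f m0 alpha n)) (fst p) (snd p) t))"

text \<open>The flow is iterated with alpha fixed, and convergence is proved for every agent's
  trajectory rather than in a space of measures. Consecutive trajectories over the same sample
  couple their laws, so their distance bounds the W2 distance that enters the field in the next
  iterate.\<close>

lemma motion_exists:
 fixes f :: "real => 'a::euclidean_space => 'a measure => 'u::metric_space => 'a"
 assumes cpt: "compact (UNIV :: 'u set)" and T: "0 < T" and cs: "control_system T f K" and fc: "field_consts T f K L R"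
  and m0: "m0 : P2_on K" and alpha: "alpha : control_distributions 0 T m0"
 shows "EX m:motions f K T m0. regular_field L R (flow_field T f m) \<and>
  (ALL t:{0..T}. m t : P2_on K & m t = distr alpha borel (%p. solution T (flow_field T f m) (fst p) (snd p) t))"
proof -
 have m0P: "m0 : P2 euclidean_metric" using m0 by (simp add: P2_on_def)
 note pr = distribution_props[OF m0P alpha]
 interpret A: prob_space alpha by (rule pr(2))
 have L: "0 < L" and R: "0 < R" using fc by (auto simp: field_consts_def)
 have cl: "clamp_time T t : {0..T}" for t using T by (intro clamp_time_in) simp
 define mf where "mf = picard_flow T f m0 alpha"
 define G where "G n = flow_field T f (mf n)" for n
 \<comment> \<open>Positions of the n-th iterate, all on the one sample space alpha; for n = 0 the
   agents stay at their starting points.\<close>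
 define Y where "Y n t p = (case n of 0 => fst p | Suc k => solution T (G k) (fst p) (snd p) t)" for n t and p :: "'a * (real * 'u) measure"
 have mf0: "mf 0 = (%t. m0)" and mfS: "mf (Suc n) = (%t. distr alpha borel (%p. solution T (G n) (fst p) (snd p) t))" for n
  by (simp_all add: mf_def G_def)
 have G0: "G n ((tau, z), u) = 0" if "tau : {0..T}" "z \<notin> K" "mf n tau : P2_on K" for n tau z u
  using that field_zero_off[OF cs that(1,3,2), of u] by (simp add: G_def flow_field_def)
 have inv: "(ALL t:{0..T}. mf n t : P2_on K) & W2_continuous T (mf n)" for n
 proof (induction n)
  case 0
  have "W2 m0 m0 = 0" using m0P by (intro W2_refl) (simp add: P2_euclidean_metric)
  then show ?case using m0 by (auto simp: mf0 W2_continuous_def intro!: exI[of _ 1])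
 next
  case (Suc n)
  then have mK: "!!t. t : {0..T} ==> mf n t : P2_on K" and W: "W2_continuous T (mf n)" by auto
  have rf: "regular_field L R (G n)" unfolding G_def by (rule flow_field_regular_on[OF cs T fc mK W])
  have "mf (Suc n) t : P2_on K" if "t : {0..T}" for t
   unfolding mfS by (rule law_P2_on[OF cpt T rf L m0P alpha m0 that]) (rule G0[OF _ _ mK])
  moreover have "W2_continuous T (mf (Suc n))"
   by (rule law_W2_continuous[OF cpt T rf L m0P alpha]) (simp add: mfS)
  ultimately show ?case by blast
 qed
 have rf: "regular_field L R (G n)" for n unfolding G_def using inv[of n] by (intro flow_field_regular_on[OF cs T fc]) auto
 note sol_meas = solution_measurable_dist[OF cpt T rf L m0P alpha]
 have Ym: "Y n t : bmeas alpha" for n t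
 proof (cases n)
  case 0 then show ?thesis using pr(5) by (simp add: Y_def[abs_def])
 next
  case (Suc k) then show ?thesis using sol_meas[of k t] by (simp add: Y_def[abs_def])
 qed
 have mfY: "mf n t = distr alpha borel (Y n t)" for n t
  by (cases n) (simp_all add: mf0 mfS Y_def[abs_def] pr(3))
 have Ytm: "(%t. Y n t p) : bmeas borel" if "p : space alpha" for n p
  using solution_measurable_time[OF cpt T rf L pr(4)[OF that], of "n - 1" "fst p"] by (cases n) (simp_all add: Y_def)
 have disp: "norm (Y n t p - fst p) <= R * T" if p: "p : space alpha" and t: "t : {0..T}" for n t p
  using solution_displacement[OF cpt T rf L m0P alpha p t, of "n - 1"] R T by (cases n) (simp_all add: Y_def)
 have lip: "dist (Y n s p) (Y n t p) <= R * \<bar>s - t\<bar>" if p: "p : space alpha" and s: "s : {0..T}" and t: "t : {0..T}" for n s t p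
  using solution_lipschitz[OF cpt T rf L pr(4)[OF p] t s, of "n - 1" "fst p"] R by (cases n) (simp_all add: Y_def dist_norm)
 \<comment> \<open>With this rate \<open>L / beta\<close> times the Gronwall factor
   \<open>exp (L * T)\<close> equals 1/2, so that consecutive iterates contract by 1/2 in the weight
   \<open>exp (beta * t)\<close>.\<close>
 define beta where "beta = 2 * L * exp (L * T)"
 define D where "D = R * T"
 have beta: "0 < beta" and D: "0 < D" using L R T by (auto simp: beta_def D_def)
 have diff: "ALL p:space alpha. ALL t:{0..T}. norm (Y (Suc n) t p - Y n t p) <= D * (1/2) ^ n * exp (beta * (t - 0))" for n
 proof (induction n)
  case 0
  show ?case
  proof (intro ballI)
   fix p t assume p: "p : space alpha" and t: "t : {0..T}"
   have "norm (Y (Suc 0) t p - Y 0 t p) <= D * 1" using disp[OF p t, of 1] by (simp add: Y_def D_def)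
   also have "... <= D * exp (beta * (t - 0))" using D beta t by (intro mult_left_mono) auto
   finally show "norm (Y (Suc 0) t p - Y 0 t p) <= D * (1/2) ^ 0 * exp (beta * (t - 0))" by simp
  qed
 next
  case (Suc n)
  have Wb: "W2 (mf (Suc n) tau) (mf n tau) <= D * (1/2) ^ n * exp (beta * (tau - 0))" if tau: "tau : {0..T}" for tau
   unfolding mfY
  proof (rule W2_le_distr[OF Ym Ym])
   have "(NN p:alpha. ennreal ((dist (Y (Suc n) tau p) (Y n tau p))^2)) <= (NN p:alpha. ennreal ((D * (1/2) ^ n * exp (beta * (tau - 0)))^2))"
    using Suc.IH tau by (intro nn_integral_mono ennreal_leI power_mono) (auto simp: dist_norm)
   then show "(NN p:alpha. ennreal ((dist (Y (Suc n) tau p) (Y n tau p))^2)) <= ennreal ((D * (1/2) ^ n * exp (beta * (tau - 0)))^2)"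
    by (simp add: A.emeasure_space_1)
  qed (use D in simp)
  show ?case
  proof (intro ballI)
   fix p t assume p: "p : space alpha" and t: "t : {0..T}"
   note xi = pr(4)[OF p]
   define d where "d s = norm (Y (Suc (Suc n)) s p - Y (Suc n) s p)" for s
   define a where "a = L * (D * (1/2) ^ n) * (exp (beta * (t - 0)) - 1) / beta"
   have dm: "d : bmeas borel" unfolding d_def using Ytm[OF p] by measurable
   have a0: "0 <= a" using L D beta t by (auto simp: a_def)
   have "d t <= a * exp (L * (t - 0))"
   proof (rule gronwall[where M="2 * R * T" and r=t])
    fix s assume s: "s : {0..t}"
    then have sT: "s : {0..T}" using t by auto
    have "d s <= norm (Y (Suc (Suc n)) s p - fst p) + norm (Y (Suc n) s p - fst p)"
     unfolding d_def using norm_triangle_ineq4[of "Y (Suc (Suc n)) s p - fst p" "Y (Suc n) s p - fst p"] by simp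
    then show "d s <= 2 * R * T" using disp[OF p sT, of "Suc (Suc n)"] disp[OF p sT, of "Suc n"] by linarith
    let ?x = "%t. solution T (G (Suc n)) (fst p) (snd p) t" and ?x' = "%t. solution T (G n) (fst p) (snd p) t"
    note am = along_measurable[OF cpt rf solution_measurable_time[OF cpt T rf L xi]]
    have "ennreal (d s) = ennreal (norm (cint T (snd p) (along (G (Suc n)) ?x) s - cint T (snd p) (along (G n) ?x') s))"
     using solution_eq[OF cpt T rf L xi sT, of "Suc n" "fst p"] solution_eq[OF cpt T rf L xi sT, of n "fst p"]
     by (simp add: d_def Y_def)
    also have "... <= (NN tau:lborel|{0..s}. ennreal (L * d tau + L * (D * (1/2) ^ n) * exp (beta * (tau - 0))))"
    proof (rule control_integral_diff[OF xi T am am along_bound[OF rf] along_bound[OF rf] _ _ sT])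
     show "(%tau. L * d tau + L * (D * (1/2) ^ n) * exp (beta * (tau - 0))) : bmeas borel" using dm by measurable
     fix tau and u :: 'u assume "tau : {0..s}"
     then have tau: "tau : {0..T}" using sT by auto
     have "norm (along (G (Suc n)) ?x (tau, u) - along (G n) ?x' (tau, u)) = norm (f tau (?x tau) (mf (Suc n) tau) u - f tau (?x' tau) (mf n tau) u)"
      using tau by (simp add: along_def G_def flow_field_def)
     also have "... <= L * (norm (?x tau - ?x' tau) + W2 (mf (Suc n) tau) (mf n tau))"
      using fc inv[of n] inv[of "Suc n"] tau unfolding field_consts_def by blast
     also have "... <= L * (d tau + D * (1/2) ^ n * exp (beta * (tau - 0)))"
      using Wb[OF tau] L by (intro mult_left_mono add_mono) (auto simp: d_def Y_def)
     finally show "norm (along (G (Suc n)) ?x (tau, u) - along (G n) ?x' (tau, u)) <= L * d tau + L * (D * (1/2) ^ n) * exp (beta * (tau - 0))"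
      by (simp add: algebra_simps)
    qed
    also have "... = (NN tau:lborel. ennreal (L * d tau) * ind {0..s} tau + ennreal (L * (D * (1/2) ^ n) * exp (beta * (tau - 0))) * ind {0..s} tau)"
     using L D by (intro nn_integral_cong) (auto simp: d_def ennreal_plus split: split_indicator)
    also have "... = (NN tau:lborel|{0..s}. ennreal (L * d tau)) + (NN tau:lborel|{0..s}. ennreal (L * (D * (1/2) ^ n) * exp (beta * (tau - 0))))"
     using dm by (intro nn_integral_add) auto
    also have "(NN tau:lborel|{0..s}. ennreal (L * (D * (1/2) ^ n) * exp (beta * (tau - 0))))
     = ennreal (L * (D * (1/2) ^ n) * (exp (beta * (s - 0)) - 1) / beta)"
     using L D beta sT by (intro nn_integral_exp_Icc) auto
    also have "L * (D * (1/2) ^ n) * (exp (beta * (s - 0)) - 1) / beta <= a"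
     unfolding a_def using L D beta s by (intro divide_right_mono mult_left_mono) auto
    finally show "ennreal (d s) <= ennreal a + (NN tau:lborel|{0..s}. ennreal (L * d tau))"
     by (simp add: add.commute ennreal_leI add_left_mono)
   qed (use t L a0 in \<open>auto simp: d_def\<close>)
   also have "... <= a * exp (L * T)" using a0 L t by (intro mult_left_mono) auto
   also have "... = D * (1/2) ^ Suc n * (exp (beta * (t - 0)) - 1)"
    using L by (simp add: a_def beta_def)
   also have "... <= D * (1/2) ^ Suc n * exp (beta * (t - 0))" using D by (intro mult_left_mono) auto
   finally show "norm (Y (Suc (Suc n)) t p - Y (Suc n) t p) <= D * (1/2) ^ Suc n * exp (beta * (t - 0))" by (simp add: d_def)
  qed
 qed
 define E where "E = D * exp (beta * T)"
 have E0: "0 <= E" using D by (simp add: E_def)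
 define Yi where "Yi t p = lim (%n. Y n (clamp_time T t) p)" for t p
 have lim: "(%n. Y n (clamp_time T t) p) \<longlonglongrightarrow> Yi t p & (ALL n. norm (Y n (clamp_time T t) p - Yi t p) <= 2 * E * (1/2) ^ n)"
  if p: "p : space alpha" for t p
 proof -
  have "norm (Y (Suc n) (clamp_time T t) p - Y n (clamp_time T t) p) <= E * (1/2) ^ n" for n
  proof -
   have "norm (Y (Suc n) (clamp_time T t) p - Y n (clamp_time T t) p) <= D * (1/2) ^ n * exp (beta * (clamp_time T t - 0))"
    using diff[of n] p cl by blast
   also have "... <= D * (1/2) ^ n * exp (beta * T)" using D beta cl[of t] by (intro mult_left_mono) auto
   finally show ?thesis by (simp add: E_def mult_ac)
  qed
  from geometric_limit[OF this] obtain l where l: "(%n. Y n (clamp_time T t) p) \<longlonglongrightarrow> l"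
   "ALL n. norm (Y n (clamp_time T t) p - l) <= 2 * E * (1/2) ^ n" by blast
  then have "Yi t p = l" unfolding Yi_def by (intro limI)
  then show ?thesis using l by simp
 qed
 have Yim: "Yi t : bmeas alpha" for t
  by (rule borel_measurable_LIMSEQ_metric[where f="%n. Y n (clamp_time T t)", OF Ym]) (use lim in blast)
 define m where "m t = distr alpha borel (Yi t)" for t
 have mP: "m t : P2 euclidean_metric" if t: "t : {0..T}" for t
  unfolding m_def
 proof (rule displaced_law_P2[OF m0P alpha Yim])
  fix p assume p: "p : space alpha"
  have "(%n. Y n t p) \<longlonglongrightarrow> Yi t p" using lim[OF p, of t] t by simp
  then have l: "(%n. Y n t p - fst p) \<longlonglongrightarrow> Yi t p - fst p" by (intro tendsto_intros)
  show "norm (Yi t p - fst p) <= R * T"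
   by (rule Lim_norm_ubound[OF _ l]) (use disp[OF p t] in auto)
 qed
 have W: "W2_continuous T m"
 proof (rule lipschitz_law_W2_continuous[OF m0P alpha Yim])
  fix p s t assume p: "p : space alpha" and s: "s : {0..T}" and t: "t : {0..T}"
  have "(%n. Y n t p) \<longlonglongrightarrow> Yi t p" "(%n. Y n s p) \<longlonglongrightarrow> Yi s p" using lim[OF p, of t] lim[OF p, of s] t s by simp_all
  then have l: "(%n. Y n s p - Y n t p) \<longlonglongrightarrow> Yi s p - Yi t p" by (intro tendsto_intros)
  have "norm (Yi s p - Yi t p) <= R * \<bar>s - t\<bar>"
   by (rule Lim_norm_ubound[OF _ l]) (use lip[OF p s t] in \<open>auto simp: dist_norm\<close>)
  then show "dist (Yi s p) (Yi t p) <= R * \<bar>s - t\<bar>" by (simp add: dist_norm)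
 qed (use R in \<open>auto simp: m_def\<close>)
 have mW: "W2 (mf n t) (m t) <= 2 * E * (1/2) ^ n" if t: "t : {0..T}" for n t
  unfolding mfY m_def
 proof (rule W2_le_distr[OF Ym Yim])
  have "(NN p:alpha. ennreal ((dist (Y n t p) (Yi t p))^2)) <= (NN p:alpha. ennreal ((2 * E * (1/2) ^ n)^2))"
  proof (rule nn_integral_mono, rule ennreal_leI, rule power_mono)
   fix p assume p: "p : space alpha"
   show "dist (Y n t p) (Yi t p) <= 2 * E * (1/2) ^ n" using lim[OF p, of t] t by (simp add: dist_norm)
  qed simp
  then show "(NN p:alpha. ennreal ((dist (Y n t p) (Yi t p))^2)) <= ennreal ((2 * E * (1/2) ^ n)^2)"
   by (simp add: A.emeasure_space_1)
 qed (use E0 in simp)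
 \<comment> \<open>K may fail to be closed, so the limit flow is not yet known to lie in
   \<open>P2_on K\<close> and \<open>field_consts\<close> cannot be applied to it. Bounds and zeros
   of f along the limit are limits of those along the iterates; membership in \<open>P2_on K\<close>
   then follows from \<open>law_P2_on\<close>.\<close>
 have fconv: "(%n. f t (x n) (mf n t) u) \<longlonglongrightarrow> f t xl (m t) u" if t: "t : {0..T}" and x: "x \<longlonglongrightarrow> xl" for t x xl u
 proof (rule metric_LIMSEQ_I, goal_cases)
  case e: (1 e)
  from field_continuous[OF cs t mP[OF t] e, where x=xl and u=u] obtain delta where delta: "delta > 0"
   "ALL t':{0..T}. ALL x'. ALL m':P2 euclidean_metric. ALL u'.
    dist t' t < delta & dist x' xl < delta & W2 m' (m t) < delta & dist u' u < delta --> dist (f t' x' m' u') (f t xl (m t) u) < e" by blast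
  obtain N1 where N1: "!!n. n >= N1 ==> dist (x n) xl < delta" using metric_LIMSEQ_D[OF x delta(1)] by blast
  have "(%n. 2 * E * (1/2) ^ n) \<longlonglongrightarrow> 2 * E * 0" by (intro tendsto_intros LIMSEQ_power_zero) simp
  from metric_LIMSEQ_D[OF this delta(1)] obtain N2 where N2: "!!n. n >= N2 ==> 2 * E * (1/2) ^ n < delta"
   by (auto simp: dist_real_def) (meson abs_ge_self le_less_trans)
  have "dist (f t (x n) (mf n t) u) (f t xl (m t) u) < e" if n: "n >= max N1 N2" for n
  proof -
   have "mf n t : P2 euclidean_metric" using inv[of n] t by (auto simp: P2_on_def)
   moreover have "dist (x n) xl < delta" using N1[of n] n by simp
   moreover have "W2 (mf n t) (m t) < delta" using mW[OF t, of n] N2[of n] n by simp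
   ultimately show ?thesis using delta t by simp
  qed
  then show ?case by blast
 qed
 have fbn: "norm (f t x (mf n t) u) <= R" if "t : {0..T}" for t x u n
  using fc inv[of n] that unfolding field_consts_def by blast
 have rfm: "regular_field L R (flow_field T f m)"
 proof (rule flow_field_regular[OF cs T mP W])
  fix t x u assume t: "t : {0..T}"
  show "norm (f t x (m t) u) <= R"
   by (rule Lim_norm_ubound[OF _ fconv[OF t tendsto_const]]) (use fbn[OF t] in auto)
  fix x'
  show "norm (f t x (m t) u - f t x' (m t) u) <= L * norm (x - x')"
  proof (rule Lim_norm_ubound[OF _ tendsto_diff[OF fconv[OF t tendsto_const] fconv[OF t tendsto_const]]])
   have "norm (f t x (mf n t) u - f t x' (mf n t) u) <= L * norm (x - x')" for n
    using rf[of n] t unfolding regular_field_def G_def flow_field_def by (metis clamp_time_id fst_conv snd_conv)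
   then show "\<forall>\<^sub>F n in sequentially. norm (f t x (mf n t) u - f t x' (mf n t) u) <= L * norm (x - x')" by simp
  qed simp
 qed
 let ?g = "flow_field T f m"
 have Ysol: "Yi t p = solution T ?g (fst p) (snd p) t" if p: "p : space alpha" and t: "t : {0..T}" for p t
 proof -
  note xi = pr(4)[OF p]
  have Yitm: "(%t. Yi t p) : bmeas borel"
  proof (rule borel_measurable_LIMSEQ_metric[where f="%n t. Y n (clamp_time T t) p"])
   show "(%t. Y n (clamp_time T t) p) : bmeas borel" for n
    by (rule mcomp[OF measurable_clamp_time Ytm[OF p]])
  qed (use lim[OF p] in blast)
  have "Yi t p = fst p + cint T (snd p) (along ?g (%t. Yi t p)) t" if t: "t : {0..T}" for t
  proof -
   let ?x = "%n t. solution T (G n) (fst p) (snd p) t"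
   have xl: "(%n. ?x n s) \<longlonglongrightarrow> Yi s p" if "s : {0..T}" for s
    using LIMSEQ_Suc[OF conjunct1[OF lim[OF p, of s]]] that by (simp add: Y_def)
   have "(%n. cint T (snd p) (along (G n) (?x n)) t) \<longlonglongrightarrow> cint T (snd p) (along ?g (%t. Yi t p)) t"
   proof (rule control_integral_tendsto[OF xi T along_measurable[OF cpt rf solution_measurable_time[OF cpt T rf L xi]]
     along_measurable[OF cpt rfm Yitm] along_bound[OF rf]])
    fix tau and u :: 'u assume "tau : {0..t}"
    then have tau: "tau : {0..T}" using t by auto
    show "(%n. along (G n) (?x n) (tau, u)) \<longlonglongrightarrow> along ?g (%t. Yi t p) (tau, u)"
     using fconv[OF tau xl[OF tau], of u] tau by (simp add: along_def G_def flow_field_def)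
   qed
   then have "(%n. fst p + cint T (snd p) (along (G n) (?x n)) t) \<longlonglongrightarrow> fst p + cint T (snd p) (along ?g (%t. Yi t p)) t"
    by (intro tendsto_intros)
   moreover have "?x n t = fst p + cint T (snd p) (along (G n) (?x n)) t" for n
    by (rule solution_eq[OF cpt T rf L xi t])
   ultimately have "(%n. ?x n t) \<longlonglongrightarrow> fst p + cint T (snd p) (along ?g (%t. Yi t p)) t" by simp
   then show ?thesis using xl[OF t] LIMSEQ_unique by blast
  qed
  then show ?thesis
   by (rule ode_unique[OF cpt T rfm L xi Yitm solution_measurable_time[OF cpt T rfm L xi] _ solution_eq[OF cpt T rfm L xi] t])
 qed
 have mlaw: "m t = distr alpha borel (%p. solution T ?g (fst p) (snd p) t)" if t: "t : {0..T}" for t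
 proof -
  have "distr alpha borel (Yi t) = distr alpha borel (%p. solution T ?g (fst p) (snd p) t)"
   by (rule distr_cong[OF refl refl]) (rule Ysol[OF _ t])
  then show ?thesis by (simp only: m_def)
 qed
 have g0: "?g ((tau, z), u) = 0" if tau: "tau : {0..T}" and z: "z \<notin> K" for tau z u
 proof -
  have "f tau z (mf n tau) u = 0" for n using field_zero_off[OF cs tau _ z] inv[of n] tau by blast
  then have "f tau z (m tau) u = 0" using fconv[OF tau tendsto_const[of z], of u] LIMSEQ_unique[OF _ tendsto_const] by auto
  then show ?thesis using tau by (simp add: flow_field_def)
 qed
 have mK: "m t : P2_on K" if t: "t : {0..T}" for t
  unfolding mlaw[OF t] by (rule law_P2_on[OF cpt T rfm L m0P alpha m0 t g0])
 note pl = path_law[where f=f and m=m, OF cpt T rfm L m0P alpha flow_field_eq[where T=T and f=f and m=m]]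
 have "m 0 = m0"
 proof -
  have "m 0 = distr alpha borel fst"
   using mlaw[of 0] T solution_initial[OF cpt T rfm L pr(4)] by (simp cong: distr_cong)
  then show ?thesis by (simp add: pr(3))
 qed
 then have "is_motion f 0 T m0 alpha m"
  unfolding is_motion_def using mP pl(2) pl(3) mlaw by auto
 then have "m : motions f K T m0" unfolding motions_def using alpha mK by blast
 then show ?thesis using rfm mK mlaw by blast
qed

declare measurable_interval [measurable del]

section \<open>Countable sums\<close>

lemma ennreal_le_plus: "a <= b + c ==> 0 <= b ==> 0 <= c ==> ennreal a <= ennreal b + ennreal c"
 by (metis ennreal_leI ennreal_plus)

lemma has_sum_CS:
 fixes f :: "'a => real"
 assumes "!!x. x : S ==> 0 <= f x" and s: "(f has_sum a) S"
 shows "(CS x:S. ennreal (f x)) = ennreal a"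
proof -
 have "f summable_on S" using s by (rule has_sum_imp_summable)
 then have "Infinite_Set_Sum.abs_summable_on f S"
  by (metis abs_summable_equivalent summable_on_iff_abs_summable_on_real)
 then have "(CS x:S. ennreal (f x)) = ennreal (infsetsum f S)" "infsetsum f S = infsum f S"
  using assms(1) by (auto intro!: nn_integral_conv_infsetsum infsetsum_infsum)
 then show ?thesis using infsumI[OF s] by simp
qed

lemma has_sum_singleton:
 fixes c :: real
 assumes "x : S"
 shows "((%y. if y = x then c else 0) has_sum c) S"
proof -
 have "((%y. if y = x then c else 0) has_sum c) {x}" using has_sum_finite[of "{x}" "%y. if y = x then c else 0"] by simp
 then show ?thesis by (rule has_sum_cong_neutral[THEN iffD1, rotated 3]) (use assms in auto)
qed

lemma integrable_count_space_ennreal: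
 fixes f :: "'a => real"
 assumes "(CS x:S. ennreal \<bar>f x\<bar>) < \<infinity>"
 shows "integrable (count_space S) f"
 by (rule integrableI_bounded) (use assms in simp_all)

lemma swap_CS:
 fixes f :: "'a => 'b => ennreal"
 assumes "countable S" "!!y. y : S ==> f y : bmeas M"
 shows "(CS y:S. (NN x:M. f y x)) = (NN x:M. (CS y:S. f y x))"
 using nn_integral_count_space_nn_integral[OF assms] by simp

lemma Sigma_nn_integral:
 fixes mu :: "'a::euclidean_space => real"
 assumes "mu : Sigma1 S"
 shows "(CS x:S. ennreal (mu x)) = 1"
 using has_sum_CS[of S mu 1] assms by (auto simp: Sigma1_def)

section \<open>Weights and rates\<close>

text \<open>Weights that grow at most quadratically along a jump. Truncations of
  \<open>weight\<close> satisfy the same inequalities with the same constants, which lets moment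
  bounds be proved for bounded weights first.\<close>

definition weight_fn :: "('a::euclidean_space => real) => bool" where
 "weight_fn W \<longleftrightarrow> (ALL y. 1 <= W y) & (ALL x y. W y <= 2 * W x + 2 * (norm (y - x))^2)"

definition weight :: "'a::euclidean_space => real" where
 "weight y = 1 + (norm y)^2"

lemma norm_square_triangle:
 fixes x y :: "'a::euclidean_space"
 shows "(norm y)^2 <= 2 * (norm x)^2 + 2 * (norm (y - x))^2"
proof -
 have "(norm y)^2 <= (norm x + norm (y - x))^2"
  by (intro power_mono) (metis add.commute diff_add_cancel norm_triangle_ineq, simp)
 also have "... <= 2 * (norm x)^2 + 2 * (norm (y - x))^2"
  using sum_squares_bound[of "norm x" "norm (y - x)"] by (simp add: power2_sum)
 finally show ?thesis .
qed

lemma weight_fn_weight: "weight_fn weight"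
 unfolding weight_fn_def weight_def
proof (intro conjI allI)
 fix x y :: 'a
 show "1 + (norm y)^2 <= 2 * (1 + (norm x)^2) + 2 * (norm (y - x))^2"
  using norm_square_triangle[of y x] by simp
qed simp

lemma weight_fn_min: "weight_fn W ==> 1 <= n ==> weight_fn (%y. min (W y) n)"
 unfolding weight_fn_def
proof (intro conjI allI)
 fix x y :: 'a assume a: "(ALL y. 1 <= W y) & (ALL x y. W y <= 2 * W x + 2 * (norm (y - x))^2)" and n: "1 <= n"
 have 1: "W y <= 2 * W x + 2 * (norm (y - x))^2" using a by blast
 have 2: "0 <= (norm (y - x))^2" by simp
 show "min (W y) n <= 2 * min (W x) n + 2 * (norm (y - x))^2"
 proof (cases "W x <= n")
  case True then show ?thesis using 1 min.cobounded1[of "W y" n] by (simp add: min_absorb1)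
 next
  case False
  then have "min (W x) n = n" by simp
  then show ?thesis using 2 n min.cobounded2[of "W y" n] by linarith
 qed
qed auto

text \<open>What one row of Q retains of the Kolmogorov property, of (A2) and of (A4). For a
  nonnegative B the zero row qualifies, which covers times outside the interval considered.\<close>

definition rate_row :: "'a::euclidean_space set => real => real => 'a => ('a => real) => bool" where
 "rate_row S B eps x q \<longleftrightarrow> (ALL y:S. y ~= x --> 0 <= q y) & (q has_sum 0) S & (ALL y:S. \<bar>q y\<bar> <= B) \<and>
  (%y. (norm (y - x))^2 * q y) summable_on S & (\<Sum>\<^sub>\<infinity>y\<in>S. (norm (y - x))^2 * q y) <= eps^2"

lemma rate_row_moment:
 assumes r: "rate_row S B eps x q"
 shows "(CS y:S. ennreal ((norm (y - x))^2 * \<bar>q y\<bar>)) <= ennreal (eps^2)"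
proof -
 have "(CS y:S. ennreal ((norm (y - x))^2 * \<bar>q y\<bar>)) = (CS y:S. ennreal ((norm (y - x))^2 * q y))"
 proof (rule nn_integral_cong, goal_cases)
  case (1 y)
  then show ?case
   using r by (cases "y = x") (auto simp: rate_row_def)
 qed
 also have "... = ennreal (\<Sum>\<^sub>\<infinity>y\<in>S. (norm (y - x))^2 * q y)"
 proof (rule has_sum_CS)
  show "0 <= (norm (y - x))^2 * q y" if "y : S" for y using r that by (cases "y = x") (auto simp: rate_row_def)
  show "((%y. (norm (y - x))^2 * q y) has_sum (\<Sum>\<^sub>\<infinity>y\<in>S. (norm (y - x))^2 * q y)) S"
   using r by (intro has_sum_infsum) (simp add: rate_row_def)
 qed
 also have "... <= ennreal (eps^2)" using r by (intro ennreal_leI) (simp add: rate_row_def)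
 finally show ?thesis .
qed

lemma rate_row_abs:
 assumes r: "rate_row S B eps x q" and x: "x : S"
 shows "(CS y:S. ennreal \<bar>q y\<bar>) <= ennreal (2 * B)"
proof -
 have B: "\<bar>q y\<bar> <= B" if "y : S" for y using r that by (simp add: rate_row_def)
 \<comment> \<open>Only the diagonal entry can be negative, and \<open>q x + 2 * B\<close> still
   dominates its absolute value; the row sum 0 then leaves 2 B.\<close>
 have "(CS y:S. ennreal \<bar>q y\<bar>) <= (CS y:S. ennreal (q y + (if y = x then 2 * B else 0)))"
  using r B[OF x] by (intro nn_integral_mono ennreal_leI) (auto simp: rate_row_def abs_if)
 also have "... = ennreal (0 + 2 * B)"
 proof (rule has_sum_CS)
  show "((%y. q y + (if y = x then 2 * B else 0)) has_sum (0 + 2 * B)) S"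
   using r by (intro has_sum_add has_sum_singleton x) (simp add: rate_row_def)
  show "0 <= q y + (if y = x then 2 * B else 0)" if "y : S" for y
   using r B[OF x] that by (auto simp: rate_row_def abs_if split: if_splits)
 qed
 finally show ?thesis by simp
qed

text \<open>The part 2 W(x) of the weight at y meets the absolute row sum 2 B, the part 2 |y - x|^2
  meets the variance bound, and eps <= 1 <= W(x) absorbs the latter.\<close>

lemma rate_row_weight:
 assumes r: "rate_row S B eps x q" and x: "x : S" and W: "weight_fn W" and eps: "0 < eps" "eps <= 1"
 shows "(CS y:S. ennreal (W y * \<bar>q y\<bar>)) <= ennreal ((4 * B + 2) * W x)"
proof -
 have W1: "1 <= W x" using W by (simp add: weight_fn_def)
 have B0: "0 <= B" using r x unfolding rate_row_def by (meson abs_ge_zero order_trans)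
 have "(CS y:S. ennreal (W y * \<bar>q y\<bar>))
  <= (CS y:S. ennreal (2 * W x) * ennreal \<bar>q y\<bar> + 2 * ennreal ((norm (y - x))^2 * \<bar>q y\<bar>))"
 proof (rule nn_integral_mono, goal_cases)
  case (1 y)
  have "W y <= 2 * W x + 2 * (norm (y - x))^2" using W by (simp add: weight_fn_def)
  then have "W y * \<bar>q y\<bar> <= (2 * W x + 2 * (norm (y - x))^2) * \<bar>q y\<bar>" by (rule mult_right_mono) simp
  then have "ennreal (W y * \<bar>q y\<bar>) <= ennreal (2 * W x * \<bar>q y\<bar> + 2 * ((norm (y - x))^2 * \<bar>q y\<bar>))"
   by (intro ennreal_leI) (simp add: algebra_simps)
  also have "... = ennreal (2 * W x) * ennreal \<bar>q y\<bar> + 2 * ennreal ((norm (y - x))^2 * \<bar>q y\<bar>)"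
   using W1 by (simp add: ennreal_plus ennreal_mult)
  finally show ?case .
 qed
 also have "... = ennreal (2 * W x) * (CS y:S. ennreal \<bar>q y\<bar>) + 2 * (CS y:S. ennreal ((norm (y - x))^2 * \<bar>q y\<bar>))"
  by (subst nn_integral_add) (auto simp: nn_integral_cmult)
 also have "... <= ennreal (2 * W x) * ennreal (2 * B) + 2 * ennreal (eps^2)"
  by (intro add_mono mult_left_mono rate_row_abs[OF r x] rate_row_moment[OF r]) auto
 also have "... = ennreal (4 * B * W x + 2 * eps^2)"
  using W1 B0 by (simp add: ennreal_plus ennreal_mult[symmetric] mult_ac flip: ennreal_numeral)
 also have "... <= ennreal ((4 * B + 2) * W x)"
 proof (rule ennreal_leI)
  have "eps^2 <= 1" using eps by (simp add: power_le_one)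
  then show "4 * B * W x + 2 * eps^2 <= (4 * B + 2) * W x" using W1 by (simp add: algebra_simps)
 qed
 finally show ?thesis .
qed

lemma rate_row_zero: "0 <= B ==> rate_row S B eps x (%_. 0)"
 by (simp add: rate_row_def)

section \<open>Linear Kolmogorov equations with bounded rates\<close>

lemma mean_rate:
 fixes rho :: "real => 'a::euclidean_space => real"
 assumes S: "countable S" and x: "x : S" and m: "!!y. y : S ==> (%v. rho v y) : bmeas U01"
  and r: "!!v. rate_row S B eps x (rho v)" and eps: "0 < eps" "eps <= 1"
 shows "y : S ==> integrable U01 (%v. rho v y)" "y : S ==> \<bar>(LINT v|U01. rho v y)\<bar> <= B"
  "weight_fn W ==> (CS y:S. ennreal (W y * \<bar>(LINT v|U01. rho v y)\<bar>)) <= ennreal ((4 * B + 2) * W x)"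
proof -
 interpret V: prob_space U01 by (rule prob_space_U01)
 have b: "\<bar>rho v y\<bar> <= B" if "y : S" for v y using r[of v] that by (simp add: rate_row_def)
 show i: "integrable U01 (%v. rho v y)" if y: "y : S" for y
  by (rule V.integrable_const_bound[of _ B]) (use b[OF y] m[OF y] in auto)
 show "\<bar>(LINT v|U01. rho v y)\<bar> <= B" if y: "y : S" for y
 proof -
  have "\<bar>(LINT v|U01. rho v y)\<bar> <= (LINT v|U01. \<bar>rho v y\<bar>)" using integral_norm_bound[of U01 "%v. rho v y"] by simp
  also have "... <= B" by (rule V.integral_le_const) (use i[OF y] b[OF y] in auto)
  finally show ?thesis .
 qed
 assume W: "weight_fn W"
 have W1: "1 <= W y" for y using W by (simp add: weight_fn_def)
 then have W0: "0 <= W y" for y using order_trans[OF zero_le_one] by blast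
 have "(CS y:S. ennreal (W y * \<bar>(LINT v|U01. rho v y)\<bar>)) <= (CS y:S. (NN v:U01. ennreal (W y * \<bar>rho v y\<bar>)))"
 proof (rule nn_integral_mono, goal_cases)
  case (1 y)
  then have y: "y : S" by simp
  have "ennreal (W y * \<bar>(LINT v|U01. rho v y)\<bar>) = ennreal (W y) * ennreal (norm (LINT v|U01. rho v y))" using W0 by (simp add: ennreal_mult)
  also have "... <= ennreal (W y) * (NN v:U01. ennreal (norm (rho v y)))"
   by (intro mult_left_mono integral_norm_bound_ennreal i[OF y]) auto
  also have "... = (NN v:U01. ennreal (W y * \<bar>rho v y\<bar>))"
   using m[OF y] W0 by (subst nn_integral_cmult[symmetric]) (auto simp: ennreal_mult)
  finally show ?case .
 qed
 also have "... = (NN v:U01. (CS y:S. ennreal (W y * \<bar>rho v y\<bar>)))"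
  by (rule swap_CS[OF S]) (use m in measurable)
 also have "... <= (NN v:U01. ennreal ((4 * B + 2) * W x))"
  by (intro nn_integral_mono rate_row_weight[OF r x W eps])
 also have "... = ennreal ((4 * B + 2) * W x)" by (simp add: V.emeasure_space_1 del: space_lebesgue_on_interval)
 finally show "(CS y:S. ennreal (W y * \<bar>(LINT v|U01. rho v y)\<bar>)) <= ennreal ((4 * B + 2) * W x)" .
qed

text \<open>By Tonelli, the row bound A W(x) means that the rates act on weighted l^1 with norm at
  most A, also under the time integral.\<close>

lemma weighted_integral_swap:
 fixes a :: "real => 'a => real" and qb :: "'a => 'a => real => real"
 assumes S: "countable S" and qm: "!!x y. x : S ==> y : S ==> qb x y : bmeas borel"
  and am: "!!x. x : S ==> (%tau. ind I tau * a tau x) : bmeas borel" and I: "I : sets borel"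
  and W0: "!!y. 0 <= W y" and A: "0 <= A"
  and qw: "!!x tau. x : S ==> (CS y:S. ennreal (W y * \<bar>qb x y tau\<bar>)) <= ennreal (A * W x)"
 shows "(CS y:S. ennreal (W y) * (NN tau:lborel|I. (CS x:S. ennreal (\<bar>a tau x\<bar> * \<bar>qb x y tau\<bar>))))
  <= (NN tau:lborel|I. ennreal A * (CS x:S. ennreal (W x * \<bar>a tau x\<bar>)))"
proof -
 define b where "b tau x = ind I tau * a tau x" for tau x
 have bm[measurable]: "(%tau. b tau x) : bmeas borel" if "x : S" for x using am[OF that] by (simp add: b_def)
 have m1: "(%tau. ennreal (\<bar>b tau x\<bar> * \<bar>qb x y tau\<bar>)) : bmeas lborel" if "x : S" "y : S" for x y
  using bm[OF that(1)] qm[OF that] by measurable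
 have m2: "(%tau. (CS x:S. ennreal (\<bar>b tau x\<bar> * \<bar>qb x y tau\<bar>))) : bmeas lborel" if y: "y : S" for y
 proof (rule sigma_finite_measure.borel_measurable_nn_integral[OF sigma_finite_measure_count_space_countable[OF S]])
  have "(%z. ennreal (\<bar>b (snd z) (fst z)\<bar> * \<bar>qb (fst z) y (snd z)\<bar>)) : bmeas (count_space S *M lborel)"
   by (rule measurable_pair_measure_countable1[OF S]) (use m1[OF _ y] in simp)
  then have "(%(z, tau). ennreal (\<bar>b tau z\<bar> * \<bar>qb z y tau\<bar>)) : bmeas (count_space S *M lborel)" by (simp add: case_prod_unfold)
  from measurable_pair_swap[OF this] show "(%(tau, z). ennreal (\<bar>b tau z\<bar> * \<bar>qb z y tau\<bar>)) : bmeas (lborel *M count_space S)"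
   by (simp add: case_prod_unfold)
 qed
 have "(CS y:S. ennreal (W y) * (NN tau:lborel|I. (CS x:S. ennreal (\<bar>a tau x\<bar> * \<bar>qb x y tau\<bar>))))
  = (CS y:S. (NN tau:lborel. (CS x:S. ennreal (W y) * ennreal (\<bar>b tau x\<bar> * \<bar>qb x y tau\<bar>))))"
 proof (rule nn_integral_cong, goal_cases)
  case (1 y)
  then have y: "y : S" by simp
  have "(NN tau:lborel|I. (CS x:S. ennreal (\<bar>a tau x\<bar> * \<bar>qb x y tau\<bar>))) = (NN tau:lborel. (CS x:S. ennreal (\<bar>b tau x\<bar> * \<bar>qb x y tau\<bar>)))"
   by (intro nn_integral_cong) (auto simp: b_def split: split_indicator)
  then show ?case
   using m2[OF y] by (simp add: nn_integral_cmult)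
 qed
 also have "... = (NN tau:lborel. (CS y:S. (CS x:S. ennreal (W y) * ennreal (\<bar>b tau x\<bar> * \<bar>qb x y tau\<bar>))))"
  by (rule swap_CS[OF S]) (use m2 in \<open>simp add: nn_integral_cmult\<close>)
 also have "... = (NN tau:lborel. (CS x:S. (CS y:S. ennreal (W y) * ennreal (\<bar>b tau x\<bar> * \<bar>qb x y tau\<bar>))))"
  by (intro nn_integral_cong swap_CS[OF S]) simp
 also have "... <= (NN tau:lborel. (CS x:S. ennreal \<bar>b tau x\<bar> * ennreal (A * W x)))"
 proof (intro nn_integral_mono)
  fix tau x assume "x : space (count_space S)"
  then have x: "x : S" by simp
  have "(CS y:S. ennreal (W y) * ennreal (\<bar>b tau x\<bar> * \<bar>qb x y tau\<bar>)) = (CS y:S. ennreal \<bar>b tau x\<bar> * ennreal (W y * \<bar>qb x y tau\<bar>))"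
   using W0 by (intro nn_integral_cong) (simp add: mult_ac flip: ennreal_mult)
  also have "... = ennreal \<bar>b tau x\<bar> * (CS y:S. ennreal (W y * \<bar>qb x y tau\<bar>))" by (rule nn_integral_cmult) simp
  also have "... <= ennreal \<bar>b tau x\<bar> * ennreal (A * W x)" by (intro mult_left_mono qw[OF x]) simp
  finally show "(CS y:S. ennreal (W y) * ennreal (\<bar>b tau x\<bar> * \<bar>qb x y tau\<bar>)) <= ennreal \<bar>b tau x\<bar> * ennreal (A * W x)" .
 qed
 also have "... = (NN tau:lborel|I. ennreal A * (CS x:S. ennreal (W x * \<bar>a tau x\<bar>)))"
 proof (rule nn_integral_cong, goal_cases)
  case (1 tau)
  have "(CS x:S. ennreal \<bar>b tau x\<bar> * ennreal (A * W x)) = (CS x:S. (ennreal A * ind I tau) * ennreal (W x * \<bar>a tau x\<bar>))"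
   using W0 A by (intro nn_integral_cong) (auto simp: b_def mult_ac abs_mult ennreal_mult split: split_indicator)
  also have "... = (ennreal A * ind I tau) * (CS x:S. ennreal (W x * \<bar>a tau x\<bar>))" by (rule nn_integral_cmult) simp
  finally show ?case
   by (simp add: mult_ac)
 qed
 finally show ?thesis .
qed

text \<open>Inserting a known chain motion into the rates leaves a linear equation with given
  coefficients \<open>qb\<close>; in this form the motion can be compared with an Euler scheme for
  the same coefficients.\<close>

locale linear_chain =
 fixes S :: "'a::euclidean_space set" and B s r :: real and qb :: "'a => 'a => real => real" and mu :: "real => 'a => real"
 assumes S: "countable S" and B: "1 <= B" and sr: "s <= r"
  and qm: "!!x y. x : S ==> y : S ==> qb x y : bmeas borel"
  and qB: "!!x y tau. x : S ==> y : S ==> \<bar>qb x y tau\<bar> <= B"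
  and qw: "!!W x tau. weight_fn W ==> x : S ==> (CS y:S. ennreal (W y * \<bar>qb x y tau\<bar>)) <= ennreal ((4 * B + 2) * W x)"
  and muS: "!!t. t : {s..r} ==> mu t : Sigma2 S"
  and Fi: "!!y. y : S ==> set_integrable lborel {s..r} (%tau. (LINT x|count_space S. mu tau x * qb x y tau))"
  and eq: "!!y t. y : S ==> t : {s..r} ==> mu t y = mu s y + (LINT tau:{s..t}|lborel. (LINT x|count_space S. mu tau x * qb x y tau))"
begin

definition "A = 4 * B + 2"

lemma A_pos: "0 < A" using B by (simp add: A_def)

lemma mu_nonneg: "t : {s..r} ==> 0 <= mu t x"
 using muS[of t] by (auto simp: Sigma2_def Sigma1_def)

lemma mu_sum: "t : {s..r} ==> (CS x:S. ennreal (mu t x)) = 1"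
 using muS[of t] by (intro Sigma_nn_integral) (simp add: Sigma2_def)

lemma sum_abs_rate:
 assumes t: "t : {s..r}" and y: "y : S"
 shows "(CS x:S. ennreal (\<bar>mu t x\<bar> * \<bar>qb x y tau\<bar>)) <= ennreal B"
proof -
 have "(CS x:S. ennreal (\<bar>mu t x\<bar> * \<bar>qb x y tau\<bar>)) <= (CS x:S. ennreal B * ennreal (mu t x))"
 proof (rule nn_integral_mono, goal_cases)
  case (1 x)
  then have "\<bar>mu t x\<bar> * \<bar>qb x y tau\<bar> <= mu t x * B" using qB[OF _ y, of x tau] mu_nonneg[OF t, of x] by (simp add: mult_left_mono)
  then show ?case
   using B mu_nonneg[OF t, of x] by (simp add: mult.commute flip: ennreal_mult)
 qed
 also have "... = ennreal B" using mu_sum[OF t] by (simp add: nn_integral_cmult)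
 finally show ?thesis .
qed

lemma integrable_rate:
 assumes t: "t : {s..r}" and y: "y : S"
 shows "integrable (count_space S) (%x. mu t x * qb x y tau)"
 by (rule integrable_count_space_ennreal)
  (use le_less_trans[OF sum_abs_rate[OF t y, of tau] ennreal_less_top] in \<open>simp add: abs_mult\<close>)

lemma abs_drift:
 assumes t: "t : {s..r}" and y: "y : S"
 shows "ennreal \<bar>(LINT x|count_space S. mu t x * qb x y tau)\<bar> <= (CS x:S. ennreal (\<bar>mu t x\<bar> * \<bar>qb x y tau\<bar>))"
 using integral_norm_bound_ennreal[OF integrable_rate[OF t y, of tau]] by (simp add: abs_mult)

lemma increment_abs:
 assumes t: "t : {s..r}" and y: "y : S"
 shows "ennreal \<bar>mu t y - mu s y\<bar> <= (NN tau:lborel|{s..t}. (CS x:S. ennreal (\<bar>mu tau x\<bar> * \<bar>qb x y tau\<bar>)))"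
proof -
 have "set_integrable lborel {s..t} (%tau. (LINT x|count_space S. mu tau x * qb x y tau))"
  by (rule set_integrable_subset[OF Fi[OF y]]) (use t in auto)
 then have "ennreal (norm (LINT tau:{s..t}|lborel. (LINT x|count_space S. mu tau x * qb x y tau)))
  <= (NN tau:lborel. ennreal (norm (ind {s..t} tau *\<^sub>R (LINT x|count_space S. mu tau x * qb x y tau))))"
  unfolding set_integrable_def set_lebesgue_integral_def by (rule integral_norm_bound_ennreal)
 also have "... <= (NN tau:lborel|{s..t}. (CS x:S. ennreal (\<bar>mu tau x\<bar> * \<bar>qb x y tau\<bar>)))"
  by (intro nn_integral_mono) (use abs_drift[OF _ y] t in \<open>auto split: split_indicator\<close>)
 finally show ?thesis using eq[OF y t] by simp
qed

lemma increment_lipschitz: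
 assumes t: "t : {s..r}" and t': "t' : {s..r}" and y: "y : S"
 shows "\<bar>mu t y - mu t' y\<bar> <= B * \<bar>t - t'\<bar>"
proof -
 have *: "\<bar>mu t y - mu t' y\<bar> <= B * (t - t')" if t: "t : {s..r}" and t': "t' : {s..r}" and "t' <= t" for t t'
 proof -
  let ?F = "%tau. (LINT x|count_space S. mu tau x * qb x y tau)"
  have i: "set_integrable lborel {s..t} ?F" "set_integrable lborel {s..t'} ?F"
   by (rule set_integrable_subset[OF Fi[OF y]]; use t t' in auto)+
  have "mu t y - mu t' y = (LINT tau|lborel. ind {s..t} tau *\<^sub>R ?F tau - ind {s..t'} tau *\<^sub>R ?F tau)"
   using eq[OF y t] eq[OF y t'] i unfolding set_integrable_def set_lebesgue_integral_def
   by (subst Bochner_Integration.integral_diff) auto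
  then have "ennreal \<bar>mu t y - mu t' y\<bar> <= (NN tau:lborel. ennreal (norm (ind {s..t} tau *\<^sub>R ?F tau - ind {s..t'} tau *\<^sub>R ?F tau)))"
   using integral_norm_bound_ennreal[of lborel "%tau. ind {s..t} tau *\<^sub>R ?F tau - ind {s..t'} tau *\<^sub>R ?F tau"] i
   unfolding set_integrable_def by simp
  also have "... <= (NN tau:lborel. ennreal B * ind {t'<..t} tau)"
  proof (rule nn_integral_mono, goal_cases)
   case (1 tau)
   have "\<bar>?F tau\<bar> <= B" if "tau : {s..t}"
   proof -
    have "ennreal \<bar>?F tau\<bar> <= ennreal B" using abs_drift[of tau y tau] sum_abs_rate[of tau y tau] that t y by (meson atLeastAtMost_iff order_trans)
    then show ?thesis using B by (simp add: ennreal_le_iff)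
   qed
   then show ?case
    using \<open>t' <= t\<close> by (auto split: split_indicator intro!: ennreal_leI)
  qed
  also have "... = ennreal (B * (t - t'))" using B \<open>t' <= t\<close> by (simp add: nn_integral_cmult_indicator ennreal_mult)
  finally show ?thesis using B \<open>t' <= t\<close> by (simp add: ennreal_le_iff)
 qed
 show ?thesis using *[OF t t'] *[OF t' t] by (cases "t' <= t") (auto simp: abs_minus_commute)
qed

lemma mu_measurable:
 assumes x: "x : S"
 shows "(%tau. ind {s..r} tau * mu tau x) : bmeas borel"
proof -
 have "B-lipschitz_on {s..r} (%tau. mu tau x)"
  by (rule lipschitz_onI) (use increment_lipschitz[OF _ _ x] B in \<open>auto simp: dist_real_def\<close>)
 then have "continuous_on {s..r} (%tau. mu tau x)" by (rule lipschitz_on_continuous_on)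
 then have "(%tau. mu tau x) : bmeas (restrict_space borel {s..r})" by (rule borel_measurable_continuous_on_restrict)
 then show ?thesis by (subst (asm) borel_measurable_restrict_space_iff) auto
qed

lemma weighted_increment:
 assumes W: "weight_fn W" and t: "t : {s..r}"
 shows "(CS y:S. ennreal (W y * \<bar>mu t y - mu s y\<bar>))
  <= (NN tau:lborel|{s..t}. ennreal A * (CS x:S. ennreal (W x * \<bar>mu tau x\<bar>)))"
proof -
 have W0: "0 <= W y" for y using W order_trans[OF zero_le_one] unfolding weight_fn_def by blast
 have "(CS y:S. ennreal (W y * \<bar>mu t y - mu s y\<bar>))
  <= (CS y:S. ennreal (W y) * (NN tau:lborel|{s..t}. (CS x:S. ennreal (\<bar>mu tau x\<bar> * \<bar>qb x y tau\<bar>))))"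
  using increment_abs[OF t] W0 by (intro nn_integral_mono) (simp add: ennreal_mult mult_left_mono)
 also have "... <= (NN tau:lborel|{s..t}. ennreal A * (CS x:S. ennreal (W x * \<bar>mu tau x\<bar>)))"
 proof (rule weighted_integral_swap[OF S qm _ _ W0 less_imp_le[OF A_pos]])
  fix x assume x: "x : S"
  have "(%tau. ind {s..t} tau * (ind {s..r} tau * mu tau x)) : bmeas borel"
   using mu_measurable[OF x] by measurable
  moreover have "(%tau. ind {s..t} tau * (ind {s..r} tau * mu tau x)) = (%tau. ind {s..t} tau * mu tau x)"
   using t by (auto simp: fun_eq_iff split: split_indicator)
  ultimately show "(%tau. ind {s..t} tau * mu tau x) : bmeas borel" by simp
  show "(CS y:S. ennreal (W y * \<bar>qb x y tau\<bar>)) <= ennreal (A * W x)" for tau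
   using qw[OF W x] by (simp add: A_def)
 qed auto
 finally show ?thesis .
qed

text \<open>Membership in \<open>Sigma2 S\<close> gives a finite moment at each time but no bound
  over time. Gronwall is therefore applied to the truncated weights \<open>Wn n\<close>, whose
  moments are at most n + 1; the rate A does not depend on n, and monotone convergence removes the
  truncation.\<close>

lemma moment_bound:
 assumes t: "t : {s..r}" and M: "(CS x:S. ennreal (weight x * mu s x)) <= ennreal M" and M0: "0 <= M"
 shows "(CS x:S. ennreal (weight x * mu t x)) <= ennreal (M * exp (A * (t - s)))"
proof -
 define Wn where "Wn n y = min (weight y) (real (Suc n))" for n and y :: 'a
 have Wn: "weight_fn (Wn n)" for n unfolding Wn_def by (rule weight_fn_min[OF weight_fn_weight]) simp
 have Wn0: "0 <= Wn n y" for n y by (simp add: Wn_def weight_def)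
 have bound: "(CS x:S. ennreal (Wn n x * mu t x)) <= ennreal (M * exp (A * (t - s)))" for n
 proof -
  define u where "u t = enn2real (CS x:S. ennreal (Wn n x * mu t x))" for t
  have fin: "(CS x:S. ennreal (Wn n x * mu t x)) <= ennreal (real (Suc n))" if t: "t : {s..r}" for t
  proof -
   have "(CS x:S. ennreal (Wn n x * mu t x)) <= (CS x:S. ennreal (real (Suc n)) * ennreal (mu t x))"
    using mu_nonneg[OF t] by (intro nn_integral_mono) (auto simp: Wn_def ennreal_mult[symmetric] simp del: of_nat_Suc intro!: ennreal_leI mult_right_mono)
   also have "... = ennreal (real (Suc n))" using mu_sum[OF t] by (simp add: nn_integral_cmult)
   finally show ?thesis .
  qed
  have u: "ennreal (u t) = (CS x:S. ennreal (Wn n x * mu t x))" if "t : {s..r}" for t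
   unfolding u_def using le_less_trans[OF fin[OF that] ennreal_less_top] by simp
  have us: "u s <= M"
  proof -
   have "ennreal (u s) <= (CS x:S. ennreal (weight x * mu s x))"
    using sr mu_nonneg[of s] unfolding u[of s, simplified, OF sr]
    by (intro nn_integral_mono ennreal_leI mult_right_mono) (auto simp: Wn_def)
   then have "ennreal (u s) <= ennreal M" using M by (rule order_trans)
   then show ?thesis using M0 by (simp add: ennreal_le_iff)
  qed
  have "u t <= M * exp (A * (t - s))"
  proof (rule gronwall[where M="real (Suc n)" and r=r, OF _ _ M0 less_imp_le[OF A_pos] _ t])
   fix t assume t: "t : {s..r}"
   show "0 <= u t" by (simp add: u_def)
   show "u t <= real (Suc n)" using fin[OF t] by (simp add: u_def enn2real_leI)
   have "ennreal (u t) <= (CS x:S. ennreal (Wn n x * mu s x) + ennreal (Wn n x * \<bar>mu t x - mu s x\<bar>))"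
    unfolding u[OF t]
   proof (rule nn_integral_mono, goal_cases)
    case (1 x)
    have "mu t x <= mu s x + \<bar>mu t x - mu s x\<bar>" by simp
    then have "Wn n x * mu t x <= Wn n x * mu s x + Wn n x * \<bar>mu t x - mu s x\<bar>"
     using mult_left_mono[OF _ Wn0[of n x]] by (simp add: distrib_left[symmetric])
    then show ?case
     using Wn0[of n x] mu_nonneg[of s x] sr by (simp add: ennreal_leI flip: ennreal_plus)
   qed
   also have "... = ennreal (u s) + (CS x:S. ennreal (Wn n x * \<bar>mu t x - mu s x\<bar>))"
    using u[of s] sr by (simp add: nn_integral_add)
   also have "... <= ennreal M + (NN tau:lborel|{s..t}. ennreal A * (CS x:S. ennreal (Wn n x * \<bar>mu tau x\<bar>)))"
    using us by (intro add_mono weighted_increment[OF Wn t] ennreal_leI)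
   also have "(NN tau:lborel|{s..t}. ennreal A * (CS x:S. ennreal (Wn n x * \<bar>mu tau x\<bar>))) = (NN tau:lborel|{s..t}. ennreal (A * u tau))"
   proof (rule nn_integral_cong, goal_cases)
    case (1 tau)
    show ?case
    proof (cases "tau : {s..t}")
     case True
     then have tau: "tau : {s..r}" using t by auto
     have "ennreal (A * u tau) = ennreal A * ennreal (u tau)" using A_pos by (simp add: u_def ennreal_mult)
     then show ?thesis using mu_nonneg[OF tau] unfolding u[OF tau] by simp
    qed simp
   qed
   finally show "ennreal (u t) <= ennreal M + (NN tau:lborel|{s..t}. ennreal (A * u tau))" .
  qed
  then show ?thesis unfolding u[OF t, symmetric] by (rule ennreal_leI)
 qed
 have "(CS x:S. ennreal (weight x * mu t x)) = (CS x:S. (SUP n. ennreal (Wn n x * mu t x)))"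
 proof (rule nn_integral_cong, goal_cases)
  case (1 x)
  obtain k :: nat where k: "weight x <= real k" using real_arch_simple by blast
  have "ennreal (Wn n x * mu t x) <= ennreal (weight x * mu t x)" for n
   using mu_nonneg[OF t, of x] by (intro ennreal_leI mult_right_mono) (auto simp: Wn_def)
  moreover have "ennreal (weight x * mu t x) = ennreal (Wn k x * mu t x)" using k by (simp add: Wn_def min_def)
  ultimately show ?case
   by (intro antisym SUP_least) (auto intro: SUP_upper2[of k])
 qed
 also have "... = (SUP n. (CS x:S. ennreal (Wn n x * mu t x)))"
  using mu_nonneg[OF t] by (intro nn_integral_monotone_convergence_SUP)
   (auto simp: incseq_def le_fun_def Wn_def intro!: ennreal_leI mult_right_mono)
 also have "... <= ennreal (M * exp (A * (t - s)))" by (intro SUP_least bound)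
 finally show ?thesis .
qed

lemma weighted_increment_bound:
 assumes t: "t : {s..r}" and M: "(CS x:S. ennreal (weight x * mu s x)) <= ennreal M" and M0: "0 <= M"
 shows "(CS y:S. ennreal (weight y * \<bar>mu t y - mu s y\<bar>)) <= ennreal (A * (r - s) * (M * exp (A * (r - s))))"
proof -
 let ?M = "M * exp (A * (r - s))"
 have "(NN tau:lborel|{s..t}. ennreal A * (CS x:S. ennreal (weight x * \<bar>mu tau x\<bar>))) <= (NN tau:lborel. ennreal (A * ?M) * ind {s..r} tau)"
 proof (rule nn_integral_mono, goal_cases)
  case (1 tau)
  show ?case
  proof (cases "tau : {s..t}")
   case True
   then have tau: "tau : {s..r}" using t by auto
   have "(CS x:S. ennreal (weight x * \<bar>mu tau x\<bar>)) <= ennreal (M * exp (A * (tau - s)))"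
    using moment_bound[OF tau M M0] mu_nonneg[OF tau] by simp
   also have "... <= ennreal ?M" using tau A_pos M0 by (intro ennreal_leI mult_left_mono) auto
   finally have "ennreal A * (CS x:S. ennreal (weight x * \<bar>mu tau x\<bar>)) <= ennreal A * ennreal ?M" by (rule mult_left_mono) simp
   then show ?thesis using True tau A_pos M0 by (simp add: ennreal_mult)
  qed simp
 qed
 also have "... = ennreal (A * (r - s) * ?M)"
  using A_pos M0 sr by (subst nn_integral_cmult_indicator) (auto simp: ennreal_mult[symmetric] mult_ac)
 finally show ?thesis using weighted_increment[OF weight_fn_weight t] by (rule order_trans[rotated])
qed

lemma euler_distance:
 assumes t: "t : {s..r}" and M: "(CS x:S. ennreal (weight x * mu s x)) <= ennreal M" and M0: "0 <= M"
  and e: "(CS x:S. ennreal (weight x * \<bar>nu x - mu s x\<bar>)) <= ennreal e" and e0: "0 <= e"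
 shows "(CS x:S. ennreal (weight x * \<bar>nu x - mu t x\<bar>)) <= ennreal (e + A * (r - s) * (M * exp (A * (r - s))))"
proof -
 have "(CS x:S. ennreal (weight x * \<bar>nu x - mu t x\<bar>))
  <= (CS x:S. ennreal (weight x * \<bar>nu x - mu s x\<bar>) + ennreal (weight x * \<bar>mu t x - mu s x\<bar>))"
 proof (rule nn_integral_mono, goal_cases)
  case (1 x)
  have "weight x * \<bar>nu x - mu t x\<bar> <= weight x * (\<bar>nu x - mu s x\<bar> + \<bar>mu t x - mu s x\<bar>)"
   by (intro mult_left_mono) (auto simp: weight_def)
  then show ?case
   by (intro ennreal_le_plus) (auto simp: weight_def distrib_left)
 qed
 also have "... = (CS x:S. ennreal (weight x * \<bar>nu x - mu s x\<bar>)) + (CS x:S. ennreal (weight x * \<bar>mu t x - mu s x\<bar>))"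
  by (rule nn_integral_add) auto
 also have "... <= ennreal e + ennreal (A * (r - s) * (M * exp (A * (r - s))))"
  by (intro add_mono e weighted_increment_bound[OF t M M0])
 also have "... = ennreal (e + A * (r - s) * (M * exp (A * (r - s))))"
  using e0 A_pos sr M0 by (intro ennreal_plus[symmetric]) auto
 finally show ?thesis .
qed

text \<open>The increments of the Euler scheme and of mu differ by the time integral of (nu - mu
  tau) applied to the rates. In the weighted norm this costs A (r - s) times the bound of
  \<open>euler_distance\<close>, so that, apart from the propagated e, the error is quadratic in r -
  s.\<close>

lemma euler_step:
 assumes M: "(CS x:S. ennreal (weight x * mu s x)) <= ennreal M" and M0: "0 <= M"
  and e: "(CS x:S. ennreal (weight x * \<bar>nu x - mu s x\<bar>)) <= ennreal e" and e0: "0 <= e"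
  and nu: "!!x. x : S ==> 0 <= nu x" "(CS x:S. ennreal (nu x)) = 1"
  and nu': "!!y. y : S ==> nu' y = nu y + (LINT x|count_space S. nu x * (LINT tau:{s..r}|lborel. qb x y tau))"
 shows "(CS y:S. ennreal (weight y * \<bar>nu' y - mu r y\<bar>))
  <= ennreal (e + A * (r - s) * (e + A * (r - s) * (M * exp (A * (r - s)))))"
proof -
 let ?c = "A * (r - s) * (M * exp (A * (r - s)))"
 have c0: "0 <= ?c" using A_pos sr M0 by simp
 have w0: "0 <= weight y" for y :: 'a by (simp add: weight_def)
 interpret CL: pair_sigma_finite "count_space S" lborel
  by (intro pair_sigma_finite.intro sigma_finite_measure_count_space_countable S sigma_finite_lborel)
 have dm: "(%tau. ind {s..r} tau * (nu x - mu tau x)) : bmeas borel" if x: "x : S" for x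
 proof -
  have "(%tau. ind {s..r} tau * nu x - ind {s..r} tau * mu tau x) : bmeas borel"
   using mu_measurable[OF x] by measurable
  then show ?thesis by (simp add: right_diff_distrib)
 qed
 have pt: "ennreal \<bar>nu' y - mu r y\<bar> <= ennreal \<bar>nu y - mu s y\<bar> + (NN tau:lborel|{s..r}. (CS x:S. ennreal (\<bar>nu x - mu tau x\<bar> * \<bar>qb x y tau\<bar>)))"
  if y: "y : S" for y
 proof -
  let ?h = "%x tau. ind {s..r} tau * (nu x * qb x y tau)"
  have hm: "?h x : bmeas lborel" if "x : S" for x using qm[OF that y] by measurable
  have hjm: "case_prod ?h : bmeas (count_space S *M lborel)"
   by (rule measurable_pair_measure_countable1[OF S]) (use hm in simp)
  have hint: "integrable (count_space S *M lborel) (case_prod ?h)"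
  proof (rule integrableI_bounded[OF hjm])
   have "(NN z:(count_space S *M lborel). ennreal (norm (case_prod ?h z))) = (CS x:S. (NN tau:lborel. ennreal (norm (?h x tau))))"
    using lborel.nn_integral_fst[of "%z. ennreal (norm (case_prod ?h z))" "count_space S"] hjm by simp
   also have "... <= (CS x:S. (NN tau:lborel. ennreal (nu x * B) * ind {s..r} tau))"
   proof (intro nn_integral_mono)
    fix x tau assume "x : space (count_space S)"
    then have x: "x : S" by simp
    have "\<bar>nu x * qb x y tau\<bar> <= nu x * B" using qB[OF x y, of tau] nu(1)[OF x] by (simp add: abs_mult mult_left_mono)
    then show "ennreal (norm (?h x tau)) <= ennreal (nu x * B) * ind {s..r} tau"
     by (auto split: split_indicator intro: ennreal_leI)
   qed
   also have "... = (CS x:S. ennreal (B * (r - s)) * ennreal (nu x))"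
    using nu(1) B sr by (intro nn_integral_cong) (simp add: nn_integral_cmult_indicator ennreal_mult[symmetric] mult_ac)
   also have "... = ennreal (B * (r - s))" by (simp add: nn_integral_cmult nu(2))
   finally show "(NN z:(count_space S *M lborel). ennreal (norm (case_prod ?h z))) < \<infinity>"
    by (rule le_less_trans) simp
  qed
  have "(LINT x|count_space S. nu x * (LINT tau:{s..r}|lborel. qb x y tau)) = (LINT x|count_space S. (LINT tau|lborel. ?h x tau))"
   unfolding set_lebesgue_integral_def by (simp add: mult.left_commute)
  also have "... = (LINT tau|lborel. (LINT x|count_space S. ?h x tau))"
   by (rule CL.Fubini_integral[OF hint, symmetric])
  finally have F1: "(LINT x|count_space S. nu x * (LINT tau:{s..r}|lborel. qb x y tau)) = (LINT tau|lborel. (LINT x|count_space S. ?h x tau))" .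
  have i1: "integrable lborel (%tau. (LINT x|count_space S. ?h x tau))"
   by (rule CL.integrable_snd[OF hint])
  have i2: "integrable lborel (%tau. ind {s..r} tau *\<^sub>R (LINT x|count_space S. mu tau x * qb x y tau))"
   using Fi[OF y] by (simp add: set_integrable_def)
  have nui: "integrable (count_space S) (%x. nu x * qb x y tau)" for tau
  proof (rule integrable_count_space_ennreal)
   have "(CS x:S. ennreal \<bar>nu x * qb x y tau\<bar>) <= (CS x:S. ennreal B * ennreal (nu x))"
   proof (rule nn_integral_mono, goal_cases)
    case (1 x)
    then have x: "x : S" by simp
    have "\<bar>nu x * qb x y tau\<bar> <= B * nu x" using mult_right_mono[OF qB[OF x y, of tau] nu(1)[OF x]] nu(1)[OF x] by (simp add: abs_mult mult.commute)
    then show ?case using B nu(1)[OF x] by (simp add: ennreal_leI flip: ennreal_mult)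
   qed
   also have "... < \<infinity>" by (simp add: nn_integral_cmult nu(2))
   finally show "(CS x:S. ennreal \<bar>nu x * qb x y tau\<bar>) < \<infinity>" .
  qed
  have "nu' y - mu r y = (nu y - mu s y) + (LINT tau|lborel. (LINT x|count_space S. ?h x tau) - ind {s..r} tau *\<^sub>R (LINT x|count_space S. mu tau x * qb x y tau))"
   using nu'[OF y] eq[OF y, of r] sr F1 i1 i2 by (simp add: Bochner_Integration.integral_diff set_lebesgue_integral_def)
  then have "ennreal \<bar>nu' y - mu r y\<bar> <= ennreal \<bar>nu y - mu s y\<bar> + ennreal \<bar>(LINT tau|lborel. (LINT x|count_space S. ?h x tau) - ind {s..r} tau *\<^sub>R (LINT x|count_space S. mu tau x * qb x y tau))\<bar>"
   by (intro ennreal_le_plus) auto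
  also have "ennreal \<bar>(LINT tau|lborel. (LINT x|count_space S. ?h x tau) - ind {s..r} tau *\<^sub>R (LINT x|count_space S. mu tau x * qb x y tau))\<bar>
   <= (NN tau:lborel. ennreal (norm ((LINT x|count_space S. ?h x tau) - ind {s..r} tau *\<^sub>R (LINT x|count_space S. mu tau x * qb x y tau))))"
   using integral_norm_bound_ennreal[OF Bochner_Integration.integrable_diff[OF i1 i2]] by simp
  also have "... <= (NN tau:lborel|{s..r}. (CS x:S. ennreal (\<bar>nu x - mu tau x\<bar> * \<bar>qb x y tau\<bar>)))"
  proof (rule nn_integral_mono, goal_cases)
   case (1 tau)
   show ?case
   proof (cases "tau : {s..r}")
    case True
    note mi = integrable_rate[OF True y, of tau]
    have "(LINT x|count_space S. ?h x tau) - ind {s..r} tau *\<^sub>R (LINT x|count_space S. mu tau x * qb x y tau)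
     = (LINT x|count_space S. nu x * qb x y tau - mu tau x * qb x y tau)"
     using True nui[of tau] mi by (simp add: Bochner_Integration.integral_diff)
    also have "ennreal (norm ...) <= (CS x:S. ennreal (norm (nu x * qb x y tau - mu tau x * qb x y tau)))"
     by (rule integral_norm_bound_ennreal[OF Bochner_Integration.integrable_diff[OF nui mi]])
    also have "... = (CS x:S. ennreal (\<bar>nu x - mu tau x\<bar> * \<bar>qb x y tau\<bar>))"
     by (simp add: left_diff_distrib[symmetric] abs_mult)
    finally show ?thesis using True by simp
   qed simp
  qed
  finally show ?thesis by (simp add: add_left_mono)
 qed
 have "(CS y:S. ennreal (weight y * \<bar>nu' y - mu r y\<bar>))
  <= (CS y:S. ennreal (weight y * \<bar>nu y - mu s y\<bar>) + ennreal (weight y) * (NN tau:lborel|{s..r}. (CS x:S. ennreal (\<bar>nu x - mu tau x\<bar> * \<bar>qb x y tau\<bar>))))"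
 proof (rule nn_integral_mono, goal_cases)
  case (1 y)
  then have y: "y : S" by simp
  show ?case
   using mult_left_mono[OF pt[OF y], of "ennreal (weight y)"] w0[of y] by (simp add: ennreal_mult distrib_left)
 qed
 also have "... = (CS y:S. ennreal (weight y * \<bar>nu y - mu s y\<bar>))
  + (CS y:S. ennreal (weight y) * (NN tau:lborel|{s..r}. (CS x:S. ennreal (\<bar>nu x - mu tau x\<bar> * \<bar>qb x y tau\<bar>))))"
  by (rule nn_integral_add) auto
 also have "... <= ennreal e + (NN tau:lborel|{s..r}. ennreal A * (CS x:S. ennreal (weight x * \<bar>nu x - mu tau x\<bar>)))"
  by (intro add_mono e weighted_integral_swap[where a="%tau x. nu x - mu tau x", OF S qm dm _ w0 less_imp_le[OF A_pos]])
   (use qw[OF weight_fn_weight] in \<open>auto simp: A_def\<close>)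
 also have "(NN tau:lborel|{s..r}. ennreal A * (CS x:S. ennreal (weight x * \<bar>nu x - mu tau x\<bar>))) <= (NN tau:lborel. ennreal (A * (e + ?c)) * ind {s..r} tau)"
 proof (rule nn_integral_mono, goal_cases)
  case (1 tau)
  show ?case
  proof (cases "tau : {s..r}")
   case True
   have "ennreal A * (CS x:S. ennreal (weight x * \<bar>nu x - mu tau x\<bar>)) <= ennreal A * ennreal (e + ?c)"
    by (intro mult_left_mono euler_distance[OF True M M0 e e0]) simp
   then show ?thesis using True A_pos e0 c0 by (simp add: ennreal_mult)
  qed simp
 qed
 also have "... = ennreal (A * (r - s) * (e + ?c))"
  using A_pos e0 c0 sr by (subst nn_integral_cmult_indicator) (auto simp: ennreal_mult[symmetric] mult_ac)
 also have "ennreal e + ... = ennreal (e + A * (r - s) * (e + ?c))"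
  using A_pos e0 c0 sr by (intro ennreal_plus[symmetric]) auto
 finally show ?thesis by (simp add: add_left_mono)
qed

end

section \<open>Chain motions as linear equations\<close>

lemma Sigma_integrable:
 fixes mu q :: "'a::euclidean_space => real"
 assumes mu: "mu : Sigma1 S" and q: "!!x. x : S ==> \<bar>q x\<bar> <= B"
 shows "integrable (count_space S) (%x. mu x * q x)" "\<bar>(LINT x|count_space S. mu x * q x)\<bar> <= B"
  "(%x. mu x * q x) summable_on S" "(\<Sum>\<^sub>\<infinity>x\<in>S. mu x * q x) = (LINT x|count_space S. mu x * q x)"
proof -
 have m0: "0 <= mu x" for x using mu by (simp add: Sigma1_def)
 obtain x where x: "x : S" using mu infsumI[of mu S 1] by (cases "S = {}") (auto simp: Sigma1_def)
 have B0: "0 <= B" using q[OF x] by linarith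
 have le: "(CS x:S. ennreal \<bar>mu x * q x\<bar>) <= ennreal B"
 proof -
  have "(CS x:S. ennreal \<bar>mu x * q x\<bar>) <= (CS x:S. ennreal B * ennreal (mu x))"
  proof (rule nn_integral_mono, goal_cases)
   case (1 x)
   then have "\<bar>mu x * q x\<bar> <= mu x * B" using q[of x] m0[of x] by (simp add: abs_mult mult_left_mono)
   then show ?case using B0 m0[of x] by (simp add: ennreal_leI mult.commute flip: ennreal_mult)
  qed
  also have "... = ennreal B" by (simp add: nn_integral_cmult Sigma_nn_integral[OF mu])
  finally show ?thesis .
 qed
 show i: "integrable (count_space S) (%x. mu x * q x)"
  by (rule integrable_count_space_ennreal) (rule le_less_trans[OF le], simp)
 have "ennreal \<bar>(LINT x|count_space S. mu x * q x)\<bar> <= ennreal B"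
  using order_trans[OF integral_norm_bound_ennreal[OF i]] le by simp
 then show "\<bar>(LINT x|count_space S. mu x * q x)\<bar> <= B" using B0 by simp
 have a: "Infinite_Set_Sum.abs_summable_on (%x. mu x * q x) S" using i by (simp add: Infinite_Set_Sum.abs_summable_on_def)
 then show "(%x. mu x * q x) summable_on S" by (metis abs_summable_equivalent abs_summable_summable)
 show "(\<Sum>\<^sub>\<infinity>x\<in>S. mu x * q x) = (LINT x|count_space S. mu x * q x)"
  using infsetsum_infsum[OF a] by (simp add: infsetsum_def)
qed

lemma borel_measurable_countable_integral:
 fixes f :: "'a => 'b => real"
 assumes S: "countable S" and f: "!!x. x : S ==> f x : bmeas M"
 shows "(%tau. (LINT x|count_space S. f x tau)) : bmeas M"
proof -
 have "(%(x, tau). f x tau) : bmeas (count_space S *M M)"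
  by (rule measurable_pair_measure_countable1[OF S]) (use f in simp)
 from measurable_pair_swap[OF this] have "(%(tau, x). f x tau) : bmeas (M *M count_space S)"
  by (simp add: case_prod_unfold)
 then show ?thesis
  by (rule sigma_finite_measure.borel_measurable_lebesgue_integral[OF sigma_finite_measure_count_space_countable[OF S]])
qed

text \<open>The upper limit moves into the integrand as an indicator, which makes measurability in t
  that of an integral with a parameter.\<close>

lemma indefinite_integral_measurable:
 fixes F :: "real => real"
 assumes F: "set_integrable lborel {s..r} F" and mu: "!!t. t : {s..r} ==> mu t = c + (LINT tau:{s..t}|lborel. F tau)"
 shows "(%t. ind {s..r} t * mu t) : bmeas borel"
proof -
 have Fm[measurable]: "(%tau. ind {s..r} tau * F tau) : bmeas borel"
  using F by (simp add: set_integrable_def)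
 have "(%t. (LINT tau|lborel. (if s <= tau & tau <= t then 1 else 0) * (ind {s..r} tau * F tau))) : bmeas borel"
  by (rule lborel.borel_measurable_lebesgue_integral) measurable
 then have "(%t. ind {s..r} t * (c + (LINT tau|lborel. (if s <= tau & tau <= t then 1 else 0) * (ind {s..r} tau * F tau)))) : bmeas borel"
  by measurable
 also have "(%t. ind {s..r} t * (c + (LINT tau|lborel. (if s <= tau & tau <= t then 1 else 0) * (ind {s..r} tau * F tau))))
  = (%t. ind {s..r} t * mu t)"
 proof
  fix t
  have "(LINT tau|lborel. (if s <= tau & tau <= t then 1 else 0) * (ind {s..r} tau * F tau)) = (LINT tau:{s..t}|lborel. F tau)" if "t : {s..r}"
   unfolding set_lebesgue_integral_def by (rule Bochner_Integration.integral_cong) (use that in \<open>auto split: split_indicator\<close>)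
  then show "ind {s..r} t * (c + (LINT tau|lborel. (if s <= tau & tau <= t then 1 else 0) * (ind {s..r} tau * F tau))) = ind {s..r} t * mu t"
   using mu[of t] by (cases "t : {s..r}") auto
 qed
 finally show ?thesis .
qed

lemma drift_integrable:
 fixes q :: "'a::euclidean_space => real => real"
 assumes S: "countable S" and mu: "!!t. t : {s..r} ==> mu t : Sigma1 S"
  and m: "!!x. x : S ==> (%t. ind {s..r} t * mu t x) : bmeas borel"
  and q: "!!x. x : S ==> (%t. ind {s..r} t * q x t) : bmeas borel"
  and B: "!!x t. x : S ==> t : {s..r} ==> \<bar>q x t\<bar> <= B"
 shows "set_integrable lborel {s..r} (%tau. (LINT x|count_space S. mu tau x * q x tau))"
proof -
 have "(%tau. (LINT x|count_space S. (ind {s..r} tau * mu tau x) * (ind {s..r} tau * q x tau))) : bmeas borel"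
  by (intro borel_measurable_countable_integral[OF S] borel_measurable_times m q)
 moreover have "(%tau. (LINT x|count_space S. (ind {s..r} tau * mu tau x) * (ind {s..r} tau * q x tau))) = (%tau. ind {s..r} tau *\<^sub>R (LINT x|count_space S. mu tau x * q x tau))"
  by (auto split: split_indicator)
 ultimately have mm: "(%tau. ind {s..r} tau *\<^sub>R (LINT x|count_space S. mu tau x * q x tau)) : bmeas lborel" by simp
 have "integrable lborel (%tau. ind {s..r} tau *\<^sub>R (LINT x|count_space S. mu tau x * q x tau))"
 proof (rule Bochner_Integration.integrable_bound[OF _ mm])
  show "integrable lborel (%tau. ind {s..r} tau *\<^sub>R B)" using emeasure_compact_finite[OF compact_Icc, of s r] by (intro integrable_scaleR_left) simp
  show "AE tau in lborel. norm (ind {s..r} tau *\<^sub>R (LINT x|count_space S. mu tau x * q x tau)) <= norm (ind {s..r} tau *\<^sub>R B)"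
  proof (rule AE_I2, goal_cases)
   case (1 tau)
   show ?case
   proof (cases "tau : {s..r}")
    case True
    have "\<bar>(LINT x|count_space S. mu tau x * q x tau)\<bar> <= B" by (rule Sigma_integrable(2)[OF mu[OF True]]) (use B True in auto)
    then show ?thesis using True by simp
   qed simp
  qed
 qed
 then show ?thesis by (simp add: set_integrable_def)
qed

lemma LINT_Ioc:
 fixes F :: "real => real"
 assumes F: "set_integrable lborel {a..b} F"
 shows "(LINT tau:{a<..b}|lborel. F tau) = (LINT tau:{a..b}|lborel. F tau)"
proof -
 have 1: "set_integrable lborel {a<..b} F" by (rule set_integrable_subset[OF F]) auto
 show ?thesis unfolding set_lebesgue_integral_def
 proof (rule integral_cong_AE)
  show "(%x. ind {a<..b} x *\<^sub>R F x) : bmeas lborel" using 1 by (simp add: set_integrable_def)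
  show "(%x. ind {a..b} x *\<^sub>R F x) : bmeas lborel" using F by (simp add: set_integrable_def)
  show "AE x in lborel. ind {a<..b} x *\<^sub>R F x = ind {a..b} x *\<^sub>R F x"
   using AE_lborel_singleton[of a] by eventually_elim (auto split: split_indicator)
 qed
qed

lemma LINT_split:
 fixes F :: "real => real"
 assumes F: "set_integrable lborel {a..c} F" and b: "a <= b" "b <= c"
 shows "(LINT tau:{a..c}|lborel. F tau) = (LINT tau:{a..b}|lborel. F tau) + (LINT tau:{b..c}|lborel. F tau)"
proof -
 have 1: "set_integrable lborel {b..c} F" "set_integrable lborel {b<..c} F" "set_integrable lborel {a..b} F"
  by (rule set_integrable_subset[OF F]; use b in auto)+
 have "{a..c} = {a..b} \<union> {b<..c}" using b by auto
 then have "(LINT tau:{a..c}|lborel. F tau) = (LINT tau:{a..b}|lborel. F tau) + (LINT tau:{b<..c}|lborel. F tau)"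
  using set_integral_Un[OF _ 1(3,2)] b by (simp add: disjoint_iff)
 then show ?thesis using LINT_Ioc[OF 1(1)] by simp
qed

text \<open>The indicator discards Q at times where mu is not known to be a chain motion; the result
  is a \<open>rate_row\<close> at every point of the plane.\<close>

definition rate :: "(real => ('a => real) => 'u => 'a => 'a => real) => real => real => (real => 'a => real) => 'a => 'a => real * 'u => real" where
 "rate Q s r mu x y z = ind {s..r} (fst z) * Q (fst z) (mu (fst z)) (snd z) x y"

definition averaged :: "(real => ('a => real) => 'u => 'a => 'a => real) => real => real => ('a => real * real => 'u) => (real => 'a => real) => 'a => 'a => real => real" where
 "averaged Q s r Phi mu x y tau = (LINT v|U01. rate Q s r mu x y (tau, Phi x (tau, v)))"

text \<open>Chain motions for feedbacks represented by functions \<open>Phi x\<close>: chosen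
  kernels become integrals over \<open>U01\<close> and infinite sums become integrals over
  \<open>count_space S\<close>, a form suited to Fubini and to concatenation in time.\<close>

definition chain_flow :: "'a::euclidean_space set => (real => ('a => real) => 'u::metric_space => 'a => 'a => real) => real => real => ('a => real * real => 'u) => (real => 'a => real) => bool" where
 "chain_flow S Q s r Phi mu \<longleftrightarrow> (ALL x:S. Phi x : borel2 ->M borel) & (ALL t:{s..r}. mu t : Sigma2 S) \<and>
  (ALL x:S. ALL y:S. rate Q s r mu x y : bmeas (borel2)) \<and>
  (ALL y:S. set_integrable lborel {s..r} (%tau. (LINT x|count_space S. mu tau x * averaged Q s r Phi mu x y tau)) \<and>
   (ALL t:{s..r}. mu t y = mu s y + (LINT tau:{s..t}|lborel. (LINT x|count_space S. mu tau x * averaged Q s r Phi mu x y tau))))"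

lemma measurable_time_mixture:
 assumes h: "h : bmeas (borel2)" and Phi: "Phi : borel2 ->M borel"
 shows "(%z. h (fst z, Phi z)) : bmeas (borel *M U01)" "(%v. h (tau, Phi (tau, v))) : bmeas U01"
proof -
 have 1: "(%z. (fst z, snd z)) : borel *M U01 ->M borel2"
  by (intro measurable_Pair measurable_fst mcomp[OF measurable_snd measurable_interval])
 have 2: "(%z. h (fst z, Phi z)) : bmeas (borel2)"
  by (rule mcomp[OF measurable_Pair[OF measurable_fst Phi] h])
 show 3: "(%z. h (fst z, Phi z)) : bmeas (borel *M U01)" using mcomp[OF 1 2] by simp
 show "(%v. h (tau, Phi (tau, v))) : bmeas U01" using mcomp[OF measurable_Pair1' 3, of tau] by simp
qed

section \<open>Passing between chain motions and flows with represented feedback\<close>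

locale rate_system =
 fixes T :: real and f :: "real => 'a::euclidean_space => 'a measure => 'u::metric_space => 'a" and K S :: "'a set"
  and Q :: "real => ('a => real) => 'u => 'a => 'a => real" and BQ eps :: real
 assumes T: "0 < T" and cpt: "compact (UNIV :: 'u set)" and mc: "markov_chain T K S Q" and ap: "approximates T f K S Q BQ eps"
  and eps: "0 < eps" "eps <= 1"
begin

definition "B = max 1 BQ"

lemma B1: "1 <= B" by (simp add: B_def)

lemma countable_states: "countable S" and states_subset: "S \<subseteq> K"
 using mc by (auto simp: markov_chain_def)

lemma rate_row_rate:
 assumes I: "0 <= s" "r <= T" and x: "x : S" and mu: "!!t. t : {s..r} ==> mu t : Sigma2 S"
 shows "rate_row S B eps x (%y. rate Q s r mu x y z)"
proof (cases "fst z : {s..r}")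
 case True
 then have t: "fst z : {0..T}" using I by auto
 have 1: "(ALL y:S. x ~= y --> 0 <= Q (fst z) (mu (fst z)) (snd z) x y) & ((%y. Q (fst z) (mu (fst z)) (snd z) x y) has_sum 0) S"
  using mc t x mu[OF True] by (auto simp: markov_chain_def kolmogorov_family_def)
 have 2: "(ALL y:S. \<bar>Q (fst z) (mu (fst z)) (snd z) x y\<bar> <= BQ) & (%y. (norm (y - x))^2 * Q (fst z) (mu (fst z)) (snd z) x y) summable_on S \<and>
   (\<Sum>\<^sub>\<infinity>y\<in>S. (norm (y - x))^2 * Q (fst z) (mu (fst z)) (snd z) x y) <= eps^2"
  using ap t x mu[OF True] unfolding approximates_def by blast
 show ?thesis using True 1 2 by (auto simp: rate_row_def rate_def B_def max.coboundedI2)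
next
 case False then show ?thesis using rate_row_zero[of B] B1 by (simp add: rate_def)
qed

lemma averaged_props:
 assumes I: "0 <= s" "r <= T" and x: "x : S" and mu: "!!t. t : {s..r} ==> mu t : Sigma2 S"
  and Phi: "Phi x : borel2 ->M borel" and rm: "!!y. y : S ==> rate Q s r mu x y : bmeas (borel2)"
 shows "y : S ==> averaged Q s r Phi mu x y : bmeas borel"
  "y : S ==> integrable U01 (%v. rate Q s r mu x y (tau, Phi x (tau, v)))"
  "y : S ==> \<bar>averaged Q s r Phi mu x y tau\<bar> <= B"
  "weight_fn W ==> (CS y:S. ennreal (W y * \<bar>averaged Q s r Phi mu x y tau\<bar>)) <= ennreal ((4 * B + 2) * W x)"
proof -
 interpret V: prob_space U01 by (rule prob_space_U01)
 show "averaged Q s r Phi mu x y : bmeas borel" if y: "y : S"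
 proof -
  have "(%(tau, v). rate Q s r mu x y (tau, Phi x (tau, v))) : bmeas (borel *M U01)"
   using measurable_time_mixture(1)[OF rm[OF y] Phi] by (simp add: case_prod_unfold)
  from V.borel_measurable_lebesgue_integral[OF this] show ?thesis by (simp add: averaged_def[abs_def])
 qed
 note mr = mean_rate[where rho="%v y. rate Q s r mu x y (tau, Phi x (tau, v))", OF countable_states x
   measurable_time_mixture(2)[OF rm Phi] rate_row_rate[OF I x mu] eps]
 show "y : S ==> integrable U01 (%v. rate Q s r mu x y (tau, Phi x (tau, v)))" by (rule mr(1))
 show "y : S ==> \<bar>averaged Q s r Phi mu x y tau\<bar> <= B" unfolding averaged_def by (rule mr(2))
 show "weight_fn W ==> (CS y:S. ennreal (W y * \<bar>averaged Q s r Phi mu x y tau\<bar>)) <= ennreal ((4 * B + 2) * W x)"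
  unfolding averaged_def by (rule mr(3))
qed

lemma chain_flow_linear:
 assumes I: "0 <= s" "s <= r" "r <= T" and cf: "chain_flow S Q s r Phi mu"
 shows "linear_chain S B s r (averaged Q s r Phi mu) mu"
proof -
 have mu: "!!t. t : {s..r} ==> mu t : Sigma2 S" and Phi: "!!x. x : S ==> Phi x : borel2 ->M borel"
  and rm: "!!x y. x : S ==> y : S ==> rate Q s r mu x y : bmeas (borel2)"
  using cf unfolding chain_flow_def by blast+
 note ps = averaged_props[where Phi=Phi and mu=mu, OF I(1,3) _ mu Phi rm]
 show ?thesis
 proof (unfold_locales, goal_cases)
  case (4 x y) then show ?case using ps(1) by blast
 next
  case (5 x y tau) then show ?case using ps(3) by blast
 next
  case (6 W x tau) then show ?case using ps(4) by blast
 next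
  case (8 y) then show ?case using cf unfolding chain_flow_def by blast
 next
  case (9 y t) then show ?case using cf unfolding chain_flow_def by blast
 qed (use countable_states B1 I mu in simp_all)
qed

text \<open>Measurability of the rates is extracted from the clause of
  \<open>is_chain_motion\<close> that the entries are integrable against \<open>zeta x\<close>,
  whose sigma-algebra is that of the strip. Chosen and explicit kernels agree only for almost every
  time, so the drifts are compared under the time integral.\<close>

lemma chain_motion_flow:
 assumes I: "0 <= s" "s <= r" "r <= T" and mui: "mui : Sigma2 S" and cm: "is_chain_motion S Q s r mui zeta mu"
  and Phi: "!!x. x : S ==> Phi x : borel2 ->M borel" and zeta: "!!x. x : S ==> zeta x = fcontrol s r (Phi x)"
 shows "chain_flow S Q s r Phi mu" "mu s = mui"
proof -
 have mu: "!!t. t : {s..r} ==> mu t : Sigma2 S" using cm by (simp add: is_chain_motion_def)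
 then have mu1: "!!t. t : {s..r} ==> mu t : Sigma1 S" by (simp add: Sigma2_def)
 have rm: "rate Q s r mu x y : bmeas (borel2)" if xy: "x : S" "y : S" for x y
 proof -
  have "(%(tau, u). Q tau (mu tau) u x y) : bmeas (zeta x)"
   using cm xy unfolding is_chain_motion_def by (blast intro: borel_measurable_integrable)
  moreover have "sets (zeta x) = sets (restrict_space (borel2) ({s..r} \<times> UNIV))"
   using zeta[OF xy(1)] restrict_pair_sets[of s r "borel :: 'u measure"] by simp
  ultimately have "(%(tau, u). Q tau (mu tau) u x y) : bmeas (restrict_space (borel2) ({s..r} \<times> UNIV))"
   using measurable_cong_sets by blast
  then have "(%z. ind ({s..r} \<times> UNIV) z *\<^sub>R (case z of (tau, u) => Q tau (mu tau) u x y)) : bmeas (borel2)"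
   by (subst (asm) borel_measurable_restrict_space_iff) auto
  moreover have "(%z. ind ({s..r} \<times> UNIV) z *\<^sub>R (case z of (tau, u) => Q tau (mu tau) u x y)) = rate Q s r mu x y"
   by (auto simp: rate_def fun_eq_iff split: split_indicator)
  ultimately show ?thesis by simp
 qed
 note ps = averaged_props[where Phi=Phi and mu=mu, OF I(1,3) _ mu Phi rm]
 have "AE tau in lborel. ALL x:S. tau : {s..r} --> control_kernel s r (zeta x) tau = distr U01 borel (%v. Phi x (tau, v))"
  using control_kernel_function[OF cpt Phi, of _ s r] zeta by (subst AE_ball_countable[OF countable_states]) simp
 then have aeq: "AE tau in lborel. ALL x:S. ALL y:S. tau : {s..r} --> avg_rate Q s r zeta tau (mu tau) x y = averaged Q s r Phi mu x y tau"
 proof eventually_elim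
  case (elim tau)
  show ?case
  proof (intro ballI impI)
   fix x y assume xy: "x : S" "y : S" and t: "tau : {s..r}"
   have "(%u. rate Q s r mu x y (tau, u)) : bmeas borel" by (rule mcomp[OF measurable_Pair1' rm[OF xy]]) simp
   then have Qm: "(%u. Q tau (mu tau) u x y) : bmeas borel" using t by (simp add: rate_def)
   have Pm: "(%v. Phi x (tau, v)) : U01 ->M borel"
    by (rule mcomp[OF mcomp[OF measurable_interval measurable_Pair1'] Phi[OF xy(1)]]) simp
   show "avg_rate Q s r zeta tau (mu tau) x y = averaged Q s r Phi mu x y tau"
    using elim xy t integral_distr[OF Pm Qm] by (simp add: avg_rate_def averaged_def rate_def)
  qed
 qed
 let ?D = "%y tau. (LINT x|count_space S. mu tau x * averaged Q s r Phi mu x y tau)"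
 let ?F = "%y tau. \<Sum>\<^sub>\<infinity>x\<in>S. mu tau x * avg_rate Q s r zeta tau (mu tau) x y"
 have Fi: "set_integrable lborel {s..r} (?F y)" and eq: "t : {s..r} ==> mu t y = mui y + (LINT tau:{s..t}|lborel. ?F y tau)" if "y : S" for y t
  using cm that unfolding is_chain_motion_def by blast+
 have mm: "(%t. ind {s..r} t * mu t y) : bmeas borel" if y: "y : S" for y
  by (rule indefinite_integral_measurable[OF Fi[OF y]]) (rule eq[OF y])
 have Di: "set_integrable lborel {s..r} (?D y)" if y: "y : S" for y
  by (rule drift_integrable[OF countable_states mu1 mm, where B=B]) (use ps(1,3) y in auto)
 have LL: "(LINT tau:{s..t}|lborel. ?F y tau) = (LINT tau:{s..t}|lborel. ?D y tau)" if y: "y : S" and t: "t : {s..r}" for y t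
  unfolding set_lebesgue_integral_def
 proof (rule integral_cong_AE)
  have sub: "{s..t} \<subseteq> {s..r}" using t by auto
  show "(%x. ind {s..t} x *\<^sub>R ?F y x) : bmeas lborel"
   using set_integrable_subset[OF Fi[OF y] _ sub] by (simp add: set_integrable_def)
  show "(%x. ind {s..t} x *\<^sub>R ?D y x) : bmeas lborel"
   using set_integrable_subset[OF Di[OF y] _ sub] by (simp add: set_integrable_def)
  show "AE tau in lborel. ind {s..t} tau *\<^sub>R ?F y tau = ind {s..t} tau *\<^sub>R ?D y tau"
   using aeq
  proof eventually_elim
   case (elim tau)
   show ?case
   proof (cases "tau : {s..t}")
    case True
    then have tr: "tau : {s..r}" using t by auto
    have "?F y tau = (\<Sum>\<^sub>\<infinity>x\<in>S. mu tau x * averaged Q s r Phi mu x y tau)" by (rule infsum_cong) (use elim tr y in auto)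
    also have "... = ?D y tau" by (rule Sigma_integrable(4)[OF mu1[OF tr], where B=B]) (use ps(3) y in auto)
    finally show ?thesis by simp
   qed simp
  qed
 qed
 have s: "s : {s..r}" using I by simp
 have null: "(LINT tau:{s..s}|lborel. ?D y tau) = 0" for y
  unfolding set_lebesgue_integral_def by (rule integral_eq_zero_AE) (use AE_lborel_singleton[of s] in \<open>eventually_elim, auto\<close>)
 have ini: "mu s y = mui y" if y: "y : S" for y using eq[OF y s] LL[OF y s] null by simp
 show "mu s = mui"
 proof
  fix y show "mu s y = mui y" using ini[of y] mu[OF s] mui by (cases "y : S") (auto simp: Sigma2_def Sigma1_def)
 qed
 show "chain_flow S Q s r Phi mu" unfolding chain_flow_def
 proof (intro conjI ballI)
  fix y t assume "y : S" "t : {s..r}"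
  then show "mu t y = mu s y + (LINT tau:{s..t}|lborel. ?D y tau)" by (simp only: eq ini LL)
 qed (rule Phi mu rm Di; assumption)+
qed

lemma chain_flow_measurable:
 assumes "chain_flow S Q s r Phi mu" "y : S"
 shows "(%t. ind {s..r} t * mu t y) : bmeas borel"
proof (rule indefinite_integral_measurable)
 show "set_integrable lborel {s..r} (%tau. (LINT x|count_space S. mu tau x * averaged Q s r Phi mu x y tau))"
  using assms unfolding chain_flow_def by blast
 show "mu t y = mu s y + (LINT tau:{s..t}|lborel. (LINT x|count_space S. mu tau x * averaged Q s r Phi mu x y tau))" if "t : {s..r}" for t
  using assms that unfolding chain_flow_def by blast
qed

text \<open>Converse to \<open>chain_motion_flow\<close>. The chosen kernel is a probability at
  every time of the interval, so that its averages are measurable and obey the bound B; equality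
  with the explicit averages almost everywhere then transfers the equation.\<close>

lemma chain_flow_motion:
 assumes I: "0 <= s" "s <= r" "r <= T" and cf: "chain_flow S Q s r Phi mu"
 shows "is_chain_motion S Q s r (mu s) (%x. fcontrol s r (Phi x)) mu"
proof -
 have mu: "!!t. t : {s..r} ==> mu t : Sigma2 S" and Phi: "!!x. x : S ==> Phi x : borel2 ->M borel"
  and rm: "!!x y. x : S ==> y : S ==> rate Q s r mu x y : bmeas (borel2)"
  using cf unfolding chain_flow_def by blast+
 have mu1: "!!t. t : {s..r} ==> mu t : Sigma1 S" using mu by (simp add: Sigma2_def)
 note ps = averaged_props[where Phi=Phi and mu=mu, OF I(1,3) _ mu Phi rm]
 let ?zeta = "%x. fcontrol s r (Phi x)"
 let ?k = "%x. control_kernel s r (?zeta x)"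
 have rB: "\<bar>rate Q s r mu x y z\<bar> <= B" if "x : S" "y : S" for x y z
  using rate_row_rate[OF I(1,3) that(1) mu] that(2) by (simp add: rate_row_def)
 have km: "?k x : lebesgue_on_interval s r ->M prob_algebra borel" if x: "x : S" for x
  using someI[of "is_disintegration (lebesgue_on_interval s r) borel (?zeta x)", OF disintegration_function_control[OF Phi[OF x]]]
  unfolding control_kernel_def disintegration_def is_disintegration_def by blast
 have pk: "prob_space (?k x t)" "sets (?k x t) = sets borel" if "x : S" "t : {s..r}" for x t
  using measurable_space[OF km[OF that(1)], of t] that by (auto simp: space_prob_algebra)
 have ar: "avg_rate Q s r ?zeta t (mu t) x y = (LINT u|?k x t. rate Q s r mu x y (t, u))" if "t : {s..r}" for t x y
  using that by (simp add: avg_rate_def rate_def)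
 have aB: "\<bar>avg_rate Q s r ?zeta t (mu t) x y\<bar> <= B" if xy: "x : S" "y : S" and t: "t : {s..r}" for t x y
 proof -
  interpret k: prob_space "?k x t" by (rule pk[OF xy(1) t])
  have m: "(%u. rate Q s r mu x y (t, u)) : bmeas (?k x t)"
   using mcomp[OF measurable_Pair1'[of t] rm[OF xy]] by (simp add: measurable_cong_sets[OF pk(2)[OF xy(1) t] refl])
  have "\<bar>(LINT u|?k x t. rate Q s r mu x y (t, u))\<bar> <= (LINT u|?k x t. \<bar>rate Q s r mu x y (t, u)\<bar>)"
   using integral_norm_bound[of "?k x t" "%u. rate Q s r mu x y (t, u)"] by simp
  also have "... <= B"
  proof (rule k.integral_le_const)
   show "integrable (?k x t) (%u. \<bar>rate Q s r mu x y (t, u)\<bar>)"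
    by (rule k.integrable_const_bound[of _ B]) (use rB[OF xy] m in auto)
  qed (use rB[OF xy] in auto)
  finally show ?thesis by (simp add: ar[OF t])
 qed
 have am: "(%t. ind {s..r} t * avg_rate Q s r ?zeta t (mu t) x y) : bmeas borel" if xy: "x : S" "y : S" for x y
 proof -
  have "(%t. (LINT u|?k x t. rate Q s r mu x y (t, u))) : bmeas (lebesgue_on_interval s r)"
   by (rule integral_measurable_kernel[OF measurable_lebesgue_on_interval_pair[OF rm[OF xy]] km[OF xy(1)], where C=B]) (use rB[OF xy] in simp)
  then have "(%t. ind {s..r} t *\<^sub>R (LINT u|?k x t. rate Q s r mu x y (t, u))) : bmeas borel"
   by (subst borel_measurable_restrict_space_iff[symmetric]) (simp_all add: measurable_cong_sets[OF sets_lebesgue_on_interval refl])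
  moreover have "(%t. ind {s..r} t *\<^sub>R (LINT u|?k x t. rate Q s r mu x y (t, u))) = (%t. ind {s..r} t * avg_rate Q s r ?zeta t (mu t) x y)"
   using ar by (auto simp: fun_eq_iff split: split_indicator)
  ultimately show ?thesis by simp
 qed
 have "AE tau in lborel. ALL x:S. tau : {s..r} --> ?k x tau = distr U01 borel (%v. Phi x (tau, v))"
  using control_kernel_function[OF cpt Phi, of _ s r] by (subst AE_ball_countable[OF countable_states]) simp
 then have aeq: "AE tau in lborel. ALL x:S. ALL y:S. tau : {s..r} --> avg_rate Q s r ?zeta tau (mu tau) x y = averaged Q s r Phi mu x y tau"
 proof eventually_elim
  case (elim tau)
  show ?case
  proof (intro ballI impI)
   fix x y assume xy: "x : S" "y : S" and t: "tau : {s..r}"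
   have Rm: "(%u. rate Q s r mu x y (tau, u)) : bmeas borel" by (rule mcomp[OF measurable_Pair1' rm[OF xy]]) simp
   have Pm: "(%v. Phi x (tau, v)) : U01 ->M borel"
    by (rule mcomp[OF mcomp[OF measurable_interval measurable_Pair1'] Phi[OF xy(1)]]) simp
   show "avg_rate Q s r ?zeta tau (mu tau) x y = averaged Q s r Phi mu x y tau"
    using elim xy t integral_distr[OF Pm Rm] by (simp add: ar averaged_def)
  qed
 qed
 let ?D = "%y tau. (LINT x|count_space S. mu tau x * averaged Q s r Phi mu x y tau)"
 let ?F = "%y tau. \<Sum>\<^sub>\<infinity>x\<in>S. mu tau x * avg_rate Q s r ?zeta tau (mu tau) x y"
 have Di: "set_integrable lborel {s..r} (?D y)" and eq: "t : {s..r} ==> mu t y = mu s y + (LINT tau:{s..t}|lborel. ?D y tau)" if "y : S" for y t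
  using cf that unfolding chain_flow_def by blast+
 have su: "(%x. mu tau x * avg_rate Q s r ?zeta tau (mu tau) x y) summable_on S"
  and Fe: "?F y tau = (LINT x|count_space S. mu tau x * avg_rate Q s r ?zeta tau (mu tau) x y)" if "y : S" "tau : {s..r}" for y tau
  by (rule Sigma_integrable[OF mu1[OF that(2)], where B=B], rule aB; use that in simp)+
 have Fi: "set_integrable lborel {s..r} (?F y)" if y: "y : S" for y
 proof -
  have "set_integrable lborel {s..r} (%tau. (LINT x|count_space S. mu tau x * avg_rate Q s r ?zeta tau (mu tau) x y))"
   by (rule drift_integrable[OF countable_states mu1 chain_flow_measurable[OF cf] am aB]) (use y in auto)
  moreover have "(%x. ind {s..r} x *\<^sub>R ?F y x) = (%tau. ind {s..r} tau *\<^sub>R (LINT x|count_space S. mu tau x * avg_rate Q s r ?zeta tau (mu tau) x y))"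
   using Fe[OF y] by (auto simp: fun_eq_iff split: split_indicator)
  ultimately show ?thesis by (simp add: set_integrable_def)
 qed
 have LL: "(LINT tau:{s..t}|lborel. ?F y tau) = (LINT tau:{s..t}|lborel. ?D y tau)" if y: "y : S" and t: "t : {s..r}" for y t
  unfolding set_lebesgue_integral_def
 proof (rule integral_cong_AE)
  have sub: "{s..t} \<subseteq> {s..r}" using t by auto
  show "(%x. ind {s..t} x *\<^sub>R ?F y x) : bmeas lborel"
   using set_integrable_subset[OF Fi[OF y] _ sub] by (simp add: set_integrable_def)
  show "(%x. ind {s..t} x *\<^sub>R ?D y x) : bmeas lborel"
   using set_integrable_subset[OF Di[OF y] _ sub] by (simp add: set_integrable_def)
  show "AE tau in lborel. ind {s..t} tau *\<^sub>R ?F y tau = ind {s..t} tau *\<^sub>R ?D y tau"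
   using aeq
  proof eventually_elim
   case (elim tau)
   have "?F y tau = ?D y tau" if "tau : {s..t}"
    using Fe[OF y, of tau] elim y t that by (auto intro!: Bochner_Integration.integral_cong)
   then show ?case by (cases "tau : {s..t}") auto
  qed
 qed
 have qi: "integrable (?zeta x) (%(tau, u). Q tau (mu tau) u x y)" if xy: "x : S" "y : S" for x y
 proof -
  note rc = function_control_in[OF Phi[OF xy(1)], of s r]
  interpret z: finite_measure "?zeta x" by standard (use relaxed_control_finite[OF rc] in simp)
  have "integrable (?zeta x) (rate Q s r mu x y)"
   by (rule z.integrable_const_bound[of _ B]) (use rB[OF xy] relaxed_control_measurable[OF rc rm[OF xy]] in auto)
  then show ?thesis
   by (rule Bochner_Integration.integrable_cong[THEN iffD1, rotated -1]) (use relaxed_control_sets(2)[OF rc] in \<open>auto simp: rate_def\<close>)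
 qed
 show ?thesis unfolding is_chain_motion_def AE_lebesgue_on_interval
 proof (intro conjI ballI AE_I2 impI)
  fix y t assume y: "y : S" and t: "t : {s..r}"
  show "mu t y = mu s y + (LINT tau:{s..t}|lborel. ?F y tau)" unfolding LL[OF y t] by (rule eq[OF y t])
 qed (rule mu qi su Fi; assumption)+
qed

lemma averaged_subinterval:
 assumes "tau : {s'..r'}" "s <= s'" "r' <= r"
 shows "averaged Q s' r' Phi mu x y tau = averaged Q s r Phi mu x y tau"
 using assms by (simp add: averaged_def rate_def)

lemma chain_flow_subinterval:
 assumes cf: "chain_flow S Q s r Phi mu" and sub: "s <= s'" "s' <= r'" "r' <= r"
 shows "chain_flow S Q s' r' Phi mu"
 unfolding chain_flow_def
proof (intro conjI ballI)
 let ?D = "%s r y tau. (LINT x|count_space S. mu tau x * averaged Q s r Phi mu x y tau)"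
 have Dc: "?D s' r' y tau = ?D s r y tau" if "tau : {s'..r'}" for y tau
  using averaged_subinterval[OF that sub(1,3)] by simp
 fix y assume y: "y : S"
 have Di: "set_integrable lborel {s..r} (?D s r y)" using cf y unfolding chain_flow_def by blast
 have "set_integrable lborel {s'..r'} (?D s r y)" by (rule set_integrable_subset[OF Di]) (use sub in auto)
 moreover have "(%x. ind {s'..r'} x *\<^sub>R ?D s' r' y x) = (%x. ind {s'..r'} x *\<^sub>R ?D s r y x)"
  using Dc[of _ y] by (auto simp: fun_eq_iff split: split_indicator)
 ultimately show "set_integrable lborel {s'..r'} (?D s' r' y)" by (simp add: set_integrable_def)
 fix t assume t: "t : {s'..r'}"
 have "set_integrable lborel {s..t} (?D s r y)" by (rule set_integrable_subset[OF Di]) (use sub t in auto)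
 then have sp: "(LINT tau:{s..t}|lborel. ?D s r y tau) = (LINT tau:{s..s'}|lborel. ?D s r y tau) + (LINT tau:{s'..t}|lborel. ?D s r y tau)"
  by (rule LINT_split) (use sub t in auto)
 have eq: "mu t y = mu s y + (LINT tau:{s..t}|lborel. ?D s r y tau)" if "t : {s..r}" for t
  using cf y that unfolding chain_flow_def by blast
 have "t : {s..r}" "s' : {s..r}" using t sub by auto
 note e = eq[OF this(1)] eq[OF this(2)]
 have "(LINT tau:{s'..t}|lborel. ?D s' r' y tau) = (LINT tau:{s'..t}|lborel. ?D s r y tau)"
  by (rule set_lebesgue_integral_cong) (use Dc t in auto)
 with e sp show "mu t y = mu s' y + (LINT tau:{s'..t}|lborel. ?D s' r' y tau)" by simp
next
 fix x y assume "x : S" "y : S"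
 then have [measurable]: "rate Q s r mu x y : bmeas (borel2)" using cf unfolding chain_flow_def by blast
 have "(%z. ind {s'..r'} (fst z) * rate Q s r mu x y z) : bmeas (borel2)" by measurable
 also have "(%z. ind {s'..r'} (fst z) * rate Q s r mu x y z) = rate Q s' r' mu x y"
  using sub by (auto simp: rate_def fun_eq_iff split: split_indicator)
 finally show "rate Q s' r' mu x y : bmeas (borel2)" .
next
 fix t assume "t : {s'..r'}"
 then have "t : {s..r}" using sub by simp
 then show "mu t : Sigma2 S" using cf unfolding chain_flow_def by blast
next
 fix x assume "x : S" then show "Phi x : borel2 ->M borel" using cf unfolding chain_flow_def by blast
qed

text \<open>The time r belongs to the first piece, so that integrals split over {s..r} and {r<..t};
  the half-open interval changes nothing because single times are null.\<close>

lemma chain_flow_concat: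
 assumes cf: "chain_flow S Q s r Phi mu" and cf': "chain_flow S Q r q Phi' mu'" and o: "s <= r" "r <= q" and j: "mu r = mu' r"
 shows "chain_flow S Q s q (%x z. if fst z <= r then Phi x z else Phi' x z) (%t. if t <= r then mu t else mu' t)"
  (is "chain_flow S Q s q ?Phi ?mu")
 unfolding chain_flow_def
proof (intro conjI ballI)
 have rt: "rate Q s q ?mu x y z = (if fst z <= r then rate Q s r mu x y z else rate Q r q mu' x y z)" for x y z
  using o by (auto simp: rate_def split: split_indicator)
 fix x assume x: "x : S"
 then have [measurable]: "Phi x : borel2 ->M borel" "Phi' x : borel2 ->M borel"
  using cf cf' unfolding chain_flow_def by blast+
 show "?Phi x : borel2 ->M borel" by measurable
 fix y assume y: "y : S"
 have [measurable]: "rate Q s r mu x y : bmeas (borel2)" "rate Q r q mu' x y : bmeas (borel2)"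
  using cf cf' x y unfolding chain_flow_def by blast+
 have "(%z. if fst z <= r then rate Q s r mu x y z else rate Q r q mu' x y z) : bmeas (borel2)" by measurable
 then show "rate Q s q ?mu x y : bmeas (borel2)" by (simp add: rt[abs_def] cong: measurable_cong)
next
 fix t assume "t : {s..q}" then show "?mu t : Sigma2 S" using cf cf' unfolding chain_flow_def by (cases "t <= r") auto
next
 have av: "averaged Q s q ?Phi ?mu x y tau = (if tau <= r then averaged Q s r Phi mu x y tau else averaged Q r q Phi' mu' x y tau)" for x y tau
  using o by (auto simp: averaged_def rate_def split: split_indicator)
 let ?D = "%y tau. (LINT x|count_space S. mu tau x * averaged Q s r Phi mu x y tau)"
 let ?D' = "%y tau. (LINT x|count_space S. mu' tau x * averaged Q r q Phi' mu' x y tau)"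
 let ?E = "%y tau. (LINT x|count_space S. ?mu tau x * averaged Q s q ?Phi ?mu x y tau)"
 fix y assume y: "y : S"
 have 1: "set_integrable lborel {s..r} (?D y)" and 2: "set_integrable lborel {r..q} (?D' y)"
  and e1: "!!t. t : {s..r} ==> mu t y = mu s y + (LINT tau:{s..t}|lborel. ?D y tau)"
  and e2: "!!t. t : {r..q} ==> mu' t y = mu' r y + (LINT tau:{r..t}|lborel. ?D' y tau)"
  using cf cf' y unfolding chain_flow_def by blast+
 have i2q: "set_integrable lborel {r<..q} (?D' y)" by (rule set_integrable_subset[OF 2]) auto
 have c1: "(%x. ind {s..r} x *\<^sub>R ?E y x) = (%x. ind {s..r} x *\<^sub>R ?D y x)"
  by (auto simp: av fun_eq_iff split: split_indicator)
 have c2: "(%x. ind {r<..t} x *\<^sub>R ?E y x) = (%x. ind {r<..t} x *\<^sub>R ?D' y x)" for t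
  by (auto simp: av fun_eq_iff split: split_indicator)
 have s1: "set_integrable lborel {s..r} (?E y)" and s2: "set_integrable lborel {r<..q} (?E y)"
  using 1 i2q by (simp_all only: set_integrable_def c1 c2)
 have "{s..q} = {s..r} \<union> {r<..q}" using o by auto
 then show "set_integrable lborel {s..q} (?E y)" using set_integrable_Un[OF s1 s2] by simp
 fix t assume t: "t : {s..q}"
 show "?mu t y = ?mu s y + (LINT tau:{s..t}|lborel. ?E y tau)"
 proof (cases "t <= r")
  case True
  have "(LINT tau:{s..t}|lborel. ?E y tau) = (LINT tau:{s..t}|lborel. ?D y tau)"
   by (rule set_lebesgue_integral_cong) (use True in \<open>auto simp: av\<close>)
  then show ?thesis using True e1[of t] t o by simp
 next
  case False
  then have st: "{s..t} = {s..r} \<union> {r<..t}" using o by auto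
  have s2t: "set_integrable lborel {r<..t} (?E y)" by (rule set_integrable_subset[OF s2]) (use t in auto)
  have i2: "set_integrable lborel {r..t} (?D' y)" by (rule set_integrable_subset[OF 2]) (use t in auto)
  have "(LINT tau:{s..t}|lborel. ?E y tau) = (LINT tau:{s..r}|lborel. ?E y tau) + (LINT tau:{r<..t}|lborel. ?E y tau)"
   unfolding st by (rule set_integral_Un[OF _ s1 s2t]) auto
  also have "(LINT tau:{s..r}|lborel. ?E y tau) = (LINT tau:{s..r}|lborel. ?D y tau)" by (simp only: set_lebesgue_integral_def c1)
  also have "(LINT tau:{r<..t}|lborel. ?E y tau) = (LINT tau:{r..t}|lborel. ?D' y tau)"
   using LINT_Ioc[OF i2] by (simp only: set_lebesgue_integral_def c2)
  finally show ?thesis using False e1[of r] e2[of t] j t o by simp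
 qed
qed

end

section \<open>Discrete states over a probability space\<close>

lemma measurable_pair_countable:
 assumes "countable S" "!!y. y : S ==> (%om. h (om, y)) : M ->M N"
 shows "h : M *M count_space S ->M N"
proof -
 have "(%(y, om). h (om, y)) : count_space S *M M ->M N"
  by (rule measurable_pair_measure_countable1) (use assms in auto)
 from measurable_pair_swap[OF this] show ?thesis by (simp add: case_prod_unfold)
qed

lemma measurable_state_indicator:
 assumes "Y : M ->M count_space S"
 shows "(%om. ind {x} (Y om) :: ennreal) : bmeas M"
 using mcomp[OF assms borel_measurable_count_space] .

lemma CS_singleton:
 assumes "x : S"
 shows "(CS y:S. ind {x} y * (f y :: ennreal)) = f x"
proof -
 have "(CS y:S. ind {x} y * f y) = (CS y:S. f x * ind {x} y)"
  by (rule nn_integral_cong) (auto split: split_indicator)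
 also have "... = f x" using assms by (subst nn_integral_cmult_indicator) auto
 finally show ?thesis .
qed

lemma nn_integral_partition:
 assumes S: "countable S" and Y: "Y : M ->M count_space S" and g: "!!x. x : S ==> g x : bmeas M"
 shows "(NN om:M. g (Y om) om) = (CS x:S. (NN om:M. ind {x} (Y om) * g x om))"
proof -
 have "(CS x:S. (NN om:M. ind {x} (Y om) * g x om)) = (NN om:M. (CS x:S. ind {x} (Y om) * g x om))"
  by (rule swap_CS[OF S]) (intro borel_measurable_times_ennreal measurable_state_indicator[OF Y] g)
 also have "... = (NN om:M. g (Y om) om)"
 proof (rule nn_integral_cong, goal_cases)
  case (1 om)
  then have "Y om : S" using measurable_space[OF Y] by simp
  from CS_singleton[OF this, of "%x. g x om"]
  show ?case by (simp add: indicator_def eq_commute)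
 qed
 finally show ?thesis by simp
qed

lemma has_sum_nn_integral_count_space:
 fixes f :: "'a => real"
 assumes "!!x. x : S ==> 0 <= f x" and s: "(CS x:S. ennreal (f x)) = ennreal a" and a: "0 <= a"
 shows "(f has_sum a) S"
proof -
 have "(CS x:S. ennreal \<bar>f x\<bar>) = (CS x:S. ennreal (f x))"
  using assms(1) by (intro nn_integral_cong) simp
 then have "integrable (count_space S) f" by (intro integrable_count_space_ennreal) (simp add: s)
 then have A: "Infinite_Set_Sum.abs_summable_on f S" by (simp add: Infinite_Set_Sum.abs_summable_on_def)
 then have su: "f summable_on S" by (metis abs_summable_equivalent abs_summable_summable)
 have "(CS x:S. ennreal (f x)) = ennreal (infsum f S)"
  by (rule has_sum_CS) (use assms(1) su in auto)
 moreover have "0 <= infsum f S" by (rule infsum_nonneg) (use assms(1) in simp)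
 ultimately have "infsum f S = a" using s a by simp
 then show ?thesis using su by (metis has_sum_infsum)
qed

definition state_law :: "'w measure => ('w => 'a) => 'a => real" where
 "state_law M Y x = measure M (Y -` {x} \<inter> space M)"

lemma state_law_nn_integral:
 assumes "prob_space M" "Y : M ->M count_space S"
 shows "(NN om:M. ind {x} (Y om)) = ennreal (state_law M Y x)"
proof (cases "x : S")
 case True
 interpret prob_space M by fact
 have m: "Y -` {x} \<inter> space M : sets M" using True by (intro measurable_sets[OF assms(2)]) simp
 have "(NN om:M. ind {x} (Y om)) = (NN om:M. ind (Y -` {x} \<inter> space M) om)"
  by (rule nn_integral_cong) (auto split: split_indicator)
 then show ?thesis using m by (simp add: state_law_def emeasure_eq_measure)
next
 case False
 then have "Y om ~= x" if "om : space M" for om using measurable_space[OF assms(2) that] by auto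
 then have e: "Y -` {x} \<inter> space M = {}" and "(NN om:M. ind {x} (Y om)) = (NN om:M. (0 :: ennreal))"
  by (blast, intro nn_integral_cong, simp)
 then show ?thesis by (simp add: state_law_def)
qed

lemma state_law_integral:
 assumes S: "countable S" and M: "prob_space M" and Y: "Y : M ->M count_space S"
 shows "(NN om:M. g (Y om)) = (CS x:S. ennreal (state_law M Y x) * g x)"
proof -
 have "(NN om:M. g (Y om)) = (CS x:S. (NN om:M. ind {x} (Y om) * g x))"
  by (rule nn_integral_partition[OF S Y, where g="%x _. g x"]) simp
 also have "... = (CS x:S. ennreal (state_law M Y x) * g x)"
  by (intro nn_integral_cong) (simp add: nn_integral_multc measurable_state_indicator[OF Y] state_law_nn_integral[OF M Y])
 finally show ?thesis .
qed

lemma state_law_Sigma: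
 assumes S: "countable S" and M: "prob_space M" and Y: "Y : M ->M count_space S"
 shows "state_law M Y : Sigma1 S"
proof -
 have "(CS x:S. ennreal (state_law M Y x)) = 1"
  using state_law_integral[OF assms, of "%_. 1"] prob_space.emeasure_space_1[OF M] by simp
 then have "(state_law M Y has_sum 1) S" by (intro has_sum_nn_integral_count_space) (simp_all add: state_law_def)
 moreover have "state_law M Y x = 0" if "x \<notin> S" for x
 proof -
  have "Y -` {x} \<inter> space M = {}" using measurable_space[OF Y] that by auto
  then show ?thesis by (simp add: state_law_def)
 qed
 ultimately show ?thesis by (simp add: Sigma1_def state_law_def)
qed

text \<open>\<open>G om y\<close> is the conditional probability of the new state y given om; with
  countably many states a density with respect to counting measure serves as the kernel.\<close>

definition extend_state :: "'a set => 'w measure => ('w => 'a => ennreal) => ('w * 'a) measure" where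
 "extend_state S M G = density (M *M count_space S) (%p. G (fst p) (snd p))"

lemma sets_extend_state [simp, measurable_cong]: "sets (extend_state S M G) = sets (M *M count_space S)"
 by (simp add: extend_state_def)

lemma space_extend_state: "space (extend_state S M G) = space M \<times> S"
 by (simp add: extend_state_def space_pair_measure)

lemma nn_integral_extend_state:
 assumes S: "countable S" and G: "!!y. y : S ==> (%om. G om y) : bmeas M"
  and h: "!!y. y : S ==> (%om. h (om, y)) : bmeas M"
 shows "(NN p:(extend_state S M G). h p) = (NN om:M. (CS y:S. G om y * h (om, y)))"
proof -
 interpret sigma_finite_measure "count_space S" by (rule sigma_finite_measure_count_space_countable[OF S])
 have Gm: "(%p. G (fst p) (snd p)) : bmeas (M *M count_space S)" and hm: "h : bmeas (M *M count_space S)"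
  by (rule measurable_pair_countable[OF S]; use G h in simp)+
 then have "(NN p:(extend_state S M G). h p) = (NN p:(M *M count_space S). G (fst p) (snd p) * h p)"
  unfolding extend_state_def by (rule nn_integral_density)
 also have "... = (NN om:M. (CS y:S. G om y * h (om, y)))"
  using nn_integral_fst[OF borel_measurable_times_ennreal[OF Gm hm]] by simp
 finally show ?thesis .
qed

lemma prob_space_extend_state:
 assumes S: "countable S" and M: "prob_space M" and G: "!!y. y : S ==> (%om. G om y) : bmeas M"
  and G1: "AE om in M. (CS y:S. G om y) = 1"
 shows "prob_space (extend_state S M G)"
proof
 have "emeasure (extend_state S M G) (space (extend_state S M G)) = (NN p:(extend_state S M G). 1)" by simp
 also have "... = (NN om:M. (CS y:S. G om y * 1))" by (rule nn_integral_extend_state[OF S G]) simp_all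
 also have "... = (NN om:M. 1)" by (rule nn_integral_cong_AE) (use G1 in simp)
 also have "... = 1" using prob_space.emeasure_space_1[OF M] by simp
 finally show "emeasure (extend_state S M G) (space (extend_state S M G)) = 1" .
qed

lemma distr_eq_nn_integral:
 assumes [measurable]: "f : M ->M N" and N: "sets N' = sets N"
  and eq: "!!A. A : sets N ==> (NN x:M. ind A (f x)) = (NN y:N'. ind A y)"
 shows "distr M N f = N'"
proof (rule measure_eqI)
 fix A assume "A : sets (distr M N f)"
 then have A[measurable]: "A : sets N" by simp
 have "emeasure (distr M N f) A = (NN x:(distr M N f). ind A x)" by simp
 also have "... = (NN x:M. ind A (f x))" by (rule nn_integral_distr) measurable
 also have "... = emeasure N' A" unfolding eq[OF A] using A N by simp
 finally show "emeasure (distr M N f) A = emeasure N' A" .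
qed (simp add: N)

section \<open>Distance of a chain to a coupled process\<close>

lemma sets_chain_measure [simp, measurable_cong]: "sets (chain_measure S mu) = sets borel"
 by (simp add: chain_measure_def)

lemma nn_integral_chain_measure:
 assumes "h : bmeas borel"
 shows "(NN x:(chain_measure S mu). h x) = (CS x:S. ennreal (mu x) * h x)"
 unfolding chain_measure_def point_measure_def using assms
 by (subst nn_integral_distr) (auto simp: nn_integral_density)

lemma chain_measure_P2_on:
 fixes mu :: "'a::euclidean_space => real"
 assumes S: "countable S" "S \<subseteq> K" and mu: "mu : Sigma2 S"
 shows "chain_measure S mu : P2_on K"
proof -
 have m0: "0 <= mu x" for x using mu by (simp add: Sigma2_def Sigma1_def)
 have "(NN x:(chain_measure S mu). 1) = 1"
  using Sigma_nn_integral[of mu S] mu by (subst nn_integral_chain_measure) (auto simp: Sigma2_def)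
 then have p: "prob_space (chain_measure S mu)" by (intro prob_spaceI) simp
 have "(NN x:(chain_measure S mu). ennreal ((dist 0 x)^2)) = (CS x:S. ennreal ((norm x)^2 * mu x))"
  by (subst nn_integral_chain_measure) (auto simp: m0 ennreal_mult mult.commute intro!: nn_integral_cong)
 also have "... = ennreal (\<Sum>\<^sub>\<infinity>x\<in>S. (norm x)^2 * mu x)"
  by (rule has_sum_CS) (use m0 mu in \<open>auto simp: Sigma2_def\<close>)
 finally have m2: "(NN x:(chain_measure S mu). ennreal ((dist 0 x)^2)) < \<infinity>" by simp
 have Sb: "S : sets borel" by (rule sets.countable[OF _ S(1)]) simp
 then have "emeasure (chain_measure S mu) (- S) = (NN x:(chain_measure S mu). ind (- S) x)" by simp
 also have "... = (CS x:S. 0)"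
  using Sb by (subst nn_integral_chain_measure) (simp, intro nn_integral_cong, simp)
 finally have "- S : null_sets (chain_measure S mu)" using Sb by (simp add: null_sets_def)
 then have "AE x in chain_measure S mu. x : K" by (rule AE_I') (use S(2) in auto)
 then show ?thesis unfolding P2_on_def using p m2 by (auto simp: P2_euclidean_metric intro!: exI[of _ 0])
qed

text \<open>The common part of the two laws is kept in place, and the excess \<open>a\<close> of \<open>\<nu>\<close> over \<open>\<mu>\<close> is
  redistributed proportionally to the excess \<open>b\<close> of \<open>\<mu>\<close> over \<open>\<nu>\<close>.\<close>

lemma W2_chain_measure_le:
 fixes X :: "'w => 'a::euclidean_space"
 assumes S: "countable S" and M: "prob_space M" and Y: "Y : M ->M count_space S" and X[measurable]: "X : bmeas M"
  and mu: "mu : Sigma1 S" and V: "(NN om:M. ennreal ((norm (Y om - X om))^2)) <= ennreal V" "0 <= V"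
  and e: "(CS x:S. ennreal (weight x * \<bar>state_law M Y x - mu x\<bar>)) <= ennreal e" "0 <= e"
 shows "W2 (distr M borel X) (chain_measure S mu) <= sqrt (2 * V + 4 * e)"
proof -
 define nu where "nu = state_law M Y"
 have n0: "0 <= nu x" and p0: "0 <= mu x" for x using mu by (auto simp: nu_def state_law_def Sigma1_def)
 define a where "a x = max 0 (nu x - mu x)" for x
 define b where "b x = max 0 (mu x - nu x)" for x
 have ab0[simp]: "0 <= a x" "0 <= b x" for x by (auto simp: a_def b_def)
 have n1: "(nu has_sum 1) S" and p1: "(mu has_sum 1) S"
  using mu state_law_Sigma[OF S M Y] by (auto simp: nu_def Sigma1_def)
 have bs: "b summable_on S"
  by (rule summable_on_comparison_test[OF has_sum_imp_summable[OF p1]]) (use n0 p0 in \<open>auto simp: b_def\<close>)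
 define R where "R = infsum b S"
 have bh: "(b has_sum R) S" unfolding R_def using bs by (rule has_sum_infsum)
 have R0: "0 <= R" unfolding R_def by (rule infsum_nonneg) simp
 have ah: "(a has_sum R) S"
 proof -
  have "((%x. b x + nu x + - mu x) has_sum (R + 1 + - 1)) S"
   by (intro has_sum_add bh n1 has_sum_uminusI p1)
  moreover have "b x + nu x + - mu x = a x" for x by (auto simp: a_def b_def)
  ultimately show ?thesis by simp
 qed
 have bR: "b x = 0" if "R = 0" "x : S" for x
  using nonneg_infsum_le_0D[of b S x] that bs by (simp add: R_def)
 have aR: "a x = 0" if "R = 0" "x : S" for x
  using nonneg_infsum_le_0D[of a S x] that infsumI[OF ah] has_sum_imp_summable[OF ah] by simp
 have nb: "(CS y:S. ennreal (b y)) = ennreal R" by (rule has_sum_CS[OF _ bh]) simp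
 have na: "(CS y:S. ennreal (a y)) = ennreal R" by (rule has_sum_CS[OF _ ah]) simp
 \<comment> \<open>States with \<open>nu x = 0\<close> are null for Y, and for R = 0 both excesses
   vanish on S; in these cases the values given by division by zero are harmless.\<close>
 define c where "c x = (if nu x = 0 then 0 else a x / nu x)" for x
 define kappa where "kappa x y = (if y = x then min (nu x) (mu x) / nu x else 0) + c x * (b y / R)" for x y
 have c0: "0 <= c x" and nc: "nu x * c x = a x" for x using n0[of x] p0[of x] by (auto simp: c_def a_def)
 have k0: "0 <= kappa x y" for x y using n0 p0 c0 R0 by (auto simp: kappa_def intro!: add_nonneg_nonneg divide_nonneg_nonneg mult_nonneg_nonneg)
 have k1: "(CS y:S. ennreal (kappa x y)) = 1" if x: "x : S" "nu x ~= 0" for x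
 proof -
  have "((%y. kappa x y) has_sum (min (nu x) (mu x) / nu x + c x * (1 / R * R))) S"
   unfolding kappa_def using has_sum_cmult_right[OF bh, of "1 / R"]
   by (intro has_sum_add has_sum_singleton x has_sum_cmult_right) simp
  moreover have "min (nu x) (mu x) / nu x + c x * (1 / R * R) = 1"
   using x aR[OF _ x(1)] n0[of x] by (cases "R = 0") (auto simp: c_def a_def field_simps min_def max_def split: if_splits)
  ultimately show ?thesis using has_sum_CS[of S "kappa x" 1] k0 by simp
 qed
 define P where "P = extend_state S M (%om y. ennreal (kappa (Y om) y))"
 have Gm: "(%om. ennreal (kappa (Y om) y)) : bmeas M" for y
  using mcomp[OF Y borel_measurable_count_space] .
 note PI = nn_integral_extend_state[where G="%om y. ennreal (kappa (Y om) y)", OF S Gm, folded P_def]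
 have nz: "AE om in M. nu (Y om) ~= 0"
 proof -
  have "(NN om:M. (if nu (Y om) = 0 then 1 else 0 :: ennreal)) = (CS x:S. ennreal (nu x) * (if nu x = 0 then 1 else 0))"
   unfolding nu_def by (rule state_law_integral[OF S M Y])
  also have "... = (CS x:S. 0)" by (rule nn_integral_cong) simp
  finally have z: "(NN om:M. (if nu (Y om) = 0 then 1 else 0 :: ennreal)) = 0" by simp
  have "(%om. if nu (Y om) = 0 then 1 else 0 :: ennreal) : bmeas M"
   using mcomp[OF Y borel_measurable_count_space, of "%x. if nu x = 0 then 1 else 0"] .
  with z have "AE om in M. (if nu (Y om) = 0 then 1 else 0 :: ennreal) = 0" by (simp add: nn_integral_0_iff_AE)
  then show ?thesis by eventually_elim (auto split: if_splits)
 qed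
 have Sm: "snd : bmeas P" unfolding P_def
  by (rule measurable_cong_sets[THEN equalityD1, THEN subsetD, OF sets_extend_state[symmetric] refl]) (rule measurable_pair_countable[OF S], simp)
 have Xm: "(%p. X (fst p)) : bmeas P" unfolding P_def by (rule mcomp[OF _ X]) simp
 have d1: "distr P borel (%p. X (fst p)) = distr M borel X"
 proof (rule distr_eq_nn_integral[OF Xm])
  fix A :: "'a set" assume [measurable]: "A : sets borel"
  have "(NN p:P. ind A (X (fst p))) = (NN om:M. (CS y:S. ennreal (kappa (Y om) y) * ind A (X om)))"
   by (subst PI) simp_all
  also have "... = (NN om:M. ind A (X om))"
  proof (rule nn_integral_cong_AE)
   show "AE om in M. (CS y:S. ennreal (kappa (Y om) y) * ind A (X om)) = ind A (X om)"
    using nz AE_space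
   proof eventually_elim
    case (elim om)
    then have "Y om : S" using measurable_space[OF Y] by simp
    then show ?case using k1[of "Y om"] elim by (simp add: nn_integral_multc)
   qed
  qed
  also have "... = (NN x:(distr M borel X). ind A x)" by (rule nn_integral_distr[symmetric]) measurable
  finally show "(NN p:P. ind A (X (fst p))) = (NN x:(distr M borel X). ind A x)" .
 qed simp
 have nk: "(CS x:S. ennreal (nu x) * ennreal (kappa x y)) = ennreal (mu y)" if y: "y : S" for y
 proof -
  have eq: "nu x * kappa x y = (if x = y then min (nu y) (mu y) else 0) + b y / R * a x" for x
   using nc[of x] n0[of x] p0[of x] by (auto simp: kappa_def distrib_left mult.left_commute[of "nu x"] mult.commute)
  have "((%x. nu x * kappa x y) has_sum (min (nu y) (mu y) + b y / R * R)) S"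
   unfolding eq by (intro has_sum_add has_sum_singleton[OF y] has_sum_cmult_right ah)
  moreover have "min (nu y) (mu y) + b y / R * R = mu y"
   using bR[OF _ y] by (cases "R = 0") (auto simp: b_def max_def min_def split: if_splits)
  ultimately show ?thesis
   using has_sum_CS[of S "%x. nu x * kappa x y" "mu y"] n0 k0 by (simp add: ennreal_mult)
 qed
 have d2: "distr P borel snd = chain_measure S mu"
 proof (rule distr_eq_nn_integral[OF Sm])
  fix A :: "'a set" assume A[measurable]: "A : sets borel"
  have "(NN p:P. ind A (snd p)) = (NN om:M. (CS y:S. ennreal (kappa (Y om) y) * ind A y))"
   by (subst PI) simp_all
  also have "... = (CS x:S. ennreal (nu x) * (CS y:S. ennreal (kappa x y) * ind A y))"
   unfolding nu_def by (rule state_law_integral[OF S M Y])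
  also have "... = (CS x:S. (CS y:S. ennreal (nu x) * (ennreal (kappa x y) * ind A y)))"
   by (simp add: nn_integral_cmult)
  also have "... = (CS y:S. (CS x:S. ennreal (nu x) * (ennreal (kappa x y) * ind A y)))"
   by (rule swap_CS[OF S]) simp
  also have "... = (CS y:S. ennreal (mu y) * ind A y)"
   by (intro nn_integral_cong) (simp add: nk nn_integral_multc flip: mult.assoc)
  also have "... = (NN y:(chain_measure S mu). ind A y)" by (rule nn_integral_chain_measure[symmetric]) measurable
  finally show "(NN p:P. ind A (snd p)) = (NN y:(chain_measure S mu). ind A y)" .
 qed simp
 \<comment> \<open>Mass that stays pays the old squared distance between X and Y, at most doubled;
   redistributed mass pays in addition at most 4 |x|^2 + 4 |y|^2, which the weight turns into the
   error e.\<close>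
 have cb: "(CS y:S. ennreal (kappa (Y om) y) * ennreal ((norm (X om - y))^2))
   <= 2 * ennreal ((norm (Y om - X om))^2) + (CS y:S. ennreal (c (Y om) * (b y / R) * (4 * (norm (Y om))^2 + 4 * (norm y)^2)))"
  if om: "Y om : S" "nu (Y om) ~= 0" for om
 proof -
  let ?x = "Y om" let ?d = "(norm (?x - X om))^2"
  let ?t = "%y. c ?x * (b y / R) * (4 * (norm ?x)^2 + 4 * (norm y)^2)"
  have t0: "0 <= ?t y" for y using c0 R0 by simp
  have pt: "kappa ?x y * (norm (X om - y))^2 <= 2 * ?d * kappa ?x y + ?t y" for y
  proof (cases "y = ?x")
   case True
   have "kappa ?x y * ?d <= 2 * ?d * kappa ?x y" using k0[of ?x y] by (simp add: mult_nonneg_nonneg)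
   then show ?thesis using True t0[of y] by (simp add: norm_minus_commute)
  next
   case False
   have "(norm (X om - y))^2 <= 2 * ?d + 2 * (norm (?x - y))^2"
    using norm_square_triangle[of "X om - y" "X om - ?x"] by (simp add: norm_minus_commute)
   also have "(norm (?x - y))^2 <= 2 * (norm ?x)^2 + 2 * (norm y)^2"
    using norm_square_triangle[of "?x - y" ?x] by simp
   finally have "(norm (X om - y))^2 <= 2 * ?d + (4 * (norm ?x)^2 + 4 * (norm y)^2)" by simp
   then have "kappa ?x y * (norm (X om - y))^2 <= kappa ?x y * (2 * ?d + (4 * (norm ?x)^2 + 4 * (norm y)^2))"
    by (rule mult_left_mono) (rule k0)
   then show ?thesis using False by (simp add: kappa_def distrib_left mult.commute)
  qed
  have "(CS y:S. ennreal (kappa ?x y) * ennreal ((norm (X om - y))^2)) <= (CS y:S. ennreal (2 * ?d) * ennreal (kappa ?x y) + ennreal (?t y))"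
   using ennreal_le_plus[OF pt _ t0] k0 by (intro nn_integral_mono) (simp add: ennreal_mult)
  also have "... = ennreal (2 * ?d) * 1 + (CS y:S. ennreal (?t y))"
   using k1[OF om] by (subst nn_integral_add) (simp_all add: nn_integral_cmult)
  finally show ?thesis by (simp add: ennreal_mult)
 qed
 have tb: "(CS x:S. ennreal (nu x) * (CS y:S. ennreal (c x * (b y / R) * (4 * (norm x)^2 + 4 * (norm y)^2)))) <= ennreal (4 * e)"
 proof -
  let ?n = "%x::'a. (norm x)^2"
  \<comment> \<open>Once summed over the two states, the total mass R of one excess cancels 1/R and
    leaves the other excess against the square of the norm.\<close>
  have sw: "ennreal (nu x) * ennreal (c x * (b y / R) * (4 * ?n x + 4 * ?n y))
   = ennreal (4 / R) * (ennreal (a x * ?n x) * ennreal (b y) + ennreal (a x) * ennreal (b y * ?n y))" for x y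
  proof -
   have "nu x * (c x * (b y / R) * (4 * ?n x + 4 * ?n y)) = a x * (b y / R) * (4 * ?n x + 4 * ?n y)"
    unfolding nc[symmetric] by (simp add: mult_ac)
   also have "... = 4 / R * (a x * ?n x * b y + a x * (b y * ?n y))" by (simp add: field_simps)
   finally show ?thesis using n0[of x] c0[of x] R0 by (simp flip: ennreal_mult ennreal_plus)
  qed
  have RR: "ennreal (4 / R) * (ennreal R * z) <= 4 * z" for z
   using R0 by (cases "R = 0") (simp_all flip: mult.assoc ennreal_mult)
  have "(CS x:S. ennreal (nu x) * (CS y:S. ennreal (c x * (b y / R) * (4 * ?n x + 4 * ?n y))))
   = (CS x:S. ennreal (4 / R) * (ennreal (a x * ?n x) * ennreal R + ennreal (a x) * (CS y:S. ennreal (b y * ?n y))))"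
  proof (rule nn_integral_cong, goal_cases)
   case (1 x)
   have "ennreal (nu x) * (CS y:S. ennreal (c x * (b y / R) * (4 * ?n x + 4 * ?n y)))
    = (CS y:S. ennreal (nu x) * ennreal (c x * (b y / R) * (4 * ?n x + 4 * ?n y)))" by (rule nn_integral_cmult[symmetric]) simp
   also have "... = ennreal (4 / R) * (ennreal (a x * ?n x) * ennreal R + ennreal (a x) * (CS y:S. ennreal (b y * ?n y)))"
    unfolding sw by (simp add: nn_integral_add nn_integral_cmult nb)
   finally show ?case .
  qed
  also have "... = ennreal (4 / R) * ((CS x:S. ennreal (a x * ?n x)) * ennreal R + ennreal R * (CS y:S. ennreal (b y * ?n y)))"
   by (simp add: nn_integral_cmult nn_integral_add nn_integral_multc na)
  also have "... = ennreal (4 / R) * (ennreal R * ((CS x:S. ennreal (a x * ?n x)) + (CS y:S. ennreal (b y * ?n y))))"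
   by (simp add: algebra_simps)
  also have "... <= 4 * ((CS x:S. ennreal (a x * ?n x)) + (CS y:S. ennreal (b y * ?n y)))" by (rule RR)
  also have "... = 4 * (CS x:S. ennreal (a x * ?n x) + ennreal (b x * ?n x))" by (subst nn_integral_add) auto
  also have "... <= 4 * (CS x:S. ennreal (weight x * \<bar>nu x - mu x\<bar>))"
  proof (intro mult_left_mono nn_integral_mono)
   fix x
   have "a x * ?n x + b x * ?n x = \<bar>nu x - mu x\<bar> * ?n x" by (auto simp: a_def b_def max_def)
   also have "... <= weight x * \<bar>nu x - mu x\<bar>" by (simp add: weight_def algebra_simps)
   finally show "ennreal (a x * ?n x) + ennreal (b x * ?n x) <= ennreal (weight x * \<bar>nu x - mu x\<bar>)"
    by (simp add: ennreal_leI flip: ennreal_plus)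
  qed simp
  also have "... <= 4 * ennreal e" using e(1) unfolding nu_def by (intro mult_left_mono) auto
  finally show ?thesis using e(2) by (simp add: ennreal_mult)
 qed
 have cost: "(NN p:P. ennreal ((dist (X (fst p)) (snd p))^2)) <= ennreal ((sqrt (2 * V + 4 * e))^2)"
 proof -
  have "(NN p:P. ennreal ((dist (X (fst p)) (snd p))^2)) = (NN om:M. (CS y:S. ennreal (kappa (Y om) y) * ennreal ((norm (X om - y))^2)))"
   by (subst PI) (simp_all add: dist_norm)
  also have "... <= (NN om:M. 2 * ennreal ((norm (Y om - X om))^2) + (CS y:S. ennreal (c (Y om) * (b y / R) * (4 * (norm (Y om))^2 + 4 * (norm y)^2))))"
   by (rule nn_integral_mono_AE) (use nz AE_space in \<open>eventually_elim, intro cb, use measurable_space[OF Y] in auto\<close>)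
  also have "... = 2 * (NN om:M. ennreal ((norm (Y om - X om))^2)) + (NN om:M. (CS y:S. ennreal (c (Y om) * (b y / R) * (4 * (norm (Y om))^2 + 4 * (norm y)^2))))"
  proof -
   have [measurable]: "Y : bmeas M" using mcomp[OF Y borel_measurable_count_space, of "%x. x"] by simp
   have "(%om. (CS y:S. ennreal (c (Y om) * (b y / R) * (4 * (norm (Y om))^2 + 4 * (norm y)^2)))) : bmeas M"
    using mcomp[OF Y borel_measurable_count_space] .
   then show ?thesis by (subst nn_integral_add) (auto simp: nn_integral_cmult)
  qed
  also have "... <= 2 * ennreal V + ennreal (4 * e)"
  proof (intro add_mono mult_left_mono V)
   show "(NN om:M. (CS y:S. ennreal (c (Y om) * (b y / R) * (4 * (norm (Y om))^2 + 4 * (norm y)^2)))) <= ennreal (4 * e)"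
    using tb state_law_integral[OF S M Y, of "%x. (CS y:S. ennreal (c x * (b y / R) * (4 * (norm x)^2 + 4 * (norm y)^2)))"] by (simp add: nu_def)
  qed simp
  also have "... = ennreal ((sqrt (2 * V + 4 * e))^2)" using V(2) e(2) by (simp add: ennreal_mult)
  finally show ?thesis .
 qed
 have cp: "distr P (borel2) (%p. (X (fst p), snd p)) : couplings (distr M borel X) (chain_measure S mu)"
  unfolding couplings_def using d1 d2 by (simp add: distr_distr Xm Sm o_def measurable_Pair)
 show ?thesis
 proof (rule W2_le_coupling[OF cp])
  show "(NN z:(distr P (borel2) (%p. (X (fst p), snd p))). ennreal ((dist (fst z) (snd z))^2)) <= ennreal ((sqrt (2 * V + 4 * e))^2)"
   using cost by (subst nn_integral_distr) (auto intro!: measurable_Pair Xm Sm)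
 qed (use V e in simp)
qed

section \<open>One step of the coupling\<close>

text \<open>The window from s (excluded) to r has mass (r - s)/T under \<open>normed T xi\<close>,
  so this is 1[y = x] plus the integral of q over the window against xi. With the identity part
  under the integral the integrand is nonnegative for short steps, so that \<open>ennreal\<close>
  cuts nothing off.\<close>

definition jump :: "real => real => real => 'a => (real * 'u::metric_space => real) => 'a => (real * 'u) measure => ennreal" where
 "jump T s r x q y xi = (NN z:(normed T xi). ind {s<..r} (fst z) * ennreal (T * ((if y = x then 1 / (r - s) else 0) + q z)))"

locale one_step =
 fixes T s r B eps :: real and S :: "'a::euclidean_space set" and x :: 'a and rho :: "'a => real * 'u::metric_space => real" and xi :: "(real * 'u) measure"
 assumes T: "0 < T" and I: "0 <= s" "s < r" "r <= T" and S: "countable S" and x: "x : S" and xi: "xi : relaxed_controls 0 T"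
  and m: "!!y. y : S ==> rho y : bmeas (borel2)" and row: "!!z. rate_row S B eps x (%y. rho y z)"
  and hB: "(r - s) * B <= 1"
begin

definition "w y z = (if y = x then 1 / (r - s) else 0) + rho y z"

lemma w_nonneg:
 assumes "y : S"
 shows "0 <= w y z"
proof (cases "y = x")
 case True
 have "\<bar>rho x z\<bar> <= B" using row[of z] x by (simp add: rate_row_def)
 \<comment> \<open>The diagonal rate is at least -B; this is where the step length is restricted by
   \<open>hB\<close>.\<close>
 moreover have "B <= 1 / (r - s)" using hB I by (simp add: field_simps)
 ultimately show ?thesis using True by (simp add: w_def abs_le_iff)
qed (use row[of z] assms in \<open>simp add: rate_row_def w_def\<close>)

lemma w_measurable [measurable]: "y : S ==> w y : bmeas (borel2)"
 unfolding w_def[abs_def] using m by measurable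

lemma jump_eq: "jump T s r x (rho y) y xi = (NN z:(normed T xi). ind {s<..r} (fst z) * ennreal (T * w y z))"
 by (simp add: jump_def w_def)

lemma jump_integral:
 "(CS y:S. jump T s r x (rho y) y xi * ennreal (q y))
  = (NN z:(normed T xi). ind {s<..r} (fst z) * (CS y:S. ennreal (T * w y z) * ennreal (q y)))"
proof -
 have mm: "(%z. ind {s<..r} (fst z) * ennreal (T * w y z)) : bmeas (normed T xi)" if "y : S" for y
  using w_measurable[OF that] by (simp cong: measurable_cong_sets)
 have "(CS y:S. jump T s r x (rho y) y xi * ennreal (q y))
  = (CS y:S. (NN z:(normed T xi). ind {s<..r} (fst z) * ennreal (T * w y z) * ennreal (q y)))"
  unfolding jump_eq by (intro nn_integral_cong nn_integral_multc[symmetric] mm) simp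
 also have "... = (NN z:(normed T xi). (CS y:S. ind {s<..r} (fst z) * ennreal (T * w y z) * ennreal (q y)))"
  by (rule swap_CS[OF S]) (rule borel_measurable_times_ennreal[OF mm borel_measurable_const])
 also have "... = (NN z:(normed T xi). ind {s<..r} (fst z) * (CS y:S. ennreal (T * w y z) * ennreal (q y)))"
  by (simp add: nn_integral_cmult mult.assoc)
 finally show ?thesis .
qed

lemma window: "(NN z:(normed T xi). ind {s<..r} (fst z)) = ennreal ((r - s) / T)"
proof -
 have "(NN z:(normed T xi). ind {s<..r} (fst z)) = ennreal (1 / T) * (NN t:lborel|{0..T}. ind {s<..r} t)"
  by (rule normalized_control_marginal[OF xi T]) simp
 also have "(NN t:lborel|{0..T}. ind {s<..r} t) = (NN t:lborel. ind {s<..r} t)"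
  by (rule nn_integral_cong) (use I in \<open>auto split: split_indicator\<close>)
 finally show ?thesis using I T by (simp flip: ennreal_mult)
qed

lemma jump_sum: "(CS y:S. jump T s r x (rho y) y xi) = 1"
proof -
 have sm: "(CS y:S. ennreal (T * w y z)) = ennreal (T / (r - s))" for z
 proof (rule has_sum_CS)
  have "((%y. T * w y z) has_sum (T * (1 / (r - s) + 0))) S" unfolding w_def
   using row[of z] by (intro has_sum_cmult_right has_sum_add has_sum_singleton x) (simp add: rate_row_def)
  then show "((%y. T * w y z) has_sum (T / (r - s))) S" by simp
 qed (use T w_nonneg in simp)
 have "(CS y:S. jump T s r x (rho y) y xi) = (NN z:(normed T xi). ind {s<..r} (fst z) * ennreal (T / (r - s)))"
  using jump_integral[of "%_. 1"] sm by simp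
 also have "... = ennreal ((r - s) / T) * ennreal (T / (r - s))" by (subst nn_integral_multc) (simp_all add: window)
 also have "... = 1" using I T by (simp flip: ennreal_mult)
 finally show ?thesis .
qed

text \<open>With e the offset of x from the displaced agent, the square of (y - x) + e is averaged
  over the jump: |e|^2 from the total mass 1, at most (r - s) eps^2 from the variance bound, and a
  cross term with the mean jump, for which F is substituted at the price c. Jump and displacement
  use the same control, so integrating F gives back the displacement, and the cross term completes
  |e|^2 to at most |x - X|^2.\<close>

lemma jump_cost:
 fixes F :: "real * 'u => 'a" and X :: 'a
 assumes F[measurable]: "F : bmeas (borel2)" and R: "!!z. norm (F z) <= R"
  and b: "!!z. fst z : {s<..r} ==> (%y. rho y z *\<^sub>R (y - x)) summable_on S & norm (F z - (\<Sum>\<^sub>\<infinity>y\<in>S. rho y z *\<^sub>R (y - x))) <= c"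
  and c: "0 <= c"
 shows "(CS y:S. jump T s r x (rho y) y xi * ennreal ((norm (y - (X + (cint T xi F r - cint T xi F s))))^2))
  <= ennreal ((norm (x - X))^2 + (r - s) * eps^2 + 2 * (r - s) * c * (norm (x - X) + R * (r - s)))"
proof -
 let ?N = "normed T xi"
 interpret N: prob_space ?N by (rule prob_space_normalized_control[OF xi T])
 define h where "h = r - s"
 have h: "0 < h" using I by (simp add: h_def)
 define \<Delta> where "\<Delta> = cint T xi F r - cint T xi F s"
 define e where "e = x - (X + \<Delta>)"
 \<comment> \<open>The mean cost density at a fixed time and control, with the mean jump replaced by
   \<open>F z\<close>.\<close>
 define J where "J z = (norm e)^2 / h + eps^2 + 2 * (F z \<bullet> e) + 2 * c * norm e" for z
 have i0: "integrable ?N (%z. ind {0..t} (fst z) *\<^sub>R F z)" for t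
  by (rule integrable_normalized_control[OF xi T F R])
 have ind: "ind {s<..r} (fst z) *\<^sub>R F z = ind {0..r} (fst z) *\<^sub>R F z - ind {0..s} (fst z) *\<^sub>R F z" for z
  using I by (auto split: split_indicator)
 have iF: "integrable ?N (%z. ind {s<..r} (fst z) *\<^sub>R F z)" unfolding ind by (intro Bochner_Integration.integrable_diff i0)
 have \<Delta>: "\<Delta> = T *\<^sub>R (LINT z|?N. ind {s<..r} (fst z) *\<^sub>R F z)"
  unfolding ind \<Delta>_def cint_def by (simp add: Bochner_Integration.integral_diff i0 scaleR_diff_right)
 have D: "norm \<Delta> <= R * h" unfolding \<Delta>_def h_def
  by (rule control_integral_lipschitz[OF xi T F R]) (use I in auto)
 have R0: "0 <= R" using R[of undefined] norm_ge_zero order_trans by blast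
 have cost: "(CS y:S. ennreal (T * w y z) * ennreal ((norm (y - (X + \<Delta>)))^2)) <= ennreal (T * J z)" and J0: "0 <= J z"
  if z: "fst z : {s<..r}" for z
 proof -
  define bz where "bz = (\<Sum>\<^sub>\<infinity>y\<in>S. rho y z *\<^sub>R (y - x))"
  define Sq where "Sq = (\<Sum>\<^sub>\<infinity>y\<in>S. (norm (y - x))^2 * rho y z)"
  have r0: "((%y. rho y z) has_sum 0) S" and r2: "((%y. (norm (y - x))^2 * rho y z) has_sum Sq) S" and Sq: "Sq <= eps^2"
   using row[of z] by (simp_all add: rate_row_def Sq_def has_sum_infsum)
  have "((%y. rho y z *\<^sub>R (y - x)) has_sum bz) S" unfolding bz_def using b[OF z] by (simp add: has_sum_infsum)
  from has_sum_bounded_linear[OF bounded_linear_inner_left this, of e]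
  have r1: "((%y. (rho y z *\<^sub>R (y - x)) \<bullet> e) has_sum (bz \<bullet> e)) S" by (simp add: o_def)
  have pt: "w y z * (norm (y - (X + \<Delta>)))^2
   = (if y = x then (norm e)^2 / h else 0) + (norm (y - x))^2 * rho y z + 2 * ((rho y z *\<^sub>R (y - x)) \<bullet> e) + (norm e)^2 * rho y z" for y
  proof -
   have eq: "y - (X + \<Delta>) = (y - x) + e" by (simp add: e_def)
   have "(norm (y - (X + \<Delta>)))^2 = (norm (y - x))^2 + 2 * ((y - x) \<bullet> e) + (norm e)^2"
    unfolding eq power2_norm_eq_inner inner_add_left inner_add_right by (simp add: inner_commute)
   then show ?thesis by (simp add: w_def h_def distrib_left distrib_right)
  qed
  have hs: "((%y. w y z * (norm (y - (X + \<Delta>)))^2) has_sum ((norm e)^2 / h + Sq + 2 * (bz \<bullet> e) + (norm e)^2 * 0)) S"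
   unfolding pt by (intro has_sum_add has_sum_singleton[OF x] has_sum_cmult_right r0 r1 r2)
  have nn: "0 <= w y z * (norm (y - (X + \<Delta>)))^2" if "y : S" for y using w_nonneg[OF that] by simp
  have "(bz - F z) \<bullet> e <= norm (F z - bz) * norm e" using norm_cauchy_schwarz[of "bz - F z" e] by (simp add: norm_minus_commute)
  also have "... <= c * norm e" using b[OF z] by (intro mult_right_mono) (simp_all add: bz_def)
  finally have le: "(norm e)^2 / h + Sq + 2 * (bz \<bullet> e) + (norm e)^2 * 0 <= J z" using Sq by (simp add: J_def inner_diff_left)
  moreover have "0 <= (norm e)^2 / h + Sq + 2 * (bz \<bullet> e) + (norm e)^2 * 0" by (rule has_sum_nonneg[OF hs nn])
  ultimately show "0 <= J z" by linarith
  have "ennreal (T * w y z) * ennreal ((norm (y - (X + \<Delta>)))^2) = ennreal T * ennreal (w y z * (norm (y - (X + \<Delta>)))^2)" if "y : S" for y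
   using w_nonneg[OF that, of z] T by (simp add: ennreal_mult mult.assoc)
  then have "(CS y:S. ennreal (T * w y z) * ennreal ((norm (y - (X + \<Delta>)))^2))
   = ennreal T * (CS y:S. ennreal (w y z * (norm (y - (X + \<Delta>)))^2))"
   by (subst nn_integral_cmult[symmetric]) (auto intro!: nn_integral_cong)
  also have "(CS y:S. ennreal (w y z * (norm (y - (X + \<Delta>)))^2)) = ennreal ((norm e)^2 / h + Sq + 2 * (bz \<bullet> e) + (norm e)^2 * 0)"
   by (rule has_sum_CS[OF nn hs])
  also have "ennreal T * ... <= ennreal T * ennreal (J z)" using le by (intro mult_left_mono ennreal_leI) auto
  finally show "(CS y:S. ennreal (T * w y z) * ennreal ((norm (y - (X + \<Delta>)))^2)) <= ennreal (T * J z)"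
   using T \<open>0 <= J z\<close> by (simp add: ennreal_mult)
 qed
 have iI: "integrable ?N (%z. ind {s<..r} (fst z) :: real)" "(LINT z|?N. ind {s<..r} (fst z)) = h / T"
 proof -
  show 1: "integrable ?N (%z. ind {s<..r} (fst z) :: real)"
   by (rule N.integrable_const_bound[of _ 1]) (auto split: split_indicator)
  have "ennreal (LINT z|?N. ind {s<..r} (fst z)) = (NN z:?N. ind {s<..r} (fst z))"
   by (subst nn_integral_eq_integral[symmetric, OF 1]) (auto intro!: nn_integral_cong split: split_indicator)
  then show "(LINT z|?N. ind {s<..r} (fst z)) = h / T" unfolding window using h T by (simp add: h_def)
 qed
 define k0 where "k0 = (norm e)^2 / h + eps^2 + 2 * c * norm e"
 have Je: "ind {s<..r} (fst z) * (T * J z) = T * k0 * ind {s<..r} (fst z) + 2 * T * ((ind {s<..r} (fst z) *\<^sub>R F z) \<bullet> e)" for z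
  by (auto simp: J_def k0_def algebra_simps split: split_indicator)
 have i3: "integrable ?N (%z. T * k0 * ind {s<..r} (fst z))" and i4: "integrable ?N (%z. 2 * T * ((ind {s<..r} (fst z) *\<^sub>R F z) \<bullet> e))"
  by (intro integrable_mult_right iI integrable_inner_left iF)+
 then have iJ: "integrable ?N (%z. ind {s<..r} (fst z) * (T * J z))"
  unfolding Je by (rule Bochner_Integration.integrable_add)
 have "(LINT z|?N. ind {s<..r} (fst z) * (T * J z)) = T * k0 * (h / T) + 2 * T * ((LINT z|?N. ind {s<..r} (fst z) *\<^sub>R F z) \<bullet> e)"
  unfolding Je Bochner_Integration.integral_add[OF i3 i4] integral_mult_right_zero iI(2) integral_inner_left[OF iF] by (rule refl)
 also have "... = h * k0 + 2 * (\<Delta> \<bullet> e)" using T unfolding \<Delta> by simp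
 also have "... = (norm e)^2 + 2 * (\<Delta> \<bullet> e) + h * eps^2 + 2 * h * c * norm e" using h by (simp add: k0_def algebra_simps)
 also have "... <= (norm (x - X))^2 + h * eps^2 + 2 * h * c * (norm (x - X) + R * h)"
 proof -
  \<comment> \<open>This identity absorbs the cross term; the squared norm of \<Delta> is dropped
    with the favourable sign.\<close>
  have "x - X = e + \<Delta>" by (simp add: e_def)
  then have "(norm (x - X))^2 = (norm e)^2 + 2 * (\<Delta> \<bullet> e) + (norm \<Delta>)^2"
   by (simp add: power2_norm_eq_inner inner_add_left inner_add_right inner_commute)
  then have 1: "(norm e)^2 + 2 * (\<Delta> \<bullet> e) <= (norm (x - X))^2" by simp
  have "norm e <= norm (x - X) + norm \<Delta>" unfolding e_def using norm_triangle_ineq4[of "x - X" \<Delta>] by (simp add: diff_diff_add)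
  then have "norm e <= norm (x - X) + R * h" using D by simp
  then have "2 * h * c * norm e <= 2 * h * c * (norm (x - X) + R * h)" by (rule mult_left_mono) (use h c in simp)
  then show ?thesis using 1 by simp
 qed
 finally have le: "(LINT z|?N. ind {s<..r} (fst z) * (T * J z)) <= (norm (x - X))^2 + h * eps^2 + 2 * h * c * (norm (x - X) + R * h)" .
 have "(CS y:S. jump T s r x (rho y) y xi * ennreal ((norm (y - (X + \<Delta>)))^2))
  <= (NN z:?N. ennreal (ind {s<..r} (fst z) * (T * J z)))"
  unfolding jump_integral by (rule nn_integral_mono) (use cost in \<open>auto split: split_indicator\<close>)
 also have "... = ennreal (LINT z|?N. ind {s<..r} (fst z) * (T * J z))"
  by (rule nn_integral_eq_integral[OF iJ]) (use J0 T in \<open>auto split: split_indicator\<close>)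
 finally show ?thesis using le by (simp add: h_def \<Delta>_def order_trans[OF _ ennreal_leI])
qed

end

text \<open>Young's inequality for the products of q with eps and with cW; whatever is proportional
  to d^2 becomes the growth factor of the step.\<close>

lemma quadratic_step_bound:
 fixes d q h L eps cW R :: real
 assumes h: "0 <= h" and L: "0 <= L" and q: "q = d + R * h"
 shows "d^2 + h * eps^2 + 2 * h * (eps + L * (q + cW)) * q
  <= d^2 * (1 + h * (2 + 6 * L)) + h * (2 * eps^2 + (2 + 6 * L) * (R^2 * h^2) + L * cW^2)"
proof -
 have 1: "2 * eps * q <= eps^2 + q^2" by (rule sum_squares_bound)
 have "2 * cW * q <= cW^2 + q^2" by (rule sum_squares_bound)
 then have 2: "L * (2 * cW * q) <= L * (cW^2 + q^2)" using L by (rule mult_left_mono)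
 have "2 * (eps + L * (q + cW)) * q = 2 * eps * q + 2 * L * q^2 + L * (2 * cW * q)" by (simp add: algebra_simps power2_eq_square)
 then have 3: "2 * (eps + L * (q + cW)) * q <= eps^2 + (1 + 3 * L) * q^2 + L * cW^2" using 1 2 by (simp add: algebra_simps power2_eq_square)
 have "q^2 <= 2 * d^2 + 2 * (R^2 * h^2)"
  using sum_squares_bound[of d "R * h"] by (simp add: q power2_sum power_mult_distrib)
 then have "(1 + 3 * L) * q^2 <= (1 + 3 * L) * (2 * d^2 + 2 * (R^2 * h^2))" by (rule mult_left_mono) (use L in simp)
 with 3 have "2 * (eps + L * (q + cW)) * q <= eps^2 + (1 + 3 * L) * (2 * d^2 + 2 * (R^2 * h^2)) + L * cW^2" by linarith
 then have "h * (2 * (eps + L * (q + cW)) * q) <= h * (eps^2 + (1 + 3 * L) * (2 * d^2 + 2 * (R^2 * h^2)) + L * cW^2)"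
  by (rule mult_left_mono) (rule h)
 then show ?thesis by (simp add: algebra_simps)
qed

locale coupled_system = rate_system T f K S Q BQ eps
 for T :: real and f :: "real => 'a::euclidean_space => 'a measure => 'u::metric_space => 'a" and K S Q BQ eps +
 fixes L R :: real and m :: "real => 'a measure"
 assumes fc: "field_consts T f K L R" and rf: "regular_field L R (flow_field T f m)" and mK: "!!t. t : {0..T} ==> m t : P2_on K"
begin

lemma L0: "0 < L" and R0: "0 < R" using fc by (simp_all add: field_consts_def)

abbreviation "agent y xi \<equiv> solution T (flow_field T f m) y xi"

end

section \<open>The coupled step for the whole population\<close>

definition chain_jump :: "real => (real => ('a => real) => 'u::metric_space => 'a => 'a => real) => real => real => (real => 'a => real) => ('w => 'a) => ('w => (real * 'u) measure) => 'w => 'a => ennreal" where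
 "chain_jump T Q s r mu Y xi om y = jump T s r (Y om) (rate Q s r mu (Y om) y) y (xi om)"

locale jump_step = rate_system T f K S Q BQ eps
 for T :: real and f :: "real => 'a::euclidean_space => 'a measure => 'u::metric_space => 'a" and K S Q BQ eps +
 fixes s r :: real and Phi :: "'a => real * real => 'u" and mu :: "real => 'a => real"
  and M :: "'w measure" and Y :: "'w => 'a" and xi :: "'w => (real * 'u) measure"
 assumes I: "0 <= s" "s < r" "r <= T" and hB: "(r - s) * B <= 1" and cf: "chain_flow S Q s r Phi mu"
  and M: "prob_space M" and Y: "Y : M ->M count_space S" and xi: "xi : M ->M relaxed_space 0 T"
begin

definition "h = r - s"

lemma h0: "0 < h" using I by (simp add: h_def)

lemma control: "om : space M ==> xi om : relaxed_controls 0 T"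
 using measurable_space[OF xi] by (simp add: space_relaxed_space)

lemma Y_borel [measurable]: "Y : bmeas M"
 using mcomp[OF Y borel_measurable_count_space, of "%x. x"] by simp

lemma linear: "linear_chain S B s r (averaged Q s r Phi mu) mu"
 using chain_flow_linear[OF I(1) _ I(3) cf] I by simp

lemma mu2: "t : {s..r} ==> mu t : Sigma2 S" and Phim: "x : S ==> Phi x : borel2 ->M borel"
 and rm: "x : S ==> y : S ==> rate Q s r mu x y : bmeas (borel2)"
 using cf unfolding chain_flow_def by blast+

abbreviation "G \<equiv> chain_jump T Q s r mu Y xi"

lemma one_step: "om : space M ==> one_step T s r B eps S (Y om) (rate Q s r mu (Y om)) (xi om)"
 using measurable_space[OF Y, of om] T I countable_states control[of om] rm rate_row_rate[OF I(1,3) _ mu2] hB by (simp add: one_step_def)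

lemma kernel_measurable:
 assumes F: "F : bmeas (borel2)"
 shows "(%om. (NN z:(normed T (xi om)). F z)) : bmeas M"
 by (rule mcomp[OF mcomp[OF xi measurable_prob_algebraD[OF measurable_normalized_control[OF cpt T]]] nn_integral_measurable_subprob_algebra[OF F]])

lemma jump_measurable:
 assumes "x : S" "y : S"
 shows "(%om. jump T s r x (rate Q s r mu x y) y (xi om)) : bmeas M"
proof -
 have [measurable]: "rate Q s r mu x y : bmeas (borel2)" by (rule rm[OF assms])
 show ?thesis unfolding jump_def by (rule kernel_measurable) measurable
qed

lemma G_measurable:
 assumes y: "y : S"
 shows "(%om. G om y) : bmeas M"
 unfolding chain_jump_def by (rule measurable_compose_countable'[OF jump_measurable[OF _ y] Y countable_states])

lemma G_sum: "om : space M ==> (CS y:S. G om y) = 1"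
 unfolding chain_jump_def using one_step.jump_sum[OF one_step] .

lemma prob_space_step: "prob_space (extend_state S M G)"
 by (rule prob_space_extend_state[OF countable_states M G_measurable]) (use G_sum in auto)

lemma step_marginal:
 assumes [measurable]: "k : bmeas M"
 shows "(NN p:(extend_state S M G). k (fst p)) = (NN om:M. k om)"
proof -
 have "(NN p:(extend_state S M G). k (fst p)) = (NN om:M. (CS y:S. G om y * k om))"
  by (subst nn_integral_extend_state[OF countable_states G_measurable]) auto
 also have "... = (NN om:M. k om)" by (rule nn_integral_cong) (simp add: nn_integral_multc G_sum)
 finally show ?thesis .
qed

text \<open>Averaged over the window against the feedback \<open>Phi x\<close>, the jump density
  gives the Euler probability for the averaged rates; nonnegativity is inherited from the density at
  each time.\<close>

lemma mean_jump:
 assumes xy: "x : S" "y : S"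
 shows "(NN tau:lborel|{s<..r}. (NN v:U01. ennreal (T * ((if y = x then 1 / (r - s) else 0) + rate Q s r mu x y (tau, Phi x (tau, v))))))
   = ennreal (T * ((if y = x then 1 else 0) + (LINT tau:{s..r}|lborel. averaged Q s r Phi mu x y tau)))"
  and "\<bar>LINT tau:{s..r}|lborel. averaged Q s r Phi mu x y tau\<bar> <= B * h"
  and "0 <= (if y = x then 1 else 0) + (LINT tau:{s..r}|lborel. averaged Q s r Phi mu x y tau)"
proof -
 let ?delta = "if y = x then 1 / (r - s) else 0 :: real" let ?q = "averaged Q s r Phi mu x y"
 interpret U: prob_space U01 by (rule prob_space_U01)
 note ps = averaged_props[where Phi=Phi and mu=mu, OF I(1,3) xy(1) mu2 Phim[OF xy(1)] rm[OF xy(1)]]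
 have qm[measurable]: "?q : bmeas borel" and qi: "integrable U01 (%v. rate Q s r mu x y (tau, Phi x (tau, v)))" and qB: "\<bar>?q tau\<bar> <= B" for tau
  using ps(1,2,3) xy(2) by blast+
 \<comment> \<open>Any control will do: it makes the pointwise facts of \<open>one_step\<close>
   available.\<close>
 obtain zeta :: "(real * 'u) measure" where zeta: "zeta : relaxed_controls 0 T" using function_control_in[OF Phim[OF xy(1)]] by blast
 interpret P: one_step T s r B eps S x "rate Q s r mu x" zeta
  using T I countable_states xy zeta rm rate_row_rate[OF I(1,3) _ mu2] hB by (simp add: one_step_def)
 have w0: "0 <= ?delta + rate Q s r mu x y z" for z using P.w_nonneg[OF xy(2), of z] by (simp add: P.w_def)
 have w1: "0 <= ?delta + ?q tau" for tau
 proof -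
  have "0 <= (LINT v|U01. ?delta + rate Q s r mu x y (tau, Phi x (tau, v)))" by (rule Bochner_Integration.integral_nonneg) (rule w0)
  also have "... = ?delta + ?q tau" using qi U.prob_space by (simp add: averaged_def Bochner_Integration.integral_add del: space_lebesgue_on_interval)
  finally show ?thesis .
 qed
 have in1: "(NN v:U01. ennreal (T * (?delta + rate Q s r mu x y (tau, Phi x (tau, v))))) = ennreal (T * (?delta + ?q tau))" for tau
 proof -
  have "(NN v:U01. ennreal (T * (?delta + rate Q s r mu x y (tau, Phi x (tau, v))))) = ennreal (LINT v|U01. T * (?delta + rate Q s r mu x y (tau, Phi x (tau, v))))"
   by (rule nn_integral_eq_integral) (use qi w0 T in auto)
  also have "(LINT v|U01. T * (?delta + rate Q s r mu x y (tau, Phi x (tau, v)))) = T * (?delta + ?q tau)"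
   using qi U.prob_space by (simp add: averaged_def Bochner_Integration.integral_add del: space_lebesgue_on_interval)
  finally show ?thesis .
 qed
 have fin: "emeasure lborel {s..r} < \<infinity>" using emeasure_compact_finite[OF compact_Icc] by simp
 have iq: "set_integrable lborel {s..r} ?q"
  unfolding set_integrable_def
  by (rule Bochner_Integration.integrable_bound[where f="%tau. ind {s..r} tau *\<^sub>R B"]) (use fin order_trans[OF qB abs_ge_self] in \<open>auto split: split_indicator\<close>)
 have iq1: "set_integrable lborel {s<..r} ?q" by (rule set_integrable_subset[OF iq]) auto
 have i1: "set_integrable lborel {s<..r} (%tau. ?delta)" "(LINT tau:{s<..r}|lborel. ?delta) = (if y = x then 1 else 0)"
  using I by (auto simp: set_integrable_def set_lebesgue_integral_def)
 have i2: "set_integrable lborel {s<..r} (%tau. T * (?delta + ?q tau))" by (intro set_integrable_mult_right set_integral_add i1 iq1)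
 have eq: "(LINT tau:{s<..r}|lborel. ?delta + ?q tau) = (if y = x then 1 else 0) + (LINT tau:{s..r}|lborel. ?q tau)"
  by (simp add: set_integral_add(2)[OF i1(1) iq1] i1(2) LINT_Ioc[OF iq])
 have "0 <= (LINT tau:{s<..r}|lborel. ?delta + ?q tau)" unfolding set_lebesgue_integral_def by (rule Bochner_Integration.integral_nonneg) (use w1 in simp)
 then show "0 <= (if y = x then 1 else 0) + (LINT tau:{s..r}|lborel. ?q tau)" by (simp only: eq)
 have "(NN tau:lborel|{s<..r}. (NN v:U01. ennreal (T * (?delta + rate Q s r mu x y (tau, Phi x (tau, v))))))
  = (NN tau:lborel. ennreal (ind {s<..r} tau *\<^sub>R (T * (?delta + ?q tau))))"
  unfolding in1 by (intro nn_integral_cong) (auto split: split_indicator)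
 also have "... = ennreal (LINT tau:{s<..r}|lborel. T * (?delta + ?q tau))"
  unfolding set_lebesgue_integral_def by (rule nn_integral_eq_integral) (use i2 w1 T in \<open>auto simp: set_integrable_def\<close>)
 also have "(LINT tau:{s<..r}|lborel. T * (?delta + ?q tau)) = T * ((if y = x then 1 else 0) + (LINT tau:{s..r}|lborel. ?q tau))"
  by (simp add: eq[symmetric])
 finally show "(NN tau:lborel|{s<..r}. (NN v:U01. ennreal (T * (?delta + rate Q s r mu x y (tau, Phi x (tau, v))))))
   = ennreal (T * ((if y = x then 1 else 0) + (LINT tau:{s..r}|lborel. ?q tau)))" .
 have "norm (LINT tau:{s..r}|lborel. ?q tau) <= (LINT tau|lborel. ind {s..r} tau *\<^sub>R B)"
  unfolding set_lebesgue_integral_def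
  by (rule Bochner_Integration.integral_norm_bound_integral) (use iq fin qB in \<open>auto simp: set_integrable_def split: split_indicator\<close>)
 also have "... = B * h" using I by (simp add: h_def)
 finally show "\<bar>LINT tau:{s..r}|lborel. ?q tau\<bar> <= B * h" by simp
qed

end

locale coupled_step = coupled_system T f K S Q BQ eps L R m + jump_step T f K S Q BQ eps s r Phi mu M Y xi
 for T :: real and f :: "real => 'a::euclidean_space => 'a measure => 'u::metric_space => 'a" and K S Q BQ eps L R m s r Phi mu
  and M :: "'w measure" and Y xi +
 fixes y0 :: "'w => 'a" and V e Mo :: real
 assumes y0: "y0 : bmeas M"
  and mX: "!!t. t : {s..r} ==> m t = distr M borel (%om. agent (y0 om) (xi om) t)"
  and V: "(NN om:M. ennreal ((norm (Y om - agent (y0 om) (xi om) s))^2)) <= ennreal V" "0 <= V"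
  and e: "(CS x:S. ennreal (weight x * \<bar>state_law M Y x - mu s x\<bar>)) <= ennreal e" "0 <= e"
  and Mo: "(CS x:S. ennreal (weight x * mu s x)) <= ennreal Mo" "0 <= Mo"
begin

abbreviation "X t om \<equiv> agent (y0 om) (xi om) t"
definition "A = 4 * B + 2"
definition "e' = e + A * h * (Mo * exp (A * h))"

lemma A0: "0 < A" using B1 by (simp add: A_def)

lemma e'0: "0 <= e'" using e Mo h0 A0 by (simp add: e'_def)

lemma X_measurable [measurable]: "X t : bmeas M"
 using mcomp[OF measurable_Pair[OF y0 xi] solution_measurable[OF cpt T rf L0]] by simp

lemma step_W2:
 assumes t: "t : {s..r}"
 shows "W2 (m t) (chain_measure S (mu t)) <= sqrt (4 * V + 4 * (R^2 * h^2) + 4 * e')"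
proof -
 interpret C: linear_chain S B s r "averaged Q s r Phi mu" mu by (rule linear)
 have "(NN om:M. ennreal ((norm (Y om - X t om))^2)) <= (NN om:M. 2 * ennreal ((norm (Y om - X s om))^2) + ennreal (2 * (R^2 * h^2)))"
 proof (rule nn_integral_mono, goal_cases)
  case (1 om)
  then have "norm (X t om - X s om) <= R * \<bar>t - s\<bar>"
   by (intro solution_lipschitz[OF cpt T rf L0] control) (use I t in auto)
  also have "... <= R * h" using t R0 by (intro mult_left_mono) (auto simp: h_def)
  finally have "(norm (X t om - X s om))^2 <= R^2 * h^2" using power_mono[of "norm (X t om - X s om)" "R * h" 2] by (simp add: power_mult_distrib)
  moreover have "(norm (Y om - X t om))^2 <= 2 * (norm (Y om - X s om))^2 + 2 * (norm (X t om - X s om))^2"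
   using norm_square_triangle[of "Y om - X t om" "Y om - X s om"] by (simp add: norm_minus_commute)
  ultimately have "(norm (Y om - X t om))^2 <= 2 * (norm (Y om - X s om))^2 + 2 * (R^2 * h^2)" by linarith
  then show ?case
   using ennreal_le_plus[of "(norm (Y om - X t om))^2" "2 * (norm (Y om - X s om))^2" "2 * (R^2 * h^2)"] by (simp add: ennreal_mult)
 qed
 also have "... = 2 * (NN om:M. ennreal ((norm (Y om - X s om))^2)) + ennreal (2 * (R^2 * h^2))"
  by (subst nn_integral_add) (simp_all add: nn_integral_cmult prob_space.emeasure_space_1[OF M])
 also have "... <= 2 * ennreal V + ennreal (2 * (R^2 * h^2))" by (intro add_mono mult_left_mono V) auto
 also have "... = ennreal (2 * V + 2 * (R^2 * h^2))" using V(2) by (simp add: ennreal_plus ennreal_mult)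
 finally have 1: "(NN om:M. ennreal ((norm (Y om - X t om))^2)) <= ennreal (2 * V + 2 * (R^2 * h^2))" .
 have 2: "(CS x:S. ennreal (weight x * \<bar>state_law M Y x - mu t x\<bar>)) <= ennreal e'"
  using C.euler_distance[OF t Mo e] by (simp add: e'_def h_def A_def C.A_def)
 have "W2 (m t) (chain_measure S (mu t)) <= sqrt (2 * (2 * V + 2 * (R^2 * h^2)) + 4 * e')"
  unfolding mX[OF t] by (rule W2_chain_measure_le[OF countable_states M Y X_measurable _ 1 _ 2]) (use mu2[OF t] V e'0 in \<open>auto simp: Sigma2_def\<close>)
 then show ?thesis by (simp add: algebra_simps)
qed

text \<open>(A3) compares the mean jump with f at the state Y and the law of the chain, while the
  agent moves with f at X and the motion m; the Lipschitz property bridges the two.\<close>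

lemma drift_bound:
 assumes om: "om : space M" and z: "fst z : {s<..r}"
 shows "(%y. rate Q s r mu (Y om) y z *\<^sub>R (y - Y om)) summable_on S \<and>
  norm (along (flow_field T f m) (agent (y0 om) (xi om)) z - (\<Sum>\<^sub>\<infinity>y\<in>S. rate Q s r mu (Y om) y z *\<^sub>R (y - Y om)))
   <= eps + L * (norm (Y om - X s om) + R * h + sqrt (4 * V + 4 * (R^2 * h^2) + 4 * e'))" (is "_ & ?n <= eps + L * (?d + _ + ?c)")
proof -
 obtain t u where zt: "z = (t, u)" by (cases z)
 have t: "t : {s..r}" "t : {0..T}" using z I by (auto simp: zt)
 have x: "Y om : S" using measurable_space[OF Y om] by simp
 have rate: "rate Q s r mu (Y om) y z = Q t (mu t) u (Y om) y" for y using t by (simp add: rate_def zt)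
 have a: "(%y. Q t (mu t) u (Y om) y *\<^sub>R (y - Y om)) summable_on S"
  "norm (f t (Y om) (chain_measure S (mu t)) u - (\<Sum>\<^sub>\<infinity>y\<in>S. Q t (mu t) u (Y om) y *\<^sub>R (y - Y om))) <= eps"
  using ap t(2) x mu2[OF t(1)] unfolding approximates_def by blast+
 have "norm (f t (X t om) (m t) u - f t (Y om) (chain_measure S (mu t)) u) <= L * (norm (X t om - Y om) + W2 (m t) (chain_measure S (mu t)))"
  using fc t(2) mK[OF t(2)] chain_measure_P2_on[OF countable_states states_subset mu2[OF t(1)]] unfolding field_consts_def by blast
 also have "... <= L * (?d + R * h + ?c)"
 proof (intro mult_left_mono add_mono step_W2[OF t(1)])
  have "norm (X t om - X s om) <= R * \<bar>t - s\<bar>"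
   by (intro solution_lipschitz[OF cpt T rf L0] control om) (use I t in auto)
  also have "... <= R * h" using t R0 by (intro mult_left_mono) (auto simp: h_def)
  finally show "norm (X t om - Y om) <= ?d + R * h"
   using norm_triangle_ineq4[of "X t om - X s om" "Y om - X s om"] by simp
 qed (use L0 in simp)
 finally have "norm (f t (X t om) (m t) u - (\<Sum>\<^sub>\<infinity>y\<in>S. Q t (mu t) u (Y om) y *\<^sub>R (y - Y om))) <= L * (?d + R * h + ?c) + eps"
  using a(2) by (rule norm_diff_triangle_le)
 then show ?thesis using a(1) unfolding rate by (simp add: add.commute zt along_def flow_field_eq[OF t(2), symmetric])
qed

text \<open>The constant \<open>2 + 10 * L\<close> is \<open>2 + 6 * L\<close> from
  \<open>quadratic_step_bound\<close> plus \<open>4 * L\<close>, because the square of the W2 bound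
  contains 4 V.\<close>

lemma step_cost:
 "(NN p:(extend_state S M G). ennreal ((norm (snd p - X r (fst p)))^2))
  <= ennreal ((1 + (2 + 10 * L) * h) * V + h * (2 * eps^2 + (2 + 10 * L) * (R^2 * h^2) + 4 * L * e'))"
proof -
 let ?c = "sqrt (4 * V + 4 * (R^2 * h^2) + 4 * e')"
 define c1 where "c1 = 1 + h * (2 + 6 * L)"
 define c2 where "c2 = h * (2 * eps^2 + (2 + 6 * L) * (R^2 * h^2) + L * ?c^2)"
 have c12: "0 <= c1" "0 <= c2" using h0 L0 by (simp_all add: c1_def c2_def)
 have pt: "(CS y:S. G om y * ennreal ((norm (y - X r om))^2)) <= ennreal c1 * ennreal ((norm (Y om - X s om))^2) + ennreal c2"
  if om: "om : space M" for om
 proof -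
  let ?F = "along (flow_field T f m) (agent (y0 om) (xi om))"
  let ?d = "norm (Y om - X s om)"
  note cw = control[OF om]
  interpret P: one_step T s r B eps S "Y om" "rate Q s r mu (Y om)" "xi om" by (rule one_step[OF om])
  have Fm: "?F : bmeas (borel2)"
   by (rule along_measurable[OF cpt rf solution_measurable_time[OF cpt T rf L0 cw]])
  have "X r om = y0 om + cint T (xi om) ?F r" "X s om = y0 om + cint T (xi om) ?F s"
   by (rule solution_eq[OF cpt T rf L0 cw]; use I in simp)+
  then have Xr: "X r om = X s om + (cint T (xi om) ?F r - cint T (xi om) ?F s)" by simp
  have "(CS y:S. G om y * ennreal ((norm (y - X r om))^2))
   <= ennreal (?d^2 + (r - s) * eps^2 + 2 * (r - s) * (eps + L * (?d + R * h + ?c)) * (?d + R * (r - s)))"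
   unfolding chain_jump_def Xr by (rule P.jump_cost[OF Fm along_bound[OF rf] drift_bound[OF om]]) (use eps L0 R0 h0 V e'0 in simp_all)
  also have "... <= ennreal (?d^2 * c1 + c2)"
   using quadratic_step_bound[of h L "?d + R * h" ?d R eps ?c] h0 L0 by (intro ennreal_leI) (simp add: c1_def c2_def h_def)
  finally show ?thesis using c12 by (simp add: ennreal_plus ennreal_mult mult.commute)
 qed
 have "(NN p:(extend_state S M G). ennreal ((norm (snd p - X r (fst p)))^2)) = (NN om:M. (CS y:S. G om y * ennreal ((norm (y - X r om))^2)))"
  by (subst nn_integral_extend_state[OF countable_states G_measurable]) auto
 also have "... <= (NN om:M. ennreal c1 * ennreal ((norm (Y om - X s om))^2) + ennreal c2)"
  by (rule nn_integral_mono) (rule pt)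
 also have "... = ennreal c1 * (NN om:M. ennreal ((norm (Y om - X s om))^2)) + ennreal c2"
  by (subst nn_integral_add) (simp_all add: nn_integral_cmult prob_space.emeasure_space_1[OF M])
 also have "... <= ennreal c1 * ennreal V + ennreal c2" by (intro add_mono mult_left_mono V) auto
 also have "... = ennreal (c1 * V + c2)" using c12 V(2) by (simp add: ennreal_plus ennreal_mult)
 also have "c1 * V + c2 = (1 + (2 + 10 * L) * h) * V + h * (2 * eps^2 + (2 + 10 * L) * (R^2 * h^2) + 4 * L * e')"
  using V(2) e'0 by (simp add: c1_def c2_def algebra_simps)
 finally show ?thesis .
qed

text \<open>The hypothesis \<open>mix\<close> says that the agents in state x use on average the
  feedback \<open>Phi x\<close>. Jump probabilities are linear in the control, so averaging over the
  agents turns individual jumps into an Euler step of the chain equation.\<close>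

lemma step_law:
 assumes mix: "!!x F. x : S ==> F : bmeas (borel2) ==>
  (NN om:M. ind {x} (Y om) * (NN z:(normed T (xi om)). ind {s<..r} (fst z) * F z))
   = ennreal (state_law M Y x) * (ennreal (1 / T) * (NN tau:lborel|{s<..r}. (NN v:U01. F (tau, Phi x (tau, v)))))"
 shows "(CS y:S. ennreal (weight y * \<bar>state_law (extend_state S M G) snd y - mu r y\<bar>))
  <= ennreal (e + A * h * (e + A * h * (Mo * exp (A * h))))"
proof -
 interpret C: linear_chain S B s r "averaged Q s r Phi mu" mu by (rule linear)
 let ?nu = "state_law M Y" let ?l = "%x y. LINT tau:{s..r}|lborel. averaged Q s r Phi mu x y tau"
 have nu: "?nu : Sigma1 S" by (rule state_law_Sigma[OF countable_states M Y])
 have n0: "0 <= ?nu x" for x by (simp add: state_law_def)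
 have up: "state_law (extend_state S M G) snd y = ?nu y + (LINT x|count_space S. ?nu x * ?l x y)" if y: "y : S" for y
 proof -
  let ?k = "%x. (if y = x then 1 else 0) + ?l x y"
  have sm: "snd : extend_state S M G ->M count_space S" by (simp cong: measurable_cong_sets)
  have "ennreal (state_law (extend_state S M G) snd y) = (NN p:(extend_state S M G). ind {y} (snd p))"
   by (rule state_law_nn_integral[OF prob_space_step sm, symmetric])
  also have "... = (NN om:M. (CS y':S. G om y' * ind {y} y'))"
   by (subst nn_integral_extend_state[OF countable_states G_measurable]) auto
  also have "... = (NN om:M. jump T s r (Y om) (rate Q s r mu (Y om) y) y (xi om))"
   unfolding chain_jump_def by (intro nn_integral_cong) (simp add: CS_singleton[OF y] mult.commute)
  also have "... = (CS x:S. (NN om:M. ind {x} (Y om) * jump T s r x (rate Q s r mu x y) y (xi om)))"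
   by (rule nn_integral_partition[OF countable_states Y jump_measurable[OF _ y]])
  also have "... = (CS x:S. ennreal (?nu x * ?k x))"
  proof (rule nn_integral_cong, goal_cases)
   case (1 x)
   then have x: "x : S" by simp
   have [measurable]: "rate Q s r mu x y : bmeas (borel2)" by (rule rm[OF x y])
   have "(NN om:M. ind {x} (Y om) * jump T s r x (rate Q s r mu x y) y (xi om))
    = ennreal (?nu x) * (ennreal (1 / T) * ennreal (T * ?k x))"
    unfolding jump_def by (subst mix[OF x]) (measurable, simp only: mean_jump(1)[OF x y])
   also have "... = ennreal (?nu x * ?k x)"
    using T n0[of x] mean_jump(3)[OF x y] by (simp flip: ennreal_mult)
   finally show ?case .
  qed
  also have "... = ennreal (LINT x|count_space S. ?nu x * ?k x)"
  proof (rule nn_integral_eq_integral)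
   show "integrable (count_space S) (%x. ?nu x * ?k x)"
   proof (rule Sigma_integrable(1)[OF nu])
    fix x assume "x : S" then show "\<bar>?k x\<bar> <= 1 + B * h" using mean_jump(2)[OF _ y, of x] by (cases "y = x") (auto simp: abs_le_iff)
   qed
   show "AE x in count_space S. 0 <= ?nu x * ?k x" using mean_jump(3)[OF _ y] n0 by (auto simp: AE_count_space)
  qed
  finally have 1: "ennreal (state_law (extend_state S M G) snd y) = ennreal (LINT x|count_space S. ?nu x * ?k x)" .
  have "0 <= (LINT x|count_space S. ?nu x * ?k x)"
   by (rule Bochner_Integration.integral_nonneg_AE) (use mean_jump(3)[OF _ y] n0 in \<open>auto simp: AE_count_space\<close>)
  with 1 have 2: "state_law (extend_state S M G) snd y = (LINT x|count_space S. ?nu x * ?k x)" by (simp add: state_law_def)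
  have "(LINT x|count_space S. ?nu x * ?k x) = ?nu y + (LINT x|count_space S. ?nu x * ?l x y)"
  proof -
   have i: "integrable (count_space S) (%x. ?nu x * ?l x y)" by (rule Sigma_integrable(1)[OF nu, where B="B * h"]) (rule mean_jump(2)[OF _ y])
   have d: "\<bar>if y = x then 1 else 0 :: real\<bar> <= 1" for x by simp
   have "(\<Sum>\<^sub>\<infinity>x\<in>S. ?nu x * (if y = x then 1 else 0)) = ?nu y"
    using infsumI[OF has_sum_singleton[OF y, of "?nu y"]] by (simp add: if_distrib eq_commute cong: if_cong)
   then have d': "(LINT x|count_space S. ?nu x * (if y = x then 1 else 0)) = ?nu y"
    using Sigma_integrable(4)[OF nu, of "%x. if y = x then 1 else 0" 1] d by simp
   have "(LINT x|count_space S. ?nu x * ?k x) = (LINT x|count_space S. ?nu x * (if y = x then 1 else 0) + ?nu x * ?l x y)"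
    by (simp only: distrib_left)
   also have "... = (LINT x|count_space S. ?nu x * (if y = x then 1 else 0)) + (LINT x|count_space S. ?nu x * ?l x y)"
    by (rule Bochner_Integration.integral_add[OF Sigma_integrable(1)[OF nu d] i])
   finally show ?thesis by (simp only: d')
  qed
  with 2 show ?thesis by simp
 qed
 have "(CS x:S. ennreal (?nu x)) = 1" by (rule Sigma_nn_integral[OF nu])
 from C.euler_step[OF Mo e n0 this up] show ?thesis by (simp add: h_def A_def C.A_def)
qed

end

section \<open>Iteration of the coupling\<close>

definition coupled :: "real => real => 'a::euclidean_space set => 'w measure => ('w => 'a) => ('w => 'a) => ('a => real) => bool" where
 "coupled V e S M Y X mu \<longleftrightarrow> prob_space M & Y : M ->M count_space S & X : bmeas M \<and>
  (NN om:M. ennreal ((norm (Y om - X om))^2)) <= ennreal V \<and>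
  (CS x:S. ennreal (weight x * \<bar>state_law M Y x - mu x\<bar>)) <= ennreal e"

lemma coupled_mono: "coupled V e S M Y X mu ==> V <= V' ==> e <= e' ==> coupled V' e' S M Y X mu"
 unfolding coupled_def by (meson ennreal_leI order_trans)

text \<open>Each jump enlarges the type of the sample space; pushing forward along J returns to a
  type that fits the iteration.\<close>

lemma coupled_distr:
 assumes c: "coupled V e S M Y X mu" and J: "J : M ->M N" and Y': "Y' : N ->M count_space S" and X'[measurable]: "X' : bmeas N"
  and eq: "!!p. p : space M ==> Y' (J p) = Y p & X' (J p) = X p"
 shows "coupled V e S (distr M N J) Y' X' mu"
proof -
 have M: "prob_space M" using c by (simp add: coupled_def)
 have [measurable]: "Y' : bmeas N" using mcomp[OF Y' borel_measurable_count_space, of "%x. x"] by simp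
 have "(NN om:(distr M N J). ennreal ((norm (Y' om - X' om))^2)) = (NN om:M. ennreal ((norm (Y' (J om) - X' (J om)))^2))"
  by (rule nn_integral_distr[OF J]) simp
 also have "... = (NN om:M. ennreal ((norm (Y om - X om))^2))" by (rule nn_integral_cong) (simp add: eq)
 finally have 1: "(NN om:(distr M N J). ennreal ((norm (Y' om - X' om))^2)) <= ennreal V" using c by (simp add: coupled_def)
 have 2: "state_law (distr M N J) Y' x = state_law M Y x" if x: "x : S" for x
 proof -
  have "Y' -` {x} \<inter> space N : sets N" using x by (intro measurable_sets[OF Y']) simp
  then have "state_law (distr M N J) Y' x = measure M (J -` (Y' -` {x} \<inter> space N) \<inter> space M)"
   unfolding state_law_def space_distr by (rule measure_distr[OF J])
  also have "J -` (Y' -` {x} \<inter> space N) \<inter> space M = Y -` {x} \<inter> space M" using eq measurable_space[OF J] by auto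
  finally show ?thesis by (simp add: state_law_def)
 qed
 have "(CS x:S. ennreal (weight x * \<bar>state_law (distr M N J) Y' x - mu x\<bar>)) = (CS x:S. ennreal (weight x * \<bar>state_law M Y x - mu x\<bar>))"
  by (rule nn_integral_cong) (simp add: 2)
 then show ?thesis using c 1 Y' prob_space.prob_space_distr[OF M J] by (simp add: coupled_def)
qed

text \<open>The disintegration of a coupling of a discrete law with \<open>m0\<close>, as densities with respect to \<open>m0\<close>.\<close>

lemma coupling_weights:
 fixes m0 :: "'a::euclidean_space measure"
 assumes S: "countable S" and mu: "mu : Sigma1 S" and p: "p : couplings (chain_measure S mu) m0" and m0: "prob_space m0" "sets m0 = sets borel"
 obtains w :: "'a => 'a => ennreal" where "!!y. w y : bmeas borel" "AE x in m0. (CS y:S. w y x) = 1"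
  "!!y h. h : bmeas borel ==> (NN x:m0. w y x * h x) = (NN z:p. ind {y} (fst z) * h (snd z))"
proof -
 interpret m0: prob_space m0 by fact
 have sp[measurable_cong]: "sets p = sets (borel2)" and d1: "distr p borel fst = chain_measure S mu" and d2: "distr p borel snd = m0"
  using p by (auto simp: couplings_def)
 have fm[measurable]: "fst : p ->M borel" "snd : p ->M borel" by measurable
 \<comment> \<open>The part of the coupling with first coordinate y, seen through its second
   coordinate; it is dominated by m0 and so has a density.\<close>
 define py where "py y = distr (density p (%z. ind {y} (fst z))) borel snd" for y
 have pyi: "(NN x:(py y). h x) = (NN z:p. ind {y} (fst z) * h (snd z))" if [measurable]: "h : bmeas borel" for h y
  unfolding py_def by (simp add: nn_integral_distr nn_integral_density)
 have m0i: "(NN x:m0. h x) = (NN z:p. h (snd z))" if "h : bmeas borel" for h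
  unfolding d2[symmetric] by (rule nn_integral_distr[OF fm(2)]) (use that in simp)
 have ac: "absolutely_continuous m0 (py y)" for y unfolding absolutely_continuous_def
 proof
  fix A assume A: "A : null_sets m0"
  then have [measurable]: "A : sets borel" using m0 by (auto simp: null_sets_def)
  have "(NN x:(py y). ind A x) <= (NN x:m0. ind A x)"
   unfolding pyi[of "ind A", simplified] m0i[of "ind A", simplified] by (rule nn_integral_mono) (auto split: split_indicator)
  then show "A : null_sets (py y)" using A m0 by (simp add: null_sets_def py_def)
 qed
 define w where "w y = RN_deriv m0 (py y)" for y
 have wm: "w y : bmeas borel" for y using borel_measurable_RN_deriv[of m0 "py y"] m0 by (simp add: w_def cong: measurable_cong_sets)
 have dw: "density m0 (w y) = py y" for y unfolding w_def
  by (rule m0.density_RN_deriv[OF ac]) (simp add: py_def m0)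
 have wi: "(NN x:m0. w y x * h x) = (NN z:p. ind {y} (fst z) * h (snd z))" if h: "h : bmeas borel" for y h
  using nn_integral_density[of "w y" m0 h] wm h m0 unfolding dw pyi[OF h] by (simp cong: measurable_cong_sets)
 have Sb: "S : sets borel" by (rule sets.countable[OF _ S]) simp
 have fS: "AE z in p. fst z : S"
 proof -
  have "(NN z:p. ind (- S) (fst z)) = (NN x:(chain_measure S mu). ind (- S) x)"
   unfolding d1[symmetric] by (rule nn_integral_distr[OF fm(1), symmetric]) (use Sb in simp)
  also have "... = (CS x:S. 0)" using Sb by (subst nn_integral_chain_measure) (simp, intro nn_integral_cong, simp)
  finally have z: "(NN z:p. ind (- S) (fst z)) = 0" by simp
  have "(%z. ind (- S) (fst z) :: ennreal) : bmeas p"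
   by (rule mcomp[OF fm(1) borel_measurable_indicator]) (use Sb in simp)
  from nn_integral_0_iff_AE[OF this] z have "AE z in p. ind (- S) (fst z) = (0::ennreal)" by simp
  then show ?thesis by eventually_elim (auto split: split_indicator_asm)
 qed
 let ?W = "%x. (CS y:S. w y x)"
 have Wm: "?W : bmeas m0"
 proof -
  have "(%(x, y). w y x) : bmeas (m0 *M count_space S)"
   by (rule measurable_pair_countable[OF S]) (use wm m0 in \<open>simp cong: measurable_cong_sets\<close>)
  then show ?thesis by (rule sigma_finite_measure.borel_measurable_nn_integral[OF sigma_finite_measure_count_space_countable[OF S]])
 qed
 have "density m0 ?W = density m0 (%_. 1)"
 proof (rule measure_eqI)
  fix A assume "A : sets (density m0 ?W)"
  then have A[measurable]: "A : sets borel" "A : sets m0" using m0 by simp_all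
  have "emeasure (density m0 ?W) A = (NN x:m0. (CS y:S. w y x * ind A x))"
   using Wm A by (simp add: emeasure_density nn_integral_multc)
  also have "... = (CS y:S. (NN x:m0. w y x * ind A x))"
   by (rule swap_CS[OF S, symmetric]) (use wm m0 in \<open>simp cong: measurable_cong_sets\<close>)
  also have "... = (CS y:S. (NN z:p. ind {y} (fst z) * ind A (snd z)))"
   using A by (intro nn_integral_cong wi) simp
  also have "... = (NN z:p. (CS y:S. ind {y} (fst z) * ind A (snd z)))"
   by (rule swap_CS[OF S]) measurable
  also have "... = (NN z:p. ind A (snd z))"
  proof (rule nn_integral_cong_AE)
   show "AE z in p. (CS y:S. ind {y} (fst z) * ind A (snd z)) = ind A (snd z)"
    using fS
   proof eventually_elim
    case (elim z)
    from CS_singleton[OF this, of "%_. ind A (snd z)"] show ?case by (simp add: indicator_def eq_commute)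
   qed
  qed
  also have "... = emeasure m0 A" using m0i[of "ind A"] A by simp
  finally show "emeasure (density m0 ?W) A = emeasure (density m0 (%_. 1)) A" by (simp add: density_1)
 qed simp
 then have "AE x in m0. ?W x = 1" using m0.density_unique_iff[OF Wm, of "%_. 1"] by simp
 then show thesis by (rule that[OF wm _ wi])
qed

text \<open>The initial state is drawn with the conditional weights of the coupling at the position
  \<open>y0\<close>. This realises the cost of p on a sample space that may carry further data, such
  as the agent's control.\<close>

lemma coupled_initial:
 fixes m0 :: "'a::euclidean_space measure"
 assumes S: "countable S" and mu: "mu : Sigma1 S" and p: "p : couplings (chain_measure S mu) m0" and M: "prob_space M"
  and y0[measurable]: "y0 : bmeas M" and law: "distr M borel y0 = m0" and V: "(NN z:p. ennreal ((dist (fst z) (snd z))^2)) <= ennreal V"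
 obtains G where "!!y. (%om. G om y) : bmeas M" "AE om in M. (CS y:S. G om y) = 1"
  "coupled V 0 S (extend_state S M G) snd (%p. y0 (fst p)) mu"
proof -
 have m0: "prob_space m0" "sets m0 = sets borel" unfolding law[symmetric] by (auto intro: prob_space.prob_space_distr[OF M])
 have [measurable_cong]: "sets p = sets (borel2)" and d1: "distr p borel fst = chain_measure S mu" using p by (auto simp: couplings_def)
 obtain w where wm[measurable]: "!!y. w y : bmeas borel" and w1: "AE x in m0. (CS y:S. w y x) = 1"
  and wi: "!!y h. h : bmeas borel ==> (NN x:m0. w y x * h x) = (NN z:p. ind {y} (fst z) * h (snd z))"
  by (rule coupling_weights[OF S mu p m0]) (rule that)
 define G where "G om y = w y (y0 om)" for om y
 have Gm: "(%om. G om y) : bmeas M" for y unfolding G_def by measurable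
 have G1: "AE om in M. (CS y:S. G om y) = 1"
 proof -
  have "AE x in distr M borel y0. (CS y:S. w y x) = 1" unfolding law by (rule w1)
  then have "AE om in M. (CS y:S. w y (y0 om)) = 1" by (rule AE_distrD[OF y0])
  then show ?thesis by (simp add: G_def)
 qed
 have P: "prob_space (extend_state S M G)" by (rule prob_space_extend_state[OF S M Gm G1])
 have sm: "snd : extend_state S M G ->M count_space S" by (simp cong: measurable_cong_sets)
 have int: "(NN q:(extend_state S M G). ind {y} (snd q) * h (y0 (fst q))) = (NN z:p. ind {y} (fst z) * h (snd z))"
  if h[measurable]: "h : bmeas borel" and y: "y : S" for h y
 proof -
  have "(NN q:(extend_state S M G). ind {y} (snd q) * h (y0 (fst q))) = (NN om:M. (CS y':S. G om y' * (ind {y} y' * h (y0 om))))"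
   by (subst nn_integral_extend_state[OF S Gm]) simp_all
  also have "... = (NN om:M. w y (y0 om) * h (y0 om))"
  proof (rule nn_integral_cong, goal_cases)
   case (1 om)
   from CS_singleton[OF y, of "%y'. w y' (y0 om) * h (y0 om)"]
   show ?case
    by (simp only: G_def mult.left_commute[of "w _ _"])
  qed
  also have "... = (NN x:m0. w y x * h x)" unfolding law[symmetric] by (rule nn_integral_distr[symmetric]) measurable
  finally show ?thesis using wi[OF h] by simp
 qed
 have "state_law (extend_state S M G) snd y = mu y" if y: "y : S" for y
 proof -
  have "ennreal (state_law (extend_state S M G) snd y) = (NN z:p. ind {y} (fst z))"
   using int[of "%_. 1" y] y by (simp add: state_law_nn_integral[OF P sm])
  also have "... = (NN x:(chain_measure S mu). ind {y} x)"
   unfolding d1[symmetric] by (rule nn_integral_distr[symmetric]) measurable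
  also have "... = (CS x:S. ennreal (mu x) * ind {y} x)" by (rule nn_integral_chain_measure) simp
  also have "... = ennreal (mu y)" using CS_singleton[OF y, of "%x. ennreal (mu x)"] by (simp add: mult.commute)
  finally show ?thesis using mu by (simp add: state_law_def Sigma1_def)
 qed
 then have "(CS x:S. ennreal (weight x * \<bar>state_law (extend_state S M G) snd x - mu x\<bar>)) = (CS x:S. 0)"
  by (intro nn_integral_cong) simp
 moreover have "(NN q:(extend_state S M G). ennreal ((norm (snd q - y0 (fst q)))^2)) <= ennreal V"
 proof -
  have "(NN q:(extend_state S M G). ennreal ((norm (snd q - y0 (fst q)))^2))
   = (CS y:S. (NN q:(extend_state S M G). ind {y} (snd q) * ennreal ((norm (y - y0 (fst q)))^2)))"
   by (rule nn_integral_partition[OF S sm, where g="%y q. ennreal ((norm (y - y0 (fst q)))^2)"]) measurable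
  also have "... = (CS y:S. (NN z:p. ind {y} (fst z) * ennreal ((norm (y - snd z))^2)))"
   by (rule nn_integral_cong, rule int[where h="%x. ennreal ((norm (_ - x))^2)"]) auto
  also have "... = (NN z:p. (CS y:S. ind {y} (fst z) * ennreal ((norm (y - snd z))^2)))"
   by (rule swap_CS[OF S]) measurable
  also have "... <= (NN z:p. ennreal ((dist (fst z) (snd z))^2))"
  proof (rule nn_integral_mono, goal_cases)
   case (1 z)
   show ?case
   proof (cases "fst z : S")
    case True
    from CS_singleton[OF True, of "%y. ennreal ((norm (y - snd z))^2)"]
    show ?thesis by (simp add: indicator_def eq_commute dist_norm)
   next
    case False
    then have "(CS y:S. ind {y} (fst z) * ennreal ((norm (y - snd z))^2)) = (CS y:S. 0)"
     by (intro nn_integral_cong) (auto split: split_indicator)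
    then show ?thesis by simp
   qed
  qed
  finally show ?thesis using V by (rule order_trans)
 qed
 moreover have "(%p. y0 (fst p)) : bmeas (extend_state S M G)" by measurable
 ultimately show thesis using P sm by (intro that[OF Gm G1]) (simp add: coupled_def)
qed

text \<open>Conditioning on Y = x and averaging the normalised controls with \<open>bind\<close>
  gives a probability on time and control. Every control has the uniform time marginal, hence so has
  the average, and its functional representation is again a relaxed control.\<close>

lemma mixture_control:
 fixes xi :: "'w => (real * 'u::metric_space) measure"
 assumes cpt: "compact (UNIV :: 'u set)" and T: "0 < T" and M: "prob_space M" and Y: "Y : M ->M count_space S"
  and xi: "xi : M ->M relaxed_space 0 T"
 shows "EX Phi:borel2 ->M borel. ALL F:bmeas (borel2).
  (NN om:M. ind {x} (Y om) * (NN z:(normed T (xi om)). F z))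
   = ennreal (state_law M Y x) * (ennreal (1 / T) * (NN t:lborel|{0..T}. (NN v:U01. F (t, Phi (t, v)))))"
\<comment> \<open>States of probability zero receive an arbitrary control, both sides being
  zero.\<close>
proof (cases "state_law M Y x = 0")
 case True
 have im: "(%om. ind {x} (Y om) :: ennreal) : bmeas M" by (rule measurable_state_indicator[OF Y])
 have "AE om in M. ind {x} (Y om) = (0::ennreal)"
  using state_law_nn_integral[OF M Y, of x] True im by (simp add: nn_integral_0_iff_AE)
 then have "(NN om:M. ind {x} (Y om) * h om) = (NN om:M. 0)" for h :: "'w => ennreal"
  by (intro nn_integral_cong_AE) auto
 then show ?thesis using True by (intro bexI[of _ "%_. undefined"]) simp_all
next
 case False
 define c where "c = state_law M Y x"
 have c: "0 < c" using False by (simp add: c_def state_law_def zero_less_measure_iff)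
 have im[measurable]: "(%om. ind {x} (Y om) :: ennreal) : bmeas M" by (rule measurable_state_indicator[OF Y])
 define Mx where "Mx = density M (%om. ennreal (1 / c) * ind {x} (Y om))"
 have Mxi: "(NN om:Mx. h om) = ennreal (1 / c) * (NN om:M. ind {x} (Y om) * h om)" if [measurable]: "h : bmeas M" for h
  unfolding Mx_def by (subst nn_integral_density) (simp_all add: mult.assoc nn_integral_cmult)
 have "(NN om:Mx. 1) = 1" using c by (subst Mxi) (simp_all add: state_law_nn_integral[OF M Y] c_def[symmetric] flip: ennreal_mult)
 then have Mx: "prob_space Mx" by (intro prob_spaceI) simp
 have K: "(%om. normed T (xi om)) : M ->M prob_algebra (borel2)"
  by (rule mcomp[OF xi measurable_normalized_control[OF cpt T]])
 then have Kx: "(%om. normed T (xi om)) : Mx ->M prob_algebra (borel2)" by (simp add: Mx_def)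
 have Ki: "(%om. (NN z:(normed T (xi om)). F z)) : bmeas M" if "F : bmeas (borel2)" for F
  by (rule mcomp[OF measurable_prob_algebraD[OF K] nn_integral_measurable_subprob_algebra[OF that]])
 define beta where "beta = Mx \<bind> (%om. normed T (xi om))"
 have ne: "space Mx ~= {}" by (rule prob_space.not_empty[OF Mx])
 have sbeta: "sets beta = sets (borel2)" unfolding beta_def by (rule sets_bind[OF _ ne]) simp
 have pbeta: "prob_space beta" unfolding beta_def
  by (rule prob_space.prob_space_bind[OF Mx AE_I2 measurable_prob_algebraD[OF Kx]]) (use measurable_space[OF Kx] in \<open>auto simp: space_prob_algebra\<close>)
 have betai: "(NN z:beta. F z) = ennreal (1 / c) * (NN om:M. ind {x} (Y om) * (NN z:(normed T (xi om)). F z))"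
  if F: "F : bmeas (borel2)" for F
  unfolding beta_def by (simp only: nn_integral_bind[OF F measurable_prob_algebraD[OF Kx]] Mxi[OF Ki[OF F]])
 obtain Phi where Phi[measurable]: "Phi : borel2 ->M borel" and rep: "beta = distr (distr beta borel fst *M U01) (borel2) (%(t, v). (t, Phi (t, v)))"
  using functional_representation[OF cpt pbeta sbeta] by blast
 have fm: "fst : beta ->M borel" using sbeta by (simp cong: measurable_cong_sets)
 have marg: "(NN t:(distr beta borel fst). k t) = ennreal (1 / T) * (NN t:lborel|{0..T}. k t)" if k[measurable]: "k : bmeas borel" for k
 proof -
  have "(NN t:(distr beta borel fst). k t) = (NN z:beta. k (fst z))" by (rule nn_integral_distr[OF fm]) simp
  also have "... = ennreal (1 / c) * (NN om:M. ind {x} (Y om) * (NN z:(normed T (xi om)). k (fst z)))" by (rule betai) measurable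
  also have "(NN om:M. ind {x} (Y om) * (NN z:(normed T (xi om)). k (fst z)))
   = (NN om:M. ind {x} (Y om) * (ennreal (1 / T) * (NN t:lborel|{0..T}. k t)))"
   by (rule nn_integral_cong) (use measurable_space[OF xi] in \<open>simp add: space_relaxed_space normalized_control_marginal[OF _ T k]\<close>)
  also have "... = ennreal c * (ennreal (1 / T) * (NN t:lborel|{0..T}. k t))"
   by (simp add: nn_integral_multc state_law_nn_integral[OF M Y] c_def)
  finally show ?thesis using c by (simp flip: mult.assoc ennreal_mult)
 qed
 show ?thesis
 proof (intro bexI[OF _ Phi] ballI)
  fix F :: "real * 'u => ennreal" assume F[measurable]: "F : bmeas (borel2)"
  interpret V: prob_space U01 by (rule prob_space_U01)
  note FP = measurable_time_mixture(1)[OF _ Phi]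
  have 1: "(%z. (fst z, snd z)) : borel *M U01 ->M borel2"
   by (intro measurable_Pair measurable_fst mcomp[OF measurable_snd measurable_interval])
  have gm: "(%z. (fst z, Phi z)) : borel *M U01 ->M borel2"
   using mcomp[OF 1 measurable_Pair[OF measurable_fst Phi]] by simp
  have hm: "(%z. F (fst z, Phi z)) : bmeas (borel *M U01)" by (rule mcomp[OF gm F])
  have km: "(%t. (NN v:U01. F (t, Phi (t, v)))) : bmeas borel"
   by (rule V.borel_measurable_nn_integral) (use hm in \<open>simp add: case_prod_unfold\<close>)
  have "(NN z:beta. F z) = (NN z:(distr beta borel fst *M U01). F (fst z, Phi z))"
   using gm by (subst rep) (simp add: nn_integral_distr case_prod_unfold cong: measurable_cong_sets)
  also have "... = (NN t:(distr beta borel fst). (NN v:U01. F (t, Phi (t, v))))"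
   using V.nn_integral_fst[of "%z. F (fst z, Phi z)" "distr beta borel fst"] hm by (simp cong: measurable_cong_sets)
  also have "... = ennreal (1 / T) * (NN t:lborel|{0..T}. (NN v:U01. F (t, Phi (t, v))))" by (rule marg[OF km])
  finally have "ennreal c * (ennreal (1 / c) * (NN om:M. ind {x} (Y om) * (NN z:(normed T (xi om)). F z)))
   = ennreal c * (ennreal (1 / T) * (NN t:lborel|{0..T}. (NN v:U01. F (t, Phi (t, v)))))" unfolding betai[OF F] by simp
  then show "(NN om:M. ind {x} (Y om) * (NN z:(normed T (xi om)). F z))
   = ennreal (state_law M Y x) * (ennreal (1 / T) * (NN t:lborel|{0..T}. (NN v:U01. F (t, Phi (t, v)))))"
   using c by (simp add: c_def[symmetric] flip: mult.assoc ennreal_mult)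
 qed
qed

section \<open>Error schedule\<close>

text \<open>\<open>V0\<close> bounds the initial cost, \<open>M0\<close> the initial weighted
  moment, and h D the error in law that arises within one step. The conditions \<open>small\<close>
  make every remainder that contains B, M0 or R cost at most eps^2, so that only L and T enter the
  final bound.\<close>

locale schedule =
 fixes T h eps L R B M0 V0 A C D :: real and n :: nat
 assumes n: "0 < n" and Th: "T = n * h" and h: "0 < h" and L: "0 < L" and B: "1 <= B" and M0: "0 <= M0" and V0: "0 <= V0"
  and A: "A = 4 * B + 2" and C: "C = 2 + 10 * L" and D: "D = A * M0 * exp (2 * A * T)"
  and small: "C * (R^2 * h^2) + 4 * L * (h * D * exp (A * T)) <= eps^2" "R^2 * h^2 + h * D * exp (A * T) <= eps^2"
begin

definition "V k = exp (C * (real k * h)) * (V0 + 3 * (real k * h) * eps^2)"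
text \<open>Vanishes at k = 0 and dominates the recursion that sends e to (1 + A h) e + A h (h
  D).\<close>

definition "e k = h * D * (exp (A * (real k * h)) - 1)"
definition "Mo k = M0 * exp (A * (real k * h))"
definition "E k = e k + A * h * (Mo k * exp (A * h))"
definition "bound = sqrt (4 * exp (C * T) * (V0 + 3 * T * eps^2) + 4 * eps^2)"

lemma pos: "0 < A" "0 < C" "0 <= D" using A B C D L M0 by auto

lemma nonneg: "0 <= V k" "0 <= e k" "0 <= Mo k"
 using pos h V0 M0 by (auto simp: V_def e_def Mo_def intro!: mult_nonneg_nonneg add_nonneg_nonneg)

lemma time_le: "k <= n ==> real k * h <= T"
 unfolding Th by (intro mult_right_mono) (use h in auto)

lemma euler_increment:
 assumes "k < n"
 shows "A * h * (Mo k * exp (A * h)) <= h * D"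
proof -
 have "real k * h + h = real (Suc k) * h" by (simp add: algebra_simps)
 also have "... <= 2 * T" using time_le[of "Suc k"] assms Th h by simp
 finally have "A * (real k * h + h) <= A * (2 * T)" using pos by (intro mult_left_mono) auto
 then have "exp (A * (real k * h)) * exp (A * h) <= exp (2 * A * T)" by (simp add: exp_add[symmetric] algebra_simps)
 then have "A * h * M0 * (exp (A * (real k * h)) * exp (A * h)) <= A * h * M0 * exp (2 * A * T)"
  by (rule mult_left_mono) (use pos h M0 in auto)
 then show ?thesis by (simp add: Mo_def D algebra_simps)
qed

lemma E_le:
 assumes k: "k < n"
 shows "E k <= h * D * exp (A * T)"
proof -
 have "E k <= h * D * exp (A * (real k * h))" using euler_increment[OF k] by (simp add: E_def e_def algebra_simps)
 also have "... <= h * D * exp (A * T)"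
  using time_le[of k] k pos h by (intro mult_left_mono) auto
 finally show ?thesis .
qed

lemma e_step:
 assumes k: "k < n"
 shows "e k + A * h * E k <= e (Suc k)"
proof -
 define x where "x = exp (A * (real k * h))"
 have "e k + A * h * E k <= e k + A * h * (e k + h * D)"
  unfolding E_def using euler_increment[OF k] pos h by (intro add_left_mono mult_left_mono) auto
 also have "... = h * D * (x * (1 + A * h) - 1)" by (simp add: e_def x_def algebra_simps)
 also have "... <= h * D * (x * exp (A * h) - 1)"
  using exp_ge_add_one_self[of "A * h"] pos h by (intro mult_left_mono diff_right_mono) (auto simp: x_def)
 also have "... = e (Suc k)" by (simp add: e_def x_def exp_add[symmetric] algebra_simps)
 finally show ?thesis .
qed

lemma V_step:
 assumes k: "k < n"
 shows "(1 + (2 + 10 * L) * h) * V k + h * (2 * eps^2 + (2 + 10 * L) * (R^2 * h^2) + 4 * L * E k) <= V (Suc k)"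
proof -
 have "4 * L * E k <= 4 * L * (h * D * exp (A * T))" by (rule mult_left_mono[OF E_le[OF k]]) (use L in simp)
 then have "h * (2 * eps^2 + C * (R^2 * h^2) + 4 * L * E k) <= h * (3 * eps^2)"
  using small(1) h by (intro mult_left_mono) auto
 moreover have "(1 + C * h) * V k <= exp (C * h) * V k"
  using exp_ge_add_one_self[of "C * h"] nonneg(1) by (intro mult_right_mono) auto
 moreover have "h * (3 * eps^2) <= exp (C * (real (Suc k) * h)) * (h * (3 * eps^2))"
  using pos h mult_right_mono[of 1 "exp (C * (real (Suc k) * h))" "h * (3 * eps^2)"] by simp
 moreover have "exp (C * h) * V k + exp (C * (real (Suc k) * h)) * (h * (3 * eps^2)) = V (Suc k)"
 proof -
  have "exp (C * (real (Suc k) * h)) = exp (C * h) * exp (C * (real k * h))" by (simp add: exp_add[symmetric] algebra_simps)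
  then show ?thesis by (simp add: V_def algebra_simps)
 qed
 ultimately show ?thesis unfolding C[symmetric] by linarith
qed

lemma W2_bound:
 assumes k: "k < n"
 shows "sqrt (4 * V k + 4 * (R^2 * h^2) + 4 * E k) <= bound"
proof -
 have t: "real k * h <= T" "0 <= real k * h" using time_le[of k] k h by auto
 have "V k <= exp (C * T) * (V0 + 3 * T * eps^2)"
  unfolding V_def using t pos V0 h by (intro mult_mono add_left_mono mult_right_mono) auto
 then show ?thesis unfolding bound_def using small(2) E_le[OF k] by (intro real_sqrt_le_mono) simp
qed

end

section \<open>Chain motions near a given motion\<close>

locale scheduled = coupled_system T f K S Q BQ eps L R m + schedule T h eps L R B M0 V0 A C D n
 for T :: real and f :: "real => 'a::euclidean_space => 'a measure => 'u::metric_space => 'a" and K S Q BQ eps L R m h M0 V0 A C D n +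
 assumes hB: "h * B <= 1"
begin

text \<open>The induction step common to both directions, which differ in the sample space and in
  how the law of the agents and the hypothesis \<open>mix\<close> are secured.\<close>

lemma advance:
 assumes k: "k < n" and cf: "chain_flow S Q (real k * h) (real (Suc k) * h) Phi mu"
  and c: "coupled (V k) (e k) S M Y (%om. agent (y0 om) (xi om) (real k * h)) (mu (real k * h))"
  and Mo: "(CS x:S. ennreal (weight x * mu (real k * h) x)) <= ennreal (Mo k)"
  and y0: "y0 : bmeas M" and xi: "xi : M ->M relaxed_space 0 T"
  and mX0: "ALL t:{real k * h..real (Suc k) * h}. m t = distr M borel (%om. agent (y0 om) (xi om) t)"
  and mix: "ALL x:S. ALL F:bmeas (borel2).
   (NN om:M. ind {x} (Y om) * (NN z:(normed T (xi om)). ind {real k * h<..real (Suc k) * h} (fst z) * F z))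
    = ennreal (state_law M Y x) * (ennreal (1 / T) * (NN tau:lborel|{real k * h<..real (Suc k) * h}. (NN v:U01. F (tau, Phi x (tau, v)))))"
 shows "!!t. t : {real k * h..real (Suc k) * h} ==> W2 (m t) (chain_measure S (mu t)) <= bound"
  and "coupled (V (Suc k)) (e (Suc k)) S (extend_state S M (chain_jump T Q (real k * h) (real (Suc k) * h) mu Y xi)) snd
   (%p. agent (y0 (fst p)) (xi (fst p)) (real (Suc k) * h)) (mu (real (Suc k) * h))"
  and "(CS x:S. ennreal (weight x * mu (real (Suc k) * h) x)) <= ennreal (Mo (Suc k))"
  and "!!g. g : bmeas M ==> (NN p:(extend_state S M (chain_jump T Q (real k * h) (real (Suc k) * h) mu Y xi)). g (fst p)) = (NN om:M. g om)"
proof -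
 have d: "real (Suc k) * h - real k * h = h" by (simp add: algebra_simps)
 have t: "0 <= real k * h" "real k * h < real (Suc k) * h" "real (Suc k) * h <= T" "(real (Suc k) * h - real k * h) * B <= 1"
  using h time_le[of "Suc k"] k hB unfolding d by simp_all
 note mX = bspec[OF mX0]
 have c': "prob_space M" "Y : M ->M count_space S" "(NN om:M. ennreal ((norm (Y om - agent (y0 om) (xi om) (real k * h)))^2)) <= ennreal (V k)"
  "(CS x:S. ennreal (weight x * \<bar>state_law M Y x - mu (real k * h) x\<bar>)) <= ennreal (e k)"
  using c unfolding coupled_def by blast+
 interpret P: coupled_step T f K S Q BQ eps L R m "real k * h" "real (Suc k) * h" Phi mu M Y xi y0 "V k" "e k" "Mo k"
  by (intro coupled_step.intro jump_step.intro jump_step_axioms.intro coupled_step_axioms.intro coupled_system_axioms rate_system_axioms) (fact t c' cf y0 xi mX nonneg Mo)+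
 have e: "P.h = h" "P.A = A" unfolding P.h_def P.A_def A d by simp_all
 have e': "P.e' = E k" unfolding P.e'_def e E_def by (rule refl)
 interpret C: linear_chain S B "real k * h" "real (Suc k) * h" "averaged Q (real k * h) (real (Suc k) * h) Phi mu" mu by (rule P.linear)
 show "W2 (m t) (chain_measure S (mu t)) <= bound" if "t : {real k * h..real (Suc k) * h}" for t
  using order_trans[OF P.step_W2[OF that]] W2_bound[OF k] by (simp only: e e')
 have sm: "snd : extend_state S M P.G ->M count_space S" by (simp cong: measurable_cong_sets)
 have "coupled ((1 + (2 + 10 * L) * h) * V k + h * (2 * eps^2 + (2 + 10 * L) * (R^2 * h^2) + 4 * L * E k)) (e k + A * h * E k) S (extend_state S M P.G) snd
   (%p. agent (y0 (fst p)) (xi (fst p)) (real (Suc k) * h)) (mu (real (Suc k) * h))"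
  unfolding coupled_def
 proof (intro conjI sm P.prob_space_step)
  show "(%p. agent (y0 (fst p)) (xi (fst p)) (real (Suc k) * h)) : bmeas (extend_state S M P.G)"
   by (rule mcomp[where f=fst and g="P.X (real (Suc k) * h)", OF _ P.X_measurable]) (simp only: measurable_cong_sets[OF sets_extend_state refl] measurable_fst)
  show "(NN p:(extend_state S M P.G). ennreal ((norm (snd p - agent (y0 (fst p)) (xi (fst p)) (real (Suc k) * h)))^2))
   <= ennreal ((1 + (2 + 10 * L) * h) * V k + h * (2 * eps^2 + (2 + 10 * L) * (R^2 * h^2) + 4 * L * E k))"
   by (rule P.step_cost[unfolded e e'])
  show "(CS x:S. ennreal (weight x * \<bar>state_law (extend_state S M P.G) snd x - mu (real (Suc k) * h) x\<bar>)) <= ennreal (e k + A * h * E k)"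
   by (rule P.step_law[unfolded e, folded E_def]) (rule bspec[OF bspec[OF mix]])
 qed
 then show "coupled (V (Suc k)) (e (Suc k)) S (extend_state S M P.G) snd
   (%p. agent (y0 (fst p)) (xi (fst p)) (real (Suc k) * h)) (mu (real (Suc k) * h))"
  by (rule coupled_mono[OF _ V_step[OF k] e_step[OF k]])
 show "(NN p:(extend_state S M P.G). g (fst p)) = (NN om:M. g om)" if "g : bmeas M" for g
  by (rule P.step_marginal[OF that])
 have "(CS x:S. ennreal (weight x * mu (real (Suc k) * h) x)) <= ennreal (Mo k * exp (C.A * (real (Suc k) * h - real k * h)))"
  by (rule C.moment_bound[OF _ Mo nonneg(3)]) (use h in simp)
 also have "Mo k * exp (C.A * (real (Suc k) * h - real k * h)) = Mo (Suc k)"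
  by (simp only: d C.A_def A[symmetric]) (simp add: Mo_def exp_add[symmetric] algebra_simps)
 finally show "(CS x:S. ennreal (weight x * mu (real (Suc k) * h) x)) <= ennreal (Mo (Suc k))" .
qed

lemma chain_motion_near:
 fixes alpha :: "('a * (real * 'u) measure) measure"
 assumes alpha: "sets alpha = sets (borel *M relaxed_space 0 T)" "prob_space alpha"
  and mX: "!!t. t : {0..T} ==> m t = distr alpha borel (%p. agent (fst p) (snd p) t)"
  and mu0: "mu0 : Sigma2 S" and p: "p : couplings (chain_measure S mu0) (distr alpha borel fst)"
  and V: "(NN z:p. ennreal ((dist (fst z) (snd z))^2)) <= ennreal V0"
  and Mo: "(CS x:S. ennreal (weight x * mu0 x)) <= ennreal M0"
 shows "EX mu:chain_motions T S Q mu0. ALL t:{0..T}. W2 (m t) (chain_measure S (mu t)) <= bound"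
proof -
 have fm: "fst : bmeas alpha" "snd : alpha ->M relaxed_space 0 T" using alpha(1) by (simp_all cong: measurable_cong_sets)
 have sol: "(%p. agent (fst p) (snd p) t) : bmeas alpha" for t
  using mcomp[OF measurable_Pair[OF fm] solution_measurable[OF cpt T rf L0]] by simp
 \<comment> \<open>For prescribed functions \<open>Phi0\<close> well-posedness of the chain yields a
   flow with exactly this representation of the feedback.\<close>
 have wp: "EX Phi mu. chain_flow S Q s r Phi mu & mu s = mui & (ALL x. Phi x = Phi0 x)"
  if "0 <= s" "s < r" "r <= T" "mui : Sigma2 S" "!!x. Phi0 x : borel2 ->M borel" for s r mui and Phi0 :: "'a => real * real => 'u"
 proof -
  have "(%x. fcontrol s r (Phi0 x)) : feedback_controls S s r" unfolding feedback_controls_def using function_control_in[OF that(5)] by simp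
  moreover have "ALL zeta:feedback_controls S s r. EX mu. is_chain_motion S Q s r mui zeta mu"
   using mc that(1-4) unfolding markov_chain_def chain_well_posed_def by meson
  ultimately obtain mu where "is_chain_motion S Q s r mui (%x. fcontrol s r (Phi0 x)) mu" by blast
  from chain_motion_flow[OF that(1) _ that(3,4) this that(5) refl] that(2) show ?thesis by (intro exI[of _ Phi0] exI[of _ mu]) simp
 qed
 \<comment> \<open>The sample space is always that of alpha together with the current state. Past
   states may be forgotten, since the agents' controls are given and only the marginal alpha has to
   persist. The W2 bound is claimed for positive k, because at time 0 it is part of the first
   step.\<close>
 let ?P = "%k Phi mu N. chain_flow S Q 0 (real k * h) Phi mu & mu 0 = mu0 & sets N = sets (alpha *M count_space S) \<and>
  coupled (V k) (e k) S N snd (%p. agent (fst (fst p)) (snd (fst p)) (real k * h)) (mu (real k * h)) \<and>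
  (CS x:S. ennreal (weight x * mu (real k * h) x)) <= ennreal (Mo k) \<and>
  (ALL g:bmeas alpha. (NN p:N. g (fst p)) = (NN om:alpha. g om)) \<and>
  (0 < k --> (ALL t:{0..real k * h}. W2 (m t) (chain_measure S (mu t)) <= bound))"
 have "k <= n ==> EX Phi mu N. ?P k Phi mu N" for k
 proof (induction k)
  case 0
  obtain G where G: "!!y. (%om. G om y) : bmeas alpha" "AE om in alpha. (CS y:S. G om y) = 1"
   and c: "coupled V0 0 S (extend_state S alpha G) snd (%p. fst (fst p)) mu0"
   by (rule coupled_initial[OF countable_states _ p alpha(2) fm(1) refl V]) (use mu0 in \<open>auto simp: Sigma2_def\<close>)
  \<comment> \<open>A flow on all of {0..T} supplies the degenerate flow on {0..0} from which the
    induction starts.\<close>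
  obtain Phi mu where cf: "chain_flow S Q 0 T Phi mu" "mu 0 = mu0" using wp[of 0 T mu0 "%_ _. undefined"] T mu0 by auto
  have "xi : relaxed_controls 0 T ==> agent y xi 0 = y" for y xi by (rule solution_initial[OF cpt T rf L0])
  then have i: "agent (fst (fst p)) (snd (fst p)) 0 = fst (fst p)" if "p : space (extend_state S alpha G)" for p
   using that measurable_space[OF fm(2)] by (auto simp: space_extend_state space_relaxed_space)
  have "coupled V0 0 S (distr (extend_state S alpha G) (alpha *M count_space S) (%p. p)) snd (%p. agent (fst (fst p)) (snd (fst p)) 0) mu0"
   by (rule coupled_distr[OF c]) (use i sol in \<open>simp_all cong: measurable_cong_sets\<close>)
  moreover have "(NN p:(distr (extend_state S alpha G) (alpha *M count_space S) (%p. p)). g (fst p)) = (NN om:alpha. g om)"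
   if [measurable]: "g : bmeas alpha" for g
  proof -
   have "(NN p:(distr (extend_state S alpha G) (alpha *M count_space S) (%p. p)). g (fst p)) = (NN om:alpha. (CS y:S. G om y * g om))"
    by (subst nn_integral_distr) (simp_all add: nn_integral_extend_state[OF countable_states G(1)] cong: measurable_cong_sets)
   also have "... = (NN om:alpha. g om)"
    by (rule nn_integral_cong_AE) (use G(2) in \<open>eventually_elim, simp add: nn_integral_multc\<close>)
   finally show ?thesis .
  qed
  moreover have "chain_flow S Q 0 0 Phi mu" by (rule chain_flow_subinterval[OF cf(1)]) (use T in auto)
  ultimately show ?case
   using cf(2) Mo by (intro exI[of _ Phi] exI[of _ mu] exI[of _ "distr (extend_state S alpha G) (alpha *M count_space S) (%p. p)"]) (simp add: V_def e_def Mo_def)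
 next
  case (Suc k)
  then obtain Phi mu N where IH: "?P k Phi mu N" by auto
  then have cf: "chain_flow S Q 0 (real k * h) Phi mu" and ini: "mu 0 = mu0" and sN[measurable_cong]: "sets N = sets (alpha *M count_space S)"
   and c: "coupled (V k) (e k) S N snd (%p. agent (fst (fst p)) (snd (fst p)) (real k * h)) (mu (real k * h))"
   and Mk: "(CS x:S. ennreal (weight x * mu (real k * h) x)) <= ennreal (Mo k)"
   and marg: "!!g. g : bmeas alpha ==> (NN p:N. g (fst p)) = (NN om:alpha. g om)"
   and W: "!!t. 0 < k ==> t : {0..real k * h} ==> W2 (m t) (chain_measure S (mu t)) <= bound" by blast+
  let ?s = "real k * h" let ?r = "real (Suc k) * h"
  have sr: "0 <= ?s" "?s < ?r" "?r <= T" using h time_le[OF Suc.prems] by auto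
  have Nf: "(%p. fst (fst p)) : bmeas N" "(%p. snd (fst p)) : N ->M relaxed_space 0 T"
   by (rule mcomp[OF _ fm(1)] mcomp[OF _ fm(2)]; simp)+
  let ?Q = "%x Phi. Phi : borel2 ->M borel & (ALL F:bmeas (borel2).
   (NN om:N. ind {x} (snd om) * (NN z:(normed T (snd (fst om))). F z))
   = ennreal (state_law N snd x) * (ennreal (1 / T) * (NN t:lborel|{0..T}. (NN v:U01. F (t, Phi (t, v))))))"
  have pN: "prob_space N" "snd : N ->M count_space S" using c unfolding coupled_def by blast+
  \<comment> \<open>The new feedback depends on the joint law of the current states and controls;
    this forces chain motion and coupling to be constructed together.\<close>
  have "ALL x. EX Phi. ?Q x Phi" by (intro allI mixture_control[OF cpt T pN Nf(2), unfolded Bex_def])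
  from choice[OF this] obtain Phi' where Phim: "ALL x. ?Q x (Phi' x)" by (elim exE) (rule that)
  then have Phi': "!!x. Phi' x : borel2 ->M borel" by blast
  note mix = bspec[OF conjunct2[OF spec[OF Phim]]]
  have muk: "mu ?s : Sigma2 S" using cf sr unfolding chain_flow_def by auto
  obtain mu' where cf': "chain_flow S Q ?s ?r Phi' mu'" and j: "mu' ?s = mu ?s"
   using wp[OF sr muk, of Phi'] Phi' by (metis ext)
  have mX': "m t = distr N borel (%p. agent (fst (fst p)) (snd (fst p)) t)" if "t : {?s..?r}" for t
  proof -
   have t: "t : {0..T}" using that sr by auto
   have Nm: "(%p. agent (fst (fst p)) (snd (fst p)) t) : bmeas N" by (rule mcomp[OF _ sol]) simp
   have "distr N borel (%p. agent (fst (fst p)) (snd (fst p)) t) = m t"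
   proof (rule distr_eq_nn_integral[OF Nm])
    fix A :: "'a set" assume A: "A : sets borel"
    have "(NN p:N. ind A (agent (fst (fst p)) (snd (fst p)) t)) = (NN p:alpha. ind A (agent (fst p) (snd p) t))"
     by (rule marg[where g="%p. ind A (agent (fst p) (snd p) t)"]) (rule mcomp[OF sol], use A in simp)
    also have "... = (NN x:(m t). ind A x)" unfolding mX[OF t] by (rule nn_integral_distr[OF sol, symmetric]) (use A in simp)
    finally show "(NN p:N. ind A (agent (fst (fst p)) (snd (fst p)) t)) = (NN x:(m t). ind A x)" .
   qed (simp add: mX[OF t])
   then show ?thesis by simp
  qed
  let ?E = "extend_state S N (chain_jump T Q ?s ?r mu' snd (%p. snd (fst p)))"
  have mix': "(NN om:N. ind {x} (snd om) * (NN z:(normed T (snd (fst om))). ind {?s<..?r} (fst z) * F z))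
    = ennreal (state_law N snd x) * (ennreal (1 / T) * (NN tau:lborel|{?s<..?r}. (NN v:U01. F (tau, Phi' x (tau, v)))))"
   if [measurable]: "F : bmeas (borel2)" for x F
  proof -
   have "(NN t:lborel|{0..T}. (NN v:U01. ind {?s<..?r} t * F (t, Phi' x (t, v)))) = (NN tau:lborel|{?s<..?r}. (NN v:U01. F (tau, Phi' x (tau, v))))"
    by (rule nn_integral_cong) (use sr in \<open>auto split: split_indicator\<close>)
   then show ?thesis using mix[of "%z. ind {?s<..?r} (fst z) * F z" x] by simp
  qed
  have k: "k < n" using Suc.prems by simp
  have c1: "coupled (V k) (e k) S N snd (%p. agent (fst (fst p)) (snd (fst p)) ?s) (mu' ?s)" and M1: "(CS x:S. ennreal (weight x * mu' ?s x)) <= ennreal (Mo k)"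
   unfolding j by (rule c Mk)+
  have mX2: "ALL t:{?s..?r}. m t = distr N borel (%p. agent (fst (fst p)) (snd (fst p)) t)" by (rule ballI) (rule mX')
  have mix2: "ALL x:S. ALL F:bmeas (borel2).
   (NN om:N. ind {x} (snd om) * (NN z:(normed T (snd (fst om))). ind {?s<..?r} (fst z) * F z))
    = ennreal (state_law N snd x) * (ennreal (1 / T) * (NN tau:lborel|{?s<..?r}. (NN v:U01. F (tau, Phi' x (tau, v)))))"
   by (intro ballI) (rule mix')
  note adv = advance[OF k cf' c1 M1 Nf mX2 mix2]
  let ?N = "distr ?E (alpha *M count_space S) (%q. (fst (fst q), snd q))"
  have J: "(%q. (fst (fst q), snd q)) : ?E ->M alpha *M count_space S" by (simp cong: measurable_cong_sets)
  have "coupled (V (Suc k)) (e (Suc k)) S ?N snd (%p. agent (fst (fst p)) (snd (fst p)) ?r) (mu' ?r)"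
   by (rule coupled_distr[OF adv(2) J]) (use sol in \<open>simp_all\<close>)
  moreover have "(NN p:?N. g (fst p)) = (NN om:alpha. g om)" if [measurable]: "g : bmeas alpha" for g
  proof -
   have gN: "(%p. g (fst p)) : bmeas N" by measurable
   have "(NN p:?N. g (fst p)) = (NN q:?E. g (fst (fst q)))" by (subst nn_integral_distr[OF J]) simp_all
   then show ?thesis using adv(4)[OF gN] marg[OF that] by simp
  qed
  moreover have "W2 (m t) (chain_measure S (if t <= ?s then mu t else mu' t)) <= bound" if "t : {0..?r}" for t
  proof (cases "t <= ?s")
   case True
   then show ?thesis
   proof (cases "k = 0")
    case True then show ?thesis using adv(1)[of t] that j \<open>t <= ?s\<close> by (simp del: of_nat_Suc)
   qed (use W that in auto)
  next
   case False then show ?thesis using adv(1)[of t] that by auto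
  qed
  moreover have "chain_flow S Q 0 ?r (%x z. if fst z <= ?s then Phi x z else Phi' x z) (%t. if t <= ?s then mu t else mu' t)"
   by (rule chain_flow_concat[OF cf cf']) (use sr j in auto)
  ultimately show ?case using adv(3) sr ini
   by (intro exI[of _ "%x z. if fst z <= ?s then Phi x z else Phi' x z"] exI[of _ "%t. if t <= ?s then mu t else mu' t"] exI[of _ ?N]) (simp del: of_nat_Suc)
 qed
 from this[of n] obtain Phi mu N where P: "?P n Phi mu N" by auto
 have cf: "chain_flow S Q 0 T Phi mu" and ini: "mu 0 = mu0" and W: "ALL t:{0..T}. W2 (m t) (chain_measure S (mu t)) <= bound"
  using P n by (auto simp: Th)
 have "is_chain_motion S Q 0 T mu0 (%x. fcontrol 0 T (Phi x)) mu"
  using chain_flow_motion[OF _ _ _ cf] T ini by simp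
 moreover have "(%x. fcontrol 0 T (Phi x)) : feedback_controls S 0 T"
  using cf function_control_in unfolding chain_flow_def feedback_controls_def by blast
 ultimately show ?thesis using W unfolding chain_motions_def by blast
qed

end

section \<open>Motions near a given chain motion\<close>

lemma control_integral_causal:
 fixes F :: "real * 'u::metric_space => 'a::euclidean_space" and Phi Phi' :: "real * real => 'u"
 assumes Phi: "Phi : borel2 ->M borel" "Phi' : borel2 ->M borel" and F: "F : bmeas (borel2)"
  and eq: "!!z. fst z <= t ==> Phi z = Phi' z"
 shows "cint T (fcontrol 0 T Phi) F t = cint T (fcontrol 0 T Phi') F t"
proof -
 let ?P = "density (lebesgue_on_interval 0 T *M U01) (%_. ennreal (1 / T))"
 have d: "(LINT z|normed T (fcontrol 0 T \<Psi>). ind {0..t} (fst z) *\<^sub>R F z) = (LINT z|?P. ind {0..t} (fst z) *\<^sub>R F (fst z, \<Psi> z))"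
  if \<Psi>: "\<Psi> : borel2 ->M borel" for \<Psi> :: "real * real => 'u"
 proof -
  have "(%z. (fst z, \<Psi> z)) : ?P ->M borel2"
   using measurable_U01_pair[OF measurable_Pair[OF measurable_fst \<Psi>], of 0 T] by simp
  then show ?thesis unfolding normalized_control_distr[OF \<Psi>] by (subst integral_distr) (use F in auto)
 qed
 have e: "ind {0..t} (fst z) *\<^sub>R F (fst z, Phi z) = ind {0..t} (fst z) *\<^sub>R F (fst z, Phi' z)" for z
  using eq[of z] by (auto split: split_indicator)
 show ?thesis unfolding cint_def d[OF Phi(1)] d[OF Phi(2)] e by (rule refl)
qed

text \<open>Proved on the Picard iterates, each of which at time t uses the control and the
  preceding iterate only up to t.\<close>

lemma solution_causal:
 fixes g :: "(real * 'a::euclidean_space) * 'u::metric_space => 'a" and Phi Phi' :: "real * real => 'u"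
 assumes cpt: "compact (UNIV :: 'u set)" and T: "0 < T" and rf: "regular_field L R g"
  and Phi: "Phi : borel2 ->M borel" "Phi' : borel2 ->M borel"
  and eq: "!!z. fst z <= t1 ==> Phi z = Phi' z" and t: "t <= t1" "t : {0..T}"
 shows "solution T g y (fcontrol 0 T Phi) t = solution T g y (fcontrol 0 T Phi') t"
proof -
 let ?x = "%Phi. picard T g y (fcontrol 0 T Phi)"
 have "t <= t1 ==> t : {0..T} ==> ?x Phi k t = ?x Phi' k t" for k t
 proof (induction k arbitrary: t)
  case (Suc k)
  note c = function_control_in[OF Phi(1), of 0 T] function_control_in[OF Phi(2), of 0 T]
  have "cint T (fcontrol 0 T Phi) (along g (?x Phi k)) t = cint T (fcontrol 0 T Phi') (along g (?x Phi k)) t"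
   by (rule control_integral_causal[OF Phi along_measurable[OF cpt rf picard_measurable[OF cpt T rf c(1)]]]) (use eq Suc.prems in auto)
  also have "... = cint T (fcontrol 0 T Phi') (along g (?x Phi' k)) t"
   by (rule control_integral_cong[OF c(2)]) (use Suc in \<open>auto simp: along_def\<close>)
  finally show ?case by simp
 qed simp
 then show ?thesis using t by (simp add: solution_def)
qed

text \<open>The list holds the states with the newest first: the state reached after k jumps has k
  predecessors behind it and governs the times after k h. A grid time belongs to the earlier state,
  matching the windows that exclude their left end. Times up to 0 get an arbitrary value; only the
  single time 0 of these lies in {0..T}.\<close>

primrec path_control :: "real => ('a => real * real => 'u) => 'a list => real * real => 'u" where
 "path_control h Phi [] z = undefined"
| "path_control h Phi (y # p) z = (if fst z <= real (length p) * h then path_control h Phi p z else Phi y z)"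

text \<open>After k jumps a history has k + 1 entries, the initial state included.\<close>

definition paths :: "'a set => nat => 'a list set" where
 "paths S k = {p. set p \<subseteq> S & length p = Suc k}"

lemma paths_Cons: "y : S ==> p : paths S k ==> y # p : paths S (Suc k)"
 by (simp add: paths_def)

text \<open>Laws of an initial position together with the history of states, driven by the known
  feedback alone. No motion enters, so the resulting control distribution can be handed to
  \<open>motion_exists\<close> without circularity.\<close>

locale path_laws = rate_system T f K S Q BQ eps
 for T :: real and f :: "real => 'a::euclidean_space => 'a measure => 'u::metric_space => 'a" and K S Q BQ eps +
 fixes h :: real and n :: nat and Phi :: "'a => real * real => 'u" and mu :: "real => 'a => real" and m0 :: "'a measure" and N0 :: "('a * 'a list) measure"
 assumes h: "0 < h" and Th: "T = n * h" and hB: "h * B <= 1" and cf: "chain_flow S Q 0 T Phi mu"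
  and N0: "sets N0 = sets (borel *M count_space (paths S 0))" "prob_space N0"
   "!!g. g : bmeas borel ==> (NN om:N0. g (fst om)) = (NN x:m0. g x)"
begin

abbreviation "ctl om \<equiv> fcontrol 0 T (path_control h Phi (snd om))"
abbreviation "Pk k \<equiv> borel *M count_space (paths S k)"
abbreviation "J q \<equiv> (fst (fst q), snd q # snd (fst q))"

primrec N :: "nat => ('a * 'a list) measure" where
 "N 0 = N0"
| "N (Suc k) = distr (extend_state S (N k) (chain_jump T Q (real k * h) (real (Suc k) * h) mu (%om. hd (snd om)) ctl)) (Pk (Suc k)) J"

abbreviation "E k \<equiv> extend_state S (N k) (chain_jump T Q (real k * h) (real (Suc k) * h) mu (%om. hd (snd om)) ctl)"

lemma sets_N [simp, measurable_cong]: "sets (N k) = sets (Pk k)"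
 by (induction k) (simp_all add: N0)

lemma space_N: "space (N k) = UNIV \<times> paths S k"
 using sets_eq_imp_space_eq[OF sets_N[of k]] by (simp add: space_pair_measure)

lemma Phi_measurable: "x : S ==> Phi x : borel2 ->M borel"
 using cf unfolding chain_flow_def by blast

lemma path_control_measurable: "set p \<subseteq> S ==> path_control h Phi p : borel2 ->M borel"
proof (induction p)
 case (Cons y p)
 then have [measurable]: "path_control h Phi p : borel2 ->M borel" "Phi y : borel2 ->M borel" using Phi_measurable by auto
 have "(%z. if fst z <= real (length p) * h then path_control h Phi p z else Phi y z) : borel2 ->M borel" by measurable
 then show ?case by (simp cong: measurable_cong)
qed (simp cong: measurable_cong)

lemma measurable_path: "(!!p. p : paths S k ==> c p : space L) ==> (%om. c (snd om)) : N k ->M L"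
 by (rule mcomp[where f=snd and N="count_space (paths S k)"]) simp_all

lemma ctl_measurable: "ctl : N k ->M relaxed_space 0 T"
 by (rule measurable_path[where c="%p. fcontrol 0 T (path_control h Phi p)"])
  (use function_control_in[OF path_control_measurable] in \<open>auto simp: paths_def space_relaxed_space\<close>)

lemma hd_measurable: "(%om. hd (snd om)) : N k ->M count_space S"
 by (rule measurable_path) (auto simp: paths_def length_Suc_conv)

lemma fst_measurable: "fst : bmeas (N k)" by simp

lemma J_measurable: "J : E k ->M Pk (Suc k)"
proof -
 have "J : N k *M count_space S ->M Pk (Suc k)"
 proof (rule measurable_pair_countable[OF countable_states], goal_cases)
  case (1 y)
  then have "(%om. y # snd om) : N k ->M count_space (paths S (Suc k))" by (intro measurable_path) (simp add: paths_Cons)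
  then show ?case
   by (simp add: measurable_Pair fst_measurable)
 qed
 then show ?thesis by (simp cong: measurable_cong_sets)
qed

lemma time_le: "k <= n ==> real k * h <= T"
 unfolding Th by (intro mult_right_mono) (use h in auto)

lemma sub_flow:
 assumes k: "k < n"
 shows "chain_flow S Q (real k * h) (real (Suc k) * h) Phi mu"
 by (rule chain_flow_subinterval[OF cf]) (use h time_le[of "Suc k"] k in simp_all)

lemma jump_step:
 assumes k: "k < n" and P: "prob_space (N k)"
 shows "jump_step T f K S Q BQ eps (real k * h) (real (Suc k) * h) Phi mu (N k) (%om. hd (snd om)) ctl"
proof -
 have d: "real (Suc k) * h - real k * h = h" by (simp add: algebra_simps)
 have t: "0 <= real k * h" "real k * h < real (Suc k) * h" "real (Suc k) * h <= T" "(real (Suc k) * h - real k * h) * B <= 1"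
  using h time_le[of "Suc k"] k hB unfolding d by simp_all
 show ?thesis by (intro jump_step.intro jump_step_axioms.intro rate_system_axioms) (fact t P sub_flow[OF k] hd_measurable ctl_measurable)+
qed

lemma prob_N: "k <= n ==> prob_space (N k)"
proof (induction k)
 case (Suc k)
 then interpret P: jump_step T f K S Q BQ eps "real k * h" "real (Suc k) * h" Phi mu "N k" "%om. hd (snd om)" ctl by (intro jump_step) auto
 show ?case unfolding N.simps by (rule prob_space.prob_space_distr[OF P.prob_space_step J_measurable])
qed (simp add: N0)

lemma N_Suc_integral:
 assumes k: "k < n" and g: "g : bmeas (N k)" and g': "g' : bmeas (Pk (Suc k))"
  and eq: "!!om y. om : space (N k) ==> y : S ==> g' (fst om, y # snd om) = g om"
 shows "(NN om:(N (Suc k)). g' om) = (NN om:(N k). g om)"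
proof -
 interpret P: jump_step T f K S Q BQ eps "real k * h" "real (Suc k) * h" Phi mu "N k" "%om. hd (snd om)" ctl
  by (intro jump_step prob_N) (use k in auto)
 have "(NN om:(N (Suc k)). g' om) = (NN q:(E k). g' (J q))" unfolding N.simps by (rule nn_integral_distr[OF J_measurable]) (use g' in simp)
 also have "... = (NN q:(E k). g (fst q))" 
 proof (rule nn_integral_cong)
  fix q assume "q : space (E k)"
  then have "fst q : space (N k)" "snd q : S" by (auto simp: space_extend_state)
  from eq[OF this] show "g' (J q) = g (fst q)" .
 qed
 also have "... = (NN om:(N k). g om)" by (rule P.step_marginal[OF g])
 finally show ?thesis .
qed

lemma N_initial:
 assumes g: "g : bmeas borel"
 shows "k <= n ==> (NN om:(N k). g (fst om)) = (NN x:m0. g x)"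
proof (induction k)
 case (Suc k)
 have "(NN om:(N (Suc k)). g (fst om)) = (NN om:(N k). g (fst om))"
  by (rule N_Suc_integral) (use Suc.prems mcomp[OF fst_measurable g] mcomp[OF measurable_fst g] in auto)
 then show ?case using Suc by simp
qed (simp add: N0 g)

lemma state_measurable:
 assumes rf: "regular_field L R g" and L: "0 < L"
 shows "(%om. solution T g (fst om) (ctl om) t) : bmeas (N k)"
 using mcomp[OF measurable_Pair[OF fst_measurable ctl_measurable] solution_measurable[OF cpt T rf L]] by simp

lemma state_causal:
 assumes rf: "regular_field L R g" and om: "om : space (N k)" and y: "y : S" and t: "t <= real (Suc k) * h" "t : {0..T}"
 shows "solution T g x (fcontrol 0 T (path_control h Phi (y # snd om))) t = solution T g x (ctl om) t"
 by (rule solution_causal[OF cpt T rf path_control_measurable path_control_measurable _ t])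
  (use om y in \<open>auto simp: space_N paths_def\<close>)

text \<open>States drawn after step k alter the control only after the time (k + 1) h, so by
  causality the law of the position up to then is already determined by \<open>N k\<close>. A motion
  defined through complete histories can thus be read off on each \<open>N k\<close>.\<close>

lemma state_law_stable:
 assumes rf: "regular_field L R g" and L: "0 < L" and t: "t <= real (Suc k) * h" "t : {0..T}"
 shows "k <= l ==> l <= n ==> distr (N l) borel (%om. solution T g (fst om) (ctl om) t) = distr (N k) borel (%om. solution T g (fst om) (ctl om) t)"
proof (induction l rule: dec_induct)
 case (step l)
 note sm = state_measurable[OF rf L]
 have "real (Suc k) * h <= real (Suc l) * h" using step.hyps(1) h by (intro mult_right_mono) auto
 then have tl: "t <= real (Suc l) * h" using t(1) by linarith
 have "distr (N (Suc l)) borel (%om. solution T g (fst om) (ctl om) t) = distr (N l) borel (%om. solution T g (fst om) (ctl om) t)"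
 proof (rule distr_eq_nn_integral[OF sm])
  fix A :: "'a set" assume A: "A : sets borel"
  have im: "(%om. ind A (solution T g (fst om) (ctl om) t) :: ennreal) : bmeas (N k)" for k
   by (rule mcomp[OF sm]) (use A in simp)
  have "(NN om:(N (Suc l)). ind A (solution T g (fst om) (ctl om) t)) = (NN om:(N l). ind A (solution T g (fst om) (ctl om) t))"
  proof (rule N_Suc_integral[OF _ im])
   show "(%om. ind A (solution T g (fst om) (ctl om) t) :: ennreal) : bmeas (Pk (Suc l))"
    using im[of "Suc l"] by (simp only: measurable_cong_sets[OF sets_N refl])
  qed (use step.prems state_causal[OF rf _ _ tl t(2)] in auto)
  also have "... = (NN x:(distr (N l) borel (%om. solution T g (fst om) (ctl om) t)). ind A x)"
   by (rule nn_integral_distr[OF sm, symmetric]) (use A in simp)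
  finally show "(NN om:(N (Suc l)). ind A (solution T g (fst om) (ctl om) t)) = (NN x:(distr (N l) borel (%om. solution T g (fst om) (ctl om) t)). ind A x)" .
 qed simp
 then show ?case using step by simp
qed simp

text \<open>In the window of step k an agent in state x uses exactly \<open>Phi x\<close>, so the
  mixture identity needed by \<open>advance\<close> holds without averaging.\<close>

lemma path_mixture:
 assumes k: "k < n" and x: "x : S" and F[measurable]: "F : bmeas (borel2)"
 shows "(NN om:(N k). ind {x} (hd (snd om)) * (NN z:(normed T (ctl om)). ind {real k * h<..real (Suc k) * h} (fst z) * F z))
  = ennreal (state_law (N k) (%om. hd (snd om)) x) * (ennreal (1 / T) * (NN tau:lborel|{real k * h<..real (Suc k) * h}. (NN v:U01. F (tau, Phi x (tau, v)))))"
  (is "_ = _ * ?c")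
proof -
 have "(NN om:(N k). ind {x} (hd (snd om)) * (NN z:(normed T (ctl om)). ind {real k * h<..real (Suc k) * h} (fst z) * F z))
  = (NN om:(N k). ind {x} (hd (snd om)) * ?c)"
 proof (rule nn_integral_cong, goal_cases)
  case (1 om)
  then obtain y p where p: "snd om = y # p" "set p \<subseteq> S" "y : S" "length p = k" by (auto simp: space_N paths_def length_Suc_conv)
  have "(NN z:(normed T (ctl om)). ind {real k * h<..real (Suc k) * h} (fst z) * F z) = ?c" if "y = x"
  proof -
   have "(NN z:(normed T (ctl om)). ind {real k * h<..real (Suc k) * h} (fst z) * F z)
    = ennreal (1 / T) * (NN t:lborel|{0..T}. (NN v:U01. ind {real k * h<..real (Suc k) * h} (fst (t, path_control h Phi (snd om) (t, v))) * F (t, path_control h Phi (snd om) (t, v))))"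
    by (rule normalized_control_function[OF path_control_measurable]) (use p in simp, measurable)
   also have "(NN t:lborel|{0..T}. (NN v:U01. ind {real k * h<..real (Suc k) * h} (fst (t, path_control h Phi (snd om) (t, v))) * F (t, path_control h Phi (snd om) (t, v))))
    = (NN tau:lborel|{real k * h<..real (Suc k) * h}. (NN v:U01. F (tau, Phi x (tau, v))))"
   proof (rule nn_integral_cong, goal_cases)
    case (1 t)
    have "0 <= real k * h" using h by simp
    then show ?case
     using p that time_le[of "Suc k"] k by (cases "t : {real k * h<..real (Suc k) * h}") (auto simp del: of_nat_Suc)
   qed
   finally show ?thesis .
  qed
  then show ?case
   using p by (auto split: split_indicator)
 qed
 also have "... = ennreal (state_law (N k) (%om. hd (snd om)) x) * ?c"
  by (simp add: nn_integral_multc measurable_state_indicator[OF hd_measurable] state_law_nn_integral[OF prob_N hd_measurable] k less_imp_le)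
 finally show ?thesis .
qed

lemma path_distribution:
 assumes m0: "sets m0 = sets borel"
 shows "distr (N n) (m0 *M relaxed_space 0 T) (%om. (fst om, ctl om)) : control_distributions 0 T m0"
  and "(%om. (fst om, ctl om)) : N n ->M m0 *M relaxed_space 0 T"
proof -
 have fm: "fst : N n ->M m0" using fst_measurable by (simp add: measurable_cong_sets[OF refl m0])
 show m: "(%om. (fst om, ctl om)) : N n ->M m0 *M relaxed_space 0 T" by (rule measurable_Pair[OF fm ctl_measurable])
 have "distr (N n) m0 fst = m0"
 proof (rule distr_eq_nn_integral[OF fm refl])
  fix A assume "A : sets m0" then show "(NN om:(N n). ind A (fst om)) = (NN x:m0. ind A x)"
   by (intro N_initial) (simp_all add: m0)
 qed
 then show "distr (N n) (m0 *M relaxed_space 0 T) (%om. (fst om, ctl om)) : control_distributions 0 T m0"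
  unfolding control_distributions_def Lam_def by (simp add: distr_distr[OF measurable_fst m] o_def)
qed

end

text \<open>The control distribution is the law of starting point and control under
  \<open>PL.N n\<close>, complete before \<open>motion_exists\<close> is invoked. By
  \<open>state_law_stable\<close> the agents on each \<open>PL.N k\<close> follow the resulting
  motion during step k, as \<open>advance\<close> requires.\<close>

lemma motion_near:
 fixes f :: "real => 'a::euclidean_space => 'a measure => 'u::metric_space => 'a"
 assumes rs: "rate_system T f K S Q BQ eps" and cs: "control_system T f K" and fc: "field_consts T f K L R"
  and m0: "m0 : P2_on K" and mu0: "mu0 : Sigma2 S" and mu: "mu : chain_motions T S Q mu0"
  and sch: "schedule T h eps L R (rate_system.B BQ) M0 V0 A C D n" and hB: "h * rate_system.B BQ <= 1"
  and p: "p : couplings (chain_measure S mu0) m0" and V: "(NN z:p. ennreal ((dist (fst z) (snd z))^2)) <= ennreal V0"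
  and Mo: "(CS x:S. ennreal (weight x * mu0 x)) <= ennreal M0"
 shows "EX m:motions f K T m0. ALL t:{0..T}. W2 (m t) (chain_measure S (mu t)) <= schedule.bound T eps V0 C"
proof -
 interpret RS: rate_system T f K S Q BQ eps by fact
 interpret SC: schedule T h eps L R RS.B M0 V0 A C D n by fact
 have m0': "sets m0 = sets borel" "prob_space m0" using m0 by (auto simp: P2_on_def P2_euclidean_metric)
 have mu01: "mu0 : Sigma1 S" using mu0 by (simp add: Sigma2_def)
 obtain zeta where zeta: "zeta : feedback_controls S 0 T" and cm: "is_chain_motion S Q 0 T mu0 zeta mu" using mu by (auto simp: chain_motions_def)
 have "ALL x:S. EX Phi. Phi : borel2 ->M borel & zeta x = fcontrol 0 T Phi"
  using relaxed_control_function[OF RS.cpt RS.T] zeta unfolding feedback_controls_def by blast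
 from bchoice[OF this] obtain Phi where Phi: "!!x. x : S ==> Phi x : borel2 ->M borel" "!!x. x : S ==> zeta x = fcontrol 0 T (Phi x)" by blast
 have cf: "chain_flow S Q 0 T Phi mu" and ini: "mu 0 = mu0" using RS.chain_motion_flow[OF _ _ _ mu0 cm Phi] RS.T by simp_all
 have id: "(%x. x) : bmeas m0" "distr m0 borel (%x. x) = m0" using m0' by (simp_all add: distr_id2 cong: measurable_cong_sets)
 obtain G where G: "!!y. (%om. G om y) : bmeas m0" "AE om in m0. (CS y:S. G om y) = 1"
  and c0: "coupled V0 0 S (extend_state S m0 G) snd (%p. fst p) mu0"
  by (rule coupled_initial[OF RS.countable_states mu01 p m0'(2) id V]) blast
 let ?E0 = "extend_state S m0 G" let ?P0 = "borel *M count_space (paths S 0) :: ('a * 'a list) measure"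
 have J0: "(%q. (fst q, [snd q])) : ?E0 ->M ?P0"
 proof -
  have "(%q. (fst q, [snd q])) : m0 *M count_space S ->M ?P0"
   by (rule measurable_pair_countable[OF RS.countable_states]) (use id in \<open>simp add: measurable_Pair paths_def\<close>)
  then show ?thesis by (simp cong: measurable_cong_sets)
 qed
 define N0 where "N0 = distr ?E0 ?P0 (%q. (fst q, [snd q]))"
 have pE: "prob_space ?E0" using c0 by (simp add: coupled_def)
 have N0i: "(NN om:N0. g (fst om)) = (NN x:m0. g x)" if g: "g : bmeas borel" for g
 proof -
  have g': "g : bmeas m0" using g m0' by (simp cong: measurable_cong_sets)
  have "(NN om:N0. g (fst om)) = (NN q:?E0. g (fst q))" unfolding N0_def
   by (subst nn_integral_distr[OF J0]) (use mcomp[OF measurable_fst g] in simp_all)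
  also have "... = (NN om:m0. (CS y:S. G om y * g om))"
   by (subst nn_integral_extend_state[OF RS.countable_states G(1)]) (use g' in simp_all)
  also have "... = (NN om:m0. g om)" by (rule nn_integral_cong_AE) (use G(2) in \<open>eventually_elim, simp add: nn_integral_multc\<close>)
  finally show ?thesis .
 qed
 interpret PL: path_laws T f K S Q BQ eps h n Phi mu m0 N0
  by (intro path_laws.intro path_laws_axioms.intro rs) (use SC.h SC.Th hB cf N0i prob_space.prob_space_distr[OF pE J0] in \<open>simp_all add: N0_def\<close>)
 let ?alpha = "distr (PL.N n) (m0 *M relaxed_space 0 T) (%om. (fst om, PL.ctl om))"
 note pd = PL.path_distribution[OF m0'(1)]
 obtain m where m: "m : motions f K T m0" and rf: "regular_field L R (flow_field T f m)" and mK: "!!t. t : {0..T} ==> m t : P2_on K"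
  and ml: "!!t. t : {0..T} ==> m t = distr ?alpha borel (%p. solution T (flow_field T f m) (fst p) (snd p) t)"
  using motion_exists[OF RS.cpt RS.T cs fc m0 pd(1)] by blast
 interpret S: scheduled T f K S Q BQ eps L R m h M0 V0 A C D n
  by (intro scheduled.intro coupled_system.intro coupled_system_axioms.intro scheduled_axioms.intro rs sch) (fact fc rf mK hB)+
 have sol: "(%p. S.agent (fst p) (snd p) t) : bmeas (m0 *M relaxed_space 0 T)" for t
  using solution_measurable[OF RS.cpt RS.T rf S.L0] m0'(1) by (simp cong: measurable_cong_sets sets_pair_measure_cong)
 have mX: "m t = distr (PL.N k) borel (%om. S.agent (fst om) (PL.ctl om) t)" if "t : {real k * h..real (Suc k) * h}" "k < n" for t k
 proof -
  have "0 <= real k * h" using SC.h by simp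
  with that(1) have "0 <= t" by (meson atLeastAtMost_iff order_trans)
  then have t: "t : {0..T}" using that PL.time_le[of "Suc k"] by auto
  have "m t = distr (PL.N n) borel (%om. S.agent (fst om) (PL.ctl om) t)"
   unfolding ml[OF t] by (simp add: distr_distr[OF sol pd(2)] o_def)
  also have "... = distr (PL.N k) borel (%om. S.agent (fst om) (PL.ctl om) t)"
   by (rule PL.state_law_stable[OF rf S.L0]) (use that t in auto)
  finally show ?thesis .
 qed
 let ?Y = "%om::'a * 'a list. hd (snd om)"
 have step: "coupled (SC.V k) (SC.e k) S (PL.N k) ?Y (%om. S.agent (fst om) (PL.ctl om) (real k * h)) (mu (real k * h)) \<and>
  (CS x:S. ennreal (weight x * mu (real k * h) x)) <= ennreal (SC.Mo k) \<and>
  (ALL t:{0..real k * h}. 0 < k --> W2 (m t) (chain_measure S (mu t)) <= SC.bound)" if "k <= n" for k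
  using that
 proof (induction k)
  case 0
  have i: "S.agent x (PL.ctl om) 0 = x" if "om : space (PL.N 0)" for x om
   using measurable_space[OF PL.ctl_measurable that] by (intro solution_initial[OF RS.cpt RS.T rf S.L0]) (simp add: space_relaxed_space)
  have "coupled V0 0 S N0 ?Y (%om. S.agent (fst om) (PL.ctl om) 0) mu0" unfolding N0_def
  proof (rule coupled_distr[OF c0 J0])
   show "?Y : ?P0 ->M count_space S" using PL.hd_measurable[of 0] by (simp only: measurable_cong_sets[OF PL.sets_N refl])
   show "(%om. S.agent (fst om) (PL.ctl om) 0) : bmeas ?P0"
    using PL.state_measurable[OF rf S.L0, of 0 0] by (simp only: measurable_cong_sets[OF PL.sets_N refl])
   fix q assume "q : space ?E0"
   then have "(fst q, [snd q]) : space (PL.N 0)" unfolding PL.space_N by (auto simp: space_extend_state paths_def)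
   from i[OF this] show "?Y (fst q, [snd q]) = snd q & S.agent (fst (fst q, [snd q])) (PL.ctl (fst q, [snd q])) 0 = fst q" by simp
  qed
  then show ?case using Mo ini by (simp add: SC.V_def SC.e_def SC.Mo_def)
 next
  case (Suc k)
  then have k: "k < n" and c: "coupled (SC.V k) (SC.e k) S (PL.N k) ?Y (%om. S.agent (fst om) (PL.ctl om) (real k * h)) (mu (real k * h))"
   and Mk: "(CS x:S. ennreal (weight x * mu (real k * h) x)) <= ennreal (SC.Mo k)"
   and W: "!!t. t : {0..real k * h} ==> 0 < k ==> W2 (m t) (chain_measure S (mu t)) <= SC.bound" by auto
  have mX2: "ALL t:{real k * h..real (Suc k) * h}. m t = distr (PL.N k) borel (%om. S.agent (fst om) (PL.ctl om) t)" by (rule ballI) (rule mX[OF _ k])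
  have mix2: "ALL x:S. ALL F:bmeas (borel2).
   (NN om:(PL.N k). ind {x} (?Y om) * (NN z:(normed T (PL.ctl om)). ind {real k * h<..real (Suc k) * h} (fst z) * F z))
   = ennreal (state_law (PL.N k) ?Y x) * (ennreal (1 / T) * (NN tau:lborel|{real k * h<..real (Suc k) * h}. (NN v:U01. F (tau, Phi x (tau, v)))))"
   by (intro ballI) (rule PL.path_mixture[OF k])
  note adv = S.advance[OF k PL.sub_flow[OF k] c Mk PL.fst_measurable PL.ctl_measurable mX2 mix2]
  have "coupled (SC.V (Suc k)) (SC.e (Suc k)) S (PL.N (Suc k)) ?Y (%om. S.agent (fst om) (PL.ctl om) (real (Suc k) * h)) (mu (real (Suc k) * h))"
   unfolding PL.N.simps
  proof (rule coupled_distr[OF adv(2) PL.J_measurable])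
   show "?Y : PL.Pk (Suc k) ->M count_space S" using PL.hd_measurable[of "Suc k"] by (simp only: measurable_cong_sets[OF PL.sets_N refl])
   show "(%om. S.agent (fst om) (PL.ctl om) (real (Suc k) * h)) : bmeas (PL.Pk (Suc k))"
    using PL.state_measurable[OF rf S.L0, of "real (Suc k) * h" "Suc k"] by (simp only: measurable_cong_sets[OF PL.sets_N refl])
   fix q assume "q : space (PL.E k)"
   then have q: "fst q : space (PL.N k)" "snd q : S" by (auto simp: space_extend_state)
   have "real (Suc k) * h : {0..T}" using PL.time_le[of "Suc k"] k SC.h by simp
   from PL.state_causal[OF rf q order_refl this]
   show "?Y (PL.J q) = snd q & S.agent (fst (PL.J q)) (PL.ctl (PL.J q)) (real (Suc k) * h) = S.agent (fst (fst q)) (PL.ctl (fst q)) (real (Suc k) * h)"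
    by (simp only: fst_conv snd_conv list.sel simp_thms)
  qed
  moreover have "W2 (m t) (chain_measure S (mu t)) <= SC.bound" if "t : {0..real (Suc k) * h}" for t
  proof (cases "real k * h <= t")
   case True then show ?thesis using adv(1)[of t] that by auto
  next
   case False
   then have "0 < k" using that by (cases k) auto
   then show ?thesis using W[of t] that False by auto
  qed
  ultimately show ?case using adv(3) by (simp del: of_nat_Suc PL.N.simps)
 qed
 from step[of n] have "ALL t:{0..T}. W2 (m t) (chain_measure S (mu t)) <= SC.bound" using SC.n by (auto simp: SC.Th[symmetric])
 then show ?thesis using m by blast
qed

section \<open>The bound for the bundles\<close>

lemma exists_schedule:
 fixes T eps L R B M0 V0 :: real
 assumes T: "0 < T" and eps: "0 < eps" and L: "0 < L" and B: "1 <= B" and M0: "0 <= M0" and V0: "0 <= V0"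
 obtains n h A D where "schedule T h eps L R B M0 V0 A (2 + 10 * L) D n" "h * B <= 1"
proof -
 define A where "A = 4 * B + 2"
 define D where "D = A * M0 * exp (2 * A * T)"
 define C where "C = 2 + 10 * L"
 define G where "G = D * exp (A * T)"
 \<comment> \<open>All remainders divided by h, with h <= T used once to bound h^2 by a multiple of
   h; for large n, h Z is at most eps^2.\<close>
 define Z where "Z = C * (R^2 * T) + 4 * L * G + R^2 * T + G"
 have p: "0 <= G" "0 <= C" using B L M0 by (auto simp: G_def D_def A_def C_def)
 have Z: "0 <= Z" using p L T by (auto simp: Z_def intro!: add_nonneg_nonneg mult_nonneg_nonneg)
 obtain n :: nat where n: "T * B + T * Z / eps^2 + 1 < real n" using reals_Archimedean2 by blast
 have pos: "0 <= T * B" "0 <= T * Z / eps^2" using T B Z by auto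
 then have n0: "1 <= real n" "T * B <= real n" "T * Z / eps^2 <= real n" using n by linarith+
 define h where "h = T / real n"
 have h: "0 < h" "h <= T" "h * B <= 1" using n0 T by (auto simp: h_def field_simps)
 have hZ: "h * Z <= eps^2" using n0 eps by (simp add: h_def field_simps)
 have hh: "R^2 * h^2 <= h * (R^2 * T)" using mult_left_mono[OF mult_left_mono[OF h(2), of h], of "R^2"] h(1) by (simp add: power2_eq_square mult_ac)
 have "C * (R^2 * h^2) <= C * (h * (R^2 * T))" using hh p(2) by (rule mult_left_mono)
 moreover have "0 <= h * (R^2 * T)" "0 <= h * G" "0 <= L * (h * G)" "0 <= C * (h * (R^2 * T))" using h T p L by auto
 moreover have "h * Z = C * (h * (R^2 * T)) + 4 * (L * (h * G)) + h * (R^2 * T) + h * G" by (simp add: Z_def algebra_simps)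
 ultimately have "C * (R^2 * h^2) + 4 * (L * (h * G)) <= eps^2" "R^2 * h^2 + h * G <= eps^2" using hh hZ by linarith+
 then have s: "C * (R^2 * h^2) + 4 * L * (h * D * exp (A * T)) <= eps^2" "R^2 * h^2 + h * D * exp (A * T) <= eps^2" by (simp_all add: G_def mult.assoc)
 have "schedule T h eps L R B M0 V0 A (2 + 10 * L) D n"
  by unfold_locales (use n0 h L B M0 V0 s T in \<open>auto simp: A_def D_def C_def h_def\<close>)
 then show thesis using h(3) by (rule that)
qed

lemma Sigma2_weight:
 assumes "mu : Sigma2 S"
 obtains M0 where "0 <= M0" "(CS x:S. ennreal (weight x * mu x)) <= ennreal M0"
proof -
 have m0: "0 <= mu x" for x using assms by (simp add: Sigma2_def Sigma1_def)
 have "(%x. mu x + (norm x)^2 * mu x) summable_on S"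
  using assms by (intro summable_on_add) (auto simp: Sigma2_def Sigma1_def intro: has_sum_imp_summable)
 then have "((%x. weight x * mu x) has_sum (\<Sum>\<^sub>\<infinity>x\<in>S. weight x * mu x)) S" by (intro has_sum_infsum) (simp add: weight_def distrib_right)
 then have "(CS x:S. ennreal (weight x * mu x)) = ennreal (\<Sum>\<^sub>\<infinity>x\<in>S. weight x * mu x)"
  by (intro has_sum_CS) (simp_all add: m0 weight_def)
 then show thesis by (intro that[of "\<Sum>\<^sub>\<infinity>x\<in>S. weight x * mu x"] infsum_nonneg) (simp_all add: m0 weight_def)
qed

text \<open>Subadditivity of the square root separates the initial distance W from eps.\<close>

lemma bound_le:
 fixes W eps c T :: real
 assumes "0 <= W" "0 <= eps" "0 <= c" "0 <= T"
 shows "sqrt (4 * c * ((W^2 + eps^2) + 3 * T * eps^2) + 4 * eps^2) <= sqrt (4 * c) * W + sqrt (4 * c * (1 + 3 * T) + 4) * eps"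
proof -
 have "4 * c * ((W^2 + eps^2) + 3 * T * eps^2) + 4 * eps^2 = (4 * c) * W^2 + (4 * c * (1 + 3 * T) + 4) * eps^2" by (simp add: algebra_simps)
 then have "sqrt (4 * c * ((W^2 + eps^2) + 3 * T * eps^2) + 4 * eps^2) = sqrt ((4 * c) * W^2 + (4 * c * (1 + 3 * T) + 4) * eps^2)" by simp
 also have "... <= sqrt ((4 * c) * W^2) + sqrt ((4 * c * (1 + 3 * T) + 4) * eps^2)"
  by (rule sqrt_add_le_add_sqrt) (use assms in auto)
 finally show ?thesis using assms by (simp add: real_sqrt_mult)
qed

lemma flow_dist_le:
 assumes "ALL t:{0..T}. W2 (m t) (chain_measure S (mu t)) <= c" "c <= b"
 shows "flow_dist T S m mu <= ennreal b"
 unfolding flow_dist_def by (rule SUP_least) (use assms in \<open>auto intro!: ennreal_leI intro: order_trans\<close>)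

theorem mainTheorem3:
  fixes T :: real
    and f :: "real \<Rightarrow> 'a::euclidean_space \<Rightarrow> 'a measure \<Rightarrow> 'u::metric_space \<Rightarrow> 'a"
    and K :: "'a set"
  assumes "T > 0"
    and "compact (UNIV :: 'u set)"
    and "control_system T f K"
  shows "\<exists>C0 C1 :: real. 0 \<le> C0 \<and> 0 \<le> C1 \<and>
    (\<forall>\<epsilon> B\<^sub>Q :: real. \<forall>S :: 'a set. \<forall>Q :: real \<Rightarrow> ('a \<Rightarrow> real) \<Rightarrow> 'u \<Rightarrow> 'a \<Rightarrow> 'a \<Rightarrow> real.
       0 < \<epsilon> \<and> \<epsilon> \<le> 1 \<and> markov_chain T K S Q \<and> approximates T f K S Q B\<^sub>Q \<epsilon> \<longrightarrow>
       (\<forall>m0\<in>P2_on K. \<forall>\<mu>0\<in>Sigma2 S.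
          bundle_dist T S (motions f K T m0) (chain_motions T S Q \<mu>0)
            \<le> ennreal (C0 * W2 (chain_measure S \<mu>0) m0 + C1 * \<epsilon>)))"
proof -
 note T = assms(1) and cpt = assms(2) and cs = assms(3)
 have "EX L R. field_consts T f K L R"
 proof (rule field_constants[OF cs], goal_cases)
  case (1 L R) then show ?case unfolding field_consts_def by blast
 qed
 then obtain L R where fc: "field_consts T f K L R" by blast
 then have L: "0 < L" by (simp add: field_consts_def)
 \<comment> \<open>L comes from \<open>field_consts\<close>, hence from the control system, so the
   constants are fixed before the chain, eps and the initial data.\<close>
 let ?c = "exp ((2 + 10 * L) * T)"
 let ?C0 = "sqrt (4 * ?c)" and ?C1 = "sqrt (4 * ?c * (1 + 3 * T) + 4)"
 show ?thesis
 proof (rule exI[of _ ?C0], rule exI[of _ ?C1], intro conjI allI impI ballI)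
  fix eps BQ :: real and S :: "'a set" and Q :: "real => ('a => real) => 'u => 'a => 'a => real" and m0 mu0
  assume a: "0 < eps & eps <= 1 & markov_chain T K S Q & approximates T f K S Q BQ eps" and m0: "m0 : P2_on K" and mu0: "mu0 : Sigma2 S"
  interpret RS: rate_system T f K S Q BQ eps by unfold_locales (use T cpt a in auto)
  define W where "W = W2 (chain_measure S mu0) m0"
  \<comment> \<open>The added eps^2 pays for a coupling that is only nearly optimal; it ends up in
    the eps term of the bound.\<close>
  define V0 where "V0 = W^2 + eps^2"
  have W: "0 <= W" by (simp add: W_def)
  have e2: "0 < eps^2" using a by simp
  have m0P: "m0 : P2 euclidean_metric" using m0 by (simp add: P2_on_def)
  have "chain_measure S mu0 : P2 euclidean_metric"
   using chain_measure_P2_on[OF RS.countable_states RS.states_subset mu0] by (simp add: P2_on_def)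
  from W2_near_optimal[OF this m0P e2] obtain p where p: "p : couplings (chain_measure S mu0) m0"
   and V: "(NN z:p. ennreal ((dist (fst z) (snd z))^2)) <= ennreal V0" unfolding V0_def W_def by blast
  obtain M0 where M0: "0 <= M0" and Mo: "(CS x:S. ennreal (weight x * mu0 x)) <= ennreal M0" by (rule Sigma2_weight[OF mu0])
  obtain n h A D where sch: "schedule T h eps L R RS.B M0 V0 A (2 + 10 * L) D n" and hB: "h * RS.B <= 1"
   by (rule exists_schedule[OF T RS.eps(1) L RS.B1 M0, of V0]) (auto simp: V0_def)
  let ?b = "schedule.bound T eps V0 (2 + 10 * L)"
  have b: "?b <= ?C0 * W + ?C1 * eps"
  proof -
   have b0: "?b = sqrt (4 * ?c * (V0 + 3 * T * eps^2) + 4 * eps^2)" by (rule schedule.bound_def[OF sch])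
   show ?thesis unfolding b0 unfolding V0_def by (rule bound_le) (use W T a in auto)
  qed
  have 1: "EX mu:chain_motions T S Q mu0. ALL t:{0..T}. W2 (m t) (chain_measure S (mu t)) <= ?b" if m: "m : motions f K T m0" for m
  proof -
   obtain alpha where alpha: "alpha : control_distributions 0 T m0" and rf: "regular_field L R (flow_field T f m)"
    and mt: "ALL t:{0..T}. m t : P2_on K & m t = distr alpha borel (%p. solution T (flow_field T f m) (fst p) (snd p) t)"
    using motion_solution[OF cpt T cs fc m0 m] by blast
   have mK: "m t : P2_on K" if "t : {0..T}" for t using mt that by blast
   note ap = distribution_props[OF m0P alpha]
   interpret scheduled T f K S Q BQ eps L R m h M0 V0 A "2 + 10 * L" D n
    by (intro scheduled.intro coupled_system.intro coupled_system_axioms.intro scheduled_axioms.intro RS.rate_system_axioms sch) (fact fc rf mK hB)+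
   show ?thesis
    by (rule chain_motion_near[OF ap(1,2) _ mu0 _ V Mo]) (use mt p ap(3) in auto)
  qed
  have 2: "EX m:motions f K T m0. ALL t:{0..T}. W2 (m t) (chain_measure S (mu t)) <= ?b" if "mu : chain_motions T S Q mu0" for mu
   by (rule motion_near[OF RS.rate_system_axioms cs fc m0 mu0 that sch hB p V Mo])
  show "bundle_dist T S (motions f K T m0) (chain_motions T S Q mu0) <= ennreal (?C0 * W2 (chain_measure S mu0) m0 + ?C1 * eps)"
   unfolding bundle_dist_def W_def[symmetric]
  proof (rule max.boundedI; rule SUP_least)
   fix m assume "m : motions f K T m0"
   from 1[OF this] obtain mu where "mu : chain_motions T S Q mu0" "ALL t:{0..T}. W2 (m t) (chain_measure S (mu t)) <= ?b" by blast
   then show "(INF mu\<in>chain_motions T S Q mu0. flow_dist T S m mu) <= ennreal (?C0 * W + ?C1 * eps)"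
    by (intro INF_lower2 flow_dist_le[OF _ b])
  next
   fix mu assume "mu : chain_motions T S Q mu0"
   from 2[OF this] obtain m where "m : motions f K T m0" "ALL t:{0..T}. W2 (m t) (chain_measure S (mu t)) <= ?b" by blast
   then show "(INF m\<in>motions f K T m0. flow_dist T S m mu) <= ennreal (?C0 * W + ?C1 * eps)"
    by (intro INF_lower2 flow_dist_le[OF _ b])
  qed
 qed (use T in auto)
qed

end
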